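(* Let $p$ be a prime number, $\mathcal{Y}$ a finitely presented $\mathbb{F}_p[\overline{X}^{\pm}]$-module, where $\overline{X} = (X_1, \ldots, X_n)$, and $G = \mathcal{Y} \rtimes \mathbb{Z}^n$. Let $h_1, \ldots, h_m, g$ be elements of $G$. Then the set of solutions $(n_1, \ldots, n_m) \in \mathbb{Z}^m$ of $$h_1^{n_1} h_2^{n_2} \cdots h_m^{n_m} = g$$ is an effectively $p$-automatic subset of $\mathbb{Z}^m$.
   Context: $\mathbb{F}_p[\overline{X}^{\pm}] = \mathbb{F}_p[X_1^{\pm}, \ldots, X_n^{\pm}]$ is the Laurent polynomial ring over the field $\mathbb{F}_p$ with $p$ elements. For $\boldsymbol{a} = (a_1, \ldots, a_n) \in \mathbb{Z}^n$ write $\overline{X}^{\boldsymbol{a}} = X_1^{a_1} \cdots X_n^{a_n}$. A module is finitely presented if it is (written as) a quotient $\mathbb{F}_p[\overline{X}^{\pm}]^d / N$ with $d \in \mathbb{N}$ and $N$ a finitely generated submodule; a finite presentation is given by the generators of $N$, and elements of the module are represented by vectors in $\mathbb{F}_p[\overline{X}^{\pm}]^d$. The group $\mathcal{Y} \rtimes \mathbb{Z}^n$ is the set $\{(y, \boldsymbol{a}) \mid y \in \mathcal{Y}, \boldsymbol{a} \in \mathbb{Z}^n\}$ with multiplication $(y, \boldsymbol{a}) \cdot (y', \boldsymbol{a}') = (y + \overline{X}^{\boldsymbol{a}} \cdot y', \boldsymbol{a} + \boldsymbol{a}')$, inverse $(y, \boldsymbol{a})^{-1} = (-\overline{X}^{-\boldsymbol{a}}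 \cdot y, -\boldsymbol{a})$ and neutral element $(0, \boldsymbol{0})$. $p$-automatic sets: let $\Sigma_p = \{+, -, 0, 1, \ldots, p-1\}$. For an integer $a \geq 0$ with base-$p$ expansion $a = \sum_{i=0}^r w_i p^i$ ($r \geq 0$ as small as possible), let $w(a)$ be the word $+ w_0 w_1 \cdots w_r$ (least significant digit first); for a negative integer $-a$ let $w(-a)$ be the word $- w_0 w_1 \cdots w_r$. For $(z_1, \ldots, z_D) \in \mathbb{Z}^D$, let $w(z_1, \ldots, z_D)$ be the word over the alphabet $\Sigma_p^D$ obtained from the tuple $(w(z_1), \ldots, w(z_D))$ by appending a minimal number of zeros at the ends of the words so that they all have equal lengths. A subset $S \subseteq \mathbb{Z}^D$ is $p$-automatic if some finite automaton over $\Sigma_p^D$ accepts exactly the set of words $\{w(s) \mid s \in S\}$. It is effectively $p$-automatic if its accepting automaton is explicitly given, i.e. can be computed from the input data (here, $p$, $n$, the finite presentation of $\mathcal{Y}$, and $h_1, \ldots, h_m, g$). *)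

theory Defs
  imports
    "HOL-Algebra.Module"
    "HOL-Algebra.AbelCoset"
    "HOL-Number_Theory.Residues"
    "HOL-Library.Nat_Bijection"
begin

section \<open>Laurent polynomial rings\<close>

text \<open>
  The number of variables is part of the input of an algorithm below, so it cannot be a type.
  An exponent vector in \<open>\<int>\<^sup>n\<close> is an \<^typ>\<open>int list\<close> of length \<open>n\<close>, and a Laurent polynomial
  maps exponent vectors to coefficients. The field with \<open>p\<close> elements is
  \<^term>\<open>residue_ring (int p)\<close>.
\<close>

definition vec_add :: "int list \<Rightarrow> int list \<Rightarrow> int list" where
  "vec_add a b = map2 (+) a b"

definition laurent_support :: "('c, 'm) ring_scheme \<Rightarrow> (int list \<Rightarrow> 'c) \<Rightarrow> int list set" where
  "laurent_support K f = {a. f a \<noteq> \<zero>\<^bsub>K\<^esub>}"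

definition laurent_monom :: "('c, 'm) ring_scheme \<Rightarrow> 'c \<Rightarrow> int list \<Rightarrow> (int list \<Rightarrow> 'c)" where
  "laurent_monom K c a = (\<lambda>b. if b = a then c else \<zero>\<^bsub>K\<^esub>)"

definition laurent_ring :: "('c, 'm) ring_scheme \<Rightarrow> nat \<Rightarrow> (int list \<Rightarrow> 'c) ring" where
  "laurent_ring K n =
     \<lparr> carrier = {f. range f \<subseteq> carrier K \<and> finite (laurent_support K f) \<and>
                     (\<forall>a\<in>laurent_support K f. length a = n)},
       monoid.mult = (\<lambda>f g a. finsum K (\<lambda>(b, c). f b \<otimes>\<^bsub>K\<^esub> g c)
          {(b, c). b \<in> laurent_support K f \<and> c \<in> laurent_support K g \<and> vec_add b c = a}),
       one = laurent_monom K \<one>\<^bsub>K\<^esub> (replicate n 0),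
       zero = (\<lambda>a. \<zero>\<^bsub>K\<^esub>),
       add = (\<lambda>f g a. f a \<oplus>\<^bsub>K\<^esub> g a) \<rparr>"


section \<open>Finitely presented modules\<close>

text \<open>
  The record type of modules in HOL-Algebra extends that of rings; the fields
  \<^const>\<open>monoid.mult\<close> and \<^const>\<open>one\<close> play no role for modules and are left unspecified.
\<close>

definition free_module :: "('a, 'm) ring_scheme \<Rightarrow> nat \<Rightarrow> ('a, 'a list) module" where
  "free_module R d =
     \<lparr> carrier = {v. length v = d \<and> set v \<subseteq> carrier R},
       monoid.mult = undefined, one = undefined,
       zero = replicate d \<zero>\<^bsub>R\<^esub>,
       add = map2 (\<lambda>x y. x \<oplus>\<^bsub>R\<^esub> y),
       smult = (\<lambda>r. map (\<lambda>x. r \<otimes>\<^bsub>R\<^esub> x)) \<rparr>"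

definition submodule_gen ::
    "('a, 'm) ring_scheme \<Rightarrow> ('a, 'b, 'n) module_scheme \<Rightarrow> 'b set \<Rightarrow> 'b set" where
  "submodule_gen R M S = \<Inter> {H. submodule H R M \<and> S \<subseteq> H}"

definition quotient_module :: "('a, 'b, 'n) module_scheme \<Rightarrow> 'b set \<Rightarrow> ('a, 'b set) module" where
  "quotient_module M N =
     \<lparr> carrier = a_rcosets\<^bsub>M\<^esub> N,
       monoid.mult = undefined, one = undefined,
       zero = N,
       add = (\<lambda>C D. C <+>\<^bsub>M\<^esub> D),
       smult = (\<lambda>r C. \<Union>x\<in>C. N +>\<^bsub>M\<^esub> (r \<odot>\<^bsub>M\<^esub> x)) \<rparr>"

definition presented_module ::
    "('a, 'm) ring_scheme \<Rightarrow> nat \<Rightarrow> 'a list set \<Rightarrow> ('a, 'a list set) module" where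
  "presented_module R d S =
     quotient_module (free_module R d) (submodule_gen R (free_module R d) S)"

definition presented_elem ::
    "('a, 'm) ring_scheme \<Rightarrow> nat \<Rightarrow> 'a list set \<Rightarrow> 'a list \<Rightarrow> 'a list set" where
  "presented_elem R d S v = submodule_gen R (free_module R d) S +>\<^bsub>free_module R d\<^esub> v"


section \<open>The group \<open>\<Y> \<rtimes> \<int>\<^sup>n\<close>\<close>

definition semidirect ::
    "('c, 'm) ring_scheme \<Rightarrow> nat \<Rightarrow> (int list \<Rightarrow> 'c, 'b, 'n) module_scheme \<Rightarrow>
     ('b \<times> int list) monoid" where
  "semidirect K n Y =
     \<lparr> carrier = carrier Y \<times> {a. length a = n},
       monoid.mult = (\<lambda>(y, a) (y', a').
          (y \<oplus>\<^bsub>Y\<^esub> (laurent_monom K \<one>\<^bsub>K\<^esub> a \<odot>\<^bsub>Y\<^esub> y'), vec_add a a')),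
       one = (\<zero>\<^bsub>Y\<^esub>, replicate n 0) \<rparr>"

definition power_product :: "('g, 'm) monoid_scheme \<Rightarrow> 'g list \<Rightarrow> int list \<Rightarrow> 'g" where
  "power_product G hs ks =
     foldr (\<lambda>x y. x \<otimes>\<^bsub>G\<^esub> y) (map2 (\<lambda>h k. h [^]\<^bsub>G\<^esub> k) hs ks) \<one>\<^bsub>G\<^esub>"


section \<open>Automatic sets\<close>

datatype sym = Plus | Minus | Digit nat

definition sigma :: "nat \<Rightarrow> sym set" where
  "sigma p = {Plus, Minus} \<union> Digit ` {..<p}"

definition tuple_letters :: "nat \<Rightarrow> nat \<Rightarrow> sym list set" where
  "tuple_letters p D = {c. length c = D \<and> set c \<subseteq> sigma p}"

text \<open>The least \<open>r\<close> with \<open>a < p\<^bsup>r+1\<^esup>\<close> is the least admissible top index of an expansion of \<open>a\<close>;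
  in particular the expansion of \<open>0\<close> has the single digit \<open>0\<close>.\<close>

definition digits :: "nat \<Rightarrow> nat \<Rightarrow> nat list" where
  "digits p a = map (\<lambda>i. a div p ^ i mod p) [0..<Suc (LEAST r. a < p ^ Suc r)]"

definition int_word :: "nat \<Rightarrow> int \<Rightarrow> sym list" where
  "int_word p z = (if z \<ge> 0 then Plus else Minus) # map Digit (digits p (nat \<bar>z\<bar>))"

text \<open>The maximum below is over a list that may be empty: the word of the only element of
  \<open>\<int>\<^sup>0\<close> is the empty word.\<close>

definition tuple_word :: "nat \<Rightarrow> int list \<Rightarrow> sym list list" where
  "tuple_word p zs =
     (let ws = map (int_word p) zs;
          L = foldr max (map length ws) 0;
          padded = map (\<lambda>w. w @ replicate (L - length w) (Digit 0)) ws
      in map (\<lambda>j. map (\<lambda>w. w ! j) padded) [0..<L])"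

text \<open>Finite automata are concrete finite objects, so that they can be the output of an
  algorithm: the states are \<open>0, \<dots>, num_states - 1\<close> and transitions are listed explicitly.
  They need not be deterministic.\<close>

datatype 'l automaton = Automaton
  (num_states: nat) (initial: "nat list") (transitions: "(nat \<times> 'l \<times> nat) list") (final: "nat list")

definition automaton_over :: "'l set \<Rightarrow> 'l automaton \<Rightarrow> bool" where
  "automaton_over \<Sigma> A \<longleftrightarrow>
     set (initial A) \<subseteq> {..<num_states A} \<and> set (final A) \<subseteq> {..<num_states A} \<and>
     set (transitions A) \<subseteq> {..<num_states A} \<times> \<Sigma> \<times> {..<num_states A}"

fun run :: "'l automaton \<Rightarrow> nat \<Rightarrow> 'l list \<Rightarrow> nat \<Rightarrow> bool" where
  "run A q [] q' \<longleftrightarrow> q = q'"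
| "run A q (c # w) q' \<longleftrightarrow> (\<exists>r. (q, c, r) \<in> set (transitions A) \<and> run A r w q')"

definition language :: "'l automaton \<Rightarrow> 'l list set" where
  "language A = {w. \<exists>q\<in>set (initial A). \<exists>q'\<in>set (final A). run A q w q'}"

text \<open>\<open>accepting_automaton p D S A\<close>: the automaton \<open>A\<close> witnesses that \<open>S \<subseteq> \<int>\<^sup>D\<close> is
  \<open>p\<close>-automatic.\<close>

definition accepting_automaton ::
    "nat \<Rightarrow> nat \<Rightarrow> int list set \<Rightarrow> sym list automaton \<Rightarrow> bool" where
  "accepting_automaton p D S A \<longleftrightarrow>
     S \<subseteq> {zs. length zs = D} \<and> automaton_over (tuple_letters p D) A \<and>
     language A = tuple_word p ` S"

definition p_automatic :: "nat \<Rightarrow> nat \<Rightarrow> int list set \<Rightarrow> bool" where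
  "p_automatic p D S \<longleftrightarrow> (\<exists>A. accepting_automaton p D S A)"


section \<open>Computability\<close>

text \<open>Kleene's \<open>\<mu>\<close>-recursive functions: \<open>computes f xs y\<close> states that the partial recursive
  function with program \<open>f\<close> is defined at the arguments \<open>xs\<close> and has the value \<open>y\<close> there.\<close>

datatype recf = Zero | Succ | Proj nat | Comp recf "recf list" | PrimRec recf recf | Mu recf

inductive computes :: "recf \<Rightarrow> nat list \<Rightarrow> nat \<Rightarrow> bool" where
  zero: "computes Zero xs 0"
| succ: "computes Succ [x] (Suc x)"
| proj: "i < length xs \<Longrightarrow> computes (Proj i) xs (xs ! i)"
| comp: "list_all2 (\<lambda>g y. computes g xs y) gs ys \<Longrightarrow> computes f ys z \<Longrightarrow> computes (Comp f gs) xs z"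
| rec_0: "computes f xs y \<Longrightarrow> computes (PrimRec f g) (0 # xs) y"
| rec_Suc: "computes (PrimRec f g) (k # xs) y \<Longrightarrow> computes g (k # y # xs) z \<Longrightarrow>
    computes (PrimRec f g) (Suc k # xs) z"
| mu: "computes f (k # xs) 0 \<Longrightarrow> (\<forall>i<k. \<exists>y. computes f (i # xs) (Suc y)) \<Longrightarrow>
    computes (Mu f) xs k"

inductive_cases computes_cases:
  "computes Zero xs z" "computes Succ xs z" "computes (Proj i) xs z" "computes (Comp f gs) xs z"
  "computes (PrimRec f g) (0 # xs) z" "computes (PrimRec f g) (Suc k # xs) z" "computes (Mu f) xs z"

lemma computes_deterministic: "computes f xs y \<Longrightarrow> computes f xs z \<Longrightarrow> y = z"
proof (induction arbitrary: z rule: computes.induct)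
  case (zero xs)
  then show ?case by (auto elim: computes_cases)
next
  case (succ x)
  then show ?case by (auto elim: computes_cases)
next
  case (proj i xs)
  from proj.prems show ?case by (auto elim: computes_cases)
next
  case (comp xs gs ys f z')
  from comp.prems obtain ys' where ys': "list_all2 (\<lambda>g y. computes g xs y) gs ys'" "computes f ys' z"
    by (auto elim: computes_cases)
  have "ys = ys'"
  proof (rule nth_equalityI)
    show "length ys = length ys'"
      using list_all2_lengthD[OF comp.IH(1)] list_all2_lengthD[OF ys'(1)] by simp
    show "ys ! i = ys' ! i" if "i < length ys" for i
      using comp.IH(1) ys'(1) that by (auto simp: list_all2_conv_all_nth)
  qed
  with comp.IH(2) ys'(2) show ?case by blast
next
  case (rec_0 f xs y g)
  from rec_0.prems have "computes f xs z" by (auto elim: computes_cases)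
  then show ?case by (rule rec_0.IH)
next
  case (rec_Suc f g k xs y z')
  from rec_Suc.prems obtain y' where "computes (PrimRec f g) (k # xs) y'" "computes g (k # y' # xs) z"
    by (auto elim: computes_cases)
  with rec_Suc.IH show ?case by metis
next
  case (mu f k xs)
  from mu.prems have z: "computes f (z # xs) 0" "\<forall>i<z. \<exists>y. computes f (i # xs) (Suc y)"
    by (auto elim: computes_cases)
  have "\<not> z < k" using mu.IH(2) z(1) by (metis nat.distinct(1))
  moreover have "\<not> k < z" using mu.IH(1) z(2) by (metis nat.distinct(1))
  ultimately show ?case by simp
qed

text \<open>Finite data are coded by natural numbers through the standard pairing of
  \<^theory>\<open>HOL-Library.Nat_Bijection\<close>.\<close>

fun sym_code :: "sym \<Rightarrow> nat" where
  "sym_code Plus = 0"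
| "sym_code Minus = 1"
| "sym_code (Digit i) = i + 2"

definition transition_code :: "nat \<times> sym list \<times> nat \<Rightarrow> nat" where
  "transition_code = (\<lambda>(q, c, r).
     prod_encode (q, prod_encode (list_encode (map sym_code c), r)))"

definition automaton_code :: "sym list automaton \<Rightarrow> nat" where
  "automaton_code A = list_encode
     [num_states A, list_encode (initial A),
      list_encode (map transition_code (transitions A)), list_encode (final A)]"

text \<open>
  A family of sets \<open>S i \<subseteq> \<int>\<^bsup>D i\<^esup>\<close> is effectively \<open>p i\<close>-automatic, where \<open>i\<close> ranges over the
  set \<open>I\<close> of possible inputs, if one algorithm computes, from any given input \<open>i\<close>, an automaton
  witnessing that \<open>S i\<close> is \<open>p i\<close>-automatic.
\<close>

definition effectively_p_automatic ::
    "'i set \<Rightarrow> ('i \<Rightarrow> nat) \<Rightarrow> ('i \<Rightarrow> nat) \<Rightarrow> ('i \<Rightarrow> nat) \<Rightarrow> ('i \<Rightarrow> int list set) \<Rightarrow> bool" where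
  "effectively_p_automatic I code p D S \<longleftrightarrow>
     (\<exists>f. \<forall>i\<in>I. \<exists>A. computes f [code i] (automaton_code A) \<and>
                    accepting_automaton (p i) (D i) (S i) A)"

lemma effectively_p_automatic_imp_p_automatic:
  "effectively_p_automatic I code p D S \<Longrightarrow> i \<in> I \<Longrightarrow> p_automatic (p i) (D i) (S i)"
  unfolding effectively_p_automatic_def p_automatic_def by blast


section \<open>Input data\<close>

text \<open>
  A Laurent polynomial is given as a list of terms (exponent vector, coefficient), of which it is
  the sum; an element of the free module as a list of such polynomials; and an element of
  \<open>\<Y> \<rtimes> \<int>\<^sup>n\<close> as a vector representing its first component together with its second one.
\<close>

type_synonym poly_data = "(int list \<times> int) list"
type_synonym vec_data = "poly_data list"
type_synonym elem_data = "vec_data \<times> int list"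

record input_data =
  in_p :: nat
  in_n :: nat
  in_d :: nat
  in_rels :: "vec_data list"
  in_hs :: "elem_data list"
  in_g :: elem_data

definition wf_poly :: "nat \<Rightarrow> nat \<Rightarrow> poly_data \<Rightarrow> bool" where
  "wf_poly p n ts \<longleftrightarrow>
     (\<forall>(a, c)\<in>set ts. length a = n \<and> c \<in> carrier (residue_ring (int p)))"

definition wf_vec :: "nat \<Rightarrow> nat \<Rightarrow> nat \<Rightarrow> vec_data \<Rightarrow> bool" where
  "wf_vec p n d v \<longleftrightarrow> length v = d \<and> (\<forall>ts\<in>set v. wf_poly p n ts)"

definition wf_elem :: "nat \<Rightarrow> nat \<Rightarrow> nat \<Rightarrow> elem_data \<Rightarrow> bool" where
  "wf_elem p n d = (\<lambda>(v, a). wf_vec p n d v \<and> length a = n)"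

definition wf_input :: "input_data \<Rightarrow> bool" where
  "wf_input x \<longleftrightarrow> prime (in_p x) \<and>
     (\<forall>v\<in>set (in_rels x). wf_vec (in_p x) (in_n x) (in_d x) v) \<and>
     (\<forall>h\<in>set (in_hs x). wf_elem (in_p x) (in_n x) (in_d x) h) \<and>
     wf_elem (in_p x) (in_n x) (in_d x) (in_g x)"

definition poly_of :: "nat \<Rightarrow> nat \<Rightarrow> poly_data \<Rightarrow> (int list \<Rightarrow> int)" where
  "poly_of p n ts =
     foldr (\<lambda>(a, c) f. laurent_monom (residue_ring (int p)) c a
                          \<oplus>\<^bsub>laurent_ring (residue_ring (int p)) n\<^esub> f)
       ts \<zero>\<^bsub>laurent_ring (residue_ring (int p)) n\<^esub>"

definition vec_of :: "nat \<Rightarrow> nat \<Rightarrow> vec_data \<Rightarrow> (int list \<Rightarrow> int) list" where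
  "vec_of p n = map (poly_of p n)"

definition in_ring :: "input_data \<Rightarrow> (int list \<Rightarrow> int) ring" where
  "in_ring x = laurent_ring (residue_ring (int (in_p x))) (in_n x)"

definition in_relators :: "input_data \<Rightarrow> (int list \<Rightarrow> int) list set" where
  "in_relators x = set (map (vec_of (in_p x) (in_n x)) (in_rels x))"

definition in_module ::
    "input_data \<Rightarrow> (int list \<Rightarrow> int, (int list \<Rightarrow> int) list set) module" where
  "in_module x = presented_module (in_ring x) (in_d x) (in_relators x)"

definition in_group :: "input_data \<Rightarrow> ((int list \<Rightarrow> int) list set \<times> int list) monoid" where
  "in_group x = semidirect (residue_ring (int (in_p x))) (in_n x) (in_module x)"

definition elem_of :: "input_data \<Rightarrow> elem_data \<Rightarrow> (int list \<Rightarrow> int) list set \<times> int list" where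
  "elem_of x = (\<lambda>(v, a).
     (presented_elem (in_ring x) (in_d x) (in_relators x) (vec_of (in_p x) (in_n x) v), a))"

definition solutions :: "input_data \<Rightarrow> int list set" where
  "solutions x = {ks. length ks = length (in_hs x) \<and>
     power_product (in_group x) (map (elem_of x) (in_hs x)) ks = elem_of x (in_g x)}"

definition ints_code :: "int list \<Rightarrow> nat" where
  "ints_code a = list_encode (map int_encode a)"

definition poly_code :: "poly_data \<Rightarrow> nat" where
  "poly_code ts = list_encode (map (\<lambda>(a, c). prod_encode (ints_code a, int_encode c)) ts)"

definition vec_code :: "vec_data \<Rightarrow> nat" where
  "vec_code v = list_encode (map poly_code v)"

definition elem_code :: "elem_data \<Rightarrow> nat" where
  "elem_code = (\<lambda>(v, a). prod_encode (vec_code v, ints_code a))"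

definition input_code :: "input_data \<Rightarrow> nat" where
  "input_code x = list_encode
     [in_p x, in_n x, in_d x, list_encode (map vec_code (in_rels x)),
      list_encode (map elem_code (in_hs x)), elem_code (in_g x)]"

end

theory Submission
  imports Defs "HOL-Library.Poly_Mapping" "HOL-Library.Function_Algebras" "HOL-Library.List_Lenlexorder"
    "HOL-Computational_Algebra.Polynomial"
begin

text \<open>
  Adjoin to the module a variable \<open>t\<close> acting trivially, generators \<open>e\<^sub>j\<close> with
  \<open>(t X\<^bsup>a\<^sub>j\<^esup> - 1) e\<^sub>j = y\<^sub>j\<close>, where \<open>h\<^sub>j = (y\<^sub>j, a\<^sub>j)\<close>, and one more free generator. Then the equation
  says that a vector whose coefficients are the monomials with exponents
  \<open>n\<^sub>1 (a\<^sub>1, 1) + \<dots> + n\<^sub>l (a\<^sub>l, 1)\<close> for \<open>l \<le> m\<close>, combined linearly, lies in a submodule \<open>N\<close> of a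
  free module.

  Every submodule \<open>N\<close> that contains \<open>p\<close> times the free module is cut out by the shifts of finitely
  many functionals, whose coefficient arrays \<open>\<int>\<^sup>n \<rightarrow> \<int>\<close> lie in a finite set closed under the decimations
  \<open>t \<mapsto> (a \<mapsto> t (p a + s))\<close>. By Noetherian induction and a Fitting decomposition one may assume that every
  Laurent polynomial acts on the quotient either nilpotently or injectively. After Noether
  normalization the quotient is then torsion free of finite rank over a Laurent polynomial ring in \<open>k\<close>
  variables; the constant coefficients of the coordinates with respect to a basis over the fraction
  field are the required functionals, and the arrays of bounded support in the \<open>k\<close> variables form the
  finite set. Hence, with \<open>n\<^sub>j = p n\<^sub>j' + d\<^sub>j\<close>, membership of the monomial vector of \<open>(n\<^sub>j)\<close> in \<open>N\<close> becomes
  membership of that of \<open>(n\<^sub>j')\<close> in one of finitely many submodules, the states of the automaton.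

  For effectivity, every state carries generators of its submodule, which bound it from below, and
  functionals, which bound it from above. That these data fit together is a finite check by explicit
  linear combinations and table lookups, so a correct certificate can be found by unbounded search.
\<close>

section \<open>Computable functions on coded data\<close>

text \<open>The prime, the number of variables and the rank are inputs of one algorithm, so none of
  them can be a type. All vectors are therefore integral: a submodule over F_p is represented by its
  preimage, which contains p times the free module, and equality becomes divisibility by p.

  Decimation of arrays is adjoint to the Frobenius X^a -> X^(p a), and this shapes the structure
  theory. Noether normalization may use only monomial changes of variables, because additive maps of
  exponents commute with multiplication by p. Nilpotent elements are converted into relations by
  raising them to a power of p, which modulo p just scales the exponents. The finite set of arrays
  is made of functionals that respect the annihilator of the quotient: the submodule itself is in
  general not stable under the Frobenius, its annihilator is.

  The existence proof uses a maximal counterexample and arbitrary choices, so it yields no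
  algorithm. Hence soundness of the check and existence of a certificate are proved separately, and
  the correctness of the automaton rests on the check alone.\<close>

class enc =
  fixes enc :: "'a \<Rightarrow> nat"
  assumes bij_enc: "bij enc"

text \<open>Codes are bijections, not just injections: every number decodes to a value, so
  computability is a statement about total functions on numbers, and a search through all
  certificates is a search through all numbers.\<close>

definition dec :: "nat \<Rightarrow> 'a::enc" where "dec = inv_into UNIV enc"

lemma dec_enc [simp]: "dec (enc x) = x"
  unfolding dec_def using bij_enc by (metis bij_inv_eq_iff)

lemma enc_dec [simp]: "enc (dec n) = n"
  unfolding dec_def using bij_enc by (metis bij_inv_eq_iff)

lemma enc_inject [simp]: "enc x = enc y \<longleftrightarrow> x = y"
  by (metis dec_enc)

lemma bij_encI:
  assumes "\<And>x. g (f x) = x" "\<And>n. f (g n) = n" shows "bij f"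
  using assms by (metis bijI')

instantiation nat :: enc begin
definition enc_nat :: "nat \<Rightarrow> nat" where [simp]: "enc_nat n = n"
instance by standard (auto simp: enc_nat_def bij_def inj_def surj_def)
end

instantiation int :: enc begin
definition enc_int :: "int \<Rightarrow> nat" where "enc_int = int_encode"
instance by standard (simp add: enc_int_def bij_int_encode)
end

instantiation prod :: (enc, enc) enc begin
definition enc_prod :: "'a \<times> 'b \<Rightarrow> nat" where
  "enc_prod z = prod_encode (enc (fst z), enc (snd z))"
instance
  by standard (rule bij_encI[where g = "\<lambda>n. (dec (fst (prod_decode n)), dec (snd (prod_decode n)))"],
      auto simp: enc_prod_def)
end

instantiation list :: (enc) enc begin
definition enc_list :: "'a list \<Rightarrow> nat" where
  "enc_list xs = list_encode (map enc xs)"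
instance
  by standard (rule bij_encI[where g = "\<lambda>n. map dec (list_decode n)"],
      auto simp: enc_list_def comp_def)
end

text \<open>The code is \<open>sym_code\<close>, so that the generic codes of pairs and lists
  reproduce \<open>automaton_code\<close> in the end.\<close>

instantiation sym :: enc begin
definition enc_sym :: "sym \<Rightarrow> nat" where "enc_sym = sym_code"
instance
proof
  show "bij (enc :: sym \<Rightarrow> nat)"
    unfolding enc_sym_def
  proof (rule bij_encI[where g = "\<lambda>n. if n = 0 then Plus else if n = 1 then Minus else Digit (n - 2)"])
    show "(if sym_code x = 0 then Plus else if sym_code x = 1 then Minus else Digit (sym_code x - 2)) = x" for x
      by (cases x) auto
  qed auto
qed
end

section \<open>Total recursive functions of numbers\<close>

definition recursive :: "nat \<Rightarrow> (nat list \<Rightarrow> nat) \<Rightarrow> bool" where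
  "recursive k f \<longleftrightarrow> (\<exists>r. \<forall>xs. length xs = k \<longrightarrow> computes r xs (f xs))"

lemma recursive_proj: "i < k \<Longrightarrow> recursive k (\<lambda>xs. xs ! i)"
  unfolding recursive_def by (metis computes.proj)

lemma recursive_zero: "recursive k (\<lambda>xs. 0)"
  unfolding recursive_def by (metis computes.zero)

lemma recursive_Suc:
  assumes "recursive k f" shows "recursive k (\<lambda>xs. Suc (f xs))"
proof -
  obtain r where r: "\<And>xs. length xs = k \<Longrightarrow> computes r xs (f xs)"
    using assms unfolding recursive_def by metis
  have "computes (Comp Succ [r]) xs (Suc (f xs))" if "length xs = k" for xs
    by (rule computes.comp[where ys = "[f xs]"]) (auto intro: r that computes.succ)
  then show ?thesis unfolding recursive_def by metis
qed

lemma recursive_const: "recursive k (\<lambda>xs. c)"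
  by (induction c) (auto intro: recursive_zero recursive_Suc)

lemma recursive_comp1:
  assumes "recursive 1 (\<lambda>ys. h (ys ! 0))" "recursive k f"
  shows "recursive k (\<lambda>xs. h (f xs))"
proof -
  obtain r s where r: "\<And>xs. length xs = k \<Longrightarrow> computes r xs (f xs)"
      and s: "\<And>ys. length ys = 1 \<Longrightarrow> computes s ys (h (ys ! 0))"
    using assms unfolding recursive_def by metis
  have "computes (Comp s [r]) xs (h (f xs))" if "length xs = k" for xs
    by (rule computes.comp[where ys = "[f xs]"]) (use r that s[of "[f xs]"] in auto)
  then show ?thesis unfolding recursive_def by metis
qed

lemma recursive_comp2:
  assumes "recursive 2 (\<lambda>ys. h (ys ! 0) (ys ! 1))" "recursive k f" "recursive k g"
  shows "recursive k (\<lambda>xs. h (f xs) (g xs))"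
proof -
  obtain r r' s where r: "\<And>xs. length xs = k \<Longrightarrow> computes r xs (f xs)"
      and r': "\<And>xs. length xs = k \<Longrightarrow> computes r' xs (g xs)"
      and s: "\<And>ys. length ys = 2 \<Longrightarrow> computes s ys (h (ys ! 0) (ys ! 1))"
    using assms unfolding recursive_def by metis
  have "computes (Comp s [r, r']) xs (h (f xs) (g xs))" if "length xs = k" for xs
    by (rule computes.comp[where ys = "[f xs, g xs]"]) (use r r' that s[of "[f xs, g xs]"] in auto)
  then show ?thesis unfolding recursive_def by metis
qed

text \<open>One parameter is enough: a larger context is packed into it by pairing.\<close>

lemma recursive_rec:
  assumes "recursive 1 (\<lambda>xs. f (xs ! 0))" "recursive 3 (\<lambda>xs. g (xs ! 0) (xs ! 1) (xs ! 2))"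
  shows "recursive 2 (\<lambda>xs. rec_nat (f (xs ! 1)) (\<lambda>n y. g n y (xs ! 1)) (xs ! 0))"
proof -
  obtain r s where r: "\<And>xs. length xs = 1 \<Longrightarrow> computes r xs (f (xs ! 0))"
      and s: "\<And>ys. length ys = 3 \<Longrightarrow> computes s ys (g (ys ! 0) (ys ! 1) (ys ! 2))"
    using assms unfolding recursive_def by metis
  have *: "computes (PrimRec r s) [n, x] (rec_nat (f x) (\<lambda>n y. g n y x) n)" for n x
  proof (induction n)
    case 0
    then show ?case using r[of "[x]"] by (auto intro: computes.rec_0)
  next
    case (Suc n)
    show ?case
      by (rule computes.rec_Suc[OF Suc]) (use s[of "[n, rec_nat (f x) (\<lambda>n y. g n y x) n, x]"] in simp)
  qed
  have "computes (PrimRec r s) xs (rec_nat (f (xs ! 1)) (\<lambda>n y. g n y (xs ! 1)) (xs ! 0))"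
    if "length xs = 2" for xs
    using *[of "xs ! 0" "xs ! 1"] that by (cases xs; cases "tl xs") auto
  then show ?thesis unfolding recursive_def by metis
qed

lemma recursive_mu:
  assumes "recursive 2 (\<lambda>xs. f (xs ! 0) (xs ! 1))" "\<And>x. \<exists>n. f n x = 0"
  shows "recursive 1 (\<lambda>xs. LEAST n. f n (xs ! 0) = 0)"
proof -
  obtain r where r: "\<And>xs. length xs = 2 \<Longrightarrow> computes r xs (f (xs ! 0) (xs ! 1))"
    using assms unfolding recursive_def by metis
  have *: "computes (Mu r) [x] (LEAST n. f n x = 0)" for x
  proof (rule computes.mu)
    have "f (LEAST n. f n x = 0) x = 0" using assms(2)[of x] by (rule LeastI_ex)
    then show "computes r [LEAST n. f n x = 0, x] 0"
      using r[of "[LEAST n. f n x = 0, x]"] by simp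
    show "\<forall>i<(LEAST n. f n x = 0). \<exists>y. computes r [i, x] (Suc y)"
    proof (intro allI impI)
      fix i assume "i < (LEAST n. f n x = 0)"
      then have "f i x \<noteq> 0" by (rule not_less_Least)
      then show "\<exists>y. computes r [i, x] (Suc y)"
        using r[of "[i, x]"] by (auto simp: gr0_conv_Suc)
    qed
  qed
  have "computes (Mu r) xs (LEAST n. f n (xs ! 0) = 0)" if "length xs = 1" for xs
    using *[of "xs ! 0"] that by (cases xs) auto
  then show ?thesis unfolding recursive_def by metis
qed

lemma recursive_add: "recursive k f \<Longrightarrow> recursive k g \<Longrightarrow> recursive k (\<lambda>xs. f xs + g xs)"
proof (rule recursive_comp2[where h = "(+)"])
  have "recursive 2 (\<lambda>xs. rec_nat (xs ! 1) (\<lambda>n y. Suc y) (xs ! 0))"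
    by (rule recursive_rec) (auto intro!: recursive_Suc recursive_proj)
  moreover have "rec_nat b (\<lambda>n y. Suc y) a = a + b" for a b :: nat by (induction a) auto
  ultimately show "recursive 2 (\<lambda>ys. ys ! 0 + ys ! 1)" by simp
qed

lemma recursive_mult: "recursive k f \<Longrightarrow> recursive k g \<Longrightarrow> recursive k (\<lambda>xs. f xs * g xs)"
proof (rule recursive_comp2[where h = "(*)"])
  have "recursive 2 (\<lambda>xs. rec_nat 0 (\<lambda>n y. y + xs ! 1) (xs ! 0))"
    by (rule recursive_rec[where f = "\<lambda>_. 0"]) (auto intro!: recursive_add recursive_zero recursive_proj)
  moreover have "rec_nat 0 (\<lambda>n y. y + b) a = a * b" for a b :: nat by (induction a) auto
  ultimately show "recursive 2 (\<lambda>ys. ys ! 0 * ys ! 1)" by simp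
qed

lemma recursive_pred: "recursive k f \<Longrightarrow> recursive k (\<lambda>xs. f xs - 1)"
proof (rule recursive_comp1[where h = "\<lambda>n. n - 1"])
  have "recursive 2 (\<lambda>xs. rec_nat 0 (\<lambda>n y. n) (xs ! 0))"
    by (rule recursive_rec[where f = "\<lambda>_. 0"]) (auto intro!: recursive_zero recursive_proj)
  then have "recursive 1 (\<lambda>xs. rec_nat 0 (\<lambda>n y. n) (xs ! 0))"
    by (rule recursive_comp2[where h = "\<lambda>a b. rec_nat 0 (\<lambda>n y. n) a"])
      (auto intro!: recursive_zero recursive_proj)
  moreover have "rec_nat 0 (\<lambda>n y. n) a = a - 1" for a :: nat by (induction a) auto
  ultimately show "recursive 1 (\<lambda>ys. ys ! 0 - 1)" by simp
qed

lemma recursive_diff: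
  assumes "recursive k f" "recursive k g" shows "recursive k (\<lambda>xs. f xs - g xs)"
proof (rule recursive_comp2[where h = "\<lambda>a b. b - a", OF _ assms(2,1)])
  have "recursive 2 (\<lambda>xs. rec_nat (xs ! 1) (\<lambda>n y. y - 1) (xs ! 0))"
    by (rule recursive_rec) (auto intro!: recursive_pred[simplified] recursive_proj)
  moreover have "rec_nat b (\<lambda>n y. y - 1) a = b - a" for a b :: nat by (induction a) auto
  ultimately show "recursive 2 (\<lambda>ys. ys ! 1 - ys ! 0)" by simp
qed

lemma recursive_triangle: "recursive k f \<Longrightarrow> recursive k (\<lambda>xs. triangle (f xs))"
proof (rule recursive_comp1[where h = triangle])
  have "recursive 2 (\<lambda>xs. rec_nat 0 (\<lambda>n y. y + Suc n) (xs ! 0))"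
    by (rule recursive_rec[where f = "\<lambda>_. 0"])
      (auto simp del: add_Suc_right intro!: recursive_zero recursive_add recursive_Suc recursive_proj)
  then have "recursive 1 (\<lambda>xs. rec_nat 0 (\<lambda>n y. y + Suc n) (xs ! 0))"
    by (rule recursive_comp2[where h = "\<lambda>a b. rec_nat 0 (\<lambda>n y. y + Suc n) a"])
      (auto intro!: recursive_zero recursive_proj)
  moreover have "rec_nat 0 (\<lambda>n y. y + Suc n) a = triangle a" for a :: nat by (induction a) auto
  ultimately show "recursive 1 (\<lambda>ys. triangle (ys ! 0))" by simp
qed

lemma recursive_prod_encode:
  "recursive k f \<Longrightarrow> recursive k g \<Longrightarrow> recursive k (\<lambda>xs. prod_encode (f xs, g xs))"
  by (simp add: prod_encode_def recursive_add recursive_triangle)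

text \<open>The pairing is \<open>triangle (a + b) + a\<close>, which lies between consecutive
  triangular numbers; so a + b is the least s for which the code is below
  \<open>triangle (Suc s)\<close>. Decoding thus becomes a search for s, after which a is a
  difference.\<close>

lemma prod_encode_root:
  "(LEAST s. Suc (prod_encode (a, b)) - triangle (Suc s) = 0) = a + b"
proof (rule Least_equality)
  show "Suc (prod_encode (a, b)) - triangle (Suc (a + b)) = 0"
    by (simp add: prod_encode_def)
next
  fix s assume s: "Suc (prod_encode (a, b)) - triangle (Suc s) = 0"
  show "a + b \<le> s"
  proof (rule ccontr)
    assume "\<not> a + b \<le> s"
    then have "Suc s \<le> a + b" by simp
    moreover have "mono triangle" by (rule monoI, unfold triangle_def, rule div_le_mono, rule mult_le_mono) auto
    ultimately have "triangle (Suc s) \<le> triangle (a + b)" by (rule monoD[rotated])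
    then show False using s by (simp add: prod_encode_def)
  qed
qed

lemma recursive_prod_decode:
  assumes "recursive k f"
  shows "recursive k (\<lambda>xs. fst (prod_decode (f xs)))" "recursive k (\<lambda>xs. snd (prod_decode (f xs)))"
proof -
  have root: "(LEAST s. Suc c - triangle (Suc s) = 0) = fst (prod_decode c) + snd (prod_decode c)" for c
    using prod_encode_root[of "fst (prod_decode c)" "snd (prod_decode c)"] by simp
  have "recursive 1 (\<lambda>xs. LEAST s. (\<lambda>s c. Suc c - triangle (Suc s)) s (xs ! 0) = 0)"
  proof (rule recursive_mu)
    show "recursive 2 (\<lambda>xs. Suc (xs ! 1) - triangle (Suc (xs ! 0)))"
      by (auto simp del: triangle_Suc diff_Suc_Suc
          intro!: recursive_diff recursive_triangle recursive_Suc recursive_proj)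
    show "\<exists>n. Suc x - triangle (Suc n) = 0" for x
      by (rule exI[of _ x]) simp
  qed
  then have r: "recursive 1 (\<lambda>xs. fst (prod_decode (xs ! 0)) + snd (prod_decode (xs ! 0)))"
    unfolding root .
  have eq: "c - triangle (fst (prod_decode c) + snd (prod_decode c)) = fst (prod_decode c)" for c
  proof -
    have "c = prod_encode (fst (prod_decode c), snd (prod_decode c))" by simp
    then show ?thesis unfolding prod_encode_def by (metis (no_types, lifting) case_prod_conv diff_add_inverse)
  qed
  have f1: "recursive 1 (\<lambda>xs. fst (prod_decode (xs ! 0)))"
    using recursive_diff[OF recursive_proj[of 0 1] recursive_triangle[OF r]] by (simp add: eq)
  have "recursive 1 (\<lambda>xs. snd (prod_decode (xs ! 0)))"
    using recursive_diff[OF r f1] by simp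
  then show "recursive k (\<lambda>xs. snd (prod_decode (f xs)))" using assms by (rule recursive_comp1)
  show "recursive k (\<lambda>xs. fst (prod_decode (f xs)))" using f1 assms by (rule recursive_comp1)
qed

lemma dec_nat [simp]: "dec n = (n :: nat)"
  by (metis dec_enc enc_nat_def)

section \<open>Computable functions between coded types\<close>

definition computable :: "('a::enc \<Rightarrow> 'b::enc) \<Rightarrow> bool" where
  "computable f \<longleftrightarrow> recursive 1 (\<lambda>xs. enc (f (dec (xs ! 0))))"

definition decidable :: "('a::enc \<Rightarrow> bool) \<Rightarrow> bool" where
  "decidable P \<longleftrightarrow> computable (\<lambda>x. if P x then 1 else 0 :: nat)"

lemma computable_imp_computes:
  assumes "computable f" obtains r where "\<And>x. computes r [enc x] (enc (f x))"
proof -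
  obtain r where r: "\<And>xs. length xs = 1 \<Longrightarrow> computes r xs (enc (f (dec (xs ! 0))))"
    using assms unfolding computable_def recursive_def by metis
  have "computes r [enc x] (enc (f x))" for x using r[of "[enc x]"] by simp
  then show ?thesis by (rule that)
qed

lemma computable_recode: "(\<And>x. enc (f x) = enc x) \<Longrightarrow> computable f"
  unfolding computable_def by (simp add: recursive_proj)

lemma computable_id: "computable (\<lambda>x. x)"
  by (rule computable_recode) simp

lemma computable_const: "computable (\<lambda>x. c)"
  unfolding computable_def by (rule recursive_const)

lemma computable_comp: "computable f \<Longrightarrow> computable g \<Longrightarrow> computable (\<lambda>x. f (g x))"
  unfolding computable_def
  using recursive_comp1[of "\<lambda>n. enc (f (dec n))" 1 "\<lambda>xs. enc (g (dec (xs ! 0)))"] by simp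

lemma computable_enc: "computable g \<Longrightarrow> computable (\<lambda>x. enc (g x))"
  by (rule computable_comp[of enc]) (auto intro: computable_recode)

lemma computable_dec: "computable g \<Longrightarrow> computable (\<lambda>x. dec (g x))"
  by (rule computable_comp[of dec]) (auto intro: computable_recode)

lemma computable_Pair: "computable f \<Longrightarrow> computable g \<Longrightarrow> computable (\<lambda>x. (f x, g x))"
  unfolding computable_def by (simp add: enc_prod_def recursive_prod_encode)

lemma dec_prod: "dec n = (dec (fst (prod_decode n)), dec (snd (prod_decode n)))"
  by (metis dec_enc enc_dec enc_prod_def fst_conv prod_decode_inverse snd_conv surjective_pairing)

lemma computable_fst: "computable g \<Longrightarrow> computable (\<lambda>x. fst (g x))"
  by (rule computable_comp[of fst])
    (simp_all add: computable_def dec_prod recursive_prod_decode recursive_proj)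

lemma computable_snd: "computable g \<Longrightarrow> computable (\<lambda>x. snd (g x))"
  by (rule computable_comp[of snd])
    (simp_all add: computable_def dec_prod recursive_prod_decode recursive_proj)

lemma recursive_from_computable:
  assumes "computable f" "recursive k g" shows "recursive k (\<lambda>xs. enc (f (dec (g xs))))"
  using recursive_comp1[of "\<lambda>n. enc (f (dec n))" k g] assms unfolding computable_def by simp

text \<open>Functions under a binder are given uncurried: the first component of the argument is the
  surrounding context, the remaining ones are the bound variables. With this convention each rule
  reduces the computability of a term to that of its subterms.\<close>

lemma computable_rec_nat:
  assumes "computable (\<lambda>z. g (fst z) (fst (snd z)) (snd (snd z)))" "computable a" "computable n"
  shows "computable (\<lambda>x. rec_nat (a x) (g x) (n x))"
proof -
  have 1: "recursive 1 (\<lambda>xs. enc (a (dec (xs ! 0))))" using assms(2) unfolding computable_def .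
  have 2: "recursive 3 (\<lambda>xs. enc (g (dec (xs ! 2)) (xs ! 0) (dec (xs ! 1))))"
  proof -
    have "recursive 3 (\<lambda>xs. enc ((\<lambda>z. g (fst z) (fst (snd z)) (snd (snd z)))
            (dec (prod_encode (xs ! 2, prod_encode (xs ! 0, xs ! 1))))))"
      by (rule recursive_from_computable[OF assms(1)]) (auto intro!: recursive_prod_encode recursive_proj)
    then show ?thesis
      by (simp add: dec_prod dec_nat)
  qed
  have 3: "recursive 2 (\<lambda>xs. rec_nat (enc (a (dec (xs ! 1))))
            (\<lambda>n y. enc (g (dec (xs ! 1)) n (dec y))) (xs ! 0))"
    using recursive_rec[OF 1 2] .
  have *: "rec_nat (enc (a x)) (\<lambda>n y. enc (g x n (dec y))) m = enc (rec_nat (a x) (g x) m)" for x m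
    by (induction m) auto
  have "recursive 1 (\<lambda>xs. (\<lambda>u v. rec_nat (enc (a (dec v))) (\<lambda>n y. enc (g (dec v) n (dec y))) u)
          (n (dec (xs ! 0))) (xs ! 0))"
    by (rule recursive_comp2[OF 3]) (use assms(3) in \<open>auto simp: computable_def intro: recursive_proj\<close>)
  then show ?thesis unfolding computable_def * .
qed

lemma computable_Suc: "computable f \<Longrightarrow> computable (\<lambda>x. Suc (f x))"
  unfolding computable_def by (simp add: recursive_Suc)

lemma computable_add: "computable f \<Longrightarrow> computable g \<Longrightarrow> computable (\<lambda>x. f x + g x :: nat)"
  unfolding computable_def by (simp add: recursive_add)

lemma computable_diff: "computable f \<Longrightarrow> computable g \<Longrightarrow> computable (\<lambda>x. f x - g x :: nat)"
  unfolding computable_def by (simp add: recursive_diff)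

lemma computable_mult: "computable f \<Longrightarrow> computable g \<Longrightarrow> computable (\<lambda>x. f x * g x :: nat)"
  unfolding computable_def by (simp add: recursive_mult)

text \<open>The case distinction is a recursion of length 0 or 1.\<close>

lemma computable_if:
  assumes "decidable P" "computable f" "computable g"
  shows "computable (\<lambda>x. if P x then f x else g x)"
proof -
  have "computable (\<lambda>x. rec_nat (g x) (\<lambda>n y. f x) (if P x then 1 else 0))"
    by (rule computable_rec_nat)
      (use assms computable_comp[OF assms(2) computable_fst[OF computable_id]] in \<open>auto simp: decidable_def\<close>)
  moreover have "rec_nat (g x) (\<lambda>n y. f x) (if P x then 1 else 0) = (if P x then f x else g x)" for x
    by simp
  ultimately show ?thesis by simp
qed

lemma decidable_cong: "decidable P \<Longrightarrow> (\<And>x. P x = Q x) \<Longrightarrow> decidable Q"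
  unfolding decidable_def by simp

lemma decidable_const: "decidable (\<lambda>x. c)"
  unfolding decidable_def by (rule computable_const)

lemma decidable_bool_if:
  "decidable P \<Longrightarrow> decidable Q \<Longrightarrow> decidable R \<Longrightarrow> decidable (\<lambda>x. if P x then Q x else R x)"
  unfolding decidable_def using computable_if[of P "\<lambda>x. if Q x then 1 else 0 :: nat" "\<lambda>x. if R x then 1 else 0"]
  by (simp add: decidable_def if_distrib[where f = "\<lambda>b. if b then _ else _"] cong: if_cong)

lemma decidable_not: "decidable P \<Longrightarrow> decidable (\<lambda>x. \<not> P x)"
  by (rule decidable_cong[OF decidable_bool_if[of P "\<lambda>_. False" "\<lambda>_. True"]]) (auto intro: decidable_const)

lemma decidable_conj: "decidable P \<Longrightarrow> decidable Q \<Longrightarrow> decidable (\<lambda>x. P x \<and> Q x)"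
  by (rule decidable_cong[OF decidable_bool_if[of P Q "\<lambda>_. False"]]) (auto intro: decidable_const)

lemma decidable_disj: "decidable P \<Longrightarrow> decidable Q \<Longrightarrow> decidable (\<lambda>x. P x \<or> Q x)"
  by (rule decidable_cong[OF decidable_bool_if[of P "\<lambda>_. True" Q]]) (auto intro: decidable_const)

lemma decidable_imp: "decidable P \<Longrightarrow> decidable Q \<Longrightarrow> decidable (\<lambda>x. P x \<longrightarrow> Q x)"
  by (rule decidable_cong[OF decidable_bool_if[of P Q "\<lambda>_. True"]]) (auto intro: decidable_const)

lemma decidable_eq_0: "computable f \<Longrightarrow> decidable (\<lambda>x. f x = (0::nat))"
proof -
  assume "computable f"
  then have "computable (\<lambda>x. 1 - f x)" by (intro computable_diff computable_const)
  moreover have "1 - n = (if n = 0 then 1 else 0 :: nat)" for n by auto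
  ultimately show ?thesis unfolding decidable_def by simp
qed

lemma decidable_le: "computable f \<Longrightarrow> computable g \<Longrightarrow> decidable (\<lambda>x. f x \<le> (g x :: nat))"
  using decidable_eq_0[of "\<lambda>x. f x - g x"] by (simp add: computable_diff)

lemma decidable_less: "computable f \<Longrightarrow> computable g \<Longrightarrow> decidable (\<lambda>x. f x < (g x :: nat))"
  using decidable_le[of "\<lambda>x. Suc (f x)" g] by (simp add: computable_Suc Suc_le_eq)

lemma decidable_eq:
  assumes "computable f" "computable g" shows "decidable (\<lambda>x. f x = g x)"
proof -
  have "decidable (\<lambda>x. enc (f x) \<le> enc (g x) \<and> enc (g x) \<le> enc (f x))"
    by (intro decidable_conj decidable_le computable_enc assms)
  then show ?thesis by (rule decidable_cong) (metis enc_inject antisym order_refl)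
qed

text \<open>The search has to succeed at every argument, also at meaningless ones, because
  \<open>computable\<close> speaks of total functions only.\<close>

lemma computable_Least:
  fixes P :: "'a::enc \<Rightarrow> nat \<Rightarrow> bool"
  assumes "decidable (\<lambda>z. P (fst z) (snd z))" "\<And>x. \<exists>n. P x n"
  shows "computable (\<lambda>x. LEAST n. P x n)"
proof -
  let ?f = "\<lambda>n u. if P (dec u) n then 0 else (1::nat)"
  have c: "computable (\<lambda>z. if P (fst z) (snd z) then 0 else (1::nat))"
    by (intro computable_if assms computable_const)
  have "recursive 2 (\<lambda>xs. enc ((\<lambda>z. if P (fst z) (snd z) then 0 else (1::nat))
          (dec (prod_encode (xs ! 1, xs ! 0)))))"
    by (rule recursive_from_computable[OF c]) (auto intro!: recursive_prod_encode recursive_proj)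
  then have "recursive 2 (\<lambda>xs. ?f (xs ! 0) (xs ! 1))"
    by (simp add: dec_prod cong: if_cong)
  then have "recursive 1 (\<lambda>xs. LEAST n. ?f n (xs ! 0) = 0)"
    by (rule recursive_mu) (use assms(2) in auto)
  moreover have "(?f n u = 0) = P (dec u) n" for n u by simp
  ultimately show ?thesis unfolding computable_def by simp
qed

lemma computable_div: 
  assumes "computable f" "computable g" shows "computable (\<lambda>x. f x div g x :: nat)"
proof -
  have "computable (\<lambda>x. LEAST q. g x = 0 \<or> f x < Suc q * g x)"
  proof (rule computable_Least)
    show "decidable (\<lambda>z. g (fst z) = 0 \<or> f (fst z) < Suc (snd z) * g (fst z))"
      by (intro decidable_disj decidable_eq_0 decidable_less computable_mult computable_Suc computable_snd
          computable_comp[OF assms(1)] computable_comp[OF assms(2)] computable_fst computable_id)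
    show "\<exists>n. g x = 0 \<or> f x < Suc n * g x" for x
      by (rule exI[of _ "f x"]) (cases "g x"; simp)
  qed
  moreover have "(LEAST q. b = 0 \<or> a < Suc q * b) = a div b" for a b :: nat
  proof (cases "b = 0")
    case False
    then show ?thesis
      by (intro Least_equality)
        (auto simp: dividend_less_div_times add.commute less_mult_imp_div_less less_Suc_eq_le[symmetric])
  qed (simp add: Least_eq_0)
  ultimately show ?thesis by simp
qed

lemma computable_mod: 
  assumes "computable f" "computable g" shows "computable (\<lambda>x. f x mod g x :: nat)"
  unfolding modulo_nat_def by (intro computable_diff computable_mult computable_div assms)

lemma computable_comp_under:
  assumes "computable (\<lambda>z. f (fst z) (snd z))" "computable g" "computable h"
  shows "computable (\<lambda>x. f (g x) (h x))"
  using computable_comp[OF assms(1) computable_Pair[OF assms(2,3)]] by simp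

lemma computable_case_nat:
  assumes "computable (\<lambda>z. g (fst z) (snd z))" "computable a" "computable n"
  shows "computable (\<lambda>x. case n x of 0 \<Rightarrow> a x | Suc k \<Rightarrow> g x k)"
proof -
  have "computable (\<lambda>x. rec_nat (a x) (\<lambda>k y. g x k) (n x))"
    by (rule computable_rec_nat)
      (intro computable_comp_under[OF assms(1)] computable_fst computable_snd computable_id assms)+
  moreover have "rec_nat (a x) (\<lambda>k y. g x k) m = (case m of 0 \<Rightarrow> a x | Suc k \<Rightarrow> g x k)" for x m
    by (cases m) auto
  ultimately show ?thesis by simp
qed

section \<open>Lists\<close>

lemma enc_Nil: "enc [] = 0"
  by (simp add: enc_list_def)

lemma enc_Cons: "enc (x # xs) = Suc (enc (x, xs))"
  by (simp add: enc_list_def enc_prod_def)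

lemma computable_Cons: "computable f \<Longrightarrow> computable g \<Longrightarrow> computable (\<lambda>x. f x # g x)"
proof -
  assume "computable f" "computable g"
  then have "computable (\<lambda>x. dec (Suc (enc (f x, g x))) :: 'b list)"
    by (intro computable_dec computable_Suc computable_enc computable_Pair)
  moreover have "dec (Suc (enc (y, ys))) = y # ys" for y :: 'b and ys
    by (metis enc_Cons dec_enc)
  ultimately show ?thesis by simp
qed

lemma computable_case_list:
  fixes l :: "'a::enc \<Rightarrow> 'b::enc list"
  assumes "computable (\<lambda>z. g (fst z) (fst (snd z)) (snd (snd z)))" "computable a" "computable l"
  shows "computable (\<lambda>x. case l x of [] \<Rightarrow> a x | y # ys \<Rightarrow> g x y ys)"
proof -
  have *: "computable (\<lambda>z. g (fst z) (fst (dec (snd z) :: 'b \<times> 'b list)) (snd (dec (snd z) :: 'b \<times> 'b list)))"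
    using computable_comp[OF assms(1), of "\<lambda>z. (fst z, dec (snd z) :: 'b \<times> 'b list)"]
    by (simp add: computable_Pair computable_fst computable_snd computable_dec computable_id)
  have "computable (\<lambda>x. case enc (l x) of 0 \<Rightarrow> a x
      | Suc k \<Rightarrow> g x (fst (dec k :: 'b \<times> 'b list)) (snd (dec k :: 'b \<times> 'b list)))"
    by (rule computable_case_nat) (use * assms in \<open>auto intro: computable_enc\<close>)
  moreover have "(case enc (l x) of 0 \<Rightarrow> a x
      | Suc k \<Rightarrow> g x (fst (dec k :: 'b \<times> 'b list)) (snd (dec k :: 'b \<times> 'b list))) =
      (case l x of [] \<Rightarrow> a x | y # ys \<Rightarrow> g x y ys)" for x
    by (cases "l x") (auto simp: enc_Nil enc_Cons)
  ultimately show ?thesis by simp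
qed

lemma length_le_enc: "length xs \<le> enc xs"
proof (induction xs)
  case (Cons x xs)
  have "enc xs \<le> enc (x, xs)" by (simp add: enc_prod_def le_prod_encode_2)
  then show ?case using Cons by (simp add: enc_Cons)
qed simp

text \<open>A left fold is a primitive recursion whose state holds the accumulator and the unread
  rest. The code of a list bounds its length, so it can serve as the number of iterations; on an
  empty rest a step changes nothing.\<close>

lemma computable_foldl:
  fixes l :: "'a::enc \<Rightarrow> 'b::enc list" and a :: "'a \<Rightarrow> 'c::enc"
  assumes "computable (\<lambda>z. g (fst z) (fst (snd z)) (snd (snd z)))" "computable a" "computable l"
  shows "computable (\<lambda>x. foldl (g x) (a x) (l x))"
proof -
  let ?step = "\<lambda>x p. case snd p of [] \<Rightarrow> p | y # ys \<Rightarrow> (g x (fst p) y, ys)"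
  have c: "computable (\<lambda>z. g (fst (fst z)) (fst (snd (snd (fst z)))) (fst (snd z)))"
    if "computable h" for h :: "('a \<times> nat \<times> 'c \<times> 'b list) \<Rightarrow> nat"
    using computable_comp[OF assms(1), of "\<lambda>z. (fst (fst z), fst (snd (snd (fst z))), fst (snd z))"]
    by (simp add: computable_Pair computable_fst computable_snd computable_id)
  have "computable (\<lambda>x. rec_nat (a x, l x) (\<lambda>k p. ?step x p) (enc (l x)))"
  proof (rule computable_rec_nat)
    show "computable (\<lambda>z. case snd (snd (snd z)) of [] \<Rightarrow> snd (snd z)
            | y # ys \<Rightarrow> (g (fst z) (fst (snd (snd z))) y, ys))"
      by (rule computable_case_list)
        (auto intro!: computable_Pair computable_fst computable_snd computable_id computable_const
            c[of "\<lambda>_. 0"])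
  qed (use assms in \<open>auto intro: computable_Pair computable_enc\<close>)
  then have *: "computable (\<lambda>x. fst (rec_nat (a x, l x) (\<lambda>k p. ?step x p) (enc (l x))))"
    by (rule computable_fst)
  have run: "rec_nat (b, ys) (\<lambda>k p. ?step x p) n = (foldl (g x) b (take n ys), drop n ys)" for x b ys n
  proof (induction n)
    case (Suc n)
    show ?case
    proof (cases "drop n ys")
      case Nil
      then show ?thesis using Suc by simp
    next
      case (Cons z zs)
      then have "n < length ys" by (metis drop_eq_Nil list.distinct(1) not_le)
      then have "take (Suc n) ys = take n ys @ [z]" "drop (Suc n) ys = zs"
        using Cons by (auto simp: take_Suc_conv_app_nth Cons_nth_drop_Suc[symmetric])
      then show ?thesis using Suc Cons by simp
    qed
  qed simp
  show ?thesis using * by (simp add: run length_le_enc)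
qed

lemma computable_rev:
  assumes "computable l" shows "computable (\<lambda>x. rev (l x))"
proof -
  have "computable (\<lambda>x. foldl (\<lambda>a y. y # a) [] (l x))"
    by (rule computable_foldl)
      (intro computable_Cons computable_const computable_fst computable_snd computable_id assms)+
  moreover have "foldl (\<lambda>a y. y # a) bs ys = rev ys @ bs" for ys bs :: "'b list"
    by (induction ys arbitrary: bs) auto
  ultimately show ?thesis by simp
qed

lemma computable_append:
  assumes "computable k" "computable l" shows "computable (\<lambda>x. k x @ l x)"
proof -
  have "computable (\<lambda>x. foldl (\<lambda>a y. y # a) (l x) (rev (k x)))"
    by (rule computable_foldl)
      (intro computable_Cons computable_rev computable_const computable_fst computable_snd computable_id assms)+
  moreover have "foldl (\<lambda>a y. y # a) bs (rev ys) = ys @ bs" for ys bs :: "'b list"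
    by (induction ys arbitrary: bs) auto
  ultimately show ?thesis by simp
qed

lemma computable_map:
  assumes "computable (\<lambda>z. f (fst z) (snd z))" "computable l"
  shows "computable (\<lambda>x. map (f x) (l x))"
proof -
  have "computable (\<lambda>x. rev (foldl (\<lambda>a y. f x y # a) [] (l x)))"
    by (intro computable_rev computable_foldl computable_Cons computable_comp_under[OF assms(1)]
        computable_const computable_fst computable_snd computable_id assms(2))
  moreover have "foldl (\<lambda>a y. f x y # a) bs ys = rev (map (f x) ys) @ bs" for x ys bs
    by (induction ys arbitrary: bs) auto
  ultimately show ?thesis by simp
qed

lemma computable_concat:
  assumes "computable l" shows "computable (\<lambda>x. concat (l x))"
proof -
  have "computable (\<lambda>x. foldl (@) [] (l x))"
    by (intro computable_foldl computable_append computable_const computable_fst computable_snd computable_id assms)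
  moreover have "foldl (@) b ys = b @ concat ys" for b :: "'b list" and ys
    by (induction ys arbitrary: b) auto
  ultimately show ?thesis by simp
qed

lemma computable_filter:
  assumes "decidable (\<lambda>z. P (fst z) (snd z))" "computable l"
  shows "computable (\<lambda>x. filter (P x) (l x))"
proof -
  have "computable (\<lambda>x. concat (map (\<lambda>y. if P x y then [y] else []) (l x)))"
    by (intro computable_concat computable_map computable_if assms computable_Cons computable_const
        computable_snd computable_id)
  moreover have "concat (map (\<lambda>y. if P x y then [y] else []) ys) = filter (P x) ys" for x ys
    by (induction ys) auto
  ultimately show ?thesis by simp
qed

lemma decidable_Ball:
  assumes "decidable (\<lambda>z. P (fst z) (snd z))" "computable l"
  shows "decidable (\<lambda>x. \<forall>y\<in>set (l x). P x y)"
proof -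
  have "decidable (\<lambda>x. filter (\<lambda>y. \<not> P x y) (l x) = [])"
    by (intro decidable_eq computable_filter decidable_not assms computable_const)
  then show ?thesis by (rule decidable_cong) (auto simp: filter_empty_conv)
qed

lemma decidable_Bex:
  assumes "decidable (\<lambda>z. P (fst z) (snd z))" "computable l"
  shows "decidable (\<lambda>x. \<exists>y\<in>set (l x). P x y)"
proof -
  have "decidable (\<lambda>x. \<not> (\<forall>y\<in>set (l x). \<not> P x y))"
    by (intro decidable_not decidable_Ball assms)
  then show ?thesis by (rule decidable_cong) auto
qed

lemma decidable_member:
  "computable f \<Longrightarrow> computable l \<Longrightarrow> decidable (\<lambda>x. f x \<in> set (l x))"
  using decidable_Bex[of "\<lambda>x y. f x = y" l]
  by (simp add: decidable_eq computable_comp[of f] computable_fst computable_snd computable_id)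

lemma computable_length:
  assumes "computable l" shows "computable (\<lambda>x. length (l x))"
proof -
  have "computable (\<lambda>x. foldl (\<lambda>a y. Suc a) 0 (l x))"
    by (intro computable_foldl computable_Suc computable_const computable_fst computable_snd computable_id assms)
  moreover have "foldl (\<lambda>a y. Suc a) n ys = n + length ys" for n and ys :: "'b list"
    by (induction ys arbitrary: n) auto
  ultimately show ?thesis by simp
qed

lemma computable_upt:
  assumes "computable f" "computable g" shows "computable (\<lambda>x. [f x..<g x])"
proof -
  have "computable (\<lambda>x. rec_nat [] (\<lambda>k l. l @ [f x + k]) (g x - f x))"
    by (intro computable_rec_nat computable_append computable_Cons computable_add computable_diff
        computable_const computable_fst computable_snd computable_id assms computable_comp[OF assms(1)])
  moreover have "rec_nat [] (\<lambda>k l. l @ [a + k]) n = [a..<a + n]" for a n :: nat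
    by (induction n) auto
  moreover have "[a..<a + (b - a)] = [a..<b]" for a b :: nat
    by (cases "a \<le> b") auto
  ultimately show ?thesis by simp
qed

lemma computable_drop:
  assumes "computable n" "computable l" shows "computable (\<lambda>x. drop (n x) (l x))"
proof -
  have "computable (\<lambda>x. rec_nat (l x) (\<lambda>k r. case r of [] \<Rightarrow> [] | y # ys \<Rightarrow> ys) (n x))"
    by (intro computable_rec_nat computable_case_list computable_const computable_fst computable_snd
        computable_id assms)
  moreover have "rec_nat ys (\<lambda>k r. case r of [] \<Rightarrow> [] | z # zs \<Rightarrow> zs) m = drop m ys" for ys :: "'b list" and m
    by (induction m) (auto simp: drop_Suc tl_drop[symmetric] split: list.split)
  ultimately show ?thesis by simp
qed

lemma computable_take:
  assumes "computable n" "computable l" shows "computable (\<lambda>x. take (n x) (l x))"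
proof -
  have "computable (\<lambda>x. rev (drop (length (l x) - n x) (rev (l x))))"
    by (intro computable_rev computable_drop computable_diff computable_length assms)
  moreover have "take (length ys - (length ys - m)) ys = take m ys" for ys :: "'b list" and m
    by (cases "m \<le> length ys") auto
  ultimately show ?thesis by (simp add: rev_drop)
qed

lemma computable_zip:
  assumes "computable k" "computable l" shows "computable (\<lambda>x. zip (k x) (l x))"
proof -
  let ?g = "\<lambda>p y. case snd p of [] \<Rightarrow> p | z # zs \<Rightarrow> (fst p @ [(y, z)], zs)"
  have "computable (\<lambda>x. fst (foldl ?g ([], l x) (k x)))"
    by (intro computable_foldl computable_case_list computable_const computable_fst computable_snd
        computable_id computable_Pair computable_append computable_Cons assms)
  moreover have "fst (foldl ?g (b, zs) ys) = b @ zip ys zs" for b and ys :: "'b list" and zs :: "'c list"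
    by (induction ys arbitrary: b zs) (auto split: list.split)
  ultimately show ?thesis by simp
qed

lemma computable_n_lists:
  assumes "computable n" "computable l" shows "computable (\<lambda>x. List.n_lists (n x) (l x))"
proof -
  have "computable (\<lambda>x. rec_nat [[]] (\<lambda>k r. concat (map (\<lambda>ys. map (\<lambda>y. y # ys) (l x)) r)) (n x))"
    by (intro computable_rec_nat computable_concat computable_map computable_Cons computable_const
        computable_fst computable_snd computable_id computable_comp[OF assms(2)] assms)
  moreover have "rec_nat [[]] (\<lambda>k r. concat (map (\<lambda>ys. map (\<lambda>y. y # ys) zs) r)) m = List.n_lists m zs"
    for zs :: "'b list" and m
    by (induction m) auto
  ultimately show ?thesis by simp
qed

lemma computable_replicate:
  assumes "computable n" "computable f" shows "computable (\<lambda>x. replicate (n x) (f x))"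
proof -
  have "computable (\<lambda>x. map (\<lambda>i. f x) [0..<n x])"
    by (intro computable_map computable_upt computable_const computable_comp[OF assms(2)]
        computable_fst computable_id assms)
  then show ?thesis by (simp add: map_replicate_const)
qed

section \<open>Integers\<close>

lemma computable_int: "computable f \<Longrightarrow> computable (\<lambda>x. int (f x))"
proof -
  assume "computable f"
  then have "computable (\<lambda>x. dec (2 * f x) :: int)"
    by (intro computable_dec computable_mult computable_const)
  moreover have "dec (2 * n) = int n" for n
  proof -
    have "enc (int n) = 2 * n" by (simp add: enc_int_def int_encode_def sum_encode_def)
    then show ?thesis by (metis dec_enc)
  qed
  ultimately show ?thesis by simp
qed

lemma computable_nat: "computable f \<Longrightarrow> computable (\<lambda>x. nat (f x))"
proof -
  assume "computable f"
  then have "computable (\<lambda>x. if enc (f x) mod 2 = 0 then enc (f x) div 2 else 0)"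
    by (intro computable_if decidable_eq_0 computable_mod computable_div computable_const computable_enc)
  moreover have "(if enc i mod 2 = 0 then enc i div 2 else 0) = nat i" for i :: int
    unfolding enc_int_def int_encode_def sum_encode_def by (cases "0 \<le> i") (simp_all, presburger?)
  ultimately show ?thesis by simp
qed

lemma computable_nat_uminus: "computable f \<Longrightarrow> computable (\<lambda>x. nat (- f x))"
proof -
  assume "computable f"
  then have "computable (\<lambda>x. if enc (f x) mod 2 = 0 then 0 else Suc (enc (f x) div 2))"
    by (intro computable_if decidable_eq_0 computable_mod computable_div computable_const computable_enc
        computable_Suc)
  moreover have "(if enc i mod 2 = 0 then 0 else Suc (enc i div 2)) = nat (- i)" for i :: int
    unfolding enc_int_def int_encode_def sum_encode_def by (cases "0 \<le> i") (simp_all, presburger?)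
  ultimately show ?thesis by simp
qed

text \<open>Sums and products are computed on positive and negative parts and recombined here. The
  odd codes belong to the negative numbers: \<open>- (k + 1)\<close> has the code
  \<open>2 * k + 1\<close>.\<close>

lemma computable_int_diff:
  assumes "computable f" "computable g" shows "computable (\<lambda>x. int (f x) - int (g x))"
proof -
  have "computable (\<lambda>x. if g x \<le> f x then int (f x - g x) else dec (Suc (2 * (g x - f x - 1))))"
    by (intro computable_if decidable_le computable_int computable_diff computable_dec computable_Suc
        computable_mult computable_const assms)
  moreover have "(if b \<le> a then int (a - b) else dec (Suc (2 * (b - a - 1)))) = int a - int b" for a b :: nat
  proof (cases "b \<le> a")
    case False
    have "enc (int a - int b) = Suc (2 * (b - a - 1))"
      using False unfolding enc_int_def int_encode_def sum_encode_def by simp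
    then show ?thesis using False by (metis dec_enc)
  qed simp
  ultimately show ?thesis by simp
qed

lemma computable_int_add:
  fixes f g :: "'a::enc \<Rightarrow> int"
  assumes "computable f" "computable g" shows "computable (\<lambda>x. f x + g x)"
proof -
  have "computable (\<lambda>x. int (nat (f x) + nat (g x)) - int (nat (- f x) + nat (- g x)))"
    by (intro computable_int_diff computable_add computable_nat computable_nat_uminus assms)
  moreover have "int (nat i + nat j) - int (nat (- i) + nat (- j)) = i + j" for i j :: int by simp
  ultimately show ?thesis by simp
qed

lemma computable_int_uminus:
  fixes f :: "'a::enc \<Rightarrow> int"
  assumes "computable f" shows "computable (\<lambda>x. - f x)"
proof -
  have "computable (\<lambda>x. int (nat (- f x)) - int (nat (f x)))"
    by (intro computable_int_diff computable_add computable_nat computable_nat_uminus assms)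
  moreover have "int (nat (- i)) - int (nat i) = - i" for i :: int by simp
  ultimately show ?thesis by simp
qed

lemma computable_int_mult:
  fixes f g :: "'a::enc \<Rightarrow> int"
  assumes "computable f" "computable g" shows "computable (\<lambda>x. f x * g x)"
proof -
  have "computable (\<lambda>x. int (nat (f x) * nat (g x) + nat (- f x) * nat (- g x)) -
      int (nat (- f x) * nat (g x) + nat (f x) * nat (- g x)))"
    by (intro computable_int_diff computable_add computable_mult computable_nat computable_nat_uminus assms)
  moreover have "int (nat i * nat j + nat (- i) * nat (- j)) -
      int (nat (- i) * nat j + nat i * nat (- j)) = i * j" for i j :: int
    by (cases "0 \<le> i"; cases "0 \<le> j") (simp_all add: algebra_simps)
  ultimately show ?thesis by simp
qed

lemma computable_int_div:
  fixes f :: "'a::enc \<Rightarrow> int"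
  assumes "computable f" "computable g" shows "computable (\<lambda>x. f x div int (g x))"
proof -
  \<comment> \<open>Adding \<open>n * nat (- i)\<close> makes the dividend nonnegative and raises
    the quotient by exactly \<open>nat (- i)\<close>, which is subtracted afterwards. Division by
    zero gives 0.\<close>
  have "computable (\<lambda>x. if g x = 0 then 0
      else int (nat (f x + int (g x * nat (- f x))) div g x) - int (nat (- f x)))"
    by (intro computable_if decidable_eq computable_int_diff computable_div computable_nat
        computable_int_add computable_int computable_mult computable_nat_uminus computable_const assms)
  moreover have "(if n = 0 then 0 else int (nat (i + int (n * nat (- i))) div n) - int (nat (- i))) = i div int n"
    for i n
  proof (cases "n = 0")
    case False
    have "int n * int (nat (- i)) \<ge> 1 * int (nat (- i))" using False by (intro mult_right_mono) auto
    then have nn: "i + int n * int (nat (- i)) \<ge> 0" by linarith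
    then have "int (nat (i + int (n * nat (- i))) div n) = (i + int n * int (nat (- i))) div int n"
      by (simp add: zdiv_int)
    then show ?thesis using False by simp
  qed simp
  ultimately show ?thesis by simp
qed

lemma computable_int_mod:
  fixes f :: "'a::enc \<Rightarrow> int"
  assumes "computable f" "computable g" shows "computable (\<lambda>x. f x mod int (g x))"
proof -
  have "computable (\<lambda>x. f x + - (int (g x) * (f x div int (g x))))"
    by (intro computable_int_add computable_int_uminus computable_int_mult computable_int_div
        computable_int assms)
  then show ?thesis by (simp add: minus_mult_div_eq_mod)
qed

lemma decidable_dvd:
  fixes f :: "'a::enc \<Rightarrow> int"
  assumes "computable f" "computable g" shows "decidable (\<lambda>x. int (g x) dvd f x)"
  unfolding dvd_eq_mod_eq_0 by (intro decidable_eq computable_int_mod computable_const assms)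

lemma computable_int_sum_list:
  fixes l :: "'a::enc \<Rightarrow> int list"
  assumes "computable l" shows "computable (\<lambda>x. sum_list (l x))"
proof -
  have "computable (\<lambda>x. foldl (+) 0 (l x))"
    by (intro computable_foldl computable_int_add computable_const computable_fst computable_snd
        computable_id assms)
  moreover have "foldl (+) a ys = a + sum_list ys" for a :: int and ys
    by (induction ys arbitrary: a) auto
  ultimately show ?thesis by simp
qed

lemma computable_Digit: "computable f \<Longrightarrow> computable (\<lambda>x. Digit (f x))"
proof -
  assume "computable f"
  then have "computable (\<lambda>x. dec (Suc (Suc (f x))) :: sym)"
    by (intro computable_dec computable_Suc)
  moreover have "dec (Suc (Suc n)) = Digit n" for n
  proof -
    have "enc (Digit n) = Suc (Suc n)" by (simp add: enc_sym_def)
    then show ?thesis by (metis dec_enc)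
  qed
  ultimately show ?thesis by simp
qed

lemmas computable_intros =
  computable_id computable_fst computable_snd computable_Pair computable_if computable_Suc
  computable_add computable_diff computable_mult computable_div computable_mod
  computable_Cons computable_case_list computable_foldl computable_rev computable_append computable_map
  computable_concat computable_filter computable_length computable_upt computable_drop computable_take
  computable_zip computable_n_lists computable_replicate computable_int computable_nat
  computable_nat_uminus computable_int_add computable_int_uminus computable_int_mult computable_int_div
  computable_int_mod computable_int_sum_list computable_Digit
  decidable_const decidable_not decidable_conj decidable_disj decidable_imp decidable_eq decidable_less
  decidable_le decidable_Ball decidable_Bex decidable_member decidable_dvd

section \<open>Laurent polynomials, vectors and submodules\<close>

type_synonym expo = "nat \<Rightarrow> int"
type_synonym lpoly = "expo \<Rightarrow>\<^sub>0 int"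
type_synonym lvec = "nat \<Rightarrow> lpoly"

text \<open>Exponents are functions on all indices that vanish from n on, so that the rings in
  different numbers of variables are nested; adjoining a variable is then an inclusion.\<close>

definition expos :: "nat \<Rightarrow> expo set" where
  "expos n = {a. \<forall>i\<ge>n. a i = 0}"

definition lpolys :: "nat \<Rightarrow> lpoly set" where
  "lpolys n = {f. Poly_Mapping.keys f \<subseteq> expos n}"

definition lvecs :: "nat \<Rightarrow> nat \<Rightarrow> lvec set" where
  "lvecs n K = {v. (\<forall>i. v i \<in> lpolys n) \<and> (\<forall>i\<ge>K. v i = 0)}"

abbreviation mon :: "expo \<Rightarrow> lpoly" where "mon \<equiv> frag_of"

definition smul :: "lpoly \<Rightarrow> lvec \<Rightarrow> lvec" (infixr "\<star>" 75) where
  "f \<star> v = (\<lambda>i. f * v i)"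

lemma smul_apply: "(f \<star> v) i = f * v i"
  by (simp add: smul_def)

lemmas fun_app = smul_apply plus_fun_apply zero_fun_apply minus_apply uminus_apply

declare plus_fun_apply [simp del] zero_fun_apply [simp del] minus_apply [simp del] uminus_apply [simp del]

lemma smul_simps:
  "f \<star> (u + v) = f \<star> u + f \<star> v" "f \<star> (u - v) = f \<star> u - f \<star> v" "(f + g) \<star> v = f \<star> v + g \<star> v"
  "(f - g) \<star> v = f \<star> v - g \<star> v" "1 \<star> v = v" "0 \<star> v = 0" "f \<star> 0 = 0" "(f * g) \<star> v = f \<star> g \<star> v"
  "(- f) \<star> v = - (f \<star> v)" "f \<star> (- v) = - (f \<star> v)"
  by (auto simp: fun_app fun_eq_iff algebra_simps)

lemma smul_commute: "f \<star> g \<star> v = g \<star> f \<star> v"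
  by (auto simp: fun_app fun_eq_iff algebra_simps)

lemma mon_mult: "mon a * mon b = mon (a + b)"
  by (simp add: mult_single)

lemma mon_0 [simp]: "mon 0 = 1"
  by simp

lemma expos_closed [simp, intro]:
  "0 \<in> expos n" "a \<in> expos n \<Longrightarrow> b \<in> expos n \<Longrightarrow> a + b \<in> expos n"
  "a \<in> expos n \<Longrightarrow> b \<in> expos n \<Longrightarrow> a - b \<in> expos n" "a \<in> expos n \<Longrightarrow> - a \<in> expos n"
  "a \<in> expos n \<Longrightarrow> (\<lambda>i. c * a i) \<in> expos n"
  by (auto simp: expos_def fun_app)

lemma lpolys_closed [simp, intro]:
  "0 \<in> lpolys n" "1 \<in> lpolys n"
  "f \<in> lpolys n \<Longrightarrow> g \<in> lpolys n \<Longrightarrow> f + g \<in> lpolys n"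
  "f \<in> lpolys n \<Longrightarrow> g \<in> lpolys n \<Longrightarrow> f - g \<in> lpolys n"
  "f \<in> lpolys n \<Longrightarrow> - f \<in> lpolys n"
  "f \<in> lpolys n \<Longrightarrow> g \<in> lpolys n \<Longrightarrow> f * g \<in> lpolys n"
  "a \<in> expos n \<Longrightarrow> mon a \<in> lpolys n"
proof -
  show "0 \<in> lpolys n" "1 \<in> lpolys n" by (auto simp: lpolys_def)
  show "a \<in> expos n \<Longrightarrow> mon a \<in> lpolys n" by (auto simp: lpolys_def)
  assume f: "f \<in> lpolys n"
  show "- f \<in> lpolys n" using f by (auto simp: lpolys_def)
  assume g: "g \<in> lpolys n"
  show "f + g \<in> lpolys n" using f g keys_add[of f g] by (auto simp: lpolys_def)
  show "f - g \<in> lpolys n" using f g keys_diff[of f g] by (auto simp: lpolys_def)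
  show "f * g \<in> lpolys n" using f g keys_mult[of f g] by (fastforce simp: lpolys_def)
qed

lemma lpolys_of_nat [simp, intro]: "of_nat c \<in> lpolys n"
  by (induction c) auto

lemma lpolys_of_int [simp, intro]: "of_int c \<in> lpolys n"
  by (cases c rule: int_cases2) auto

lemma lpolys_power [simp, intro]: "f \<in> lpolys n \<Longrightarrow> f ^ k \<in> lpolys n"
  by (induction k) auto

lemma lpolys_prod: "(\<And>i. i \<in> I \<Longrightarrow> f i \<in> lpolys n) \<Longrightarrow> prod f I \<in> lpolys n"
  by (induction I rule: infinite_finite_induct) auto

lemma lpolys_sum: "(\<And>i. i \<in> I \<Longrightarrow> f i \<in> lpolys n) \<Longrightarrow> sum f I \<in> lpolys n"
  by (induction I rule: infinite_finite_induct) auto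

lemma lvecs_closed [simp, intro]:
  "0 \<in> lvecs n K"
  "u \<in> lvecs n K \<Longrightarrow> v \<in> lvecs n K \<Longrightarrow> u + v \<in> lvecs n K"
  "u \<in> lvecs n K \<Longrightarrow> v \<in> lvecs n K \<Longrightarrow> u - v \<in> lvecs n K"
  "v \<in> lvecs n K \<Longrightarrow> - v \<in> lvecs n K"
  "f \<in> lpolys n \<Longrightarrow> v \<in> lvecs n K \<Longrightarrow> f \<star> v \<in> lvecs n K"
  by (auto simp: lvecs_def fun_app)

text \<open>Monomials generate the additive group by differences, so an identity between additive
  maps is checked on monomials only.\<close>

lemma lpolys_induct [consumes 1, case_names zero mon diff]:
  assumes "f \<in> lpolys n" "P 0" "\<And>a. a \<in> expos n \<Longrightarrow> P (mon a)"
    "\<And>f g. f \<in> lpolys n \<Longrightarrow> g \<in> lpolys n \<Longrightarrow> P f \<Longrightarrow> P g \<Longrightarrow> P (f - g)"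
  shows "P f"
proof -
  have "P f \<and> f \<in> lpolys n"
    by (rule frag_induction[of f "expos n"]) (use assms(1) in \<open>simp add: lpolys_def\<close>, use assms in auto)
  then show ?thesis by simp
qed

lemma lpoly_induct [case_names zero mon diff]:
  fixes f :: lpoly
  assumes "P 0" "\<And>a. P (mon a)" "\<And>f g. P f \<Longrightarrow> P g \<Longrightarrow> P (f - g)"
  shows "P f"
  by (rule frag_induction[of f UNIV]) (use assms in auto)

lemma lookup_of_nat_mult: "Poly_Mapping.lookup (of_nat c * f :: lpoly) a = int c * Poly_Mapping.lookup f a"
  by (induction c) (auto simp: algebra_simps lookup_add)

lemma lookup_of_int_mult: "Poly_Mapping.lookup (of_int c * f :: lpoly) a = c * Poly_Mapping.lookup f a"
  by (cases c rule: int_cases2) (auto simp: lookup_of_nat_mult)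

lemma lookup_mon_mult: "Poly_Mapping.lookup (mon d * f) x = Poly_Mapping.lookup f (x - d)"
proof (induction f rule: lpoly_induct)
  case (mon a)
  have "x = d + a \<longleftrightarrow> x - d = a" by auto
  then show ?case unfolding mon_mult lookup_frag_of by auto
qed (auto simp: algebra_simps lookup_minus)

lemma of_nat_dvd_lpoly_iff:
  "of_nat p dvd (f :: lpoly) \<longleftrightarrow> (\<forall>a. int p dvd Poly_Mapping.lookup f a)"
proof
  assume "of_nat p dvd f"
  then show "\<forall>a. int p dvd Poly_Mapping.lookup f a" by (auto simp: dvd_def lookup_of_nat_mult)
next
  assume *: "\<forall>a. int p dvd Poly_Mapping.lookup f a"
  have "f = of_nat p * Poly_Mapping.map (\<lambda>c. c div int p) f"
    by (rule poly_mapping_eqI) (use * in \<open>auto simp: lookup_of_nat_mult map.rep_eq when_def\<close>)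
  then show "of_nat p dvd f" by (metis dvd_triv_left)
qed

lemma lpolys_of_nat_dvd:
  assumes "of_nat p dvd f" "f \<in> lpolys n" obtains g where "g \<in> lpolys n" "f = of_nat p * g"
proof -
  let ?g = "Poly_Mapping.map (\<lambda>c. c div int p) f"
  have "f = of_nat p * ?g"
    by (rule poly_mapping_eqI)
      (use assms(1) in \<open>auto simp: of_nat_dvd_lpoly_iff lookup_of_nat_mult map.rep_eq when_def\<close>)
  moreover have "Poly_Mapping.keys ?g \<subseteq> Poly_Mapping.keys f"
    by (auto simp: in_keys_iff map.rep_eq when_def)
  then have "?g \<in> lpolys n" using assms(2) by (auto simp: lpolys_def)
  ultimately show ?thesis using that by blast
qed

section \<open>Substitutions of monomials and the Frobenius\<close>

definition push :: "(expo \<Rightarrow> expo) \<Rightarrow> lpoly \<Rightarrow> lpoly" where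
  "push h f = frag_extend (\<lambda>a. mon (h a)) f"

lemma push_simps [simp]:
  "push h 0 = 0" "push h (mon a) = mon (h a)" "push h (f - g) = push h f - push h g"
  "push h (f + g) = push h f + push h g" "push h (- f) = - push h f"
  by (simp_all add: push_def frag_extend_diff frag_extend_add frag_extend_minus)

lemma push_mult:
  assumes "\<And>a b. h (a + b) = h a + h b" shows "push h (f * g) = push h f * push h g"
proof (induction f rule: lpoly_induct)
  case (mon a)
  show ?case
    by (induction g rule: lpoly_induct) (simp_all add: assms mon_mult right_diff_distrib)
qed (simp_all add: left_diff_distrib)

lemma push_1:
  assumes "\<And>a b. h (a + b) = h a + h b" shows "push h 1 = 1"
proof -
  have "h 0 = 0" using assms[of 0 0] by simp
  then show ?thesis using push_simps(2)[of h 0] by simp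
qed

lemma push_of_nat:
  assumes "\<And>a b. h (a + b) = h a + h b" shows "push h (of_nat c) = of_nat c"
  by (induction c) (simp_all add: push_1[OF assms])

lemma push_of_int:
  assumes "\<And>a b. h (a + b) = h a + h b" shows "push h (of_int c) = of_int c"
  by (cases c rule: int_cases2) (simp_all add: push_of_nat[OF assms])

lemma push_lpolys:
  assumes "f \<in> lpolys n" "\<And>a. a \<in> expos n \<Longrightarrow> h a \<in> expos m" shows "push h f \<in> lpolys m"
  using assms(1) by (induction rule: lpolys_induct) (auto simp: assms(2))

definition scale_expo :: "nat \<Rightarrow> expo \<Rightarrow> expo" where
  "scale_expo q a = (\<lambda>i. int q * a i)"

lemma scale_expo_add: "scale_expo q (a + b) = scale_expo q a + scale_expo q b"
  by (auto simp: scale_expo_def fun_eq_iff fun_app algebra_simps)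

lemma scale_expo_expos [simp, intro]: "a \<in> expos n \<Longrightarrow> scale_expo q a \<in> expos n"
  by (auto simp: scale_expo_def expos_def)

abbreviation frob :: "nat \<Rightarrow> lpoly \<Rightarrow> lpoly" where "frob q \<equiv> push (scale_expo q)"

lemmas frob_mult = push_mult[OF scale_expo_add]
lemmas frob_of_nat [simp] = push_of_nat[OF scale_expo_add]

lemma frob_lpolys [simp, intro]: "f \<in> lpolys n \<Longrightarrow> frob q f \<in> lpolys n"
  by (rule push_lpolys) auto

lemma mon_power: "mon a ^ q = mon (scale_expo q a)"
proof (induction q)
  case (Suc q)
  have "a + scale_expo q a = scale_expo (Suc q) a"
    by (auto simp: scale_expo_def fun_eq_iff fun_app algebra_simps)
  then show ?case using Suc by (simp add: mon_mult)
qed (simp add: scale_expo_def flip: zero_fun_def)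

lemma prime_dvd_binomial_power:
  fixes a b :: "'a::comm_ring_1"
  assumes "prime p" shows "of_nat p dvd (a + b) ^ p - (a ^ p + b ^ p)"
proof -
  have p: "p > 0" using assms by (simp add: prime_gt_0_nat)
  have "(a + b) ^ p = (\<Sum>k\<le>p. of_nat (p choose k) * a ^ k * b ^ (p - k))" by (rule binomial_ring)
  also have "{..p} = insert 0 (insert p {0<..<p})" using p by auto
  also have "(\<Sum>k\<in>insert 0 (insert p {0<..<p}). of_nat (p choose k) * a ^ k * b ^ (p - k)) =
      b ^ p + (a ^ p + (\<Sum>k\<in>{0<..<p}. of_nat (p choose k) * a ^ k * b ^ (p - k)))"
    using p by simp
  finally have "(a + b) ^ p - (a ^ p + b ^ p) = (\<Sum>k\<in>{0<..<p}. of_nat (p choose k) * a ^ k * b ^ (p - k))"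
    by simp
  moreover have "of_nat p dvd (of_nat (p choose k) * a ^ k * b ^ (p - k) :: 'a)" if "k \<in> {0<..<p}" for k
  proof -
    have "p dvd (p choose k)" using that assms by (intro dvd_choose_prime) auto
    then have "(of_nat p :: 'a) dvd of_nat (p choose k)" by (auto simp: dvd_def)
    then show ?thesis by (simp add: mult.assoc)
  qed
  ultimately show ?thesis by (metis (no_types, lifting) dvd_sum)
qed

text \<open>Both sides are additive modulo p and agree on monomials.\<close>

lemma frob_cong_power:
  assumes "prime p" shows "of_nat p dvd frob p f - f ^ p"
proof (induction f rule: lpoly_induct)
  case zero
  have "p > 0" using assms by (simp add: prime_gt_0_nat)
  then show ?case by (simp add: zero_power)
next
  case (mon a)
  then show ?case by (simp add: mon_power)
next
  case (diff f g)
  \<comment> \<open>Expanding f as (f - g) + g, instead of f - g, avoids the sign of (-g)^p, which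
    would single out p = 2.\<close>
  have "of_nat p dvd (f - g + g) ^ p - ((f - g) ^ p + g ^ p)"
    by (rule prime_dvd_binomial_power[OF assms])
  then have "of_nat p dvd (frob p f - f ^ p) - (frob p g - g ^ p) + (f ^ p - ((f - g) ^ p + g ^ p))"
    by (intro dvd_add[OF dvd_diff[OF diff]]) simp
  then show ?case by (simp add: algebra_simps)
qed

lemma frob_pow_cong_power:
  assumes "prime p" shows "of_nat p dvd frob (p ^ e) f - f ^ (p ^ e)"
proof (induction e)
  case 0
  have "scale_expo 1 a = a" for a by (simp add: scale_expo_def)
  then have "frob 1 f = f" by (induction f rule: lpoly_induct) auto
  then show ?case by simp
next
  case (Suc e)
  have "scale_expo (p ^ Suc e) a = scale_expo p (scale_expo (p ^ e) a)" for a
    by (auto simp: scale_expo_def)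
  then have *: "frob (p ^ Suc e) f = frob p (frob (p ^ e) f)"
    by (induction f rule: lpoly_induct) auto
  let ?g = "frob (p ^ e) f"
  have "of_nat p dvd frob p ?g - ?g ^ p" by (rule frob_cong_power[OF assms])
  moreover have "?g - f ^ p ^ e dvd ?g ^ p - (f ^ p ^ e) ^ p"
    by (metis dvd_triv_left power_diff_sumr2)
  then have "of_nat p dvd ?g ^ p - (f ^ p ^ e) ^ p" using Suc dvd_trans by blast
  ultimately have "of_nat p dvd (frob p ?g - ?g ^ p) + (?g ^ p - (f ^ p ^ e) ^ p)" by (rule dvd_add)
  then show ?case using * by (simp add: power_mult[symmetric] mult.commute)
qed

text \<open>The pairing of a finitely supported f with an arbitrary array t.
  \<open>frag_extend\<close> takes values in a free abelian group, so the integers enter as the one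
  on the single generator \<open>()\<close>.\<close>

definition lin :: "(expo \<Rightarrow> int) \<Rightarrow> lpoly \<Rightarrow> int" where
  "lin t f = Poly_Mapping.lookup (frag_extend (\<lambda>a. frag_cmul (t a) (frag_of ())) f) ()"

lemma lin_simps [simp]:
  "lin t 0 = 0" "lin t (mon a) = t a" "lin t (f + g) = lin t f + lin t g"
  "lin t (f - g) = lin t f - lin t g" "lin t (- f) = - lin t f"
  by (simp_all add: lin_def frag_extend_add frag_extend_diff frag_extend_minus lookup_add lookup_minus)

lemma lin_of_nat_mult [simp]: "lin t (of_nat c * f) = int c * lin t f"
  by (induction c) (auto simp: algebra_simps)

lemma lin_of_int_mult [simp]: "lin t (of_int c * f) = c * lin t f"
  by (cases c rule: int_cases2) auto

lemma lin_mon_mult: "lin t (mon d * f) = lin (\<lambda>a. t (d + a)) f"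
  by (induction f rule: lpoly_induct) (auto simp: mon_mult right_diff_distrib)

lemma lin_push: "lin t (push h f) = lin (\<lambda>a. t (h a)) f"
  by (induction f rule: lpoly_induct) auto

lemma lin_cong:
  assumes "f \<in> lpolys n" "\<And>a. a \<in> expos n \<Longrightarrow> t a = t' a" shows "lin t f = lin t' f"
  using assms(1) by (induction rule: lpolys_induct) (auto simp: assms(2))

text \<open>The preimages, in the integral free module, of the submodules over F_p: the last
  condition puts the kernel of reduction modulo p inside N.\<close>

definition submod :: "nat \<Rightarrow> nat \<Rightarrow> nat \<Rightarrow> lvec set \<Rightarrow> bool" where
  "submod p n K N \<longleftrightarrow> N \<subseteq> lvecs n K \<and> 0 \<in> N \<and> (\<forall>u\<in>N. \<forall>v\<in>N. u + v \<in> N) \<and>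
     (\<forall>v\<in>N. \<forall>a\<in>expos n. mon a \<star> v \<in> N) \<and> (\<forall>v\<in>lvecs n K. of_nat p \<star> v \<in> N)"

lemma submodD:
  assumes "submod p n K N"
  shows "v \<in> N \<Longrightarrow> v \<in> lvecs n K" "0 \<in> N" "u \<in> N \<Longrightarrow> v \<in> N \<Longrightarrow> u + v \<in> N"
    "v \<in> N \<Longrightarrow> a \<in> expos n \<Longrightarrow> mon a \<star> v \<in> N" "v \<in> lvecs n K \<Longrightarrow> of_nat p \<star> v \<in> N"
  using assms unfolding submod_def by auto

text \<open>Modulo p, negation is multiplication by p - 1.\<close>

lemma submod_uminus:
  assumes "submod p n K N" "v \<in> N" "p > 0" shows "- v \<in> N"
proof -
  have *: "of_nat c \<star> v \<in> N" for c
    by (induction c) (auto simp: smul_simps assms(2) intro: submodD(2,3)[OF assms(1)])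
  have "- v = of_nat (p - 1) \<star> v + of_nat p \<star> (- v)"
    using assms(3) by (auto simp: fun_eq_iff fun_app algebra_simps of_nat_diff)
  then show ?thesis using * assms(1,2) by (metis lvecs_closed(4) submodD(1,3,5))
qed

lemma submod_diff:
  assumes "submod p n K N" "u \<in> N" "v \<in> N" "p > 0" shows "u - v \<in> N"
  using submodD(3)[OF assms(1,2) submod_uminus[OF assms(1,3,4)]] by simp

lemma submod_smul:
  assumes "submod p n K N" "f \<in> lpolys n" "v \<in> N" "p > 0" shows "f \<star> v \<in> N"
  using assms(2)
  by (induction rule: lpolys_induct)
    (auto simp: smul_simps assms(3,4) intro: submodD(2,4)[OF assms(1)] submod_diff[OF assms(1)])

lemma submod_cancel:
  assumes "submod p n K N" "u + v \<in> N" "v \<in> N" "p > 0" shows "u \<in> N"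
  using submod_diff[OF assms] by simp

lemma submod_mod_p:
  assumes "submod p n K N" "v \<in> lvecs n K" "\<And>i. of_nat p dvd v i" shows "v \<in> N"
proof -
  have "\<exists>g. g \<in> lpolys n \<and> v i = of_nat p * g" for i
    using lpolys_of_nat_dvd[OF assms(3)] assms(2) by (metis (no_types, lifting) lvecs_def mem_Collect_eq)
  then obtain g where g: "\<And>i. g i \<in> lpolys n \<and> v i = of_nat p * g i" by metis
  define h where "h i = (if i < K then g i else 0)" for i
  have "h \<in> lvecs n K" using g by (auto simp: h_def lvecs_def)
  moreover have "v = of_nat p \<star> h" using g assms(2) by (auto simp: h_def lvecs_def fun_eq_iff fun_app not_less)
  ultimately show ?thesis using assms(1) submodD(5) by metis
qed

lemma submod_lvecs: "submod p n K (lvecs n K)"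
  by (auto simp: submod_def)

section \<open>Ascending chain condition by leading terms\<close>

lemma list_less_Cons_same_length:
  fixes xs ys :: "nat list"
  assumes "length xs = length ys"
  shows "x # xs < y # ys \<longleftrightarrow> x < y \<or> x = y \<and> xs < ys"
  using assms by (auto simp: list_less_def Cons_lenlex_iff)

lemma list_less_map2_add:
  fixes xs ys zs :: "nat list"
  assumes "xs < ys" "length xs = length ys" "length zs = length ys"
  shows "map2 (+) xs zs < map2 (+) ys zs"
  using assms
proof (induction xs arbitrary: ys zs)
  case Nil
  then show ?case by simp
next
  case (Cons x xs)
  obtain y ys' where ys: "ys = y # ys'" using Cons by (cases ys) auto
  obtain z zs' where zs: "zs = z # zs'" using Cons by (cases zs) auto
  have "x < y \<or> x = y \<and> xs < ys'"
    using Cons.prems ys by (simp add: list_less_Cons_same_length)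
  then show ?case
    using Cons ys zs by (auto simp: list_less_Cons_same_length)
qed

text \<open>Every sequence of numbers has a monotone subsequence, and a decreasing one is eventually
  constant; passing to subsequences treats one coordinate after the other.\<close>

lemma dickson:
  fixes g :: "nat \<Rightarrow> nat \<Rightarrow> nat"
  shows "\<exists>r::nat \<Rightarrow> nat. strict_mono r \<and> (\<forall>c<L. incseq (\<lambda>k. g (r k) c))"
proof (induction L)
  case 0
  show ?case by (rule exI[of _ "\<lambda>k::nat. k"]) (auto simp: strict_mono_def)
next
  case (Suc L)
  then obtain r where r: "strict_mono r" "\<And>c. c < L \<Longrightarrow> incseq (\<lambda>k. g (r k) c)" by auto
  obtain s where s: "strict_mono s" "monoseq (\<lambda>k. g (r (s k)) L)"
    using seq_monosub[of "\<lambda>k. g (r k) L"] by auto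
  have "\<exists>t. strict_mono t \<and> incseq (\<lambda>k. g (r (s (t k))) L)"
  proof (cases "incseq (\<lambda>k. g (r (s k)) L)")
    case True
    then show ?thesis by (intro exI[of _ "\<lambda>k::nat. k"]) (auto simp: strict_mono_def)
  next
    case False
    then have d: "decseq (\<lambda>k. g (r (s k)) L)" using s(2) by (auto simp: monoseq_iff)
    obtain k0 where k0: "\<And>k. g (r (s k0)) L \<le> g (r (s k)) L"
      using ex_least_nat_le[of "\<lambda>x. x \<in> range (\<lambda>k. g (r (s k)) L)"]
        LeastI_ex[of "\<lambda>x. x \<in> range (\<lambda>k. g (r (s k)) L)"] Least_le[of "\<lambda>x. x \<in> range (\<lambda>k. g (r (s k)) L)"]
      by (metis (no_types, lifting) rangeE rangeI)
    have "g (r (s (k0 + k))) L = g (r (s k0)) L" for k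
      using k0[of "k0 + k"] decseqD[OF d, of k0 "k0 + k"] by simp
    then show ?thesis by (intro exI[of _ "\<lambda>k::nat. k0 + k"]) (auto simp: strict_mono_def incseq_def)
  qed
  then obtain t where t: "strict_mono t" "incseq (\<lambda>k. g (r (s (t k))) L)" by blast
  have "strict_mono (\<lambda>k. r (s (t k)))"
    using r(1) s(1) t(1) by (auto simp: strict_mono_def)
  moreover have "incseq (\<lambda>k. g (r (s (t k))) c)" if "c < Suc L" for c
  proof (cases "c = L")
    case False
    then have "incseq (\<lambda>k. g (r k) c)" using that r(2) by simp
    moreover have "incseq (\<lambda>k. s (t k))"
      using s(1) t(1) by (auto simp: incseq_def strict_mono_less_eq)
    ultimately show ?thesis by (auto simp: incseq_def)
  qed (use t in simp)
  ultimately show ?case by blast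
qed

text \<open>The support after reduction modulo p: only a coefficient prime to p can be inverted and
  used to cancel another one.\<close>

definition vsupp :: "nat \<Rightarrow> lvec \<Rightarrow> (nat \<times> expo) set" where
  "vsupp p v = {(i, a). \<not> int p dvd Poly_Mapping.lookup (v i) a}"

lemma vsupp_subset:
  assumes "v \<in> lvecs n K" shows "(i, a) \<in> vsupp p v \<Longrightarrow> i < K \<and> a \<in> expos n \<and> a \<in> Poly_Mapping.keys (v i)"
  using assms
  by (cases "i < K") (auto simp: vsupp_def lvecs_def lpolys_def in_keys_iff, metis dvd_0_right in_keys_iff subsetD)

lemma finite_vsupp: assumes "v \<in> lvecs n K" shows "finite (vsupp p v)"
proof (rule finite_subset)
  show "vsupp p v \<subseteq> (\<Union>i\<in>{..<K}. Pair i ` Poly_Mapping.keys (v i))"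
    using vsupp_subset[OF assms] by fastforce
qed auto

lemma vsupp_empty: "vsupp p v = {} \<longleftrightarrow> (\<forall>i. of_nat p dvd v i)"
  by (auto simp: vsupp_def of_nat_dvd_lpoly_iff)

lemma vsupp_shift: "(i, x) \<in> vsupp p (mon d \<star> v) \<longleftrightarrow> (i, x - d) \<in> vsupp p v"
  by (simp add: vsupp_def lookup_mon_mult smul_apply)

text \<open>All keys have the same length, so the well-order on lists compares them
  lexicographically, with the position in the vector first. As \<open>nat\<close> collapses negative
  exponents, keys are faithful only for nonnegative ones; this is why \<open>vpos\<close>
  accompanies them.\<close>

definition vkey :: "nat \<Rightarrow> nat \<times> expo \<Rightarrow> nat list" where
  "vkey n z = fst z # map (\<lambda>j. nat (snd z j)) [0..<n]"

definition vpos :: "nat \<Rightarrow> lvec \<Rightarrow> bool" where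
  "vpos p v \<longleftrightarrow> (\<forall>(i, a)\<in>vsupp p v. \<forall>j. a j \<ge> 0)"

lemma vkey_inject:
  assumes "vkey n (i, a) = vkey n (j, b)" "a \<in> expos n" "b \<in> expos n" "\<And>j. a j \<ge> 0" "\<And>j. b j \<ge> 0"
  shows "i = j" "a = b"
proof -
  show "i = j" using assms by (simp add: vkey_def)
  show "a = b"
  proof
    fix k show "a k = b k"
      using assms(1-3) assms(4)[of k] assms(5)[of k]
      by (cases "k < n") (auto simp: vkey_def expos_def nat_eq_iff2 dest!: bspec[of _ _ k])
  qed
qed

lemma vkey_add:
  assumes "\<And>j. a j \<ge> 0" "\<And>j. d j \<ge> 0"
  shows "vkey n (i, a + d) = map2 (+) (vkey n (i, a)) (vkey n (0, d))"
  by (rule nth_equalityI) (auto simp: vkey_def nth_Cons nat_add_distrib fun_app assms split: nat.split)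

lemma vkey_shift_mono:
  assumes "vkey n (i, a) < vkey n (j, b)" "\<And>j. a j \<ge> 0" "\<And>j. b j \<ge> 0" "\<And>j. d j \<ge> 0"
  shows "vkey n (i, a + d) < vkey n (j, b + d)"
  unfolding vkey_add[OF assms(2,4)] vkey_add[OF assms(3,4)]
  by (rule list_less_map2_add) (use assms(1) in \<open>auto simp: vkey_def\<close>)

text \<open>A division step: the leading term of \<open>w\<close> is cancelled by a multiple of \<open>u\<close>.\<close>

lemma lead_reduce:
  assumes p: "prime p" and u: "u \<in> lvecs n K" "vpos p u" and w: "w \<in> lvecs n K" "vpos p w"
    and lu: "(i, a) \<in> vsupp p u" "\<And>z. z \<in> vsupp p u \<Longrightarrow> vkey n z \<le> vkey n (i, a)"
    and lw: "(i, b) \<in> vsupp p w" "\<And>z. z \<in> vsupp p w \<Longrightarrow> vkey n z \<le> vkey n (i, b)"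
    and ab: "\<And>j. a j \<le> b j"
  obtains c where "vpos p (w - of_int c \<star> mon (b - a) \<star> u)"
    "\<And>z. z \<in> vsupp p (w - of_int c \<star> mon (b - a) \<star> u) \<Longrightarrow> vkey n z < vkey n (i, b)"
proof -
  let ?d = "b - a"
  have d: "?d j \<ge> 0" for j using ab[of j] by (simp add: fun_app)
  have pp: "prime (int p)" using p by simp
  have "coprime (Poly_Mapping.lookup (u i) a) (int p)"
    using lu(1) pp by (simp add: vsupp_def prime_imp_coprime_int coprime_commute)
  then obtain r where r: "[Poly_Mapping.lookup (u i) a * r = 1] (mod int p)"
    using cong_solve_coprime_int by blast
  define c where "c = r * Poly_Mapping.lookup (w i) b"
  let ?w = "w - of_int c \<star> mon ?d \<star> u"
  have lk: "Poly_Mapping.lookup (?w j) x = Poly_Mapping.lookup (w j) x - c * Poly_Mapping.lookup (u j) (x - ?d)" for j x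
    by (simp add: lookup_minus lookup_of_int_mult lookup_mon_mult fun_app)
  have "[Poly_Mapping.lookup (u i) a * r * Poly_Mapping.lookup (w i) b = 1 * Poly_Mapping.lookup (w i) b] (mod int p)"
    using r by (rule cong_scalar_right)
  then have "int p dvd Poly_Mapping.lookup (u i) a * r * Poly_Mapping.lookup (w i) b - Poly_Mapping.lookup (w i) b"
    by (simp add: cong_iff_dvd_diff)
  then have "int p dvd Poly_Mapping.lookup (w i) b - c * Poly_Mapping.lookup (u i) a"
    by (subst dvd_minus_iff[symmetric]) (simp add: c_def algebra_simps)
  then have nb: "(i, b) \<notin> vsupp p ?w" by (simp add: vsupp_def lk)
  have cases: "(j, x) \<in> vsupp p w \<or> (j, x - ?d) \<in> vsupp p u" if "(j, x) \<in> vsupp p ?w" for j x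
    using that by (auto simp: vsupp_def lk dvd_diff)
  have nonneg: "x k \<ge> 0" if "(j, x) \<in> vsupp p ?w" for j x k
    using cases[OF that]
  proof
    assume "(j, x - ?d) \<in> vsupp p u"
    then have "(x - ?d) k \<ge> 0" using u(2) by (auto simp: vpos_def)
    then show ?thesis using d[of k] by (simp add: fun_app)
  qed (use w(2) in \<open>auto simp: vpos_def\<close>)
  have b0: "b k \<ge> 0" for k using lw(1) w(2) by (auto simp: vpos_def)
  have a0: "a k \<ge> 0" for k using lu(1) u(2) by (auto simp: vpos_def)
  have "vkey n (j, x) < vkey n (i, b)" if x: "(j, x) \<in> vsupp p ?w" for j x
  proof -
    have ex: "x \<in> expos n"
      using cases[OF x]
    proof
      assume "(j, x - ?d) \<in> vsupp p u"
      then have "x - ?d \<in> expos n" using vsupp_subset[OF u(1)] by blast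
      moreover have "?d \<in> expos n" using vsupp_subset[OF u(1) lu(1)] vsupp_subset[OF w(1) lw(1)] by blast
      ultimately have "x - ?d + ?d \<in> expos n" by (rule expos_closed)
      then show ?thesis by simp
    qed (use vsupp_subset[OF w(1)] in blast)
    have "vkey n (j, x) \<le> vkey n (i, b)"
      using cases[OF x]
    proof
      assume *: "(j, x - ?d) \<in> vsupp p u"
      then have nn: "(x - ?d) k \<ge> 0" for k using u(2) by (auto simp: vpos_def)
      show ?thesis
      proof (cases "vkey n (j, x - ?d) = vkey n (i, a)")
        case True
        then have "j = i" "x - ?d = a"
          using vkey_inject[of n j "x - ?d" i a] vsupp_subset[OF u(1) lu(1)] vsupp_subset[OF u(1) *] nn a0 by auto
        then have "x = b" by (metis add.commute diff_add_cancel)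
        then show ?thesis using \<open>j = i\<close> by simp
      next
        case False
        then have "vkey n (j, x - ?d) < vkey n (i, a)" using lu(2)[OF *] by (simp add: order.strict_iff_order)
        then have "vkey n (j, x - ?d + ?d) < vkey n (i, a + ?d)"
          by (rule vkey_shift_mono) (fact nn a0 d)+
        then show ?thesis by simp
      qed
    qed (use lw(2) in blast)
    moreover have "vkey n (j, x) \<noteq> vkey n (i, b)"
      using vkey_inject[of n j x i b] nonneg[OF x] b0 ex vsupp_subset[OF w(1) lw(1)] nb x by metis
    ultimately show ?thesis by (simp add: order.strict_iff_order)
  qed
  moreover have "vpos p ?w" using nonneg by (auto simp: vpos_def)
  ultimately show ?thesis using that by (metis surj_pair)
qed

text \<open>For n > 0 no translation-invariant total order of Z^n is a well-order. Leading terms are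
  therefore taken only after a shift into nonnegative exponents, which does not affect membership in
  a submodule.\<close>

lemma vpos_shift_exists:
  assumes "v \<in> lvecs n K" obtains d where "d \<in> expos n" "vpos p (mon d \<star> v)"
proof -
  define D where "D = (\<Sum>z\<in>vsupp p v. \<Sum>j<n. \<bar>snd z j\<bar>)"
  let ?d = "\<lambda>j. if j < n then D else 0"
  have "vpos p (mon ?d \<star> v)"
    unfolding vpos_def
  proof (intro ballI allI, clarify)
    fix i x j assume "(i, x) \<in> vsupp p (mon ?d \<star> v)"
    then have *: "(i, x - ?d) \<in> vsupp p v" by (simp only: vsupp_shift)
    then have e: "x - ?d \<in> expos n" using vsupp_subset[OF assms] by blast
    show "0 \<le> x j"
    proof (cases "j < n")
      case True
      have "\<bar>(x - ?d) j\<bar> \<le> (\<Sum>j<n. \<bar>(x - ?d) j\<bar>)"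
        by (rule member_le_sum) (use True in auto)
      also have "\<dots> = (\<lambda>z. \<Sum>j<n. \<bar>snd z j\<bar>) (i, x - ?d)" by simp
      also have "\<dots> \<le> (\<Sum>z\<in>vsupp p v. \<Sum>j<n. \<bar>snd z j\<bar>)"
        by (rule member_le_sum[OF *, where f = "\<lambda>z. \<Sum>j<n. \<bar>snd z j\<bar>"])
          (auto intro: sum_nonneg finite_vsupp[OF assms])
      also have "\<dots> = D" by (simp only: D_def)
      finally show ?thesis using True by (simp add: fun_app)
    next
      case False
      then show ?thesis using e by (auto simp: expos_def fun_app)
    qed
  qed
  moreover have "?d \<in> expos n" by (simp add: expos_def)
  ultimately show ?thesis using that by blast
qed

lemma submod_shift_iff:
  assumes "submod p n K N" "d \<in> expos n" shows "mon d \<star> v \<in> N \<longleftrightarrow> v \<in> N"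
proof
  assume "mon d \<star> v \<in> N"
  then have "mon (- d) \<star> mon d \<star> v \<in> N"
    by (rule submodD(4)[OF assms(1) _ expos_closed(4)[OF assms(2)]])
  moreover have "mon (- d) \<star> mon d \<star> v = v"
    by (simp only: smul_simps(8)[symmetric] mon_mult left_minus mon_0 smul_simps(5))
  ultimately show "v \<in> N" by (simp only:)
qed (use assms submodD(4) in blast)

text \<open>From each step of the chain a new element with least leading term is taken. By Dickson's
  lemma the leading term of an earlier one divides that of a later one. Subtracting a multiple of
  the earlier element, which already lies in the smaller of the two modules at the later step,
  leaves a new element with a smaller leading term.\<close>

theorem submod_acc:
  assumes p: "prime p" and N: "\<And>k. submod p n K (N k)" and strict: "\<And>k. N k \<subset> N (Suc k)"
  shows False
proof -
  have mono: "N i \<subseteq> N j" if "i \<le> j" for i j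
    using lift_Suc_mono_le[of N] strict that by blast
  define cand where "cand k v \<longleftrightarrow> v \<in> N (Suc k) \<and> v \<notin> N k \<and> vpos p v" for k v
  define lead where "lead v = Max (vkey n ` vsupp p v)" for v
  have lead_in: "lead w \<in> vkey n ` vsupp p w" if "w \<in> lvecs n K" "vsupp p w \<noteq> {}" for w
    unfolding lead_def using that finite_vsupp[OF that(1)] by (intro Max_in) auto
  have pos: "p > 0" using p by (simp add: prime_gt_0_nat)
  have ex: "\<exists>v. cand k v" for k
  proof -
    obtain v where v: "v \<in> N (Suc k)" "v \<notin> N k" using strict[of k] by blast
    obtain d where "d \<in> expos n" "vpos p (mon d \<star> v)"
      using vpos_shift_exists submodD(1)[OF N v(1)] by metis
    then have "cand k (mon d \<star> v)" using v by (simp add: cand_def submod_shift_iff[OF N])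
    then show ?thesis by blast
  qed
  have "\<exists>v. cand k v \<and> (\<forall>w. cand k w \<longrightarrow> lead v \<le> lead w)" for k
    using ex[of k] ex_has_least_nat
  proof -
    define m where "m = (LEAST l. \<exists>v. cand k v \<and> lead v = l)"
    have "\<exists>v. cand k v \<and> lead v = m" unfolding m_def by (rule LeastI_ex) (use ex[of k] in blast)
    moreover have "m \<le> lead w" if "cand k w" for w unfolding m_def by (rule Least_le) (use that in blast)
    ultimately show ?thesis by blast
  qed
  then obtain v where v: "\<And>k. cand k (v k)" and vmin: "\<And>k w. cand k w \<Longrightarrow> lead (v k) \<le> lead w" by metis
  have vl: "v k \<in> lvecs n K" for k using v[of k] submodD(1)[OF N] by (auto simp: cand_def)
  have "vsupp p (v k) \<noteq> {}" for k
    using submod_mod_p[OF N vl] v[of k] by (auto simp: vsupp_empty cand_def)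
  then have "lead (v k) \<in> vkey n ` vsupp p (v k)" for k
    by (rule lead_in[OF vl])
  then have "\<exists>z. z \<in> vsupp p (v k) \<and> vkey n z = lead (v k)" for k by (metis imageE)
  then have "\<exists>i a. (i, a) \<in> vsupp p (v k) \<and> vkey n (i, a) = lead (v k)" for k by (metis surj_pair)
  then obtain i a where ia: "\<And>k. (i k, a k) \<in> vsupp p (v k)" "\<And>k. vkey n (i k, a k) = lead (v k)" by metis
  have le: "vkey n z \<le> vkey n (i k, a k)" if "z \<in> vsupp p (v k)" for z k
    unfolding ia(2) lead_def using that by (auto intro: Max_ge finite_vsupp[OF vl])
  \<comment> \<open>Coordinates 0 and 1 are i and K - i. Since i < K, both can be nondecreasing only
    if the leading terms sit at the same position of the vector.\<close>
  define g where "g k c = (if c = 0 then i k else if c = 1 then K - i k else nat (a k (c - 2)))" for k c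
  obtain r where r: "strict_mono r" "\<And>c. c < n + 2 \<Longrightarrow> incseq (\<lambda>k. g (r k) c)"
    using dickson[where L = "n + 2" and g = g] by blast
  let ?s = "r 0" and ?t = "r 1"
  have st: "?s < ?t" using r(1) by (simp add: strict_mono_def)
  have gle: "g ?s c \<le> g ?t c" if "c < n + 2" for c using r(2)[OF that] by (simp add: incseq_def)
  have iK: "i k < K" "a k \<in> expos n" for k using vsupp_subset[OF vl ia(1)] by auto
  have ii: "i ?s = i ?t" using gle[of 0] gle[of 1] iK(1)[of ?s] iK(1)[of ?t] by (auto simp: g_def)
  have anon: "a k j \<ge> 0" for k j using v[of k] ia(1)[of k] by (auto simp: cand_def vpos_def)
  have aa: "a ?s j \<le> a ?t j" for j
  proof (cases "j < n")
    case True
    then have "nat (a ?s j) \<le> nat (a ?t j)" using gle[of "j + 2"] by (simp add: g_def)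
    then show ?thesis using anon[of ?s j] anon[of ?t j] by linarith
  next
    case False
    then show ?thesis using iK(2)[of ?s] iK(2)[of ?t] by (auto simp: expos_def)
  qed
  obtain c where c: "vpos p (v ?t - of_int c \<star> mon (a ?t - a ?s) \<star> v ?s)"
    "\<And>z. z \<in> vsupp p (v ?t - of_int c \<star> mon (a ?t - a ?s) \<star> v ?s) \<Longrightarrow> vkey n z < vkey n (i ?t, a ?t)"
  proof (rule lead_reduce[OF p vl[of ?s] _ vl[of ?t], of "i ?t" "a ?s" "a ?t"])
    show "vpos p (v ?s)" "vpos p (v ?t)" using v by (auto simp: cand_def)
    show "(i ?t, a ?s) \<in> vsupp p (v ?s)" using ia(1)[of ?s] ii by simp
    show "(i ?t, a ?t) \<in> vsupp p (v ?t)" using ia(1)[of ?t] by simp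
    show "\<And>z. z \<in> vsupp p (v ?s) \<Longrightarrow> vkey n z \<le> vkey n (i ?t, a ?s)" using le[of _ ?s] ii by simp
    show "\<And>z. z \<in> vsupp p (v ?t) \<Longrightarrow> vkey n z \<le> vkey n (i ?t, a ?t)" using le[of _ ?t] by simp
  qed (use aa in auto)
  let ?w = "v ?t - of_int c \<star> mon (a ?t - a ?s) \<star> v ?s"
  have vs: "v ?s \<in> N ?t" using v[of ?s] mono[of "Suc ?s" ?t] st by (auto simp: cand_def)
  have sub: "of_int c \<star> mon (a ?t - a ?s) \<star> v ?s \<in> N ?t"
    by (intro submod_smul[OF N] submodD(4)[OF N] vs pos expos_closed iK lpolys_of_int)
  have "?w \<in> N (Suc ?t)"
    using submod_diff[OF N] v[of ?t] sub mono[of ?t "Suc ?t"] pos by (auto simp: cand_def)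
  moreover have wt: "?w \<notin> N ?t"
  proof
    assume "?w \<in> N ?t"
    from submodD(3)[OF N this sub] have "v ?t \<in> N ?t" by simp
    then show False using v[of ?t] by (auto simp: cand_def)
  qed
  ultimately have "cand ?t ?w" using c(1) by (simp add: cand_def)
  then have "lead (v ?t) \<le> lead ?w" by (rule vmin)
  have wl: "?w \<in> lvecs n K" using \<open>?w \<in> N (Suc ?t)\<close> submodD(1)[OF N] by blast
  have "vsupp p ?w \<noteq> {}"
    using submod_mod_p[OF N wl] wt by (auto simp: vsupp_empty)
  then have "lead ?w \<in> vkey n ` vsupp p ?w"
    by (rule lead_in[OF wl])
  then have "lead ?w < lead (v ?t)" using c(2) ia(2)[of ?t] by auto
  then show False using \<open>lead (v ?t) \<le> lead ?w\<close> by simp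
qed

definition bvec :: "lpoly \<Rightarrow> nat \<Rightarrow> lvec" where
  "bvec f i = (\<lambda>j. if j = i then f else 0)"

lemma bvec_simps [simp]:
  "bvec 0 i = 0" "bvec (f + g) i = bvec f i + bvec g i" "bvec (f - g) i = bvec f i - bvec g i"
  "g \<star> bvec f i = bvec (g * f) i"
  by (auto simp: bvec_def fun_eq_iff fun_app)

lemma bvec_lvecs [simp, intro]: "f \<in> lpolys n \<Longrightarrow> i < K \<Longrightarrow> bvec f i \<in> lvecs n K"
  by (auto simp: bvec_def lvecs_def)

lemma lvecs_induct [consumes 1, case_names zero mon diff]:
  assumes "v \<in> lvecs n K" "P 0" "\<And>a i. a \<in> expos n \<Longrightarrow> i < K \<Longrightarrow> P (bvec (mon a) i)"
    "\<And>u v. u \<in> lvecs n K \<Longrightarrow> v \<in> lvecs n K \<Longrightarrow> P u \<Longrightarrow> P v \<Longrightarrow> P (u - v)"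
  shows "P v"
proof -
  have b: "P (bvec f i)" if "f \<in> lpolys n" "i < K" for f i
    using that(1) by (induction rule: lpolys_induct) (use that(2) assms(2-4) in \<open>auto simp: bvec_lvecs\<close>)
  have "P (\<lambda>i. if i < m then v i else 0) \<and> (\<lambda>i. if i < m then v i else 0) \<in> lvecs n K" if "m \<le> K" for m
    using that
  proof (induction m)
    case 0
    have "(\<lambda>i. 0) = (0 :: lvec)" by (simp add: fun_eq_iff fun_app)
    then show ?case using assms(2) by simp
  next
    case (Suc m)
    let ?u = "\<lambda>i. if i < m then v i else 0"
    have vm: "v m \<in> lpolys n" using assms(1) by (simp add: lvecs_def)
    have *: "bvec (v m) m \<in> lvecs n K" using vm Suc by auto
    have u: "?u \<in> lvecs n K" "P ?u" using Suc by auto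
    have "P (0 - bvec (v m) m)" by (rule assms(4)) (use * b[OF vm] Suc.prems assms(2) in auto)
    moreover have "0 - bvec (v m) m \<in> lvecs n K" using * by (intro lvecs_closed)
    ultimately have "P (?u - (0 - bvec (v m) m))" by (intro assms(4)[OF u(1) _ u(2)])
    moreover have "?u - (0 - bvec (v m) m) = (\<lambda>i. if i < Suc m then v i else 0)"
      by (auto simp: fun_eq_iff bvec_def fun_app)
    moreover have "(\<lambda>i. if i < Suc m then v i else 0) \<in> lvecs n K" using assms(1) by (auto simp: lvecs_def)
    ultimately show ?case by simp
  qed
  from this[of K] have "P (\<lambda>i. if i < K then v i else 0)" by simp
  moreover have "(\<lambda>i. if i < K then v i else 0) = v" using assms(1) by (auto simp: lvecs_def fun_eq_iff)
  ultimately show ?thesis by simp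
qed

section \<open>Submodules are finite-state\<close>

text \<open>The operations whose orbit is the p-kernel of a sequence, here for families of arrays on
  Z^n.\<close>

definition decim :: "nat \<Rightarrow> expo \<Rightarrow> (nat \<Rightarrow> expo \<Rightarrow> int) \<Rightarrow> (nat \<Rightarrow> expo \<Rightarrow> int)" where
  "decim p s t = (\<lambda>i a. t i (scale_expo p a + s))"

definition digs :: "nat \<Rightarrow> nat \<Rightarrow> expo set" where
  "digs p n = {s \<in> expos n. \<forall>i. 0 \<le> s i \<and> s i < int p}"

definition evl :: "nat \<Rightarrow> (nat \<Rightarrow> expo \<Rightarrow> int) \<Rightarrow> lvec \<Rightarrow> int" where
  "evl K t v = (\<Sum>i<K. lin (t i) (v i))"

definition frobv :: "nat \<Rightarrow> lvec \<Rightarrow> lvec" where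
  "frobv p v = (\<lambda>i. frob p (v i))"

lemma frobv_simps [simp]: "frobv p 0 = 0" "frobv p (u - v) = frobv p u - frobv p v"
    "frobv p (u + v) = frobv p u + frobv p v" "frobv p (f \<star> v) = frob p f \<star> frobv p v"
  by (auto simp: frobv_def fun_eq_iff fun_app frob_mult)

lemma frobv_lvecs [simp, intro]: "v \<in> lvecs n K \<Longrightarrow> frobv p v \<in> lvecs n K"
  by (auto simp: frobv_def lvecs_def)

lemma evl_simps [simp]:
  "evl K t 0 = 0" "evl K t (u + v) = evl K t u + evl K t v" "evl K t (u - v) = evl K t u - evl K t v"
  "evl K t (- v) = - evl K t v"
  by (simp_all add: evl_def plus_fun_apply zero_fun_apply minus_apply uminus_apply sum.distrib
      sum_subtractf sum_negf)

lemma evl_scalar [simp]: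
  "evl K t (of_nat c \<star> v) = int c * evl K t v" "evl K t (of_int z \<star> v) = z * evl K t v"
  by (simp_all only: evl_def smul_apply lin_of_nat_mult lin_of_int_mult sum_distrib_left)

lemma evl_bvec: "i < K \<Longrightarrow> evl K t (bvec f i) = lin (t i) f"
proof -
  assume "i < K"
  have "evl K t (bvec f i) = (\<Sum>j<K. if j = i then lin (t i) f else 0)"
    unfolding evl_def bvec_def by (rule sum.cong) auto
  then show ?thesis using \<open>i < K\<close> by simp
qed

text \<open>Decimation is adjoint to the Frobenius followed by the shift by s. This adjunction
  carries statements about decimated arrays over to vectors.\<close>

lemma evl_decim: "evl K (decim p s t) v = evl K t (mon s \<star> frobv p v)"
  by (simp add: evl_def decim_def frobv_def fun_app lin_mon_mult lin_push add.commute)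

text \<open>Only \<open>Th0\<close> cuts out N, but an automaton needs all of \<open>Th\<close>:
  decimating the functionals of one state leads to those of the next. A single array defines just an
  additive map; quantifying over all shifts a makes the common kernel a submodule.\<close>

definition finite_state :: "nat \<Rightarrow> nat \<Rightarrow> nat \<Rightarrow> lvec set \<Rightarrow> bool" where
  "finite_state p n K N \<longleftrightarrow> (\<exists>Th Th0. finite Th \<and> Th0 \<subseteq> Th \<and> (\<forall>t\<in>Th. \<forall>s\<in>digs p n. decim p s t \<in> Th) \<and>
     N = {v \<in> lvecs n K. \<forall>t\<in>Th0. \<forall>a\<in>expos n. int p dvd evl K t (mon a \<star> v)})"

lemma finite_state_Int:
  assumes "finite_state p n K N1" "finite_state p n K N2" shows "finite_state p n K (N1 \<inter> N2)"
proof -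
  obtain T1 S1 where T1: "finite T1" "S1 \<subseteq> T1" "\<forall>t\<in>T1. \<forall>s\<in>digs p n. decim p s t \<in> T1"
     "N1 = {v \<in> lvecs n K. \<forall>t\<in>S1. \<forall>a\<in>expos n. int p dvd evl K t (mon a \<star> v)}"
    using assms(1) unfolding finite_state_def by (elim exE conjE) (rule that)
  obtain T2 S2 where T2: "finite T2" "S2 \<subseteq> T2" "\<forall>t\<in>T2. \<forall>s\<in>digs p n. decim p s t \<in> T2"
     "N2 = {v \<in> lvecs n K. \<forall>t\<in>S2. \<forall>a\<in>expos n. int p dvd evl K t (mon a \<star> v)}"
    using assms(2) unfolding finite_state_def by (elim exE conjE) (rule that)
  show ?thesis unfolding finite_state_def
    by (rule exI[of _ "T1 \<union> T2"], rule exI[of _ "S1 \<union> S2"]) (use T1 T2 in auto)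
qed

lemma finite_state_lvecs: "finite_state p n K (lvecs n K)"
  unfolding finite_state_def by (rule exI[of _ "{}"], rule exI[of _ "{}"]) auto

section \<open>Additive spans, additive maps of exponents and separating weights\<close>

inductive_set addgen :: "'a::ab_group_add set \<Rightarrow> 'a set" for A where
  zero: "0 \<in> addgen A"
| base: "a \<in> A \<Longrightarrow> a \<in> addgen A"
| diff: "x \<in> addgen A \<Longrightarrow> y \<in> addgen A \<Longrightarrow> x - y \<in> addgen A"

lemma addgen_uminus: "x \<in> addgen A \<Longrightarrow> - x \<in> addgen A"
  using addgen.diff[OF addgen.zero] by force

lemma addgen_add: "x \<in> addgen A \<Longrightarrow> y \<in> addgen A \<Longrightarrow> x + y \<in> addgen A"
  using addgen.diff[OF _ addgen_uminus] by force

lemma addgen_sum: "(\<And>i. i \<in> I \<Longrightarrow> f i \<in> addgen A) \<Longrightarrow> sum f I \<in> addgen A"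
  by (induction I rule: infinite_finite_induct) (auto intro: addgen.zero addgen_add)

lemma addgen_of_nat_mult:
  fixes x :: "'a::ring_1" assumes "x \<in> addgen A" shows "of_nat c * x \<in> addgen A"
  by (induction c) (auto simp: algebra_simps intro: addgen.zero addgen_add assms)

lemma addgen_of_int_mult:
  fixes x :: "'a::ring_1" assumes "x \<in> addgen A" shows "of_int c * x \<in> addgen A"
  by (cases c rule: int_cases2) (auto intro: addgen_of_nat_mult addgen_uminus assms)

lemma addgen_image:
  assumes "x \<in> addgen A" "h 0 = 0" "\<And>x y. h (x - y) = h x - h y" "\<And>a. a \<in> A \<Longrightarrow> h a \<in> addgen B"
  shows "h x \<in> addgen B"
  using assms(1) by induction (auto simp: assms(2-4) intro: addgen.intros)

lemma addgen_mono: "A \<subseteq> addgen B \<Longrightarrow> addgen A \<subseteq> addgen B"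
  using addgen_image[of _ A "\<lambda>x. x" B] by auto

lemma additive_diff:
  fixes h :: "expo \<Rightarrow> expo"
  assumes "\<And>a b. h (a + b) = h a + h b" shows "h (a - b) = h a - h b"
  using assms[of "a - b" b] by (simp add: algebra_simps)

lemma additive_scale_int:
  fixes h :: "expo \<Rightarrow> expo"
  assumes "\<And>a b. h (a + b) = h a + h b" shows "h (\<lambda>i. z * a i) = (\<lambda>i. z * h a i)"
proof -
  have h0: "h 0 = 0" using assms[of 0 0] by simp
  have nat: "h (\<lambda>i. int c * a i) = (\<lambda>i. int c * h a i)" for c a
  proof (induction c)
    case 0
    then show ?case using h0 by (simp add: zero_fun_def)
  next
    case (Suc c)
    have "(\<lambda>i. int (Suc c) * a i) = a + (\<lambda>i. int c * a i)" by (auto simp: fun_eq_iff fun_app algebra_simps)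
    then show ?case using Suc by (simp add: assms) (auto simp: fun_eq_iff fun_app algebra_simps)
  qed
  show ?thesis
  proof (cases z rule: int_cases2)
    case (nonneg c)
    then show ?thesis using nat by simp
  next
    case (nonpos c)
    have "(\<lambda>i. z * a i) = 0 - (\<lambda>i. int c * a i)" using nonpos by (auto simp: fun_eq_iff fun_app)
    then show ?thesis using nat nonpos
      by (simp only: additive_diff[of h, OF assms] h0) (auto simp: fun_eq_iff fun_app)
  qed
qed

lemma additive_scale_expo:
  assumes "\<And>a b. h (a + b) = h a + h b" shows "h (scale_expo q a) = scale_expo q (h a)"
  unfolding scale_expo_def by (rule additive_scale_int[OF assms])

lemma lpoly_expand: "f = (\<Sum>a\<in>Poly_Mapping.keys f. of_int (Poly_Mapping.lookup f a) * mon a)"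
proof -
  have "frag_cmul c g = of_int c * g" for g :: lpoly and c
    by (rule poly_mapping_eqI) (simp add: lookup_of_int_mult)
  then show ?thesis using frag_expansion[of f] unfolding frag_extend_def by (simp only:)
qed

lemma push_sum: "push h (sum f I) = (\<Sum>i\<in>I. push h (f i))"
  by (induction I rule: infinite_finite_induct) auto

text \<open>Two distinct exponents differ by a nonzero polynomial in B, so only finitely many B fail
  on a given pair. The coefficient of coordinate 0 is \<open>B ^ 0 = 1\<close>, which later allows
  the weight to replace this coordinate in a lattice basis.\<close>

lemma separating_weight:
  assumes "finite S" "S \<subseteq> expos k" shows "\<exists>B::int. inj_on (\<lambda>a. \<Sum>i<k. B ^ i * a i) S"
proof -
  define P where "P z = (\<Sum>i<k. Polynomial.monom (fst z i - snd z i) i)" for z :: "expo \<times> expo"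
  have pol: "poly (P (a, b)) B = (\<Sum>i<k. B ^ i * a i) - (\<Sum>i<k. B ^ i * b i)" for a b and B :: int
    by (simp add: P_def poly_sum poly_monom sum_subtractf[symmetric] algebra_simps)
  have nz: "P (a, b) \<noteq> 0" if "a \<in> S" "b \<in> S" "a \<noteq> b" for a b
  proof -
    obtain j where j: "a j \<noteq> b j" using \<open>a \<noteq> b\<close> by auto
    have "a \<in> expos k" "b \<in> expos k" using that assms(2) by auto
    then have "j < k" using j by (cases "j < k") (auto simp: expos_def)
    then have "coeff (P (a, b)) j = a j - b j" by (simp add: P_def coeff_sum)
    then show ?thesis using j by (metis coeff_0 right_minus_eq)
  qed
  let ?R = "\<Union>z\<in>{z \<in> S \<times> S. fst z \<noteq> snd z}. {x. poly (P z) x = 0}"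
  have "finite ?R"
    by (rule finite_UN_I) (use assms(1) nz in \<open>auto intro!: poly_roots_finite\<close>)
  then obtain B where "B \<notin> ?R" using ex_new_if_finite infinite_UNIV_int by blast
  then have "inj_on (\<lambda>a. \<Sum>i<k. B ^ i * a i) S"
    by (auto simp: inj_on_def pol)
  then show ?thesis by blast
qed

lemma finite_expo_box: "finite {h \<in> expos k. \<forall>j. \<bar>h j\<bar> \<le> (D::int)}"
proof -
  let ?f = "\<lambda>h::expo. restrict h {..<k}"
  have "inj_on ?f (expos k)"
  proof (rule inj_onI)
    fix a b assume ab: "a \<in> expos k" "b \<in> expos k" "?f a = ?f b"
    show "a = b"
    proof
      fix j show "a j = b j"
        using ab(1,2) fun_cong[OF ab(3), of j] by (cases "j < k") (auto simp: expos_def)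
    qed
  qed
  then have "inj_on ?f {h \<in> expos k. \<forall>j. \<bar>h j\<bar> \<le> D}" by (rule inj_on_subset) auto
  moreover have "?f ` {h \<in> expos k. \<forall>j. \<bar>h j\<bar> \<le> D} \<subseteq> PiE {..<k} (\<lambda>_. {-D..D})"
    by (auto simp: abs_le_iff minus_le_iff split: if_splits)
  ultimately show ?thesis
    by (meson finite_PiE finite_atLeastAtMost_int finite_imageD finite_lessThan finite_subset)
qed

lemma finite_int_bounded: "finite S \<Longrightarrow> \<exists>D::int. \<forall>x\<in>S. x \<le> D"
  by (induction S rule: finite_induct) (auto, metis dual_order.trans linear)

section \<open>Quotients on which every polynomial acts nilpotently or injectively\<close>

locale uniform_submod =
  fixes p n K :: nat and N :: "lvec set"
  assumes p: "prime p" and N: "submod p n K N" and proper: "N \<noteq> lvecs n K"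
    and dichotomy: "\<And>f. f \<in> lpolys n \<Longrightarrow> (\<exists>t. \<forall>v\<in>lvecs n K. f ^ t \<star> v \<in> N) \<or>
                                      (\<forall>v\<in>lvecs n K. f \<star> v \<in> N \<longrightarrow> v \<in> N)"
begin

lemma p_pos: "p > 0" using p by (simp add: prime_gt_0_nat)

definition annih :: "lpoly set" where
  "annih = {f \<in> lpolys n. \<forall>v\<in>lvecs n K. f \<star> v \<in> N}"

lemma annihD: "f \<in> annih \<Longrightarrow> f \<in> lpolys n" "f \<in> annih \<Longrightarrow> v \<in> lvecs n K \<Longrightarrow> f \<star> v \<in> N"
  by (auto simp: annih_def)

lemma annih_mult: "f \<in> annih \<Longrightarrow> g \<in> lpolys n \<Longrightarrow> g * f \<in> annih"
  using submod_smul[OF N _ _ p_pos, of g] by (auto simp: annih_def smul_simps(8))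

lemma annih_diff: "f \<in> annih \<Longrightarrow> g \<in> annih \<Longrightarrow> f - g \<in> annih"
  by (auto simp: annih_def smul_simps(4) intro!: submod_diff[OF N] p_pos)

lemma annih_0: "0 \<in> annih"
  by (auto simp: annih_def smul_simps submodD(2)[OF N])

lemma annih_add: "f \<in> annih \<Longrightarrow> g \<in> annih \<Longrightarrow> f + g \<in> annih"
  by (auto simp: annih_def smul_simps(3) intro!: submodD(3)[OF N])

lemma annih_sum: "(\<And>i. i \<in> I \<Longrightarrow> f i \<in> annih) \<Longrightarrow> sum f I \<in> annih"
  by (induction I rule: infinite_finite_induct) (auto intro: annih_0 annih_add)

lemma annih_p: "g \<in> lpolys n \<Longrightarrow> of_nat p * g \<in> annih"
  by (auto simp: annih_def smul_simps(8) intro!: submodD(5)[OF N])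

lemma annih_dvd: "of_nat p dvd f \<Longrightarrow> f \<in> lpolys n \<Longrightarrow> f \<in> annih"
  by (metis lpolys_of_nat_dvd annih_p)

lemma annih_1: "1 \<notin> annih"
  using proper submodD(1)[OF N] by (auto simp: annih_def smul_simps)

text \<open>The power f^(p^e) agrees modulo p with the substitution X^a -> X^(p^e a), so a nilpotent
  f yields a relation with explicitly known exponents.\<close>

lemma annih_frob_pow:
  assumes "f \<in> lpolys n" "f ^ (p ^ e) \<in> annih" shows "frob (p ^ e) f \<in> annih"
proof -
  have "of_nat p dvd frob (p ^ e) f - f ^ (p ^ e)" by (rule frob_pow_cong_power[OF p])
  then have "frob (p ^ e) f - f ^ (p ^ e) \<in> annih" by (rule annih_dvd) (use assms in auto)
  from annih_add[OF this assms(2)] show ?thesis by simp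
qed

lemma annih_frob:
  assumes "f \<in> annih" shows "frob p f \<in> annih"
proof -
  have "f ^ (p - 1) * f \<in> annih" using assms annihD(1) by (intro annih_mult) auto
  then have "f ^ (p ^ 1) \<in> annih" using p_pos by (simp add: power_Suc2[symmetric] del: power_Suc)
  from annih_frob_pow[OF annihD(1)[OF assms] this] show ?thesis by simp
qed

text \<open>The integer c is invertible modulo p, and multiples of p annihilate the
  quotient.\<close>

lemma of_int_annih_cancel:
  assumes "of_int c * f \<in> addgen (A \<union> annih)" "\<not> int p dvd c" "f \<in> lpolys n"
  shows "f \<in> addgen (A \<union> annih)"
proof -
  have "coprime c (int p)"
    using assms(2) p by (metis coprime_commute prime_imp_coprime prime_nat_int_transfer)
  then obtain r where "[c * r = 1] (mod int p)" using cong_solve_coprime_int by blast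
  then obtain u where u: "c * r - 1 = int p * u" by (auto simp: cong_iff_dvd_diff dvd_def)
  have "of_int r * (of_int c * f) - of_nat p * (of_int u * f) \<in> addgen (A \<union> annih)"
    by (intro addgen.diff addgen_of_int_mult assms(1) addgen.base UnI2 annih_p) (use assms(3) in auto)
  moreover have "of_int r * (of_int c * f) - of_nat p * (of_int u * f) = of_int (c * r - int p * u) * f"
    by (simp add: algebra_simps)
  moreover have "c * r - int p * u = 1" using u by simp
  ultimately show ?thesis by simp
qed

text \<open>\<open>normal_gen k h Xs\<close> says that the ring acting on the quotient module is finitely generated, by the
  monomials with exponents in \<open>Xs\<close>, over the Laurent polynomials in \<open>k\<close> variables, which act
  through \<open>h\<close>. Taking \<open>k\<close> minimal is a Noether normalization.\<close>

definition normal_gens :: "nat \<Rightarrow> (expo \<Rightarrow> expo) \<Rightarrow> expo set \<Rightarrow> lpoly set" where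
  "normal_gens k h Xs = {mon (h x + e) |x e. x \<in> expos k \<and> e \<in> Xs}"

definition normal_gen :: "nat \<Rightarrow> (expo \<Rightarrow> expo) \<Rightarrow> expo set \<Rightarrow> bool" where
  "normal_gen k h Xs \<longleftrightarrow> finite Xs \<and> Xs \<subseteq> expos n \<and> (\<forall>a b. h (a + b) = h a + h b) \<and>
     (\<forall>a\<in>expos k. h a \<in> expos n) \<and> (\<forall>a\<in>expos n. mon a \<in> addgen (normal_gens k h Xs \<union> annih))"

lemma normal_gen_exists: "normal_gen n (\<lambda>a. a) {0}"
  unfolding normal_gen_def normal_gens_def by (auto intro: addgen.base)

text \<open>A change of lattice basis makes the exponents of f pairwise distinct in one direction T.
  The two terms that are extreme in this direction have coefficients invertible modulo p, so the
  relation lowers large powers of T and raises negative ones: both T and its inverse are integral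
  over the remaining variables.\<close>

lemma normal_gen_reduce:
  assumes g: "normal_gen k h Xs" and f: "f \<in> lpolys k" "\<not> of_nat p dvd f"
    and nil: "push h f ^ t \<in> annih"
  shows "\<exists>k' h' Xs'. k' < k \<and> normal_gen k' h' Xs'"
proof -
  have fin: "finite Xs" and Xs: "Xs \<subseteq> expos n" and hadd: "\<And>a b. h (a + b) = h a + h b"
    and hn: "\<And>a. a \<in> expos k \<Longrightarrow> h a \<in> expos n"
    and gen: "\<And>a. a \<in> expos n \<Longrightarrow> mon a \<in> addgen (normal_gens k h Xs \<union> annih)"
    using g by (auto simp: normal_gen_def)
  \<comment> \<open>A power of p that is at least t: the q-th power still annihilates, and modulo p
    it is a sum over the exponents of f, scaled by q, with the coefficients of f.\<close>
  define q where "q = p ^ t"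
  have "t \<le> q" unfolding q_def using p by (simp add: less_imp_le_nat less_exp prime_ge_2_nat
      order.strict_trans2[OF less_exp power_mono])
  have qpos: "q > 0" using p_pos by (simp add: q_def)
  have hf: "push h f \<in> lpolys n" using f(1) hn by (rule push_lpolys)
  have "push h f ^ (q - t) * push h f ^ t \<in> annih" using nil hf by (intro annih_mult) auto
  then have "push h f ^ (p ^ t) \<in> annih" using \<open>t \<le> q\<close> by (simp add: power_add[symmetric] q_def)
  then have fr: "frob q (push h f) \<in> annih" unfolding q_def by (rule annih_frob_pow[OF hf])
  define c where "c = Poly_Mapping.lookup f"
  \<comment> \<open>Terms with a coefficient divisible by p annihilate by themselves and are
    dropped; each of the others can be solved for.\<close>
  define Kf where "Kf = {a \<in> Poly_Mapping.keys f. \<not> int p dvd c a}"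
  have Kf: "finite Kf" "Kf \<subseteq> expos k" using f(1) by (auto simp: Kf_def lpolys_def)
  have ne: "Kf \<noteq> {}" using f(2) by (auto simp: Kf_def of_nat_dvd_lpoly_iff c_def in_keys_iff)
    (metis dvd_0_right)
  have cK: "\<not> int p dvd c a" if "a \<in> Kf" for a using that by (simp add: Kf_def)
  define G where "G = (\<Sum>a\<in>Kf. of_int (c a) * mon (scale_expo q (h a)))"
  have "frob q (push h f) = (\<Sum>a\<in>Poly_Mapping.keys f. of_int (c a) * mon (scale_expo q (h a)))"
    by (subst lpoly_expand[of f])
      (simp add: push_sum push_mult[OF hadd] frob_mult push_of_int[OF hadd] push_of_int[OF scale_expo_add] c_def)
  also have "\<dots> = G + (\<Sum>a\<in>Poly_Mapping.keys f - Kf. of_int (c a) * mon (scale_expo q (h a)))"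
    unfolding G_def by (subst add.commute, rule sum.subset_diff) (auto simp: Kf_def)
  finally have "G = frob q (push h f) - (\<Sum>a\<in>Poly_Mapping.keys f - Kf. of_int (c a) * mon (scale_expo q (h a)))"
    by (simp add: algebra_simps)
  moreover have "(\<Sum>a\<in>Poly_Mapping.keys f - Kf. of_int (c a) * mon (scale_expo q (h a))) \<in> annih"
  proof (rule annih_sum)
    fix a assume "a \<in> Poly_Mapping.keys f - Kf"
    then have "int p dvd c a" "a \<in> expos k" using f(1) by (auto simp: Kf_def lpolys_def)
    then obtain d where "c a = int p * d" by (auto simp: dvd_def)
    then have "of_int (c a) * mon (scale_expo q (h a)) = of_nat p * (of_int d * mon (scale_expo q (h a)))"
      by (simp add: mult.assoc)
    then show "of_int (c a) * mon (scale_expo q (h a)) \<in> annih"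
      using hn[OF \<open>a \<in> expos k\<close>] by (simp only:) (intro annih_p, auto)
  qed
  ultimately have G: "G \<in> annih" using annih_diff[OF fr] by simp
  \<comment> \<open>For k = 0 the relation would be a constant invertible modulo p, and the quotient
    would be zero.\<close>
  have "k \<noteq> 0"
  proof
    assume "k = 0"
    then have "Kf \<subseteq> {0}" using Kf(2) by (auto simp: expos_def fun_eq_iff fun_app)
    then have "Kf = {0}" using ne by auto
    moreover have "h 0 = 0" using hadd[of 0 0] by simp
    moreover have "scale_expo q 0 = 0" by (simp add: scale_expo_def fun_eq_iff fun_app)
    ultimately have "of_int (c 0) * 1 \<in> addgen ({} \<union> annih)"
      using G by (auto simp: G_def intro: addgen.base)
    then have "1 \<in> addgen ({} \<union> annih)"
      using cK[of 0] \<open>Kf = {0}\<close> by (intro of_int_annih_cancel[of "c 0" 1 "{}"]) auto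
    moreover have "addgen annih \<subseteq> annih"
    proof
      fix x assume "x \<in> addgen annih" then show "x \<in> annih"
        by induction (auto intro: annih_0 annih_diff)
    qed
    ultimately show False using annih_1 by auto
  qed
  then obtain k' where k: "k = Suc k'" by (cases k) auto
  obtain B :: int where B: "inj_on (\<lambda>a. \<Sum>i<k. B ^ i * a i) Kf"
    using separating_weight[OF Kf] by blast
  define w where "w a = (\<Sum>i<k. B ^ i * a i)" for a :: expo
  \<comment> \<open>A new lattice basis: the weight w replaces coordinate 0, \<open>em\<close>
    embeds the vectors with one entry less as the sublattice of weight 0, and \<open>tl\<close>
    drops coordinate 0. Every a is then w(a) times the first unit vector plus
    \<open>em (tl a)\<close>, and h is applied to both parts.\<close>
  define T where "T = h (\<lambda>i. if i = 0 then 1 else 0)"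
  define em :: "expo \<Rightarrow> expo" where
    "em b = (\<lambda>i. if i = 0 then - (\<Sum>j<k'. B ^ Suc j * b j) else b (i - 1))" for b
  define tl where "tl a = (\<lambda>i. a (Suc i))" for a :: expo
  define h' where "h' b = h (em b)" for b
  define zT where "zT z = (\<lambda>i. z * T i)" for z :: int
  have emadd: "em (a + b) = em a + em b" for a b
    by (auto simp: em_def fun_eq_iff fun_app algebra_simps sum.distrib)
  have h'add: "h' (a + b) = h' a + h' b" for a b by (simp add: h'_def emadd hadd)
  have emk: "em b \<in> expos k" if "b \<in> expos k'" for b using that by (auto simp: em_def expos_def k)
  have h'n: "h' b \<in> expos n" if "b \<in> expos k'" for b unfolding h'_def by (intro hn emk that)
  have e0: "(\<lambda>i. if i = 0 then 1 else 0) \<in> expos k" by (auto simp: expos_def k)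
  have Tn: "T \<in> expos n" unfolding T_def by (rule hn[OF e0])
  have zTn: "zT z \<in> expos n" for z using Tn by (simp add: zT_def expos_def)
  have zTadd: "zT (y + z) = zT y + zT z" for y z by (simp add: zT_def fun_eq_iff fun_app algebra_simps)
  have tlk: "tl a \<in> expos k'" if "a \<in> expos k" for a using that by (auto simp: tl_def expos_def k)
  have decomp: "h a = zT (w a) + h' (tl a)" if "a \<in> expos k" for a
  proof -
    have wa: "w a = a 0 + (\<Sum>j<k'. B ^ Suc j * a (Suc j))"
      unfolding w_def k sum.lessThan_Suc_shift by simp
    have "a = (\<lambda>i. w a * (if i = 0 then 1 else 0)) + em (tl a)"
    proof
      fix i show "a i = ((\<lambda>i. w a * (if i = 0 then 1 else 0)) + em (tl a)) i"
        using wa by (cases i) (simp_all add: w_def k em_def tl_def fun_app)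
    qed
    then have "h a = h (\<lambda>i. w a * (if i = 0 then 1 else 0)) + h (em (tl a))" by (metis hadd)
    also have "h (\<lambda>i. w a * (if i = 0 then 1 else 0)) = zT (w a)"
      unfolding zT_def T_def by (rule additive_scale_int[OF hadd])
    finally show ?thesis by (simp add: h'_def)
  qed
  have finw: "finite (w ` Kf)" "w ` Kf \<noteq> {}" using Kf(1) ne by auto
  obtain amax where amax: "amax \<in> Kf" "w amax = Max (w ` Kf)" using Max_in[OF finw] by auto
  obtain amin where amin: "amin \<in> Kf" "w amin = Min (w ` Kf)" using Min_in[OF finw] by auto
  have wle: "w amin \<le> w a" "w a \<le> w amax" if "a \<in> Kf" for a
    using that finw amax amin by auto
  have wne: "w a \<noteq> w b" if "a \<in> Kf" "b \<in> Kf" "a \<noteq> b" for a b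
    using B that unfolding w_def inj_on_def by metis
  \<comment> \<open>The width of the relation in direction T. The exponents 0, ..., d - 1 of T
    remain as possible remainders and are added to the generators.\<close>
  define d where "d = int q * (w amax - w amin)"
  define Xs' where "Xs' = (\<lambda>(z, e). zT z + e) ` ({0..<d} \<times> Xs)"
  define S where "S = addgen (normal_gens k' h' Xs' \<union> annih)"
  have Xs'fin: "finite Xs'" using fin by (simp add: Xs'_def)
  let ?m = "\<lambda>x z e. mon (h' x + zT z + e)"
  have mn: "?m x z e \<in> lpolys n" if "x \<in> expos k'" "e \<in> Xs" for x z e
    using that Xs by (intro lpolys_closed expos_closed h'n zTn) auto
  \<comment> \<open>A shifted copy of the relation is solved for its term at b; the T-exponents of
    the other terms are those of the pivot moved by \<open>q * (w a - w b)\<close>.\<close>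
  have pivot: "?m x z e \<in> S"
    if x: "x \<in> expos k'" and e: "e \<in> Xs" and b: "b \<in> Kf"
      and others: "\<And>y a. y \<in> expos k' \<Longrightarrow> a \<in> Kf \<Longrightarrow> a \<noteq> b \<Longrightarrow> ?m y (z + int q * (w a - w b)) e \<in> S" for x z e b
  proof -
    define M where "M = mon (h' x + zT z + e - scale_expo q (h b))"
    have "M \<in> lpolys n" unfolding M_def using x e Xs b Kf(2)
      by (intro lpolys_closed expos_closed h'n zTn scale_expo_expos hn) auto
    then have "M * G \<in> S" unfolding S_def by (intro addgen.base UnI2 annih_mult G)
    have Ma: "M * (of_int (c a) * mon (scale_expo q (h a))) =
        of_int (c a) * ?m (x + scale_expo q (tl a) - scale_expo q (tl b)) (z + int q * (w a - w b)) e"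
      if "a \<in> Kf" for a
    proof -
      have ak: "a \<in> expos k" "b \<in> expos k" using that b Kf(2) by auto
      have "h' (x + scale_expo q (tl a) - scale_expo q (tl b)) =
         h' x + scale_expo q (h' (tl a)) - scale_expo q (h' (tl b))"
        by (simp add: additive_diff[of h', OF h'add] h'add additive_scale_expo[of h', OF h'add])
      then have "h' x + zT z + e - scale_expo q (h b) + scale_expo q (h a) =
         h' (x + scale_expo q (tl a) - scale_expo q (tl b)) + zT (z + int q * (w a - w b)) + e"
        by (simp add: decomp[OF ak(1)] decomp[OF ak(2)] fun_eq_iff fun_app scale_expo_def zT_def algebra_simps)
      then have "M * mon (scale_expo q (h a)) =
         ?m (x + scale_expo q (tl a) - scale_expo q (tl b)) (z + int q * (w a - w b)) e"
        unfolding M_def mon_mult by (simp only:)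
      then show ?thesis by (simp only: mult.left_commute[of M])
    qed
    have "M * G = (\<Sum>a\<in>Kf. M * (of_int (c a) * mon (scale_expo q (h a))))"
      by (simp add: G_def sum_distrib_left)
    also have "\<dots> = M * (of_int (c b) * mon (scale_expo q (h b))) +
        (\<Sum>a\<in>Kf - {b}. M * (of_int (c a) * mon (scale_expo q (h a))))"
      by (rule sum.remove[OF Kf(1) b])
    also have "M * (of_int (c b) * mon (scale_expo q (h b))) = of_int (c b) * ?m x z e"
      unfolding Ma[OF b] by simp
    finally have eq: "of_int (c b) * ?m x z e = M * G - (\<Sum>a\<in>Kf - {b}. M * (of_int (c a) * mon (scale_expo q (h a))))"
      by simp
    have "(\<Sum>a\<in>Kf - {b}. M * (of_int (c a) * mon (scale_expo q (h a)))) \<in> S"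
      unfolding S_def
    proof (rule addgen_sum)
      fix a assume a: "a \<in> Kf - {b}"
      then have "?m (x + scale_expo q (tl a) - scale_expo q (tl b)) (z + int q * (w a - w b)) e \<in> S"
        using Kf(2) b x by (intro others expos_closed scale_expo_expos tlk) auto
      then show "M * (of_int (c a) * mon (scale_expo q (h a))) \<in> addgen (normal_gens k' h' Xs' \<union> annih)"
        using a by (subst Ma) (auto simp: S_def intro: addgen_of_int_mult)
    qed
    with \<open>M * G \<in> S\<close> have "of_int (c b) * ?m x z e \<in> S"
      unfolding eq S_def by (intro addgen.diff)
    then show ?thesis unfolding S_def
      by (rule of_int_annih_cancel[OF _ cK[OF b] mn[OF x e]])
  qed
  \<comment> \<open>For exponents from d on, the term of greatest weight is the pivot: all others
    are lower by at least 1 and at most d, hence still nonnegative.\<close>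
  have pos: "\<forall>x\<in>expos k'. \<forall>e\<in>Xs. ?m x (int z) e \<in> S" for z
  proof (induction z rule: less_induct)
    case (less z)
    show ?case
    proof (intro ballI)
      fix x e assume xe: "x \<in> expos k'" "e \<in> Xs"
      show "?m x (int z) e \<in> S"
      proof (cases "int z < d")
        case True
        then have "zT (int z) + e \<in> Xs'" using xe by (auto simp: Xs'_def intro!: image_eqI[of _ _ "(int z, e)"])
        then have "mon (h' x + (zT (int z) + e)) \<in> normal_gens k' h' Xs'"
          using xe unfolding normal_gens_def by blast
        then have "?m x (int z) e \<in> normal_gens k' h' Xs'" by (simp add: add.assoc)
        then show ?thesis unfolding S_def by (intro addgen.base UnI1)
      next
        case False
        show ?thesis
        proof (rule pivot[OF xe amax(1)])
          fix y a assume y: "y \<in> expos k'" and a: "a \<in> Kf" "a \<noteq> amax"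
          let ?z = "int z + int q * (w a - w amax)"
          have "w a < w amax" using wle(2)[OF a(1)] wne[OF a(1) amax(1) a(2)] by simp
          then have "int q * (w a - w amax) < 0" using qpos by (simp add: mult_pos_neg)
          moreover have "int q * (w amin - w amax) \<le> int q * (w a - w amax)"
            using wle(1)[OF a(1)] by (intro mult_left_mono) auto
          then have "- d \<le> int q * (w a - w amax)" by (simp add: d_def algebra_simps)
          ultimately have "0 \<le> ?z" "nat ?z < z" using False by linarith+
          then show "?m y ?z e \<in> S" using less[of "nat ?z"] y xe(2) by simp
        qed
      qed
    qed
  qed
  \<comment> \<open>With the term of least weight as pivot all others are higher: they are
    nonnegative or closer to 0.\<close>
  have neg: "\<forall>x\<in>expos k'. \<forall>e\<in>Xs. ?m x (- int z) e \<in> S" for z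
  proof (induction z rule: less_induct)
    case (less z)
    show ?case
    proof (intro ballI)
      fix x e assume xe: "x \<in> expos k'" "e \<in> Xs"
      show "?m x (- int z) e \<in> S"
      proof (rule pivot[OF xe amin(1)])
        fix y a assume y: "y \<in> expos k'" and a: "a \<in> Kf" "a \<noteq> amin"
        let ?z = "- int z + int q * (w a - w amin)"
        have "w amin < w a" using wle(1)[OF a(1)] wne[OF a(1) amin(1) a(2)] by simp
        then have *: "int q * (w a - w amin) > 0" using qpos by simp
        show "?m y ?z e \<in> S"
        proof (cases "0 \<le> ?z")
          case True
          then show ?thesis using pos[of "nat ?z"] y xe(2) by simp
        next
          case False
          then have "nat (- ?z) < z" using * by linarith
          then show ?thesis using less[of "nat (- ?z)"] y xe(2) False by simp
        qed
      qed
    qed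
  qed
  have all: "?m x z e \<in> S" if "x \<in> expos k'" "e \<in> Xs" for x z e
    using pos[of "nat z"] neg[of "nat (- z)"] that by (cases "0 \<le> z") auto
  have "normal_gens k h Xs \<union> annih \<subseteq> S"
  proof
    fix u assume "u \<in> normal_gens k h Xs \<union> annih"
    then show "u \<in> S"
    proof
      assume "u \<in> normal_gens k h Xs"
      then obtain x e where u: "u = mon (h x + e)" "x \<in> expos k" "e \<in> Xs" by (auto simp: normal_gens_def)
      have "u = ?m (tl x) (w x) e" unfolding u(1) decomp[OF u(2)] by (simp add: add.commute)
      then show ?thesis using all[OF tlk[OF u(2)] u(3)] by simp
    qed (auto simp: S_def intro: addgen.base)
  qed
  then have "addgen (normal_gens k h Xs \<union> annih) \<subseteq> S" unfolding S_def by (rule addgen_mono)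
  then have "normal_gen k' h' Xs'"
    unfolding normal_gen_def using Xs'fin h'add h'n gen Xs zTn
    by (auto simp: S_def Xs'_def)
  then show ?thesis using k by blast
qed

section \<open>The torsion-free case: a basis over the fraction field\<close>

context
  fixes k h Xs
  assumes gen: "normal_gen k h Xs"
    and faithful: "\<And>f v. f \<in> lpolys k \<Longrightarrow> \<not> of_nat p dvd f \<Longrightarrow> v \<in> lvecs n K \<Longrightarrow> push h f \<star> v \<in> N \<Longrightarrow> v \<in> N"
begin

lemma h_add: "h (a + b) = h a + h b" and h_expos: "a \<in> expos k \<Longrightarrow> h a \<in> expos n"
  and Xs_finite: "finite Xs" and Xs_expos: "e \<in> Xs \<Longrightarrow> e \<in> expos n"
  and mon_gen: "a \<in> expos n \<Longrightarrow> mon a \<in> addgen (normal_gens k h Xs \<union> annih)"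
  using gen by (auto simp: normal_gen_def)

lemma push_h_lpolys: "f \<in> lpolys k \<Longrightarrow> push h f \<in> lpolys n"
  by (rule push_lpolys) (auto intro: h_expos)

text \<open>Indexes finitely many vectors that generate the quotient over the ring in k
  variables.\<close>

definition gidx :: "(expo \<times> nat) set" where "gidx = Xs \<times> {..<K}"

definition gvec :: "expo \<times> nat \<Rightarrow> lvec" where "gvec g = bvec (mon (fst g)) (snd g)"

lemma finite_gidx: "finite gidx" using Xs_finite by (simp add: gidx_def)

lemma gvec_lvecs: "g \<in> gidx \<Longrightarrow> gvec g \<in> lvecs n K"
  by (auto simp: gidx_def gvec_def intro!: Xs_expos bvec_lvecs lpolys_closed)

definition comb :: "(expo \<times> nat) set \<Rightarrow> (expo \<times> nat \<Rightarrow> lpoly) \<Rightarrow> lvec" where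
  "comb G c = (\<Sum>g\<in>G. push h (c g) \<star> gvec g)"

lemma comb_diff: "comb G (\<lambda>g. c g - d g) = comb G c - comb G d"
  by (simp add: comb_def smul_simps sum_subtractf)

lemma smul_sum: "f \<star> sum v G = (\<Sum>g\<in>G. f \<star> v g)"
  by (induction G rule: infinite_finite_induct) (simp_all add: smul_simps)

lemma comb_smul: "push h f \<star> comb G c = comb G (\<lambda>g. f * c g)"
  by (simp add: comb_def smul_sum push_mult[OF h_add] smul_simps)

lemma comb_dvd:
  assumes "G \<subseteq> gidx" "\<And>g. g \<in> G \<Longrightarrow> c g \<in> lpolys k" "\<And>g. g \<in> G \<Longrightarrow> of_nat p dvd c g"
  shows "comb G c \<in> N"
proof -
  have "push h (c g) \<star> gvec g \<in> N" if g: "g \<in> G" for g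
  proof -
    obtain d where d: "d \<in> lpolys k" "c g = of_nat p * d" using lpolys_of_nat_dvd assms(2,3) g by metis
    have "push h d \<star> gvec g \<in> lvecs n K" using assms(1) g d(1) by (intro lvecs_closed push_h_lpolys gvec_lvecs) auto
    then show ?thesis
      by (simp add: d(2) push_mult[OF h_add] push_of_nat[OF h_add] smul_simps(8) submodD(5)[OF N])
  qed
  then show ?thesis unfolding comb_def
    by (induction G rule: infinite_finite_induct) (auto intro!: submodD(2,3)[OF N])
qed

definition indep :: "(expo \<times> nat) set \<Rightarrow> bool" where
  "indep G \<longleftrightarrow> G \<subseteq> gidx \<and>
     (\<forall>c. (\<forall>g\<in>G. c g \<in> lpolys k) \<and> comb G c \<in> N \<longrightarrow> (\<forall>g\<in>G. of_nat p dvd c g))"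

lemma maximal_indep: "\<exists>G. indep G \<and> (\<forall>G'. indep G' \<longrightarrow> G \<subseteq> G' \<longrightarrow> G = G')"
proof -
  have "finite {G. indep G}" by (rule finite_subset[of _ "Pow gidx"]) (auto simp: indep_def finite_gidx)
  moreover have "indep {}" by (auto simp: indep_def)
  ultimately show ?thesis using finite_has_maximal[of "{G. indep G}"] by blast
qed

text \<open>For g outside G, maximality gives a dependency of g and G. The coefficient of g in it is
  nonzero modulo p, as otherwise G itself would be dependent; it is the denominator b.\<close>

lemma maximal_indep_spans:
  assumes G: "indep G" "\<And>G'. indep G' \<Longrightarrow> G \<subseteq> G' \<Longrightarrow> G = G'" and g: "g \<in> gidx"
  shows "\<exists>b c. b \<in> lpolys k \<and> \<not> of_nat p dvd b \<and> (\<forall>g\<in>G. c g \<in> lpolys k) \<and> push h b \<star> gvec g - comb G c \<in> N"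
proof (cases "g \<in> G")
  case True
  have fG: "finite G" using G(1) finite_gidx finite_subset by (auto simp: indep_def)
  have "comb G (\<lambda>g'. if g' = g then 1 else 0) = (\<Sum>g'\<in>G. if g' = g then gvec g else 0)"
    unfolding comb_def by (rule sum.cong) (auto simp: push_1[OF h_add] smul_simps)
  also have "\<dots> = gvec g" using True fG by simp
  finally have "push h 1 \<star> gvec g - comb G (\<lambda>g'. if g' = g then 1 else 0) = 0"
    by (simp add: push_1[OF h_add] smul_simps)
  moreover have "\<not> of_nat p dvd (1 :: lpoly)"
  proof
    assume "of_nat p dvd (1 :: lpoly)"
    then have "1 \<in> annih" by (rule annih_dvd) auto
    then show False using annih_1 by simp
  qed
  ultimately show ?thesis using submodD(2)[OF N]
    by (intro exI[of _ 1] exI[of _ "\<lambda>g'. if g' = g then 1 else 0"]) auto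
next
  case False
  have fG: "finite G" "G \<subseteq> gidx" using G(1) finite_gidx finite_subset by (auto simp: indep_def)
  have "\<not> indep (insert g G)" using G(2) False by blast
  then obtain c g' where c: "\<forall>g\<in>insert g G. c g \<in> lpolys k" "comb (insert g G) c \<in> N"
      "g' \<in> insert g G" "\<not> of_nat p dvd c g'"
    using g fG(2) unfolding indep_def by blast
  have ins: "comb (insert g G) c = push h (c g) \<star> gvec g + comb G c"
    using False fG(1) by (simp add: comb_def)
  have neg: "comb G (\<lambda>g. - c g) = - comb G c" by (simp add: comb_def smul_simps sum_negf)
  have "\<not> of_nat p dvd c g"
  proof
    assume d: "of_nat p dvd c g"
    then have "push h (c g) \<star> gvec g \<in> N"
      using comb_dvd[of "{g}" c] c(1) g by (simp add: comb_def)
    from submod_diff[OF N c(2) this p_pos] have "comb G c \<in> N" by (simp add: ins)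
    then have "\<forall>g\<in>G. of_nat p dvd c g" using G(1) c(1) unfolding indep_def by blast
    then show False using c(3,4) d by auto
  qed
  then show ?thesis
    using c(1,2) by (intro exI[of _ "c g"] exI[of _ "\<lambda>g. - c g"]) (auto simp: neg ins)
qed

text \<open>The product of the denominators of all generators is a common denominator, and it acts
  injectively because each factor does.\<close>

lemma frac_basis:
  obtains G b where "indep G" "b \<in> lpolys k"
    "\<And>v. v \<in> lvecs n K \<Longrightarrow> push h b \<star> v \<in> N \<Longrightarrow> v \<in> N"
    "\<And>v. v \<in> lvecs n K \<Longrightarrow> \<exists>c. (\<forall>g\<in>G. c g \<in> lpolys k) \<and> push h b \<star> v - comb G c \<in> N"
proof -
  obtain G where G: "indep G" "\<And>G'. indep G' \<Longrightarrow> G \<subseteq> G' \<Longrightarrow> G = G'" using maximal_indep by blast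
  have "\<forall>g\<in>gidx. \<exists>b c. b \<in> lpolys k \<and> \<not> of_nat p dvd b \<and> (\<forall>g\<in>G. c g \<in> lpolys k) \<and>
      push h b \<star> gvec g - comb G c \<in> N"
    using maximal_indep_spans[OF G] by blast
  then obtain b c where b: "\<And>g. g \<in> gidx \<Longrightarrow> b g \<in> lpolys k" "\<And>g. g \<in> gidx \<Longrightarrow> \<not> of_nat p dvd b g"
    and c: "\<And>g g'. g \<in> gidx \<Longrightarrow> g' \<in> G \<Longrightarrow> c g g' \<in> lpolys k"
      "\<And>g. g \<in> gidx \<Longrightarrow> push h (b g) \<star> gvec g - comb G (c g) \<in> N" by metis
  have Gs: "G \<subseteq> gidx" using G(1) by (simp add: indep_def)
  define d where "d = prod b gidx"
  have dk: "d \<in> lpolys k" unfolding d_def by (rule lpolys_prod) (rule b(1))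
  have inj: "v \<in> N" if "v \<in> lvecs n K" "push h (prod b I) \<star> v \<in> N" "I \<subseteq> gidx" for I v
    using finite_subset[OF that(3) finite_gidx] that
  proof (induction I arbitrary: v rule: finite_induct)
    case empty
    then show ?case by (simp add: push_1[OF h_add] smul_simps)
  next
    case (insert g I)
    have pl: "prod b I \<in> lpolys k" by (rule lpolys_prod) (use b(1) insert in auto)
    have "push h (b g) \<star> push h (prod b I) \<star> v \<in> N"
      using insert by (simp add: push_mult[OF h_add] smul_simps)
    then have "push h (prod b I) \<star> v \<in> N"
      by (rule faithful[rotated -1]) (use b insert pl push_h_lpolys in auto)
    then show ?case using insert by blast
  qed
  define R where "R = {v \<in> lvecs n K. \<exists>c. (\<forall>g\<in>G. c g \<in> lpolys k) \<and> push h d \<star> v - comb G c \<in> N}"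
  have R_N: "v \<in> R" if "v \<in> N" for v
  proof -
    have "push h d \<star> v - comb G (\<lambda>g. 0) \<in> N"
      using submod_smul[OF N push_h_lpolys[OF dk] that p_pos] by (simp add: comb_def smul_simps)
    then show ?thesis using submodD(1)[OF N that]
      by (auto simp: R_def intro!: exI[of _ "\<lambda>g. 0"])
  qed
  have R_diff: "u - v \<in> R" if uv: "u \<in> R" "v \<in> R" for u v
  proof -
    obtain c1 c2 where *: "\<forall>g\<in>G. c1 g \<in> lpolys k" "push h d \<star> u - comb G c1 \<in> N"
        "\<forall>g\<in>G. c2 g \<in> lpolys k" "push h d \<star> v - comb G c2 \<in> N"
      using uv unfolding R_def by blast
    have "push h d \<star> (u - v) - comb G (\<lambda>g. c1 g - c2 g) \<in> N"
      using submod_diff[OF N *(2,4) p_pos] by (simp add: comb_diff smul_simps algebra_simps)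
    then show ?thesis using uv * unfolding R_def
      by (auto intro!: exI[of _ "\<lambda>g. c1 g - c2 g"])
  qed
  have R_gen: "mon (h x) \<star> gvec g \<in> R" if x: "x \<in> expos k" and g: "g \<in> gidx" for x g
  proof -
    define e where "e = prod b (gidx - {g})"
    have e: "d = e * b g" unfolding d_def e_def using prod.remove[OF finite_gidx g, of b] by (simp add: mult.commute)
    have ek: "e \<in> lpolys k" unfolding e_def by (rule lpolys_prod) (use b(1) in auto)
    have "push h (mon x * e) \<star> (push h (b g) \<star> gvec g - comb G (c g)) \<in> N"
      by (intro submod_smul[OF N _ _ p_pos] c(2) g push_h_lpolys lpolys_closed ek x)
    also have "push h (mon x * e) \<star> (push h (b g) \<star> gvec g - comb G (c g)) =
        push h d \<star> mon (h x) \<star> gvec g - comb G (\<lambda>g'. mon x * e * c g g')"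
      by (simp only: smul_simps(2) comb_smul e)
        (simp add: push_mult[OF h_add] smul_simps(8)[symmetric] mult_ac)
    finally show ?thesis unfolding R_def using x g ek c(1)[OF g]
      by (auto intro!: exI[of _ "\<lambda>g'. mon x * e * c g g'"] lvecs_closed lpolys_closed h_expos gvec_lvecs)
  qed
  have "v \<in> R" if "v \<in> lvecs n K" for v
    using that
  proof (induction rule: lvecs_induct)
    case zero
    show ?case by (rule R_N[OF submodD(2)[OF N]])
  next
    case (mon a i)
    have "bvec f i \<in> R" if "f \<in> addgen (normal_gens k h Xs \<union> annih)" for f
      using that
    proof induction
      case zero
      then show ?case using R_N[OF submodD(2)[OF N]] by simp
    next
      case (base f)
      then show ?case
      proof
        assume "f \<in> normal_gens k h Xs"
        then obtain x e where "f = mon (h x + e)" "x \<in> expos k" "e \<in> Xs" by (auto simp: normal_gens_def)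
        then show ?thesis using R_gen[of x "(e, i)"] mon(2) by (simp add: gvec_def gidx_def mon_mult)
      next
        assume "f \<in> annih"
        then have "f \<star> bvec 1 i \<in> N" by (rule annihD) (use mon in auto)
        then show ?thesis using R_N by simp
      qed
    qed (simp add: R_diff)
    then show ?case using mon_gen[OF mon(1)] by blast
  next
    case (diff u v)
    then show ?case by (simp add: R_diff)
  qed
  then show ?thesis
    using that[of G d] G(1) dk inj[of _ gidx] unfolding d_def[symmetric] R_def by blast
qed

text \<open>The functionals have to respect the annihilator rather than N, since closure under the
  Frobenius, and with it under decimation, holds for the annihilator. The last condition bounds the
  support in the k free variables.\<close>

definition arrays :: "int \<Rightarrow> (nat \<Rightarrow> expo \<Rightarrow> int) set" where
  "arrays D = {t. (\<forall>i a. t i a \<in> {0..<int p}) \<and> (\<forall>i a. \<not> (i < K \<and> a \<in> expos n) \<longrightarrow> t i a = 0) \<and>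
     (\<forall>f\<in>annih. \<forall>v\<in>lvecs n K. int p dvd evl K t (f \<star> v)) \<and>
     (\<forall>i<K. \<forall>e\<in>Xs. \<forall>x\<in>expos k. (\<exists>j. \<bar>x j\<bar> > D) \<longrightarrow> int p dvd t i (h x + e))}"

lemma arraysD:
  assumes "t \<in> arrays D"
  shows "t i a \<in> {0..<int p}" "\<not> (i < K \<and> a \<in> expos n) \<Longrightarrow> t i a = 0"
    "f \<in> annih \<Longrightarrow> v \<in> lvecs n K \<Longrightarrow> int p dvd evl K t (f \<star> v)"
    "i < K \<Longrightarrow> e \<in> Xs \<Longrightarrow> x \<in> expos k \<Longrightarrow> \<bar>x j\<bar> > D \<Longrightarrow> int p dvd t i (h x + e)"
  using assms unfolding arrays_def by blast+

text \<open>Every monomial is an additive combination of generators \<open>mon (h x + e)\<close> and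
  annihilating elements. The values with x in the box therefore fix the array modulo p, hence
  exactly, as its values are reduced.\<close>

lemma finite_arrays: "finite (arrays D)"
proof -
  define F where "F = {..<K} \<times> (\<lambda>(x, e). h x + e) ` ({x \<in> expos k. \<forall>j. \<bar>x j\<bar> \<le> D} \<times> Xs)"
  have "finite F" unfolding F_def using finite_expo_box Xs_finite by auto
  let ?r = "\<lambda>t. restrict (\<lambda>(i, a). t i a) F"
  have "inj_on ?r (arrays D)"
  proof (rule inj_onI)
    fix t t' assume t: "t \<in> arrays D" and t': "t' \<in> arrays D" and eq: "?r t = ?r t'"
    have "t i a = t' i a" for i a
    proof (cases "i < K \<and> a \<in> expos n")
      case True
      have "int p dvd lin (t i) f - lin (t' i) f" if "f \<in> addgen (normal_gens k h Xs \<union> annih)" for f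
        using that
      proof induction
        case (base f)
        then show ?case
        proof
          assume "f \<in> normal_gens k h Xs"
          then obtain x e where f: "f = mon (h x + e)" "x \<in> expos k" "e \<in> Xs" by (auto simp: normal_gens_def)
          show ?thesis
          proof (cases "\<forall>j. \<bar>x j\<bar> \<le> D")
            case T: True
            then have "(i, h x + e) \<in> F" using f True by (auto simp: F_def)
            then have "t i (h x + e) = t' i (h x + e)" using fun_cong[OF eq, of "(i, h x + e)"] by simp
            then show ?thesis using f by simp
          next
            case False
            then obtain j where "\<bar>x j\<bar> > D" by (auto simp: not_le)
            then show ?thesis using arraysD(4)[OF t] arraysD(4)[OF t'] f True by (auto intro: dvd_diff)
          qed
        next
          assume "f \<in> annih"
          moreover have "bvec 1 i \<in> lvecs n K" using True by auto
          ultimately have "int p dvd evl K t (f \<star> bvec 1 i)" "int p dvd evl K t' (f \<star> bvec 1 i)"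
            using arraysD(3)[OF t] arraysD(3)[OF t'] by blast+
          then show ?thesis using True by (auto simp: evl_bvec intro: dvd_diff)
        qed
      next
        case (diff f g)
        have "int p dvd (lin (t i) f - lin (t' i) f) - (lin (t i) g - lin (t' i) g)"
          by (rule dvd_diff[OF diff.IH])
        then show ?case by (simp add: algebra_simps)
      qed simp
      from this[OF mon_gen] True have "int p dvd t i a - t' i a" by simp
      moreover have "t i a \<in> {0..<int p}" "t' i a \<in> {0..<int p}" using arraysD(1) t t' by blast+
      ultimately show ?thesis
        by (metis atLeastLessThan_iff mod_eq_dvd_iff mod_pos_pos_trivial)
    qed (use arraysD(2)[OF t] arraysD(2)[OF t'] in simp)
    then show "t = t'" by blast
  qed
  moreover have "?r ` arrays D \<subseteq> PiE F (\<lambda>_. {0..<int p})"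
    using arraysD(1) by (fastforce simp: PiE_def Pi_def)
  moreover have "finite (PiE F (\<lambda>_. {0..<int p}))" using \<open>finite F\<close> by (auto intro: finite_PiE)
  ultimately show ?thesis by (meson finite_imageD finite_subset)
qed

text \<open>Only finitely many generators enter a given element, so their exponents are
  bounded.\<close>

lemma addgen_bounded:
  assumes "f \<in> addgen (normal_gens k h Xs \<union> annih)"
  shows "\<exists>C. f \<in> addgen ({mon (h x + e) |x e. x \<in> expos k \<and> (\<forall>j. \<bar>x j\<bar> \<le> C) \<and> e \<in> Xs} \<union> annih)"
proof -
  define B where "B C = {mon (h x + e) |x e. x \<in> expos k \<and> (\<forall>j. \<bar>x j\<bar> \<le> C) \<and> e \<in> Xs} \<union> annih" for C :: int
  have mono: "addgen (B C) \<subseteq> addgen (B C')" if "C \<le> C'" for C C'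
  proof (rule addgen_mono)
    have "\<forall>j. \<bar>x j\<bar> \<le> C'" if "\<forall>j. \<bar>x j\<bar> \<le> C" for x :: expo
      using that \<open>C \<le> C'\<close> by (meson order_trans)
    then have "B C \<subseteq> B C'" unfolding B_def by blast
    then show "B C \<subseteq> addgen (B C')" by (auto intro: addgen.base)
  qed
  have "\<exists>C. f \<in> addgen (B C)"
    using assms
  proof induction
    case (base f)
    then show ?case
    proof
      assume "f \<in> normal_gens k h Xs"
      then obtain x e where f: "f = mon (h x + e)" "x \<in> expos k" "e \<in> Xs" by (auto simp: normal_gens_def)
      have "\<bar>x j\<bar> \<le> (\<Sum>j<k. \<bar>x j\<bar>)" for j
        using f(2) member_le_sum[of j "{..<k}" "\<lambda>j. \<bar>x j\<bar>"]
        by (cases "j < k") (auto simp: expos_def sum_nonneg)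
      then have "f \<in> B (\<Sum>j<k. \<bar>x j\<bar>)" using f unfolding B_def by blast
      then show ?thesis by (blast intro: addgen.base)
    qed (auto simp: B_def intro: addgen.base)
  next
    case (diff f g)
    then obtain C C' where C: "f \<in> addgen (B C)" "g \<in> addgen (B C')" by blast
    then have "f \<in> addgen (B (max C C'))" "g \<in> addgen (B (max C C'))"
      using mono[of C "max C C'"] mono[of C' "max C C'"] by auto
    then show ?case by (blast intro: addgen.diff)
  qed (auto intro: addgen.zero)
  then show ?thesis unfolding B_def .
qed

lemma finite_digs: "finite (digs p n)"
  by (rule finite_subset[OF _ finite_expo_box[of n "int p"]]) (auto simp: digs_def abs_le_iff less_imp_le,
     smt (verit))

text \<open>At \<open>h x + e\<close> the decimated array takes the value at h (p x) + (s + p e).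
  Rewriting the second summand by generators moves p x by some y with entries bounded by a constant,
  at most D. If |x_j| > D, then |p x_j + y_j| >= 2 |x_j| - D > D, so the bound reproduces
  itself.\<close>

lemma arrays_decim: "\<exists>D0. \<forall>D\<ge>D0. \<forall>t\<in>arrays D. \<forall>s\<in>digs p n. decim p s t \<in> arrays D"
proof -
  define B where "B C = {mon (h x + e) |x e. x \<in> expos k \<and> (\<forall>j. \<bar>x j\<bar> \<le> C) \<and> e \<in> Xs} \<union> annih" for C :: int
  have "\<exists>C. mon (s + scale_expo p e) \<in> addgen (B C)" if "s \<in> digs p n" "e \<in> Xs" for s e
    unfolding B_def by (rule addgen_bounded[OF mon_gen]) (use that Xs_expos in \<open>auto simp: digs_def\<close>)
  then obtain C where C: "\<And>s e. s \<in> digs p n \<Longrightarrow> e \<in> Xs \<Longrightarrow> mon (s + scale_expo p e) \<in> addgen (B (C s e))"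
    by metis
  have "finite ((\<lambda>(s, e). C s e) ` (digs p n \<times> Xs))" using finite_digs Xs_finite by auto
  from finite_int_bounded[OF this]
  obtain D0 where D0: "\<And>s e. s \<in> digs p n \<Longrightarrow> e \<in> Xs \<Longrightarrow> C s e \<le> D0" by force
  have "decim p s t \<in> arrays D" if D: "D \<ge> D0" and t: "t \<in> arrays D" and s: "s \<in> digs p n" for D t s
  proof -
    have sn: "s \<in> expos n" using s by (simp add: digs_def)
    have "decim p s t i a \<in> {0..<int p}" for i a
      unfolding decim_def by (rule arraysD(1)[OF t])
    moreover have "decim p s t i a = 0" if "\<not> (i < K \<and> a \<in> expos n)" for i a
    proof -
      have "a \<in> expos n" if "scale_expo p a + s \<in> expos n"
        using that sn p_pos by (auto simp: expos_def scale_expo_def fun_app)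
      then show ?thesis unfolding decim_def using arraysD(2)[OF t] that by blast
    qed
    moreover have "int p dvd evl K (decim p s t) (f \<star> v)" if "f \<in> annih" "v \<in> lvecs n K" for f v
    proof -
      have "evl K (decim p s t) (f \<star> v) = evl K t (frob p f \<star> (mon s \<star> frobv p v))"
        unfolding evl_decim by (simp add: smul_commute)
      then show ?thesis using arraysD(3)[OF t annih_frob[OF that(1)]] that(2) sn by auto
    qed
    moreover have "int p dvd decim p s t i (h x + e)"
      if i: "i < K" and e: "e \<in> Xs" and x: "x \<in> expos k" and j: "\<bar>x j\<bar> > D" for i e x j
    proof -
      have main: "int p dvd lin (t i) (mon (h (scale_expo p x)) * f)" if "f \<in> addgen (B (C s e))" for f
        using that
      proof induction
        case (base f)
        then show ?case unfolding B_def
        proof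
          assume "f \<in> {mon (h x + e') |x e'. x \<in> expos k \<and> (\<forall>j. \<bar>x j\<bar> \<le> C s e) \<and> e' \<in> Xs}"
          then obtain y e' where f: "f = mon (h y + e')" "y \<in> expos k" "\<bar>y j\<bar> \<le> C s e" "e' \<in> Xs" by blast
          have "\<bar>y j\<bar> \<le> D" using D0[OF s e] D f(3) by simp
          moreover have "int p * \<bar>x j\<bar> \<ge> 2 * \<bar>x j\<bar>"
            using p by (intro mult_right_mono) (auto dest: prime_ge_2_nat)
          then have "\<bar>int p * x j\<bar> \<ge> 2 * \<bar>x j\<bar>" by (simp add: abs_mult)
          ultimately have "\<bar>(scale_expo p x + y) j\<bar> > D"
            using j unfolding fun_app scale_expo_def by linarith
          then have "int p dvd t i (h (scale_expo p x + y) + e')"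
            by (rule arraysD(4)[OF t i f(4), rotated]) (use x f(2) in auto)
          then show ?thesis by (simp add: f(1) mon_mult h_add add.assoc)
        next
          assume "f \<in> annih"
          then have "int p dvd evl K t (f \<star> bvec (mon (h (scale_expo p x))) i)"
            by (rule arraysD(3)[OF t]) (use i x in \<open>auto intro!: bvec_lvecs h_expos\<close>)
          then show ?thesis using i by (simp add: evl_bvec mult.commute)
        qed
      qed (auto simp: right_diff_distrib intro: dvd_diff)
      have "int p dvd lin (t i) (mon (h (scale_expo p x)) * mon (s + scale_expo p e))"
        by (rule main[OF C[OF s e]])
      moreover have "h (scale_expo p x) + (s + scale_expo p e) = scale_expo p (h x + e) + s"
        by (simp add: additive_scale_expo[of h, OF h_add] scale_expo_add)
      ultimately show ?thesis by (simp add: mon_mult decim_def)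
    qed
    ultimately show ?thesis unfolding arrays_def by blast
  qed
  then show ?thesis by blast
qed

text \<open>The coordinates of b v in the basis G are determined modulo p by v. Their constant
  coefficients are additive in v, and a shift of v by \<open>h x\<close> moves any other coefficient
  to the constant place. If all shifts of these functionals vanish, all coordinates vanish, so b v
  and hence v lies in N.\<close>

lemma finite_state_normal: "finite_state p n K N"
proof -
  obtain G b where G: "indep G" and b: "b \<in> lpolys k"
    and inj: "\<And>v. v \<in> lvecs n K \<Longrightarrow> push h b \<star> v \<in> N \<Longrightarrow> v \<in> N"
    and span: "\<And>v. v \<in> lvecs n K \<Longrightarrow> \<exists>c. (\<forall>g\<in>G. c g \<in> lpolys k) \<and> push h b \<star> v - comb G c \<in> N"
    using frac_basis by metis
  have Gs: "G \<subseteq> gidx" using G by (simp add: indep_def)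
  then have fG: "finite G" using finite_gidx finite_subset by blast
  define rep where "rep v c \<longleftrightarrow> (\<forall>g\<in>G. c g \<in> lpolys k) \<and> push h b \<star> v - comb G c \<in> N" for v c
  have uniq: "of_nat p dvd c g - c' g" if "rep v c" "rep v c'" "g \<in> G" for v c c' g
  proof -
    have "(push h b \<star> v - comb G c') - (push h b \<star> v - comb G c) \<in> N"
      by (rule submod_diff[OF N _ _ p_pos]) (use that in \<open>auto simp: rep_def\<close>)
    then have "comb G (\<lambda>g. c g - c' g) \<in> N" by (simp add: comb_diff)
    moreover have "\<forall>g\<in>G. c g - c' g \<in> lpolys k" using that by (auto simp: rep_def)
    ultimately have "\<forall>g\<in>G. of_nat p dvd c g - c' g" using G unfolding indep_def by fast
    then show ?thesis using that(3) by blast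
  qed
  have rep_diff: "rep (u - v) (\<lambda>g. c g - c' g)" if "rep u c" "rep v c'" for u v c c'
    using that submod_diff[OF N, of "push h b \<star> u - comb G c" "push h b \<star> v - comb G c'"] p_pos
    by (auto simp: rep_def comb_diff smul_simps algebra_simps)
  have rep_N: "rep v (\<lambda>_. 0)" if "v \<in> N" for v
    using submod_smul[OF N push_h_lpolys[OF b] that p_pos] by (auto simp: rep_def comb_def smul_simps)
  have rep_shift: "rep (mon (h x) \<star> v) (\<lambda>g. mon x * c g)" if "rep v c" "x \<in> expos k" for x v c
  proof -
    have "mon (h x) \<star> (push h b \<star> v - comb G c) \<in> N"
      using that by (intro submodD(4)[OF N] h_expos) (auto simp: rep_def)
    moreover have "mon (h x) \<star> comb G c = comb G (\<lambda>g. mon x * c g)"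
      using comb_smul[of "mon x" G c] by simp
    ultimately show ?thesis using that
      by (auto simp: rep_def smul_simps(2) smul_commute[of "mon (h x)"])
  qed
  define cof where "cof v = (SOME c. rep v c)" for v
  have cof: "rep v (cof v)" if "v \<in> lvecs n K" for v
    unfolding cof_def rep_def by (rule someI_ex[OF span[OF that]])
  \<comment> \<open>The coordinates \<open>cof\<close> are a choice, determined only modulo p, and
    \<open>arrays\<close> asks for reduced values.\<close>
  define ar where "ar g i a = (if i < K \<and> a \<in> expos n
      then Poly_Mapping.lookup (cof (bvec (mon a) i) g) 0 mod int p else 0)" for g i a
  have lk: "int p dvd Poly_Mapping.lookup (c g) x - Poly_Mapping.lookup (c' g) x"
    if "rep v c" "rep v c'" "g \<in> G" for v c c' g x
    using uniq[OF that] by (auto simp: of_nat_dvd_lpoly_iff lookup_minus)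
  have ar: "\<forall>c. rep v c \<longrightarrow> int p dvd evl K (ar g) v - Poly_Mapping.lookup (c g) 0"
    if "v \<in> lvecs n K" "g \<in> G" for v g
    using that(1)
  proof (induction rule: lvecs_induct)
    case zero
    then show ?case using lk[OF _ rep_N[OF submodD(2)[OF N]] that(2), of _ 0] by simp
  next
    case (mon a i)
    show ?case
    proof (intro allI impI)
      fix c assume c: "rep (bvec (mon a) i) c"
      have "int p dvd Poly_Mapping.lookup (cof (bvec (mon a) i) g) 0 - Poly_Mapping.lookup (c g) 0"
        by (rule lk[OF cof c that(2)]) (use mon in auto)
      then have "Poly_Mapping.lookup (cof (bvec (mon a) i) g) 0 mod int p = Poly_Mapping.lookup (c g) 0 mod int p"
        by (simp add: mod_eq_dvd_iff)
      then show "int p dvd evl K (ar g) (bvec (mon a) i) - Poly_Mapping.lookup (c g) 0"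
        using mon by (simp add: evl_bvec ar_def mod_eq_dvd_iff[symmetric])
    qed
  next
    case (diff u v)
    show ?case
    proof (intro allI impI)
      fix c assume c: "rep (u - v) c"
      have "int p dvd Poly_Mapping.lookup (cof u g - cof v g) 0 - Poly_Mapping.lookup (c g) 0"
        using lk[OF rep_diff[OF cof cof] c that(2)] diff by simp
      note 1 = this
      have 2: "int p dvd evl K (ar g) u - Poly_Mapping.lookup (cof u g) 0"
          "int p dvd evl K (ar g) v - Poly_Mapping.lookup (cof v g) 0"
        using diff cof by auto
      have "int p dvd (evl K (ar g) u - Poly_Mapping.lookup (cof u g) 0) -
          (evl K (ar g) v - Poly_Mapping.lookup (cof v g) 0) +
          (Poly_Mapping.lookup (cof u g - cof v g) 0 - Poly_Mapping.lookup (c g) 0)"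
        by (rule dvd_add[OF dvd_diff[OF 2] 1])
      then show "int p dvd evl K (ar g) (u - v) - Poly_Mapping.lookup (c g) 0"
        by (simp add: lookup_minus algebra_simps)
    qed
  qed
  have ar_N: "int p dvd evl K (ar g) v" if "v \<in> N" "g \<in> G" for v g
    using ar[OF submodD(1)[OF N that(1)] that(2)] rep_N[OF that(1)] by auto
  obtain D0 where D0: "\<And>D t s. D \<ge> D0 \<Longrightarrow> t \<in> arrays D \<Longrightarrow> s \<in> digs p n \<Longrightarrow> decim p s t \<in> arrays D"
    using arrays_decim by blast
  \<comment> \<open>Finitely many generators have coordinates with bounded exponents; this bound
    makes the arrays vanish far out in the k variables.\<close>
  define keyset where "keyset = (\<Union>g\<in>G. \<Union>g'\<in>gidx. Poly_Mapping.keys (cof (gvec g') g))"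
  have "finite ((\<lambda>(x, j). \<bar>x j\<bar>) ` (keyset \<times> {..<k}))"
    unfolding keyset_def using fG finite_gidx by auto
  from finite_int_bounded[OF this]
  obtain D1 where D1: "\<And>x j. x \<in> keyset \<Longrightarrow> j < k \<Longrightarrow> \<bar>x j\<bar> \<le> D1" by force
  \<comment> \<open>The 0 ensures that an index j with |x j| > D is below k.\<close>
  define D where "D = max D0 (max D1 0)"
  have ar_in: "ar g \<in> arrays D" if g: "g \<in> G" for g
  proof -
    have "ar g i a \<in> {0..<int p}" for i a using p_pos by (auto simp: ar_def)
    moreover have "\<not> (i < K \<and> a \<in> expos n) \<Longrightarrow> ar g i a = 0" for i a by (auto simp: ar_def)
    moreover have "int p dvd evl K (ar g) (f \<star> v)" if "f \<in> annih" "v \<in> lvecs n K" for f v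
      by (rule ar_N[OF annihD(2)[OF that] g])
    moreover have "int p dvd ar g i (h x + e)"
      if i: "i < K" and e: "e \<in> Xs" and x: "x \<in> expos k" and j: "\<bar>x j\<bar> > D" for i e x j
    proof -
      have gi: "(e, i) \<in> gidx" using i e by (simp add: gidx_def)
      have "j < k" using j x by (cases "j < k") (auto simp: expos_def D_def)
      \<comment> \<open>The constant coefficient of \<open>mon x\<close> times a coordinate is the
        coefficient of that coordinate at -x.\<close>
      then have "- x \<notin> keyset" using D1[of "- x" j] j by (auto simp: D_def fun_app)
      then have "Poly_Mapping.lookup (cof (gvec (e, i)) g) (- x) = 0"
        using g gi unfolding keyset_def by (auto simp: in_keys_iff)
      then have "Poly_Mapping.lookup (mon x * cof (gvec (e, i)) g) 0 = 0"
        by (simp add: lookup_mon_mult)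
      moreover have "rep (mon (h x) \<star> gvec (e, i)) (\<lambda>g. mon x * cof (gvec (e, i)) g)"
        by (intro rep_shift cof gvec_lvecs gi x)
      moreover have "mon (h x) \<star> gvec (e, i) \<in> lvecs n K"
        by (intro lvecs_closed lpolys_closed h_expos x gvec_lvecs gi)
      ultimately have "int p dvd evl K (ar g) (mon (h x) \<star> gvec (e, i))" using ar[OF _ g] by fastforce
      then show ?thesis using i by (simp add: gvec_def mon_mult evl_bvec)
    qed
    ultimately show ?thesis unfolding arrays_def by blast
  qed
  have sep: "v \<in> N" if v: "v \<in> lvecs n K" and z: "\<And>g a. g \<in> G \<Longrightarrow> a \<in> expos n \<Longrightarrow> int p dvd evl K (ar g) (mon a \<star> v)" for v
  proof -
    let ?c = "cof v"
    have c: "\<forall>g\<in>G. ?c g \<in> lpolys k" "push h b \<star> v - comb G ?c \<in> N" using cof[OF v] by (auto simp: rep_def)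
    have "of_nat p dvd ?c g" if g: "g \<in> G" for g
      unfolding of_nat_dvd_lpoly_iff
    proof
      fix x show "int p dvd Poly_Mapping.lookup (?c g) x"
      proof (cases "x \<in> expos k")
        case True
        have "rep (mon (h (- x)) \<star> v) (\<lambda>g. mon (- x) * ?c g)" by (rule rep_shift[OF cof[OF v]]) (use True in auto)
        moreover have hx: "h (- x) \<in> expos n" using True by (intro h_expos expos_closed)
        ultimately have "int p dvd evl K (ar g) (mon (h (- x)) \<star> v) - Poly_Mapping.lookup (mon (- x) * ?c g) 0"
          using ar[OF _ g] v by blast
        with z[OF g hx] have "int p dvd Poly_Mapping.lookup (mon (- x) * ?c g) 0"
          by (metis dvd_diff_right_iff)
        then show ?thesis by (simp add: lookup_mon_mult)
      next
        case False
        then have "x \<notin> Poly_Mapping.keys (?c g)" using c(1) g by (auto simp: lpolys_def)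
        then show ?thesis by (simp add: in_keys_iff)
      qed
    qed
    then have "comb G ?c \<in> N" using Gs c(1) by (intro comb_dvd) auto
    from submodD(3)[OF N c(2) this] have "push h b \<star> v \<in> N" by simp
    then show ?thesis by (rule inj[OF v])
  qed
  have "N = {v \<in> lvecs n K. \<forall>t\<in>ar ` G. \<forall>a\<in>expos n. int p dvd evl K t (mon a \<star> v)}"
    (is "N = ?R")
  proof (intro equalityI subsetI)
    fix v assume v: "v \<in> N"
    have "int p dvd evl K (ar g) (mon a \<star> v)" if "g \<in> G" "a \<in> expos n" for g a
      by (rule ar_N[OF submodD(4)[OF N v that(2)] that(1)])
    then show "v \<in> ?R" using submodD(1)[OF N v] by simp
  next
    fix v assume "v \<in> ?R"
    then show "v \<in> N" by (intro sep) auto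
  qed
  moreover have "\<forall>t\<in>arrays D. \<forall>s\<in>digs p n. decim p s t \<in> arrays D"
    using D0[of D] by (auto simp: D_def)
  ultimately show ?thesis unfolding finite_state_def
    using finite_arrays[of D] ar_in by (intro exI[of _ "arrays D"] exI[of _ "ar ` G"]) blast
qed

end

text \<open>For the least possible k no polynomial in k variables that is nonzero modulo p acts
  nilpotently, by \<open>normal_gen_reduce\<close>; the dichotomy then makes all of them act
  injectively.\<close>

theorem finite_state_uniform: "finite_state p n K N"
proof -
  define k where "k = (LEAST k. \<exists>h Xs. normal_gen k h Xs)"
  have "\<exists>h Xs. normal_gen k h Xs" unfolding k_def by (rule LeastI) (use normal_gen_exists in blast)
  then obtain h Xs where g: "normal_gen k h Xs" by blast
  show ?thesis
  proof (rule finite_state_normal[OF g])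
    fix f v assume f: "f \<in> lpolys k" "\<not> of_nat p dvd f" and v: "v \<in> lvecs n K" "push h f \<star> v \<in> N"
    have hf: "push h f \<in> lpolys n" using f(1) g by (intro push_lpolys) (auto simp: normal_gen_def)
    have "push h f ^ t \<notin> annih" for t
      using normal_gen_reduce[OF g f] not_less_Least[of _ "\<lambda>k. \<exists>h Xs. normal_gen k h Xs"]
      unfolding k_def[symmetric] by blast
    then have "\<not> (\<forall>v\<in>lvecs n K. push h f ^ t \<star> v \<in> N)" for t
      using hf by (auto simp: annih_def)
    then show "v \<in> N" using dichotomy[OF hf] v by blast
  qed
qed

end

text \<open>A maximal counterexample M is not an intersection of two larger submodules, because
  finite-state submodules are closed under intersection. An f acting on the quotient neither
  nilpotently nor injectively would produce such an intersection: the kernel and the image of a high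
  power of f.\<close>

theorem finite_state_submod:
  assumes p: "prime p" and "submod p n K N"
  shows "finite_state p n K N"
proof (rule ccontr)
  assume "\<not> finite_state p n K N"
  define bad where "bad M \<longleftrightarrow> submod p n K M \<and> \<not> finite_state p n K M" for M
  have p_pos: "p > 0" using p by (simp add: prime_gt_0_nat)
  have "\<exists>M. bad M \<and> (\<forall>M'. bad M' \<longrightarrow> \<not> M \<subset> M')"
  proof (rule ccontr)
    assume "\<not> ?thesis"
    then have "\<forall>M. \<exists>M'. bad M \<longrightarrow> bad M' \<and> M \<subset> M'" by blast
    then obtain nx where nx: "\<And>M. bad M \<Longrightarrow> bad (nx M) \<and> M \<subset> nx M" by metis
    have "bad ((nx ^^ j) N)" for j
      by (induction j) (use nx assms(2) \<open>\<not> finite_state p n K N\<close> in \<open>auto simp: bad_def\<close>)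
    then show False
      using submod_acc[OF p, of n K "\<lambda>j. (nx ^^ j) N"] nx by (auto simp: bad_def)
  qed
  then obtain M where M: "submod p n K M" "\<not> finite_state p n K M"
    and max: "\<And>M'. submod p n K M' \<Longrightarrow> M \<subset> M' \<Longrightarrow> finite_state p n K M'"
    unfolding bad_def by blast
  have proper: "M \<noteq> lvecs n K" using M(2) finite_state_lvecs by blast
  have "(\<exists>t. \<forall>v\<in>lvecs n K. f ^ t \<star> v \<in> M) \<or> (\<forall>v\<in>lvecs n K. f \<star> v \<in> M \<longrightarrow> v \<in> M)"
    if f: "f \<in> lpolys n" for f
  proof (rule ccontr)
    assume "\<not> ?thesis"
    then have nil: "\<And>t. \<exists>v\<in>lvecs n K. f ^ t \<star> v \<notin> M" and "\<exists>v\<in>lvecs n K. f \<star> v \<in> M \<and> v \<notin> M"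
      by blast+
    then obtain v0 where v0: "v0 \<in> lvecs n K" "f \<star> v0 \<in> M" "v0 \<notin> M" by blast
    \<comment> \<open>The preimages of the kernels of f^t on the quotient; this ascending chain
      becomes stationary.\<close>
    define A where "A t = {v \<in> lvecs n K. f ^ t \<star> v \<in> M}" for t
    have A: "submod p n K (A t)" for t
      unfolding submod_def
    proof (intro conjI ballI)
      show "0 \<in> A t" using submodD(2)[OF M(1)] by (simp add: A_def smul_simps)
      show "u + v \<in> A t" if "u \<in> A t" "v \<in> A t" for u v
        using that submodD(3)[OF M(1)] by (auto simp: A_def smul_simps)
      show "mon a \<star> v \<in> A t" if "v \<in> A t" "a \<in> expos n" for v a
        using that submodD(4)[OF M(1)] by (auto simp: A_def smul_commute[of _ "mon a"])
      show "of_nat p \<star> v \<in> A t" if "v \<in> lvecs n K" for v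
        using that f submodD(5)[OF M(1)] by (auto simp: A_def smul_commute[of _ "of_nat p"])
    qed (auto simp: A_def)
    have Suc: "A t \<subseteq> A (Suc t)" for t
      using submod_smul[OF M(1) f _ p_pos] by (auto simp: A_def smul_simps)
    obtain t where t: "A t = A (Suc t)"
      using submod_acc[OF p, of n K A] A Suc by (metis psubsetI)
    have stable: "A (t + j) = A t" for j
    proof (induction j)
      case (Suc j)
      have "v \<in> A t" if "v \<in> A (Suc (t + j))" for v
      proof -
        have "f \<star> v \<in> A (t + j)" using that f by (auto simp: A_def power_Suc2 smul_simps simp del: power_Suc)
        then have "f \<star> v \<in> A t" using Suc by simp
        then have "v \<in> A (Suc t)" using that by (auto simp: A_def power_Suc2 smul_simps simp del: power_Suc)
        then show ?thesis using t by simp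
      qed
      then show ?case using Suc \<open>\<And>t. A t \<subseteq> A (Suc t)\<close>[of "t + j"] by auto
    qed simp
    have t0: "t \<noteq> 0"
    proof
      assume "t = 0"
      then have "A 1 = A 0" using t by simp
      moreover have "v0 \<in> A 1" "v0 \<notin> A 0" using v0 by (auto simp: A_def smul_simps)
      ultimately show False by blast
    qed
    \<comment> \<open>The preimage of the image of f^t. If f^t sends u + f^t v into M, with u in M,
      then v lies in \<open>A (t + t) = A t\<close>, so f^t v and the element itself lie in
      M.\<close>
    define C where "C = {u + f ^ t \<star> v |u v. u \<in> M \<and> v \<in> lvecs n K}"
    have C: "submod p n K C"
      unfolding submod_def
    proof (intro conjI ballI)
      show "C \<subseteq> lvecs n K" using f submodD(1)[OF M(1)] by (auto simp: C_def)
      have "0 = (0 :: lvec) + f ^ t \<star> 0" by (simp add: smul_simps)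
      then show "0 \<in> C" unfolding C_def using submodD(2)[OF M(1)] by blast
      show "x + y \<in> C" if xy: "x \<in> C" "y \<in> C" for x y
      proof -
        obtain u v where 1: "x = u + f ^ t \<star> v" "u \<in> M" "v \<in> lvecs n K"
          using xy(1) unfolding C_def by blast
        obtain u' v' where 2: "y = u' + f ^ t \<star> v'" "u' \<in> M" "v' \<in> lvecs n K"
          using xy(2) unfolding C_def by blast
        note * = 1 2
        have "x + y = (u + u') + f ^ t \<star> (v + v')" by (simp add: * smul_simps algebra_simps)
        then show ?thesis unfolding C_def using * submodD(3)[OF M(1)] by blast
      qed
      show "mon a \<star> x \<in> C" if x: "x \<in> C" and a: "a \<in> expos n" for x a
      proof -
        obtain u v where *: "x = u + f ^ t \<star> v" "u \<in> M" "v \<in> lvecs n K" using x unfolding C_def by blast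
        have "mon a \<star> x = mon a \<star> u + f ^ t \<star> (mon a \<star> v)" by (simp add: * smul_simps smul_commute)
        moreover have "mon a \<star> v \<in> lvecs n K" using * a by auto
        ultimately show ?thesis unfolding C_def using * a submodD(4)[OF M(1)] by blast
      qed
      show "of_nat p \<star> v \<in> C" if "v \<in> lvecs n K" for v
      proof -
        have "of_nat p \<star> v = of_nat p \<star> v + f ^ t \<star> 0" by (simp add: smul_simps)
        then show ?thesis unfolding C_def using submodD(5)[OF M(1) that] lvecs_closed(1) by blast
      qed
    qed
    have "M \<subset> A t"
    proof
      show "M \<subseteq> A t" using submod_smul[OF M(1) _ _ p_pos, of "f ^ t"] f submodD(1)[OF M(1)] by (auto simp: A_def)
      have "A 1 \<subseteq> A t" using stable[of 1] t0 lift_Suc_mono_le[of A 1 t] Suc by auto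
      then show "M \<noteq> A t" using v0 by (auto simp: A_def)
    qed
    moreover have "M \<subset> C"
    proof
      have "u = u + f ^ t \<star> 0" for u :: lvec by (simp add: smul_simps)
      then show "M \<subseteq> C" unfolding C_def using lvecs_closed(1) by blast
      obtain v where v: "v \<in> lvecs n K" "f ^ t \<star> v \<notin> M" using nil by blast
      have "f ^ t \<star> v = 0 + f ^ t \<star> v" by simp
      then have "f ^ t \<star> v \<in> C" unfolding C_def using v(1) submodD(2)[OF M(1)] by blast
      then show "M \<noteq> C" using v by blast
    qed
    moreover have "A t \<inter> C \<subseteq> M"
    proof
      fix x assume "x \<in> A t \<inter> C"
      then obtain u v where *: "x = u + f ^ t \<star> v" "u \<in> M" "v \<in> lvecs n K" "f ^ t \<star> x \<in> M"
        unfolding C_def A_def by blast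
      have "f ^ t \<star> u \<in> M" using submod_smul[OF M(1) _ *(2) p_pos] f by auto
      from submod_diff[OF M(1) *(4) this p_pos] have "f ^ (t + t) \<star> v \<in> M"
        by (simp add: * smul_simps power_add)
      then have "v \<in> A (t + t)" using * by (simp add: A_def)
      then have "v \<in> A t" using stable[of t] by simp
      then have "f ^ t \<star> v \<in> M" by (simp add: A_def)
      then show "x \<in> M" using submodD(3)[OF M(1)] * by blast
    qed
    ultimately have "A t \<inter> C = M" by blast
    then have "finite_state p n K M"
      using finite_state_Int[OF max[OF A] max[OF C]] \<open>M \<subset> A t\<close> \<open>M \<subset> C\<close> by metis
    then show False using M(2) by blast
  qed
  then interpret uniform_submod p n K M
    by unfold_locales (use p M(1) proper in auto)
  show False using finite_state_uniform M(2) by blast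
qed

section \<open>Finite generation of submodules\<close>

definition span_submod :: "nat \<Rightarrow> nat \<Rightarrow> nat \<Rightarrow> lvec set \<Rightarrow> lvec set" where
  "span_submod p n K S = \<Inter> {N. submod p n K N \<and> S \<subseteq> N}"

lemma submod_span:
  assumes "S \<subseteq> lvecs n K" shows "submod p n K (span_submod p n K S)"
proof -
  have "span_submod p n K S \<subseteq> lvecs n K"
    unfolding span_submod_def using assms submod_lvecs by blast
  then show ?thesis
    unfolding submod_def[of p n K "span_submod p n K S"] by (auto simp: span_submod_def intro: submodD)
qed

lemma span_superset: "S \<subseteq> span_submod p n K S"
  by (auto simp: span_submod_def)

lemma span_least: "submod p n K N \<Longrightarrow> S \<subseteq> N \<Longrightarrow> span_submod p n K S \<subseteq> N"
  by (auto simp: span_submod_def)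

lemma submod_finitely_generated:
  assumes p: "prime p" and N: "submod p n K N"
  shows "\<exists>S. finite S \<and> S \<subseteq> N \<and> span_submod p n K S = N"
proof (rule ccontr)
  assume neg: "\<not> ?thesis"
  have "\<exists>v. v \<in> N \<and> v \<notin> span_submod p n K S" if "finite S" "S \<subseteq> N" for S
  proof -
    have "span_submod p n K S \<subseteq> N" using that by (intro span_least N)
    then show ?thesis using neg that by blast
  qed
  then obtain pick where pick: "\<And>S. finite S \<Longrightarrow> S \<subseteq> N \<Longrightarrow> pick S \<in> N \<and> pick S \<notin> span_submod p n K S" by metis
  define S where "S = rec_nat {} (\<lambda>_ S. insert (pick S) S)"
  have S: "finite (S k) \<and> S k \<subseteq> N" for k
    by (induction k) (use pick in \<open>auto simp: S_def\<close>)
  have sub: "submod p n K (span_submod p n K (S k))" for k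
    using S[of k] submodD(1)[OF N] by (intro submod_span) auto
  have "span_submod p n K (S k) \<subset> span_submod p n K (S (Suc k))" for k
  proof
    have Suc: "S (Suc k) = insert (pick (S k)) (S k)" by (simp add: S_def)
    show "span_submod p n K (S k) \<subseteq> span_submod p n K (S (Suc k))"
      using span_superset[of "S (Suc k)" p n K] by (intro span_least sub) (simp add: Suc)
    show "span_submod p n K (S k) \<noteq> span_submod p n K (S (Suc k))"
      using pick[of "S k"] S[of k] span_superset[of "S (Suc k)" p n K] by (auto simp: Suc)
  qed
  then show False using submod_acc[OF p sub] by blast
qed

section \<open>The group equation as a membership problem\<close>

definition exv :: "int list \<Rightarrow> expo" where
  "exv a = (\<lambda>i. if i < length a then a ! i else 0)"

lemma exv_expos [simp, intro]: "length a = n \<Longrightarrow> exv a \<in> expos n"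
  by (auto simp: exv_def expos_def)

lemma exv_inject: "length a = length b \<Longrightarrow> exv a = exv b \<longleftrightarrow> a = b"
proof
  assume *: "length a = length b" "exv a = exv b"
  show "a = b"
  proof (rule nth_equalityI)
    fix i assume "i < length a"
    then show "a ! i = b ! i" using fun_cong[OF *(2), of i] * by (simp add: exv_def)
  qed (fact *)
qed simp

lemma inj_exv: "inj_on exv {a. length a = n}"
  by (rule inj_onI) (simp add: exv_inject)

lemma exv_map_upt: "a \<in> expos n \<Longrightarrow> exv (map a [0..<n]) = a"
  by (auto simp: exv_def expos_def fun_eq_iff)

lemma length_vec_add [simp]: "length (vec_add a b) = min (length a) (length b)"
  by (simp add: vec_add_def)

lemma exv_vec_add: "length a = length b \<Longrightarrow> exv (vec_add a b) = exv a + exv b"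
  by (auto simp: exv_def vec_add_def fun_eq_iff fun_app)

lemma exv_replicate_0 [simp]: "exv (replicate n 0) = 0"
  by (auto simp: exv_def fun_eq_iff fun_app)

lemma exv_image: "exv ` {a. length a = n} = expos n"
proof
  show "expos n \<subseteq> exv ` {a. length a = n}"
  proof
    fix a assume "a \<in> expos n"
    then show "a \<in> exv ` {a. length a = n}" by (intro image_eqI[of _ _ "map a [0..<n]"]) (auto simp: exv_map_upt)
  qed
qed auto

text \<open>Reduction modulo p, in the format of the ring in which the problem is posed: residues
  indexed by lists of length n.\<close>

definition lrep :: "nat \<Rightarrow> nat \<Rightarrow> lpoly \<Rightarrow> (int list \<Rightarrow> int)" where
  "lrep p n f = (\<lambda>a. if length a = n then Poly_Mapping.lookup f (exv a) mod int p else 0)"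

definition vrep :: "nat \<Rightarrow> nat \<Rightarrow> nat \<Rightarrow> lvec \<Rightarrow> (int list \<Rightarrow> int) list" where
  "vrep p n d v = map (\<lambda>i. lrep p n (v i)) [0..<d]"

lemma lookup_mult_sum:
  assumes "finite A" "finite B" "Poly_Mapping.keys f \<subseteq> A" "Poly_Mapping.keys g \<subseteq> B"
  shows "Poly_Mapping.lookup (f * g :: lpoly) x =
    (\<Sum>b\<in>A. \<Sum>c\<in>B. if b + c = x then Poly_Mapping.lookup f b * Poly_Mapping.lookup g c else 0)"
proof -
  have ex: "h = (\<Sum>a\<in>C. of_int (Poly_Mapping.lookup h a) * mon a)"
    if "finite C" "Poly_Mapping.keys h \<subseteq> C" for h C
    by (subst lpoly_expand[of h], rule sum.mono_neutral_left) (use that in \<open>auto simp: in_keys_iff\<close>)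
  have "f * g = (\<Sum>b\<in>A. of_int (Poly_Mapping.lookup f b) * mon b) * (\<Sum>c\<in>B. of_int (Poly_Mapping.lookup g c) * mon c)"
    using ex[OF assms(1,3)] ex[OF assms(2,4)] by (simp only:)
  also have "\<dots> = (\<Sum>b\<in>A. \<Sum>c\<in>B. of_int (Poly_Mapping.lookup f b) * (of_int (Poly_Mapping.lookup g c) * mon (b + c)))"
    by (simp add: sum_product mon_mult[symmetric] mult_ac)
  finally show ?thesis
    by (auto simp: lookup_sum lookup_of_int_mult intro!: sum.cong)
qed

section \<open>Geometric sums and products of powers\<close>

definition iscale :: "int \<Rightarrow> expo \<Rightarrow> expo" where "iscale k x = (\<lambda>i. k * x i)"

lemma iscale_simps [simp]: "iscale 0 x = 0" "iscale 1 x = x" "iscale (- 1) x = - x"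
  by (auto simp: iscale_def fun_eq_iff fun_app)

lemma iscale_add: "iscale (k + l) x = iscale k x + iscale l x" "iscale k (x + y) = iscale k x + iscale k y"
  by (auto simp: iscale_def fun_eq_iff fun_app algebra_simps)

lemma iscale_expos [simp, intro]: "x \<in> expos n \<Longrightarrow> iscale k x \<in> expos n"
  by (auto simp: iscale_def expos_def)

text \<open>The quotient (X^(k x) - 1) / (X^x - 1) for every integer k, written as a sum so that it
  also makes sense for x = 0. It is the multiplier of y in the k-th power of (y, x).\<close>

definition geo :: "expo \<Rightarrow> int \<Rightarrow> lpoly" where
  "geo x k = (if k \<ge> 0 then \<Sum>j<nat k. mon (iscale (int j) x) else - (\<Sum>j<nat (- k). mon (iscale (- 1 - int j) x)))"

lemma geo_0 [simp]: "geo x 0 = 0"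
  by (simp add: geo_def)

lemma geo_step: "geo x (k + 1) = geo x k + mon (iscale k x)"
proof (cases "k \<ge> 0")
  case True
  then have "nat (k + 1) = Suc (nat k)" by simp
  then show ?thesis using True by (simp add: geo_def)
next
  case False
  then have "nat (- k) = Suc (nat (- (k + 1)))" "- 1 - int (nat (- (k + 1))) = k" by simp_all
  then show ?thesis using False by (cases "k = - 1") (simp_all add: geo_def)
qed

text \<open>The cocycle identity that corresponds to adding exponents of a power in the semidirect
  product.\<close>

lemma geo_add: "geo x (k + l) = geo x k + mon (iscale k x) * geo x l"
proof (induction l rule: int_induct[where k = 0])
  case (step1 l)
  then show ?case using geo_step[of x "k + l"] geo_step[of x l]
    by (simp add: algebra_simps iscale_add mon_mult)
next
  case (step2 l)
  then show ?case using geo_step[of x "k + l - 1"] geo_step[of x "l - 1"] iscale_add(1)[of k "l - 1" x]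
    by (simp add: algebra_simps mon_mult)
qed simp

lemma geo_mult: "(mon x - 1) * geo x k = mon (iscale k x) - 1"
proof (induction k rule: int_induct[where k = 0])
  case (step1 k)
  then show ?case using geo_step[of x k] by (simp add: algebra_simps iscale_add mon_mult)
next
  case (step2 k)
  have "iscale k x = iscale (k - 1) x + x" using iscale_add(1)[of "k - 1" 1 x] by simp
  then show ?case using step2 geo_step[of x "k - 1"] by (simp add: algebra_simps mon_mult)
qed simp

lemma geo_lpolys [simp, intro]: "x \<in> expos n \<Longrightarrow> geo x k \<in> lpolys n"
  unfolding geo_def by (auto intro!: lpolys_sum)

lemma exv_iscale: "exv (map ((*) k) a) = iscale k (exv a)"
  by (auto simp: exv_def iscale_def fun_eq_iff)

text \<open>On representatives, the module component of the product of powers; \<open>ppx\<close> is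
  its lattice component.\<close>

fun ppv :: "(lvec \<times> int list) list \<Rightarrow> int list \<Rightarrow> lvec" where
  "ppv ((v, a) # hs) (k # ks) = geo (exv a) k \<star> v + mon (iscale k (exv a)) \<star> ppv hs ks"
| "ppv _ _ = 0"

fun ppx :: "(lvec \<times> int list) list \<Rightarrow> int list \<Rightarrow> expo" where
  "ppx ((v, a) # hs) (k # ks) = iscale k (exv a) + ppx hs ks"
| "ppx _ _ = 0"

lemma ppx_sum:
  "length ks = length hs \<Longrightarrow> ppx hs ks = (\<Sum>j<length hs. iscale (ks ! j) (exv (snd (hs ! j))))"
proof (induction hs arbitrary: ks)
  case (Cons h hs)
  then obtain k ks' where ks: "ks = k # ks'" by (cases ks) auto
  show ?case using Cons by (cases h) (simp add: ks sum.lessThan_Suc_shift del: sum.lessThan_Suc)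
qed simp

lemma smul_sum_right: "f \<star> sum v G = (\<Sum>g\<in>G. f \<star> v g)"
  by (induction G rule: infinite_finite_induct) (simp_all add: smul_simps)

lemma ppv_sum:
  "length ks = length hs \<Longrightarrow> ppv hs ks = (\<Sum>j<length hs.
     (mon (\<Sum>i<j. iscale (ks ! i) (exv (snd (hs ! i)))) * geo (exv (snd (hs ! j))) (ks ! j)) \<star> fst (hs ! j))"
proof (induction hs arbitrary: ks)
  case (Cons h hs)
  then obtain k ks' where ks: "ks = k # ks'" by (cases ks) auto
  show ?case using Cons
    by (cases h) (simp add: ks sum.lessThan_Suc_shift smul_sum_right smul_simps(8)[symmetric]
        mult.assoc[symmetric] mon_mult del: sum.lessThan_Suc)
qed simp

section \<open>The presented module and the group in terms of integral vectors\<close>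

locale coset_rep =
  fixes p n d :: nat and Y :: "lvec set"
  assumes prime: "prime p" and Y: "Y \<subseteq> lvecs n d"
begin

definition K :: "int ring" where "K = residue_ring (int p)"
definition R :: "(int list \<Rightarrow> int) ring" where "R = laurent_ring K n"
definition F :: "(int list \<Rightarrow> int, (int list \<Rightarrow> int) list) module" where "F = free_module R d"
definition N :: "lvec set" where "N = span_submod p n d Y"

lemma p_pos: "p > 0" using prime by (simp add: prime_gt_0_nat)

sublocale residues "int p" K
  using prime prime_gt_1_nat[of p] by unfold_locales (simp_all add: K_def)

lemma N: "submod p n d N" unfolding N_def by (rule submod_span[OF Y])

lemma K_simps [simp]: "carrier K = {0..int p - 1}" "\<zero>\<^bsub>K\<^esub> = 0" "\<one>\<^bsub>K\<^esub> = 1"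
    "x \<oplus>\<^bsub>K\<^esub> y = (x + y) mod int p" "x \<otimes>\<^bsub>K\<^esub> y = (x * y) mod int p"
  by (simp_all add: res_carrier_eq res_zero_eq res_one_eq res_add_eq res_mult_eq)

lemma R_simps: "carrier R = {f. range f \<subseteq> {0..int p - 1} \<and> finite {a. f a \<noteq> 0} \<and> (\<forall>a. f a \<noteq> 0 \<longrightarrow> length a = n)}"
    "\<zero>\<^bsub>R\<^esub> = (\<lambda>a. 0)" "f \<oplus>\<^bsub>R\<^esub> g = (\<lambda>a. (f a + g a) mod int p)"
  by (auto simp: R_def laurent_ring_def laurent_support_def)

lemma R_mult: "f \<otimes>\<^bsub>R\<^esub> g = (\<lambda>a. finsum K (\<lambda>(b, c). (f b * g c) mod int p)
          {(b, c). f b \<noteq> 0 \<and> g c \<noteq> 0 \<and> vec_add b c = a})"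
  by (simp add: R_def laurent_ring_def laurent_support_def)

lemma lrep_support: "f \<in> lpolys n \<Longrightarrow> {a. lrep p n f a \<noteq> 0} \<subseteq> {a. length a = n \<and> exv a \<in> Poly_Mapping.keys f}"
  by (auto simp: lrep_def in_keys_iff split: if_splits)

lemma finite_exv_keys: "finite {a. length a = n \<and> exv a \<in> Poly_Mapping.keys f}"
proof -
  have "finite (exv -` Poly_Mapping.keys f \<inter> {a. length a = n})"
    by (rule finite_vimage_IntI[OF finite_keys inj_exv])
  then show ?thesis by (rule rev_finite_subset) auto
qed

lemma lrep_carrier: "f \<in> lpolys n \<Longrightarrow> lrep p n f \<in> carrier R"
  using finite_subset[OF lrep_support finite_exv_keys] p_pos
  by (auto simp: R_simps lrep_def split: if_splits)

lemma lrep_surj: assumes "g \<in> carrier R" obtains f where "f \<in> lpolys n" "lrep p n f = g"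
proof -
  let ?S = "{a. g a \<noteq> 0}"
  have S: "finite ?S" "\<And>a. a \<in> ?S \<Longrightarrow> length a = n" and rg: "\<And>a. g a \<in> {0..int p - 1}"
    using assms by (auto simp: R_simps image_subset_iff)
  define f where "f = (\<Sum>a\<in>?S. of_int (g a) * mon (exv a))"
  have "f \<in> lpolys n" unfolding f_def by (rule lpolys_sum) (auto intro!: S)
  moreover have "lrep p n f = g"
  proof
    fix a
    show "lrep p n f a = g a"
    proof (cases "length a = n")
      case True
      have "Poly_Mapping.lookup f (exv a) = (\<Sum>b\<in>?S. if b = a then g b else 0)"
        unfolding f_def lookup_sum by (rule sum.cong) (use S True in \<open>auto simp: lookup_of_int_mult exv_inject\<close>)
      also have "\<dots> = g a" using S(1) by simp
      finally show ?thesis using True rg[of a] by (simp add: lrep_def)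
    next
      case False
      then have "g a = 0" using S(2) by blast
      then show ?thesis using False by (simp add: lrep_def)
    qed
  qed
  ultimately show ?thesis using that by blast
qed

lemma lrep_eq_iff:
  assumes "f \<in> lpolys n" "g \<in> lpolys n"
  shows "lrep p n f = lrep p n g \<longleftrightarrow> of_nat p dvd f - g"
proof
  assume *: "lrep p n f = lrep p n g"
  have "int p dvd Poly_Mapping.lookup (f - g) x" for x
  proof (cases "x \<in> expos n")
    case True
    have "lrep p n f (map x [0..<n]) = lrep p n g (map x [0..<n])" using * by simp
    then show ?thesis using True by (simp add: lrep_def exv_map_upt lookup_minus mod_eq_dvd_iff)
  next
    case False
    then have "Poly_Mapping.lookup f x = 0" "Poly_Mapping.lookup g x = 0"
      using assms by (auto simp: lpolys_def in_keys_iff)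
    then show ?thesis by (simp add: lookup_minus)
  qed
  then show "of_nat p dvd f - g" by (simp add: of_nat_dvd_lpoly_iff)
next
  assume "of_nat p dvd f - g"
  then show "lrep p n f = lrep p n g"
    by (auto simp: lrep_def of_nat_dvd_lpoly_iff lookup_minus mod_eq_dvd_iff fun_eq_iff)
qed

lemma lrep_add: "lrep p n (f + g) = lrep p n f \<oplus>\<^bsub>R\<^esub> lrep p n g"
  by (auto simp: lrep_def R_simps lookup_add mod_add_eq fun_eq_iff)

lemma lrep_0: "lrep p n 0 = \<zero>\<^bsub>R\<^esub>"
  by (auto simp: lrep_def R_simps fun_eq_iff)

lemma lrep_mon: "length a = n \<Longrightarrow> lrep p n (mon (exv a)) = laurent_monom K \<one>\<^bsub>K\<^esub> a"
  by (rule ext) (use m_gt_one in \<open>auto simp: lrep_def laurent_monom_def exv_inject\<close>)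

text \<open>The ring sums over supports of residues, the integral product over supports of integers.
  The former set is smaller, and the additional terms vanish after reduction.\<close>

lemma lrep_mult:
  assumes f: "f \<in> lpolys n" and g: "g \<in> lpolys n"
  shows "lrep p n (f * g) = lrep p n f \<otimes>\<^bsub>R\<^esub> lrep p n g"
proof
  fix a
  let ?A = "{a. length a = n \<and> exv a \<in> Poly_Mapping.keys f}"
  let ?B = "{a. length a = n \<and> exv a \<in> Poly_Mapping.keys g}"
  let ?f = "Poly_Mapping.lookup f" and ?g = "Poly_Mapping.lookup g"
  let ?S = "{(b, c). lrep p n f b \<noteq> 0 \<and> lrep p n g c \<noteq> 0 \<and> vec_add b c = a}"
  let ?T = "{(b, c) \<in> ?A \<times> ?B. vec_add b c = a}"
  have finT: "finite ?T" by (rule finite_subset[of _ "?A \<times> ?B"]) (auto simp: finite_exv_keys)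
  have ST: "?S \<subseteq> ?T" using lrep_support[OF f] lrep_support[OF g] by auto
  then have finS: "finite ?S" using finT finite_subset by blast
  have "(lrep p n f \<otimes>\<^bsub>R\<^esub> lrep p n g) a = finsum K (\<lambda>z. (lrep p n f (fst z) * lrep p n g (snd z)) mod int p) ?S"
    unfolding R_mult by (simp add: case_prod_beta')
  also have "\<dots> = (\<Sum>z\<in>?S. lrep p n f (fst z) * lrep p n g (snd z)) mod int p"
    by (rule sum_cong[OF finS])
  also have "(\<Sum>z\<in>?S. lrep p n f (fst z) * lrep p n g (snd z)) = (\<Sum>z\<in>?T. lrep p n f (fst z) * lrep p n g (snd z))"
    by (rule sum.mono_neutral_left[OF finT ST]) auto
  also have "\<dots> mod int p = (\<Sum>z\<in>?T. ?f (exv (fst z)) * ?g (exv (snd z))) mod int p"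
  proof -
    have "(\<Sum>z\<in>?T. lrep p n f (fst z) * lrep p n g (snd z)) mod int p =
      (\<Sum>z\<in>?T. (lrep p n f (fst z) * lrep p n g (snd z)) mod int p) mod int p" by (simp add: mod_sum_eq)
    also have "\<dots> = (\<Sum>z\<in>?T. (?f (exv (fst z)) * ?g (exv (snd z))) mod int p) mod int p"
      by (rule arg_cong[of _ _ "\<lambda>x. x mod int p"], rule sum.cong) (auto simp: lrep_def mod_mult_eq)
    finally show ?thesis by (simp add: mod_sum_eq)
  qed
  finally have R: "(lrep p n f \<otimes>\<^bsub>R\<^esub> lrep p n g) a = (\<Sum>z\<in>?T. ?f (exv (fst z)) * ?g (exv (snd z))) mod int p" .
  show "lrep p n (f * g) a = (lrep p n f \<otimes>\<^bsub>R\<^esub> lrep p n g) a"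
  proof (cases "length a = n")
    case False
    then have T0: "?T = {}" by (auto simp: vec_add_def)
    show ?thesis unfolding R T0 using False by (simp add: lrep_def)
  next
    case True
    have keys: "exv ` ?A = Poly_Mapping.keys f" "exv ` ?B = Poly_Mapping.keys g"
      using f g exv_image[of n] by (auto simp: lpolys_def image_iff)
    have inj: "inj_on exv ?A" "inj_on exv ?B" by (rule inj_on_subset[OF inj_exv[of n]], blast)+
    have "Poly_Mapping.lookup (f * g) (exv a) =
      (\<Sum>b\<in>exv ` ?A. \<Sum>c\<in>exv ` ?B. if b + c = exv a then ?f b * ?g c else 0)"
      unfolding keys by (rule lookup_mult_sum) auto
    also have "\<dots> = (\<Sum>b\<in>?A. \<Sum>c\<in>?B. if exv b + exv c = exv a then ?f (exv b) * ?g (exv c) else 0)"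
      by (simp add: sum.reindex[OF inj(1)] sum.reindex[OF inj(2)])
    also have "\<dots> = (\<Sum>z\<in>?A \<times> ?B. if exv (fst z) + exv (snd z) = exv a then ?f (exv (fst z)) * ?g (exv (snd z)) else 0)"
      by (simp add: sum.cartesian_product case_prod_beta')
    also have "\<dots> = (\<Sum>z\<in>?A \<times> ?B. if vec_add (fst z) (snd z) = a then ?f (exv (fst z)) * ?g (exv (snd z)) else 0)"
    proof (rule sum.cong)
      fix z assume "z \<in> ?A \<times> ?B"
      then have "exv (fst z) + exv (snd z) = exv (vec_add (fst z) (snd z))" "length (vec_add (fst z) (snd z)) = n"
        by (auto simp: exv_vec_add)
      then show "(if exv (fst z) + exv (snd z) = exv a then ?f (exv (fst z)) * ?g (exv (snd z)) else 0) =
          (if vec_add (fst z) (snd z) = a then ?f (exv (fst z)) * ?g (exv (snd z)) else 0)"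
        using True by (simp add: exv_inject)
    qed simp
    also have "\<dots> = (\<Sum>z\<in>?T. ?f (exv (fst z)) * ?g (exv (snd z)))"
      by (rule sum.mono_neutral_cong_right) (auto simp: finite_exv_keys)
    finally show ?thesis unfolding R using True by (simp add: lrep_def)
  qed
qed

lemma F_simps: "carrier F = {v. length v = d \<and> set v \<subseteq> carrier R}" "\<zero>\<^bsub>F\<^esub> = replicate d \<zero>\<^bsub>R\<^esub>"
    "u \<oplus>\<^bsub>F\<^esub> v = map2 (\<oplus>\<^bsub>R\<^esub>) u v" "r \<odot>\<^bsub>F\<^esub> v = map ((\<otimes>\<^bsub>R\<^esub>) r) v"
  by (simp_all add: F_def free_module_def)

lemma lvecs_lpolys: "v \<in> lvecs n d \<Longrightarrow> v i \<in> lpolys n"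
  by (simp add: lvecs_def)

lemma vrep_carrier: "v \<in> lvecs n d \<Longrightarrow> vrep p n d v \<in> carrier F"
  by (auto simp: F_simps vrep_def intro!: lrep_carrier lvecs_lpolys)

lemma vrep_surj: assumes "x \<in> carrier F" obtains v where "v \<in> lvecs n d" "vrep p n d v = x"
proof -
  have "\<exists>f. f \<in> lpolys n \<and> lrep p n f = x ! i" if "i < d" for i
  proof -
    have "x ! i \<in> carrier R" using assms that by (auto simp: F_simps)
    then show ?thesis by (metis lrep_surj)
  qed
  then obtain f where f: "\<And>i. i < d \<Longrightarrow> f i \<in> lpolys n \<and> lrep p n (f i) = x ! i" by metis
  let ?v = "\<lambda>i. if i < d then f i else 0"
  have "?v \<in> lvecs n d" using f by (auto simp: lvecs_def)
  moreover have "vrep p n d ?v = x"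
    by (rule nth_equalityI) (use f assms in \<open>auto simp: vrep_def F_simps\<close>)
  ultimately show ?thesis using that by blast
qed

lemma vrep_eq_iff:
  assumes "u \<in> lvecs n d" "v \<in> lvecs n d"
  shows "vrep p n d u = vrep p n d v \<longleftrightarrow> (\<forall>i. of_nat p dvd (u - v) i)"
proof -
  have "vrep p n d u = vrep p n d v \<longleftrightarrow> (\<forall>i<d. of_nat p dvd u i - v i)"
    using assms by (auto simp: vrep_def lrep_eq_iff lvecs_lpolys)
  also have "\<dots> \<longleftrightarrow> (\<forall>i. of_nat p dvd (u - v) i)"
  proof -
    have "of_nat p dvd u i - v i" if "\<not> i < d" for i using assms that by (simp add: lvecs_def)
    then show ?thesis unfolding fun_app by blast
  qed
  finally show ?thesis .
qed

lemma vrep_add: "vrep p n d (u + v) = vrep p n d u \<oplus>\<^bsub>F\<^esub> vrep p n d v"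
  by (auto simp: vrep_def F_simps fun_app lrep_add map2_map_map)

lemma vrep_0: "vrep p n d 0 = \<zero>\<^bsub>F\<^esub>"
  by (rule nth_equalityI) (auto simp: vrep_def F_simps fun_app lrep_0)

lemma vrep_smul: "f \<in> lpolys n \<Longrightarrow> v \<in> lvecs n d \<Longrightarrow> vrep p n d (f \<star> v) = lrep p n f \<odot>\<^bsub>F\<^esub> vrep p n d v"
  by (auto simp: vrep_def F_simps fun_app lrep_mult lvecs_lpolys)

text \<open>The laws are carried over from integral vectors along the surjection
  \<open>vrep\<close>.\<close>

lemma group_F: "comm_group (add_monoid F)"
proof (rule comm_groupI)
  fix x y z assume xyz: "x \<in> carrier (add_monoid F)" "y \<in> carrier (add_monoid F)" "z \<in> carrier (add_monoid F)"
  have xyz': "x \<in> carrier F" "y \<in> carrier F" "z \<in> carrier F" using xyz by simp_all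
  obtain u where 1: "u \<in> lvecs n d" "vrep p n d u = x" using xyz'(1) by (rule vrep_surj)
  obtain v where 2: "v \<in> lvecs n d" "vrep p n d v = y" using xyz'(2) by (rule vrep_surj)
  obtain w where 3: "w \<in> lvecs n d" "vrep p n d w = z" using xyz'(3) by (rule vrep_surj)
  note * = 1(1) 2(1) 3(1) 1(2)[symmetric] 2(2)[symmetric] 3(2)[symmetric]
  show "x \<otimes>\<^bsub>add_monoid F\<^esub> y \<in> carrier (add_monoid F)"
    using * vrep_carrier[of "u + v"] by (simp add: vrep_add)
  show "x \<otimes>\<^bsub>add_monoid F\<^esub> y \<otimes>\<^bsub>add_monoid F\<^esub> z = x \<otimes>\<^bsub>add_monoid F\<^esub> (y \<otimes>\<^bsub>add_monoid F\<^esub> z)"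
    using * by (simp add: vrep_add[symmetric] add.assoc lvecs_closed)
  show "x \<otimes>\<^bsub>add_monoid F\<^esub> y = y \<otimes>\<^bsub>add_monoid F\<^esub> x"
    using * by (simp add: vrep_add[symmetric] add.commute)
next
  show "\<one>\<^bsub>add_monoid F\<^esub> \<in> carrier (add_monoid F)"
    using vrep_carrier[of 0] by (simp add: vrep_0)
  fix x assume x: "x \<in> carrier (add_monoid F)"
  then have "x \<in> carrier F" by simp
  then obtain u where u: "u \<in> lvecs n d" "vrep p n d u = x" by (rule vrep_surj)
  note u = u(1) u(2)[symmetric]
  from u show "\<one>\<^bsub>add_monoid F\<^esub> \<otimes>\<^bsub>add_monoid F\<^esub> x = x"
    by (simp add: vrep_0[symmetric] vrep_add[symmetric])
  show "\<exists>y\<in>carrier (add_monoid F). y \<otimes>\<^bsub>add_monoid F\<^esub> x = \<one>\<^bsub>add_monoid F\<^esub>"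
    using u vrep_carrier[of "- u"]
    by (intro bexI[of _ "vrep p n d (- u)"]) (simp_all add: vrep_0[symmetric] vrep_add[symmetric])
qed

lemma inv_vrep:
  assumes "u \<in> lvecs n d" shows "inv\<^bsub>add_monoid F\<^esub> (vrep p n d u) = vrep p n d (- u)"
proof -
  interpret comm_group "add_monoid F" by (rule group_F)
  show ?thesis
    by (rule inv_equality)
      (use assms vrep_carrier[of u] vrep_carrier[of "- u"] in \<open>simp_all add: vrep_0[symmetric] vrep_add[symmetric]\<close>)
qed

lemma submodule_vrep:
  assumes M: "submod p n d M" shows "submodule (vrep p n d ` M) R F"
proof (intro submodule.intro subgroup.intro submodule_axioms.intro)
  have Ml: "\<And>v. v \<in> M \<Longrightarrow> v \<in> lvecs n d" by (rule submodD(1)[OF M])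
  show "vrep p n d ` M \<subseteq> carrier (add_monoid F)" using Ml vrep_carrier by auto
  show "x \<otimes>\<^bsub>add_monoid F\<^esub> y \<in> vrep p n d ` M" if "x \<in> vrep p n d ` M" "y \<in> vrep p n d ` M" for x y
    using that submodD(3)[OF M] by (auto simp: vrep_add[symmetric])
  show "\<one>\<^bsub>add_monoid F\<^esub> \<in> vrep p n d ` M"
    using submodD(2)[OF M] by (auto simp: vrep_0[symmetric])
  show "inv\<^bsub>add_monoid F\<^esub> x \<in> vrep p n d ` M" if "x \<in> vrep p n d ` M" for x
    using that submod_uminus[OF M _ p_pos] by (auto simp: inv_vrep Ml)
  show "a \<odot>\<^bsub>F\<^esub> x \<in> vrep p n d ` M" if ax: "a \<in> carrier R" "x \<in> vrep p n d ` M" for a x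
  proof -
    obtain f where "f \<in> lpolys n" "a = lrep p n f" using lrep_surj[OF ax(1)] by metis
    then show ?thesis using ax(2) submod_smul[OF M _ _ p_pos] Ml by (auto simp: vrep_smul[symmetric])
  qed
qed

definition H :: "(int list \<Rightarrow> int) list set" where "H = submodule_gen R F (vrep p n d ` Y)"

text \<open>Both sides are least submodules, and submodules correspond in both directions: images
  under \<open>vrep\<close> are submodules, and so are preimages, which contain p times everything
  because \<open>vrep\<close> kills it.\<close>

lemma H_eq: "H = vrep p n d ` N"
proof
  have "Y \<subseteq> N" unfolding N_def by (rule span_superset)
  then show "H \<subseteq> vrep p n d ` N"
    unfolding H_def submodule_gen_def using submodule_vrep[OF N] by blast
next
  show "vrep p n d ` N \<subseteq> H"
    unfolding H_def submodule_gen_def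
  proof (intro Inter_greatest, clarify)
    fix L v assume L: "submodule L R F" "vrep p n d ` Y \<subseteq> L" and v: "v \<in> N"
    interpret L: submodule L R F by (rule L(1))
    interpret F: comm_group "add_monoid F" by (rule group_F)
    let ?M = "{v \<in> lvecs n d. vrep p n d v \<in> L}"
    have "submod p n d ?M"
      unfolding submod_def
    proof (intro conjI ballI)
      show "0 \<in> ?M" using L.one_closed by (simp add: vrep_0)
      show "u + v \<in> ?M" if "u \<in> ?M" "v \<in> ?M" for u v
        using that L.m_closed by (auto simp: vrep_add)
      show "mon a \<star> v \<in> ?M" if "v \<in> ?M" "a \<in> expos n" for v a
        using that L.smult_closed[OF lrep_carrier] by (auto simp: vrep_smul)
      show "of_nat p \<star> v \<in> ?M" if "v \<in> lvecs n d" for v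
      proof -
        have "vrep p n d (of_nat p \<star> v) = vrep p n d 0"
          by (subst vrep_eq_iff) (use that in \<open>auto simp: fun_app\<close>)
        then show ?thesis using that L.one_closed by (auto simp: vrep_0)
      qed
    qed auto
    then have "N \<subseteq> ?M" unfolding N_def by (rule span_least) (use L(2) Y in auto)
    then show "vrep p n d v \<in> L" using v by blast
  qed
qed

definition cst :: "lvec \<Rightarrow> (int list \<Rightarrow> int) list set" where "cst v = H +>\<^bsub>F\<^esub> vrep p n d v"

lemma cst_eq: "v \<in> lvecs n d \<Longrightarrow> cst v = vrep p n d ` {u \<in> lvecs n d. u - v \<in> N}"
proof -
  assume v: "v \<in> lvecs n d"
  have "cst v = (\<lambda>u. vrep p n d (u + v)) ` N"
    unfolding cst_def a_r_coset_def r_coset_def H_eq by (auto simp: vrep_add)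
  also have "\<dots> = vrep p n d ` ((\<lambda>u. u + v) ` N)" by (simp add: image_image)
  also have "(\<lambda>u. u + v) ` N = {u \<in> lvecs n d. u - v \<in> N}"
    using v submodD(1)[OF N] by (auto intro!: image_eqI[of _ _ "_ - v"])
  finally show ?thesis .
qed

lemma vrep_in_cst: "u \<in> lvecs n d \<Longrightarrow> v \<in> lvecs n d \<Longrightarrow> vrep p n d u \<in> cst v \<longleftrightarrow> u - v \<in> N"
proof
  assume uv: "u \<in> lvecs n d" "v \<in> lvecs n d" "vrep p n d u \<in> cst v"
  then obtain w where w: "w \<in> lvecs n d" "w - v \<in> N" "vrep p n d u = vrep p n d w" by (auto simp: cst_eq)
  have "u - w \<in> N" by (rule submod_mod_p[OF N]) (use uv w vrep_eq_iff in auto)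
  from submodD(3)[OF N this w(2)] show "u - v \<in> N" by simp
qed (auto simp: cst_eq)

lemma cst_eq_iff:
  assumes "u \<in> lvecs n d" "v \<in> lvecs n d" shows "cst u = cst v \<longleftrightarrow> u - v \<in> N"
proof
  assume "cst u = cst v"
  moreover have "vrep p n d u \<in> cst u" using assms submodD(2)[OF N] by (simp add: vrep_in_cst)
  ultimately show "u - v \<in> N" using assms by (simp add: vrep_in_cst)
next
  assume *: "u - v \<in> N"
  have "w - u \<in> N \<longleftrightarrow> w - v \<in> N" for w
    using submodD(3)[OF N _ *, of "w - u"] submod_diff[OF N _ * p_pos, of "w - v"] by auto
  then show "cst u = cst v" using assms by (simp add: cst_eq)
qed

definition Q :: "(int list \<Rightarrow> int, (int list \<Rightarrow> int) list set) module" where "Q = quotient_module F H"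

lemma Q_carrier: "carrier Q = cst ` lvecs n d"
proof -
  have "carrier Q = (\<lambda>x. H +>\<^bsub>F\<^esub> x) ` carrier F"
    by (auto simp: Q_def quotient_module_def A_RCOSETS_def RCOSETS_def a_r_coset_def)
  also have "carrier F = vrep p n d ` lvecs n d" using vrep_carrier vrep_surj by (auto, metis image_eqI)
  finally show ?thesis by (simp add: image_image cst_def)
qed

lemma Q_zero: "\<zero>\<^bsub>Q\<^esub> = cst 0"
proof -
  have "cst 0 = H" unfolding H_eq using submodD(1)[OF N] by (auto simp: cst_eq)
  then show ?thesis by (simp add: Q_def quotient_module_def)
qed

lemma Q_add:
  assumes "u \<in> lvecs n d" "v \<in> lvecs n d" shows "cst u \<oplus>\<^bsub>Q\<^esub> cst v = cst (u + v)"
proof -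
  have "cst u \<oplus>\<^bsub>Q\<^esub> cst v = {h \<oplus>\<^bsub>F\<^esub> k |h k. h \<in> cst u \<and> k \<in> cst v}"
    by (auto simp: Q_def quotient_module_def set_add_def set_mult_def)
  also have "\<dots> = cst (u + v)"
  proof (intro equalityI subsetI)
    fix x assume "x \<in> {h \<oplus>\<^bsub>F\<^esub> k |h k. h \<in> cst u \<and> k \<in> cst v}"
    then obtain a b where ab: "a \<in> lvecs n d" "a - u \<in> N" "b \<in> lvecs n d" "b - v \<in> N" "x = vrep p n d (a + b)"
      using assms by (auto simp: cst_eq vrep_add)
    have "a + b - (u + v) \<in> N" using submodD(3)[OF N ab(2,4)] by (simp only: add_diff_add)
    then show "x \<in> cst (u + v)"
      unfolding ab(5) using assms ab(1,3) by (subst vrep_in_cst) auto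
  next
    fix x assume "x \<in> cst (u + v)"
    then obtain a where a: "a \<in> lvecs n d" "a - (u + v) \<in> N" "x = vrep p n d a" using assms by (auto simp: cst_eq)
    have "x = vrep p n d u \<oplus>\<^bsub>F\<^esub> vrep p n d (a - u)" by (simp add: vrep_add[symmetric] a(3))
    moreover have "vrep p n d u \<in> cst u" using assms submodD(2)[OF N] by (simp add: vrep_in_cst)
    moreover have "a - u - v \<in> N" using a(2) by (simp only: diff_diff_eq)
    then have "vrep p n d (a - u) \<in> cst v" using assms a(1) by (simp add: vrep_in_cst lvecs_closed)
    ultimately show "x \<in> {h \<oplus>\<^bsub>F\<^esub> k |h k. h \<in> cst u \<and> k \<in> cst v}" by blast
  qed
  finally show ?thesis .
qed

text \<open>A scalar multiple of a coset is defined as a union over its representatives; all cosets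
  in this union coincide.\<close>

lemma Q_smult:
  assumes a: "length a = n" and v: "v \<in> lvecs n d"
  shows "laurent_monom K \<one>\<^bsub>K\<^esub> a \<odot>\<^bsub>Q\<^esub> cst v = cst (mon (exv a) \<star> v)"
proof -
  have e: "mon (exv a) \<in> lpolys n" using a by auto
  have "laurent_monom K \<one>\<^bsub>K\<^esub> a \<odot>\<^bsub>Q\<^esub> cst v = (\<Union>x\<in>cst v. H +>\<^bsub>F\<^esub> (laurent_monom K \<one>\<^bsub>K\<^esub> a \<odot>\<^bsub>F\<^esub> x))"
    by (simp add: Q_def quotient_module_def)
  also have "\<dots> = (\<Union>u\<in>{u \<in> lvecs n d. u - v \<in> N}. cst (mon (exv a) \<star> u))"
    unfolding cst_eq[OF v] by (auto simp: cst_def vrep_smul[OF e] lrep_mon[OF a])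
  also have "\<dots> = cst (mon (exv a) \<star> v)"
  proof -
    have "cst (mon (exv a) \<star> u) = cst (mon (exv a) \<star> v)" if "u \<in> lvecs n d" "u - v \<in> N" for u
    proof -
      have "mon (exv a) \<star> u - mon (exv a) \<star> v \<in> N"
        using submodD(4)[OF N that(2), of "exv a"] a by (simp add: smul_simps(2))
      then show ?thesis using that v e by (subst cst_eq_iff) auto
    qed
    moreover have "v \<in> {u \<in> lvecs n d. u - v \<in> N}" using v submodD(2)[OF N] by simp
    ultimately show ?thesis by blast
  qed
  finally show ?thesis .
qed

definition G :: "((int list \<Rightarrow> int) list set \<times> int list) monoid" where "G = semidirect K n Q"

lemma G_simps:
  "carrier G = cst ` lvecs n d \<times> {a. length a = n}" "\<one>\<^bsub>G\<^esub> = (cst 0, replicate n 0)"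
  by (simp_all add: G_def semidirect_def Q_carrier Q_zero)

lemma G_mult:
  assumes "length a = n" "u \<in> lvecs n d" "v \<in> lvecs n d"
  shows "(cst u, a) \<otimes>\<^bsub>G\<^esub> (cst v, b) = (cst (u + mon (exv a) \<star> v), vec_add a b)"
  using assms by (simp add: G_def semidirect_def Q_smult[simplified] Q_add lvecs_closed)

lemma vec_add_assoc: "vec_add (vec_add a b) c = vec_add a (vec_add b c)"
  by (rule nth_equalityI) (auto simp: vec_add_def)

lemma vec_add_0: "length a = n \<Longrightarrow> vec_add (replicate n 0) a = a" "length a = n \<Longrightarrow> vec_add (map uminus a) a = replicate n 0"
  by (auto intro!: nth_equalityI simp: vec_add_def)

lemma exv_uminus: "exv (map uminus a) = - exv a"
  by (auto simp: exv_def fun_eq_iff fun_app)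

lemma G_carrierE:
  assumes "x \<in> carrier G" obtains u a where "u \<in> lvecs n d" "x = (cst u, a)" "length a = n"
  using assms by (auto simp: G_simps)

lemma group_G: "group G"
proof (rule groupI)
  fix x y z assume xyz: "x \<in> carrier G" "y \<in> carrier G" "z \<in> carrier G"
  obtain u a where 1: "u \<in> lvecs n d" "x = (cst u, a)" "length a = n" using xyz(1) by (rule G_carrierE)
  obtain v b where 2: "v \<in> lvecs n d" "y = (cst v, b)" "length b = n" using xyz(2) by (rule G_carrierE)
  obtain w c where 3: "w \<in> lvecs n d" "z = (cst w, c)" "length c = n" using xyz(3) by (rule G_carrierE)
  note * = 1 2 3
  then show "x \<otimes>\<^bsub>G\<^esub> y \<in> carrier G"
    by (auto simp: G_mult G_simps lvecs_closed)
  show "x \<otimes>\<^bsub>G\<^esub> y \<otimes>\<^bsub>G\<^esub> z = x \<otimes>\<^bsub>G\<^esub> (y \<otimes>\<^bsub>G\<^esub> z)"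
    using * by (simp add: G_mult lvecs_closed vec_add_assoc exv_vec_add mon_mult[symmetric] smul_simps add.assoc)
next
  show "\<one>\<^bsub>G\<^esub> \<in> carrier G" by (simp add: G_simps)
  fix x assume "x \<in> carrier G"
  then obtain u a where *: "u \<in> lvecs n d" "x = (cst u, a)" "length a = n" by (rule G_carrierE)
  then show "\<one>\<^bsub>G\<^esub> \<otimes>\<^bsub>G\<^esub> x = x" by (simp add: G_simps G_mult vec_add_0 smul_simps)
  have m: "mon (- exv a) \<in> lpolys n" using * by auto
  show "\<exists>y\<in>carrier G. y \<otimes>\<^bsub>G\<^esub> x = \<one>\<^bsub>G\<^esub>"
    by (rule bexI[of _ "(cst (- (mon (- exv a) \<star> u)), map uminus a)"])
      (use * m in \<open>auto simp: G_simps G_mult lvecs_closed exv_uminus vec_add_0\<close>)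
qed

text \<open>The right-hand side is multiplicative in k by \<open>geo_add\<close> and takes the value
  (v, a) at k = 1.\<close>

lemma G_int_pow:
  assumes v: "v \<in> lvecs n d" and a: "length a = n"
  shows "(cst v, a) [^]\<^bsub>G\<^esub> (k::int) = (cst (geo (exv a) k \<star> v), map ((*) k) a)"
proof -
  interpret group G by (rule group_G)
  define c where "c k = (cst (geo (exv a) k \<star> v), map ((*) k) a)" for k :: int
  have gl: "geo (exv a) k \<star> v \<in> lvecs n d" for k using v a by auto
  have carr: "c k \<in> carrier G" for k using gl a by (auto simp: c_def G_simps)
  have add: "c k \<otimes>\<^bsub>G\<^esub> c l = c (k + l)" for k l
  proof -
    have "vec_add (map ((*) k) a) (map ((*) l) a) = map ((*) (k + l)) a"
      by (auto intro!: nth_equalityI simp: vec_add_def algebra_simps)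
    moreover have "geo (exv a) k \<star> v + mon (exv (map ((*) k) a)) \<star> geo (exv a) l \<star> v = geo (exv a) (k + l) \<star> v"
      by (simp add: geo_add exv_iscale smul_simps)
    ultimately show ?thesis using a gl by (simp add: c_def G_mult)
  qed
  have c0: "c 0 = \<one>\<^bsub>G\<^esub>" using a by (auto simp: c_def G_simps smul_simps intro: nth_equalityI)
  have c1: "c 1 = (cst v, a)"
    using geo_step[of "exv a" 0] by (simp add: c_def smul_simps map_idI)
  have nat: "(cst v, a) [^]\<^bsub>G\<^esub> (m::nat) = c (int m)" for m
  proof (induction m)
    case (Suc m)
    have "(cst v, a) [^]\<^bsub>G\<^esub> Suc m = c (int m) \<otimes>\<^bsub>G\<^esub> c 1" using Suc c1 by simp
    then show ?case by (simp add: add algebra_simps)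
  qed (simp add: c0)
  have "(cst v, a) [^]\<^bsub>G\<^esub> k = c k"
  proof (cases "k < 0")
    case True
    have "inv\<^bsub>G\<^esub> (c (- k)) = c k" by (rule inv_equality) (simp_all add: add c0 carr)
    moreover have "(cst v, a) [^]\<^bsub>G\<^esub> nat (- k) = c (- k)" using True nat[of "nat (- k)"] by simp
    ultimately show ?thesis using True by (simp only: int_pow_def2 if_True)
  next
    case False
    moreover have "(cst v, a) [^]\<^bsub>G\<^esub> nat k = c k" using False nat[of "nat k"] by simp
    ultimately show ?thesis by (simp only: int_pow_def2 if_False)
  qed
  then show ?thesis by (simp add: c_def)
qed

lemma ppv_lvecs:
  "\<forall>h\<in>set hs. fst h \<in> lvecs n d \<and> length (snd h) = n \<Longrightarrow> ppv hs ks \<in> lvecs n d"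
  by (induction hs ks rule: ppv.induct) auto

lemma G_power_product:
  assumes "\<forall>h\<in>set hs. fst h \<in> lvecs n d \<and> length (snd h) = n" "length ks = length hs"
  shows "\<exists>c. length c = n \<and> exv c = ppx hs ks \<and>
    power_product G (map (\<lambda>h. (cst (fst h), snd h)) hs) ks = (cst (ppv hs ks), c)"
  using assms
proof (induction hs arbitrary: ks)
  case Nil
  then show ?case by (auto simp: power_product_def G_simps intro!: exI[of _ "replicate n 0"])
next
  case (Cons h hs)
  then obtain k ks' where ks: "ks = k # ks'" by (cases ks) auto
  obtain v a where h: "h = (v, a)" by (cases h)
  have va: "v \<in> lvecs n d" "length a = n" using Cons.prems(1) h by auto
  obtain c where c: "length c = n" "exv c = ppx hs ks'"
     "power_product G (map (\<lambda>h. (cst (fst h), snd h)) hs) ks' = (cst (ppv hs ks'), c)"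
    using Cons.IH[of ks'] Cons.prems ks by auto
  have "power_product G (map (\<lambda>h. (cst (fst h), snd h)) (h # hs)) ks =
      (cst v, a) [^]\<^bsub>G\<^esub> k \<otimes>\<^bsub>G\<^esub> (cst (ppv hs ks'), c)"
    using c(3) by (simp add: power_product_def ks h)
  also have "\<dots> = (cst (ppv (h # hs) ks), vec_add (map ((*) k) a) c)"
    using va ppv_lvecs[of hs ks'] Cons.prems(1) by (simp add: G_int_pow G_mult lvecs_closed h ks exv_iscale)
  finally show ?case using va c(1,2)
    by (intro exI[of _ "vec_add (map ((*) k) a) c"]) (simp add: exv_vec_add exv_iscale h ks)
qed

lemma G_solution_iff:
  assumes "\<forall>h\<in>set hs. fst h \<in> lvecs n d \<and> length (snd h) = n" "length ks = length hs"
    and "v \<in> lvecs n d" "length a = n"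
  shows "power_product G (map (\<lambda>h. (cst (fst h), snd h)) hs) ks = (cst v, a) \<longleftrightarrow>
     ppv hs ks - v \<in> N \<and> ppx hs ks = exv a"
proof -
  obtain c where c: "length c = n" "exv c = ppx hs ks"
    "power_product G (map (\<lambda>h. (cst (fst h), snd h)) hs) ks = (cst (ppv hs ks), c)"
    using G_power_product[OF assms(1,2)] by blast
  have "c = a \<longleftrightarrow> ppx hs ks = exv a" using c(1,2) assms(4) by (metis exv_inject)
  then show ?thesis using c(3) assms(3) ppv_lvecs[OF assms(1)] by (simp add: cst_eq_iff)
qed

end

text \<open>Modulo p the coefficients of f are constant along x, x - a, x - 2 a, ... This
  progression is infinite for nonzero a, but the support is finite.\<close>

lemma lpoly_cancel_mon_minus_1:
  assumes "of_nat p dvd f * (mon a - 1)" "a \<noteq> 0" shows "of_nat p dvd f"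
proof (rule ccontr)
  assume "\<not> of_nat p dvd f"
  then obtain x where x: "\<not> int p dvd Poly_Mapping.lookup f x" by (auto simp: of_nat_dvd_lpoly_iff)
  have step: "int p dvd Poly_Mapping.lookup f (y - a) - Poly_Mapping.lookup f y" for y
    using assms(1) by (simp add: of_nat_dvd_lpoly_iff right_diff_distrib mult.commute[of f] lookup_minus lookup_mon_mult)
  have nz: "\<not> int p dvd Poly_Mapping.lookup f (x - iscale (int k) a)" for k
  proof (induction k)
    case (Suc k)
    have "x - iscale (int (Suc k)) a = x - iscale (int k) a - a"
      by (auto simp: iscale_def fun_eq_iff fun_app algebra_simps)
    then have "int p dvd Poly_Mapping.lookup f (x - iscale (int (Suc k)) a) - Poly_Mapping.lookup f (x - iscale (int k) a)"
      using step[of "x - iscale (int k) a"] by (simp only:)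
    then show ?case using Suc by (metis dvd_diff_right_iff)
  qed (use x in simp)
  have "range (\<lambda>k. x - iscale (int k) a) \<subseteq> Poly_Mapping.keys f"
    using nz by (auto simp: in_keys_iff) (metis dvd_0_right)
  then have "finite (range (\<lambda>k. x - iscale (int k) a))" by (rule finite_subset) simp
  moreover have "inj (\<lambda>k. x - iscale (int k) a)"
  proof (rule injI)
    fix k l assume "x - iscale (int k) a = x - iscale (int l) a"
    then have "int k * a i = int l * a i" for i by (auto simp: iscale_def fun_eq_iff fun_app)
    moreover obtain i where "a i \<noteq> 0" using assms(2) by (auto simp: fun_eq_iff fun_app)
    ultimately show "k = l" by (metis mult_cancel_right of_nat_eq_iff)
  qed
  ultimately show False using finite_imageD by blast
qed

lemma submod_sum:
  "submod p n K M \<Longrightarrow> (\<And>i. i \<in> I \<Longrightarrow> f i \<in> M) \<Longrightarrow> sum f I \<in> M"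
  by (induction I rule: infinite_finite_induct) (auto intro: submodD(2,3))

lemma expos_mono: "n \<le> n' \<Longrightarrow> expos n \<subseteq> expos n'"
  by (auto simp: expos_def)

lemma lpolys_mono: "n \<le> n' \<Longrightarrow> f \<in> lpolys n \<Longrightarrow> f \<in> lpolys n'"
  using expos_mono[of n n'] by (auto simp: lpolys_def)

lemma lvecs_mono: "n \<le> n' \<Longrightarrow> d \<le> d' \<Longrightarrow> v \<in> lvecs n d \<Longrightarrow> v \<in> lvecs n' d'"
  using lpolys_mono[of n n'] by (auto simp: lvecs_def)

text \<open>
  Geometric sums are removed by adjoining a variable \<open>t\<close> acting trivially on the given module and,
  for every \<open>j\<close>, a generator \<open>z\<close> with \<open>(u - 1) z = y j\<close>, where \<open>u\<close> is the monomial with exponent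
  \<open>al j\<close>; then \<open>(u ^ k - 1) z\<close> is the \<open>k\<close>-th geometric sum applied to \<open>y j\<close>. The purpose of \<open>t\<close> is to
  make \<open>u\<close> different from 1. A last free generator records the \<open>\<int>\<^sup>n\<close>-component.
\<close>

locale knapsack =
  fixes p n d m :: nat and Y :: "lvec set" and y :: "nat \<Rightarrow> lvec" and x :: "nat \<Rightarrow> expo"
    and yg :: lvec and xg :: expo
  assumes prime: "prime p" and Y: "Y \<subseteq> lvecs n d" and y: "\<And>j. j < m \<Longrightarrow> y j \<in> lvecs n d"
    and x: "\<And>j. j < m \<Longrightarrow> x j \<in> expos n" and yg: "yg \<in> lvecs n d" and xg: "xg \<in> expos n"
begin

definition tau :: expo where "tau = (\<lambda>i. if i = n then 1 else 0)"
definition al :: "nat \<Rightarrow> expo" where "al j = x j + tau"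

text \<open>Positions below d carry the given module, d + j the generator adjoined for h_j, and d +
  m the free generator. The variable t acts trivially on the first and the last kind; on the middle
  ones it keeps \<open>mon (al j) - 1\<close> from being zero.\<close>

definition rels :: "lvec set" where
  "rels = Y \<union> (\<lambda>i. bvec (mon tau - 1) i) ` {..<d} \<union>
     (\<lambda>j. bvec (mon (al j) - 1) (d + j) - y j) ` {..<m} \<union> {bvec (mon tau - 1) (d + m)}"

definition lsum :: "(nat \<Rightarrow> int) \<Rightarrow> nat \<Rightarrow> expo" where
  "lsum k j = (\<Sum>i<j. iscale (k i) (al i))"

text \<open>Modulo the relations the j-th difference becomes the monomial of the first j powers
  times a geometric sum applied to \<open>y j\<close>, which is the contribution of h_j to the
  product. The last summand vanishes exactly if the lattice components agree after t = 1.\<close>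

definition lhs :: "(nat \<Rightarrow> int) \<Rightarrow> lvec" where
  "lhs k = (\<Sum>j<m. bvec (mon (lsum k (Suc j)) - mon (lsum k j)) (d + j)) - yg +
     bvec (mon (lsum k m) - mon xg) (d + m)"

abbreviation "n' \<equiv> Suc n"
abbreviation "K' \<equiv> d + m + 1"

definition N where "N = span_submod p n d Y"
definition N' where "N' = span_submod p n' K' rels"

lemma p_pos: "p > 0" using prime by (simp add: prime_gt_0_nat)

lemma tau_expos: "tau \<in> expos n'" by (simp add: tau_def expos_def)

lemma expos_Suc: "a \<in> expos n \<Longrightarrow> a \<in> expos n'" using expos_mono[of n n'] by auto

lemma al_expos: "j < m \<Longrightarrow> al j \<in> expos n'"
  unfolding al_def by (intro expos_closed expos_Suc x tau_expos)

lemma al_nonzero: "j < m \<Longrightarrow> al j \<noteq> 0"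
proof
  assume "j < m" "al j = 0"
  then have "al j n = 0" by (simp add: zero_fun_apply)
  then have "x j n + tau n = 0" "x j n = 0" using x[OF \<open>j < m\<close>] by (auto simp: al_def fun_app expos_def)
  then show False by (simp add: tau_def)
qed

lemma lift: "v \<in> lvecs n d \<Longrightarrow> v \<in> lvecs n' K'"
  by (rule lvecs_mono[of n n' d K']) auto

lemma lsum_expos: "j \<le> m \<Longrightarrow> lsum k j \<in> expos n'"
  by (induction j) (auto simp: lsum_def intro!: expos_closed iscale_expos al_expos)

lemma rels_lvecs: "rels \<subseteq> lvecs n' K'"
  using Y y lift by (auto simp: rels_def intro!: lvecs_closed bvec_lvecs lpolys_closed tau_expos al_expos)

lemma N: "submod p n d N" unfolding N_def by (rule submod_span[OF Y])

lemma N': "submod p n' K' N'" unfolding N'_def by (rule submod_span[OF rels_lvecs])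

lemma rels_N': "v \<in> rels \<Longrightarrow> v \<in> N'"
  using span_superset[of rels p n' K'] by (auto simp: N'_def)

lemma N_subset_N': "v \<in> N \<Longrightarrow> v \<in> N'"
proof -
  have "submod p n d (N' \<inter> lvecs n d)"
    unfolding submod_def
  proof (intro conjI ballI)
    show "mon a \<star> v \<in> N' \<inter> lvecs n d" if "v \<in> N' \<inter> lvecs n d" "a \<in> expos n" for v a
      using that submodD(4)[OF N'] expos_Suc by auto
    show "of_nat p \<star> v \<in> N' \<inter> lvecs n d" if "v \<in> lvecs n d" for v
      using that submodD(5)[OF N' lift] by auto
  qed (use submodD(2,3)[OF N'] in auto)
  moreover have "Y \<subseteq> N' \<inter> lvecs n d" using Y rels_N' by (auto simp: rels_def)
  ultimately have "N \<subseteq> N' \<inter> lvecs n d" unfolding N_def by (rule span_least)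
  then show "v \<in> N \<Longrightarrow> v \<in> N'" by blast
qed

text \<open>On exponents, the substitution t = 1.\<close>

definition cl :: "expo \<Rightarrow> expo" where "cl a = a(n := 0)"

lemma cl_add: "cl (a + b) = cl a + cl b"
  by (auto simp: cl_def fun_eq_iff fun_app)

lemma cl_expos: "a \<in> expos n' \<Longrightarrow> cl a \<in> expos n"
proof -
  assume a: "a \<in> expos n'"
  have "cl a i = 0" if "i \<ge> n" for i
    using a that by (cases "i = n") (simp_all add: cl_def expos_def)
  then show ?thesis by (simp add: expos_def)
qed

lemma cl_id: "a \<in> expos n \<Longrightarrow> cl a = a"
  by (auto simp: cl_def expos_def fun_eq_iff)

lemma cl_tau [simp]: "cl tau = 0"
  by (auto simp: cl_def tau_def fun_eq_iff fun_app)

lemma cl_al: "j < m \<Longrightarrow> cl (al j) = x j"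
  using x[of j] by (simp add: al_def cl_add cl_id)

abbreviation "col \<equiv> push cl"

lemmas col_mult = push_mult[OF cl_add]

lemma col_1 [simp]: "col 1 = 1" by (rule push_1[OF cl_add])

lemma col_lpolys: "f \<in> lpolys n' \<Longrightarrow> col f \<in> lpolys n"
  by (rule push_lpolys) (auto intro: cl_expos)

lemma col_id: "f \<in> lpolys n \<Longrightarrow> col f = f"
  by (induction rule: lpolys_induct) (auto simp: cl_id)

lemma col_dvd: "of_nat p dvd f \<Longrightarrow> of_nat p dvd col f"
  by (auto simp: dvd_def col_mult push_of_nat[OF cl_add])

lemma tau_acts: assumes "v \<in> lvecs n d" shows "(mon tau - 1) \<star> v \<in> N'"
  using assms
proof (induction rule: lvecs_induct)
  case zero
  then show ?case using submodD(2)[OF N'] by (simp add: smul_simps(7))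
next
  case (mon b i)
  have "mon b \<star> bvec (mon tau - 1) i \<in> N'"
    by (intro submodD(4)[OF N'] rels_N' expos_Suc mon) (use mon in \<open>auto simp: rels_def\<close>)
  moreover have "mon b \<star> bvec (mon tau - 1) i = (mon tau - 1) \<star> bvec (mon b) i"
    by (simp only: bvec_simps(4) mult.commute)
  ultimately show ?case by (simp only:)
next
  case (diff u v)
  then show ?case using submod_diff[OF N' diff(3,4) p_pos] by (simp only: smul_simps(2))
qed

text \<open>The difference of X^a and its value at t = 1 is a multiple of t - 1, which acts as zero
  on the given module.\<close>

lemma collapse: assumes "f \<in> lpolys n'" "v \<in> lvecs n d" shows "f \<star> v - col f \<star> v \<in> N'"
  using assms(1)
proof (induction rule: lpolys_induct)
  case zero
  then show ?case using submodD(2)[OF N'] by simp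
next
  case (mon a)
  have a: "a = cl a + iscale (a n) tau"
    by (auto simp: cl_def tau_def iscale_def fun_eq_iff fun_app)
  have "mon a - mon (cl a) = mon (cl a) * (mon (iscale (a n) tau) - 1)"
    using arg_cong[OF a, of mon] by (simp add: mon_mult right_diff_distrib)
  also have "mon (iscale (a n) tau) - 1 = (mon tau - 1) * geo tau (a n)" by (simp only: geo_mult)
  finally have "mon a \<star> v - col (mon a) \<star> v = (mon (cl a) * geo tau (a n)) \<star> (mon tau - 1) \<star> v"
    by (simp only: push_simps smul_simps(4)[symmetric] smul_simps(8)[symmetric]) (simp only: mult_ac)
  moreover have "(mon (cl a) * geo tau (a n)) \<star> (mon tau - 1) \<star> v \<in> N'"
    using expos_Suc[OF cl_expos[OF mon]]
    by (intro submod_smul[OF N' _ tau_acts[OF assms(2)] p_pos] lpolys_closed geo_lpolys tau_expos)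
  ultimately show ?case by (simp only:)
next
  case (diff f g)
  have "(f - g) \<star> v - col (f - g) \<star> v = (f \<star> v - col f \<star> v) - (g \<star> v - col g \<star> v)"
    by (simp add: smul_simps)
  then show ?case using submod_diff[OF N' diff(3,4) p_pos] by (simp only:)
qed

definition px :: "(nat \<Rightarrow> int) \<Rightarrow> nat \<Rightarrow> expo" where "px k j = (\<Sum>i<j. iscale (k i) (x i))"

definition py :: "(nat \<Rightarrow> int) \<Rightarrow> lvec" where
  "py k = (\<Sum>j<m. (mon (px k j) * geo (x j) (k j)) \<star> y j)"

lemma cl_iscale: "cl (iscale k a) = iscale k (cl a)"
  by (auto simp: cl_def iscale_def fun_eq_iff)

lemma cl_lsum: "j \<le> m \<Longrightarrow> cl (lsum k j) = px k j"
proof (induction j)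
  case 0
  have "cl 0 = 0" by (auto simp: cl_def fun_eq_iff fun_app)
  then show ?case by (simp add: lsum_def px_def)
qed (simp add: lsum_def px_def cl_add cl_iscale cl_al)

lemma col_geo: "col (geo a k) = geo (cl a) k"
  by (simp add: geo_def push_sum cl_iscale)

lemma lsum_diff:
  "mon (lsum k (Suc j)) - mon (lsum k j) = (mon (lsum k j) * geo (al j) (k j)) * (mon (al j) - 1)"
proof -
  have "mon (lsum k (Suc j)) = mon (lsum k j) * mon (iscale (k j) (al j))"
    by (simp add: lsum_def mon_mult)
  then have "mon (lsum k (Suc j)) - mon (lsum k j) = mon (lsum k j) * (mon (iscale (k j) (al j)) - 1)"
    by (simp add: right_diff_distrib)
  also have "\<dots> = mon (lsum k j) * ((mon (al j) - 1) * geo (al j) (k j))" by (simp only: geo_mult)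
  finally show ?thesis by (simp only: mult_ac)
qed

lemma lhs_cong: "(\<Sum>j<m. bvec (mon (lsum k (Suc j)) - mon (lsum k j)) (d + j)) - py k \<in> N'"
proof -
  have "bvec (mon (lsum k (Suc j)) - mon (lsum k j)) (d + j) - (mon (px k j) * geo (x j) (k j)) \<star> y j \<in> N'"
    if j: "j < m" for j
  proof -
    let ?c = "mon (lsum k j) * geo (al j) (k j)"
    have c: "?c \<in> lpolys n'" using j by (intro lpolys_closed lsum_expos geo_lpolys al_expos) auto
    have "?c \<star> (bvec (mon (al j) - 1) (d + j) - y j) \<in> N'"
      by (intro submod_smul[OF N' c _ p_pos] rels_N') (use j in \<open>auto simp: rels_def\<close>)
    moreover have "?c \<star> y j - col ?c \<star> y j \<in> N'" by (rule collapse[OF c y[OF j]])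
    ultimately have "?c \<star> (bvec (mon (al j) - 1) (d + j) - y j) + (?c \<star> y j - col ?c \<star> y j) \<in> N'"
      by (rule submodD(3)[OF N'])
    moreover have "col ?c = mon (px k j) * geo (x j) (k j)"
      using j by (simp add: col_mult cl_lsum col_geo cl_al)
    moreover have "?c \<star> bvec (mon (al j) - 1) (d + j) = bvec (mon (lsum k (Suc j)) - mon (lsum k j)) (d + j)"
      by (simp only: bvec_simps(4) lsum_diff)
    moreover have "?c \<star> (bvec (mon (al j) - 1) (d + j) - y j) + (?c \<star> y j - col ?c \<star> y j) =
        ?c \<star> bvec (mon (al j) - 1) (d + j) - col ?c \<star> y j"
      by (simp only: smul_simps(2) add_diff_eq diff_add_cancel)
    ultimately show ?thesis by (simp only:)
  qed
  then have "(\<Sum>j<m. bvec (mon (lsum k (Suc j)) - mon (lsum k j)) (d + j) - (mon (px k j) * geo (x j) (k j)) \<star> y j) \<in> N'"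
    by (intro submod_sum[OF N']) auto
  then show ?thesis by (simp add: py_def sum_subtractf)
qed

lemma lhs_if: assumes "py k - yg \<in> N" "px k m = xg" shows "lhs k \<in> N'"
proof -
  let ?A = "\<Sum>j<m. bvec (mon (lsum k (Suc j)) - mon (lsum k j)) (d + j)"
  let ?a = "lsum k m"
  have am: "?a \<in> expos n'" by (rule lsum_expos) simp
  have "?a = xg + iscale (?a n) tau"
    using cl_lsum[of m k] assms(2) by (auto simp: cl_def tau_def iscale_def fun_eq_iff fun_app split: if_splits)
  then have "mon ?a = mon xg * mon (iscale (?a n) tau)" using mon_mult by metis
  then have "mon ?a - mon xg = mon xg * (mon (iscale (?a n) tau) - 1)" by (simp add: right_diff_distrib)
  also have "\<dots> = (mon xg * geo tau (?a n)) * (mon tau - 1)" by (simp only: geo_mult[symmetric] mult_ac)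
  finally have "bvec (mon ?a - mon xg) (d + m) = (mon xg * geo tau (?a n)) \<star> bvec (mon tau - 1) (d + m)"
    by (simp only: bvec_simps(4))
  moreover have "(mon xg * geo tau (?a n)) \<star> bvec (mon tau - 1) (d + m) \<in> N'"
    by (intro submod_smul[OF N' _ _ p_pos] rels_N' lpolys_closed geo_lpolys tau_expos expos_Suc xg)
      (simp add: rels_def)
  ultimately have 1: "bvec (mon ?a - mon xg) (d + m) \<in> N'" by (simp only:)
  have "?A - py k + (py k - yg) \<in> N'" by (rule submodD(3)[OF N' lhs_cong N_subset_N'[OF assms(1)]])
  from submodD(3)[OF N' this 1] show ?thesis by (simp add: lhs_def)
qed

definition colv :: "lvec \<Rightarrow> lvec" where "colv v = (\<lambda>i. if i < d then col (v i) else 0)"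

lemma colv_simps: "colv (u + v) = colv u + colv v" "colv (u - v) = colv u - colv v" "colv (f \<star> v) = col f \<star> colv v" "colv 0 = 0"
  by (auto simp: colv_def fun_eq_iff fun_app col_mult)

lemma colv_lvecs: "v \<in> lvecs n' K' \<Longrightarrow> colv v \<in> lvecs n d"
  by (auto simp: colv_def lvecs_def intro: col_lpolys)

lemma colv_id: "v \<in> lvecs n d \<Longrightarrow> colv v = v"
  by (auto simp: colv_def lvecs_def fun_eq_iff intro: col_id)

lemma colv_bvec: "colv (bvec f i) = (if i < d then bvec (col f) i else 0)"
  by (auto simp: colv_def bvec_def fun_eq_iff fun_app)

text \<open>An invariant of membership in N': c_j is the multiplier of the j-th adjoined relation.
  Since \<open>mon (al j) - 1\<close> is not a zero divisor modulo p, the entry at d + j determines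
  c_j modulo p, so the invariant can be evaluated at \<open>lhs\<close>.\<close>

definition wit :: "lvec \<Rightarrow> (nat \<Rightarrow> lpoly) \<Rightarrow> bool" where
  "wit v c \<longleftrightarrow> (\<forall>j<m. c j \<in> lpolys n' \<and> of_nat p dvd v (d + j) - c j * (mon (al j) - 1)) \<and>
     colv v + (\<Sum>j<m. col (c j) \<star> y j) \<in> N \<and> of_nat p dvd col (v (d + m))"

lemma wit_zero: "colv v \<in> N \<Longrightarrow> (\<And>j. j < m \<Longrightarrow> of_nat p dvd v (d + j)) \<Longrightarrow> of_nat p dvd col (v (d + m)) \<Longrightarrow> wit v (\<lambda>_. 0)"
  by (auto simp: wit_def smul_simps)

lemma N'_wit: assumes "v \<in> N'" shows "\<exists>c. wit v c"
proof -
  let ?M = "{v \<in> lvecs n' K'. \<exists>c. wit v c}"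
  have "submod p n' K' ?M"
    unfolding submod_def
  proof (intro conjI ballI)
    show "0 \<in> ?M"
      using wit_zero[of 0] submodD(2)[OF N] by (auto simp: colv_simps fun_app)
    show "u + v \<in> ?M" if uv: "u \<in> ?M" "v \<in> ?M" for u v
    proof -
      obtain c c' where c: "wit u c" "wit v c'" using uv by blast
      have "wit (u + v) (\<lambda>j. c j + c' j)"
        unfolding wit_def
      proof (intro conjI allI impI)
        fix j assume j: "j < m"
        show "c j + c' j \<in> lpolys n'" using c j by (auto simp: wit_def)
        have "of_nat p dvd (u (d + j) - c j * (mon (al j) - 1)) + (v (d + j) - c' j * (mon (al j) - 1))"
          by (rule dvd_add) (use c j in \<open>auto simp: wit_def\<close>)
        then show "of_nat p dvd (u + v) (d + j) - (c j + c' j) * (mon (al j) - 1)"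
          by (simp add: fun_app algebra_simps)
      next
        have "colv u + (\<Sum>j<m. col (c j) \<star> y j) + (colv v + (\<Sum>j<m. col (c' j) \<star> y j)) \<in> N"
          by (rule submodD(3)[OF N]) (use c in \<open>auto simp: wit_def\<close>)
        then show "colv (u + v) + (\<Sum>j<m. col (c j + c' j) \<star> y j) \<in> N"
          by (simp add: colv_simps smul_simps sum.distrib algebra_simps)
        show "of_nat p dvd col ((u + v) (d + m))"
          using c by (auto simp: wit_def fun_app intro: dvd_add)
      qed
      then show ?thesis using uv by auto
    qed
    show "mon a \<star> v \<in> ?M" if v: "v \<in> ?M" and a: "a \<in> expos n'" for v a
    proof -
      obtain c where c: "wit v c" using v by blast
      have "wit (mon a \<star> v) (\<lambda>j. mon a * c j)"
        unfolding wit_def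
      proof (intro conjI allI impI)
        fix j assume j: "j < m"
        show "mon a * c j \<in> lpolys n'" using c j a by (auto simp: wit_def)
        have "of_nat p dvd mon a * (v (d + j) - c j * (mon (al j) - 1))"
          by (rule dvd_mult) (use c j in \<open>auto simp: wit_def\<close>)
        then show "of_nat p dvd (mon a \<star> v) (d + j) - mon a * c j * (mon (al j) - 1)"
          by (simp add: fun_app algebra_simps)
      next
        have "mon (cl a) \<star> (colv v + (\<Sum>j<m. col (c j) \<star> y j)) \<in> N"
          by (intro submodD(4)[OF N] cl_expos a) (use c in \<open>auto simp: wit_def\<close>)
        then show "colv (mon a \<star> v) + (\<Sum>j<m. col (mon a * c j) \<star> y j) \<in> N"
          by (simp add: colv_simps smul_simps smul_sum_right col_mult)
        show "of_nat p dvd col ((mon a \<star> v) (d + m))"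
          using c by (auto simp: wit_def fun_app col_mult intro: dvd_mult)
      qed
      then show ?thesis using v a by auto
    qed
    show "of_nat p \<star> v \<in> ?M" if v: "v \<in> lvecs n' K'" for v
    proof -
      have "wit (of_nat p \<star> v) (\<lambda>_. 0)"
        by (rule wit_zero)
          (use submodD(5)[OF N colv_lvecs[OF v]] in \<open>auto simp: colv_simps push_of_nat[OF cl_add] fun_app col_mult\<close>)
      then show ?thesis using v by auto
    qed
  qed auto
  moreover have "\<exists>c. wit v c" if vr: "v \<in> rels" for v
  proof -
    consider "v \<in> Y" | i where "i < d" "v = bvec (mon tau - 1) i"
      | j where "j < m" "v = bvec (mon (al j) - 1) (d + j) - y j" | "v = bvec (mon tau - 1) (d + m)"
      using vr unfolding rels_def by blast
    then show ?thesis
    proof cases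
      case 1
      then have "v \<in> N" unfolding N_def using span_superset by blast
      then have "v \<in> lvecs n d" using submodD(1)[OF N] by blast
      then have "wit v (\<lambda>_. 0)" using \<open>v \<in> N\<close> by (intro wit_zero) (auto simp: colv_id, auto simp: lvecs_def)
      then show ?thesis by blast
    next
      case 2
      have "colv v = 0" unfolding 2(2) colv_bvec by simp
      moreover have "v (d + j) = 0" for j using 2(1) by (simp add: 2(2) bvec_def del: bvec_simps)
      ultimately have "wit v (\<lambda>_. 0)" using submodD(2)[OF N] by (intro wit_zero) auto
      then show ?thesis by blast
    next
      case 3
      have y0: "y j (d + i) = 0" for i using y[OF 3(1)] by (simp add: lvecs_def)
      have "(\<Sum>i<m. col (if i = j then 1 else 0) \<star> y i) = (\<Sum>i<m. if i = j then y j else 0)"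
        by (rule sum.cong) (auto simp: smul_simps)
      then have "(\<Sum>i<m. col (if i = j then 1 else 0) \<star> y i) = y j" using 3(1) by simp
      moreover have "colv v = - y j" using colv_id[OF y[OF 3(1)]] by (simp add: 3(2) colv_simps colv_bvec)
      moreover have "col (v (d + m)) = 0" using 3 by (simp add: fun_app y0 bvec_def)
      ultimately have "wit v (\<lambda>i. if i = j then 1 else 0)"
        using submodD(2)[OF N] by (auto simp: wit_def 3(2) fun_app y0 bvec_def)
      then show ?thesis by blast
    next
      case 4
      have "colv v = 0" unfolding 4 colv_bvec by simp
      moreover have "v (d + j) = 0" if "j < m" for j using that by (simp add: 4 bvec_def del: bvec_simps)
      moreover have "col (v (d + m)) = 0" by (simp add: 4 bvec_def del: bvec_simps)
      ultimately have "wit v (\<lambda>_. 0)" using submodD(2)[OF N] by (intro wit_zero) auto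
      then show ?thesis by blast
    qed
  qed
  then have "rels \<subseteq> ?M" using rels_lvecs by blast
  ultimately have "N' \<subseteq> ?M" unfolding N'_def by (rule span_least)
  then show ?thesis using assms by blast
qed

lemma lhs_only_if: assumes "lhs k \<in> N'" shows "py k - yg \<in> N" "px k m = xg"
proof -
  let ?A = "\<Sum>j<m. bvec (mon (lsum k (Suc j)) - mon (lsum k j)) (d + j)"
  obtain c where c: "wit (lhs k) c" using N'_wit[OF assms] by blast
  have A_app: "?A i = (\<Sum>j<m. bvec (mon (lsum k (Suc j)) - mon (lsum k j)) (d + j) i)" for i
    by (induction m) (auto simp: fun_app)
  have yg0: "yg (d + i) = 0" for i using yg by (simp add: lvecs_def)
  have lj: "lhs k (d + j) = mon (lsum k (Suc j)) - mon (lsum k j)" if j: "j < m" for j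
  proof -
    have "?A (d + j) = (\<Sum>i<m. if i = j then mon (lsum k (Suc j)) - mon (lsum k j) else 0)"
      unfolding A_app by (rule sum.cong) (auto simp: bvec_def)
    then show ?thesis using j by (simp add: lhs_def fun_app yg0) (simp add: bvec_def)
  qed
  have lm: "lhs k (d + m) = mon (lsum k m) - mon xg"
  proof -
    have "?A (d + m) = 0" unfolding A_app by (rule sum.neutral) (auto simp: bvec_def)
    then show ?thesis by (simp add: lhs_def fun_app yg0) (simp add: bvec_def)
  qed
  have lc: "colv (lhs k) = - yg"
  proof -
    have "colv ?A = 0" unfolding colv_def A_app by (auto simp: fun_eq_iff fun_app bvec_def intro!: sum.neutral)
    then show ?thesis unfolding lhs_def by (simp add: colv_simps colv_id[OF yg] colv_bvec)
  qed
  have "of_nat p dvd mon (px k m) - mon xg"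
    using c cl_lsum[of m k] by (simp add: wit_def lm cl_id[OF xg])
  then have "int p dvd Poly_Mapping.lookup (mon (px k m) - mon xg) (px k m)"
    by (simp only: of_nat_dvd_lpoly_iff)
  then have "px k m \<noteq> xg \<Longrightarrow> int p dvd 1" by (simp add: lookup_minus)
  then show "px k m = xg" using prime_gt_1_nat[OF prime] by force
  \<comment> \<open>Cancelling \<open>mon (al j) - 1\<close> identifies the multiplier with the
    geometric sum; this is where \<open>al j\<close> has to be nonzero.\<close>
  have cj: "of_nat p dvd c j - mon (lsum k j) * geo (al j) (k j)" if j: "j < m" for j
  proof -
    have "of_nat p dvd lhs k (d + j) - c j * (mon (al j) - 1)" using c j by (simp add: wit_def)
    then have "of_nat p dvd (mon (lsum k j) * geo (al j) (k j) - c j) * (mon (al j) - 1)"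
      by (simp add: lj[OF j] lsum_diff left_diff_distrib)
    then have "of_nat p dvd mon (lsum k j) * geo (al j) (k j) - c j"
      using al_nonzero[OF j] by (rule lpoly_cancel_mon_minus_1)
    then show ?thesis by (metis dvd_minus_iff minus_diff_eq)
  qed
  have cN: "- yg + (\<Sum>j<m. col (c j) \<star> y j) \<in> N" using c by (simp add: wit_def lc)
  have "col (c j) \<star> y j - (mon (px k j) * geo (x j) (k j)) \<star> y j \<in> N" if j: "j < m" for j
  proof (rule submod_mod_p[OF N])
    have "c j \<in> lpolys n'" using c j by (simp add: wit_def)
    moreover have "px k j \<in> expos n" using cl_expos[OF lsum_expos[of j k]] cl_lsum[of j k] j by simp
    ultimately show "col (c j) \<star> y j - (mon (px k j) * geo (x j) (k j)) \<star> y j \<in> lvecs n d"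
      using j by (intro lvecs_closed col_lpolys lpolys_closed geo_lpolys x y) auto
    have "of_nat p dvd col (c j) - mon (px k j) * geo (x j) (k j)"
      using col_dvd[OF cj[OF j]] j by (simp add: col_mult cl_lsum col_geo cl_al)
    then show "of_nat p dvd (col (c j) \<star> y j - (mon (px k j) * geo (x j) (k j)) \<star> y j) i" for i
      by (simp add: fun_app left_diff_distrib[symmetric])
  qed
  then have "(\<Sum>j<m. col (c j) \<star> y j - (mon (px k j) * geo (x j) (k j)) \<star> y j) \<in> N"
    by (intro submod_sum[OF N]) auto
  from submod_diff[OF N cN this p_pos] show "py k - yg \<in> N" by (simp add: py_def sum_subtractf)
qed

theorem lhs_iff: "lhs k \<in> N' \<longleftrightarrow> py k - yg \<in> N \<and> px k m = xg"
  using lhs_if lhs_only_if by blast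

end

section \<open>Explicit data\<close>

type_synonym tm = "int \<times> nat \<times> int list"
text \<open>An entry (c, i, b, l) is read in two ways. In an equation it is c X^b X^(s_l) at
  position i, where s_l is the l-th partial sum of the unknown exponents. In a functional it is c
  times the value of array number i at a + b + s_l, where a is a shift.\<close>

type_synonym form = "(int \<times> nat \<times> int list \<times> nat) list"
type_synonym mcert = "(int list \<times> nat) list"

text \<open>Access with a default value: the checks have to be defined on arbitrary data.\<close>

definition nthd :: "'a list \<Rightarrow> nat \<Rightarrow> 'a \<Rightarrow> 'a" where
  "nthd xs i d = (case drop i xs of [] \<Rightarrow> d | y # ys \<Rightarrow> y)"

lemma nthd_nth [simp]: "i < length xs \<Longrightarrow> nthd xs i d = xs ! i"
  by (simp add: nthd_def Cons_nth_drop_Suc[symmetric])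

definition look :: "('a \<times> 'b) list \<Rightarrow> 'a \<Rightarrow> 'b \<Rightarrow> 'b" where
  "look l k d = (case filter (\<lambda>e. fst e = k) l of [] \<Rightarrow> d | e # es \<Rightarrow> snd e)"

lemma look_cases: "look l k d = d \<or> (\<exists>e\<in>set l. look l k d = snd e)"
proof (cases "filter (\<lambda>e. fst e = k) l")
  case (Cons e es)
  then have "e \<in> set l" by (auto dest!: filter_eq_ConsD)
  then show ?thesis using Cons by (auto simp: look_def)
qed (simp add: look_def)

lemma look_map:
  assumes "k \<in> set ks" shows "look (map (\<lambda>k. (k, f k)) ks) k d = f k"
proof -
  have "filter (\<lambda>e. fst e = k) (map (\<lambda>k. (k, f k)) ks) = map (\<lambda>k. (k, f k)) (filter (\<lambda>x. x = k) ks)"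
    by (simp add: filter_map comp_def)
  moreover have "filter (\<lambda>x. x = k) ks \<noteq> []" using assms by (simp add: filter_empty_conv)
  ultimately show ?thesis unfolding look_def
    by (cases "filter (\<lambda>x. x = k) ks") (auto dest!: filter_eq_ConsD)
qed

section \<open>Vectors as lists of terms, and certificates of membership\<close>

definition den_term :: "tm \<Rightarrow> lvec" where
  "den_term = (\<lambda>(c, i, a). of_int c \<star> bvec (mon (exv a)) i)"

definition den :: "tm list \<Rightarrow> lvec" where "den ts = sum_list (map den_term ts)"

definition wf_terms :: "nat \<Rightarrow> nat \<Rightarrow> tm list \<Rightarrow> bool" where
  "wf_terms n K ts \<longleftrightarrow> (\<forall>(c, i, a)\<in>set ts. i < K \<and> length a = n)"

lemma den_simps [simp]: "den [] = 0" "den (t # ts) = den_term t + den ts" "den (ts @ us) = den ts + den us"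
  by (simp_all add: den_def)

lemma den_lvecs: "wf_terms n K ts \<Longrightarrow> den ts \<in> lvecs n K"
proof (induction ts)
  case (Cons t ts)
  obtain c i a where t: "t = (c, i, a)" by (cases t)
  have "of_int c \<star> bvec (mon (exv a)) i \<in> lvecs n K"
    using Cons.prems t by (intro lvecs_closed lpolys_of_int bvec_lvecs lpolys_closed) (auto simp: wf_terms_def)
  then show ?case using Cons t by (auto simp: wf_terms_def den_term_def intro!: lvecs_closed)
qed simp

lemma lookup_den:
  assumes "\<forall>(c, i, a)\<in>set ts. length a = n" "length a = n"
  shows "Poly_Mapping.lookup (den ts i) (exv a) = sum_list (map fst (filter (\<lambda>y. snd y = (i, a)) ts))"
  using assms(1)
proof (induction ts)
  case (Cons t ts)
  obtain c j b where t: "t = (c, j, b)" by (cases t)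
  have "Poly_Mapping.lookup (den_term t i) (exv a) = (if j = i \<and> b = a then c else 0)"
    using Cons.prems assms(2) t by (auto simp: den_term_def fun_app bvec_def lookup_of_int_mult exv_inject)
  then show ?case using Cons t by (auto simp: fun_app lookup_add)
qed (simp add: fun_app)

text \<open>A monomial may occur several times in the list, so its coefficients are collected before
  divisibility is tested.\<close>

definition zero_terms :: "nat \<Rightarrow> tm list \<Rightarrow> bool" where
  "zero_terms p ts \<longleftrightarrow> (\<forall>x\<in>set ts. int p dvd sum_list (map fst (filter (\<lambda>y. snd y = snd x) ts)))"

lemma zero_terms_iff:
  assumes "wf_terms n K ts" shows "zero_terms p ts \<longleftrightarrow> (\<forall>i. of_nat p dvd den ts i)"
proof -
  have len: "\<forall>(c, i, a)\<in>set ts. length a = n" using assms by (auto simp: wf_terms_def)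
  have dl: "den ts \<in> lvecs n K" by (rule den_lvecs[OF assms])
  show ?thesis
  proof
    assume z: "zero_terms p ts"
    show "\<forall>i. of_nat p dvd den ts i"
      unfolding of_nat_dvd_lpoly_iff
    proof (intro allI)
      fix i x show "int p dvd Poly_Mapping.lookup (den ts i) x"
      proof (cases "x \<in> expos n")
        case True
        define a where "a = map x [0..<n]"
        have x: "x = exv a" "length a = n" using True by (simp_all add: a_def exv_map_upt)
        have l: "Poly_Mapping.lookup (den ts i) x = sum_list (map fst (filter (\<lambda>y. snd y = (i, a)) ts))"
          unfolding x(1) by (rule lookup_den[OF len x(2)])
        show ?thesis
        proof (cases "\<exists>y\<in>set ts. snd y = (i, a)")
          case True
          then show ?thesis using z unfolding l zero_terms_def by metis
        next
          case False
          then have "filter (\<lambda>y. snd y = (i, a)) ts = []" by (auto simp: filter_empty_conv)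
          then show ?thesis unfolding l by simp
        qed
      next
        case False
        then have "x \<notin> Poly_Mapping.keys (den ts i)" using dl by (auto simp: lvecs_def lpolys_def)
        then show ?thesis by (simp add: in_keys_iff)
      qed
    qed
  next
    assume d: "\<forall>i. of_nat p dvd den ts i"
    show "zero_terms p ts"
      unfolding zero_terms_def
    proof
      fix t assume t: "t \<in> set ts"
      obtain c i a where tt: "t = (c, i, a)" by (cases t)
      have "length a = n" using len t tt by auto
      from lookup_den[OF len this, of i] d show "int p dvd sum_list (map fst (filter (\<lambda>y. snd y = snd t) ts))"
        by (simp add: tt of_nat_dvd_lpoly_iff) metis
    qed
  qed
qed

definition shift_terms :: "int list \<Rightarrow> tm list \<Rightarrow> tm list" where
  "shift_terms b ts = map (\<lambda>(c, i, a). (c, i, vec_add a b)) ts"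

lemma wf_shift: "wf_terms n K ts \<Longrightarrow> length b = n \<Longrightarrow> wf_terms n K (shift_terms b ts)"
  by (auto simp: wf_terms_def shift_terms_def vec_add_def)

lemma den_shift: "wf_terms n K ts \<Longrightarrow> length b = n \<Longrightarrow> den (shift_terms b ts) = mon (exv b) \<star> den ts"
proof (induction ts)
  case (Cons t ts)
  obtain c i a where t: "t = (c, i, a)" by (cases t)
  have "length a = length b" "wf_terms n K ts" using Cons.prems t by (auto simp: wf_terms_def)
  then show ?case using Cons t
    by (simp add: shift_terms_def den_term_def exv_vec_add mon_mult[symmetric] smul_simps mult_ac del: bvec_simps)
      (simp add: smul_simps(8)[symmetric] mult_ac)
qed (simp add: shift_terms_def smul_simps)

definition cert_terms :: "tm list list \<Rightarrow> mcert \<Rightarrow> tm list" where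
  "cert_terms G cert = concat (map (\<lambda>(b, i). shift_terms b (nthd G i [])) cert)"

text \<open>A certificate lists the shifted generators that, added to t, give zero modulo p.
  Coefficients are expressed by repetition; signs are absorbed because -1 is p - 1 modulo p.\<close>

definition member_cert :: "nat \<Rightarrow> nat \<Rightarrow> tm list list \<Rightarrow> mcert \<Rightarrow> tm list \<Rightarrow> bool" where
  "member_cert n p G cert t \<longleftrightarrow> (\<forall>(b, i)\<in>set cert. length b = n \<and> i < length G) \<and>
     zero_terms p (t @ cert_terms G cert)"

lemma wf_cert:
  assumes "\<forall>g\<in>set G. wf_terms n K g" "\<forall>(b, i)\<in>set cert. length b = n \<and> i < length G"
  shows "wf_terms n K (cert_terms G cert)"
  using assms(2)
proof (induction cert)
  case (Cons e cert)
  obtain b i where e: "e = (b, i)" by (cases e)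
  have "wf_terms n K (shift_terms b (nthd G i []))" using Cons.prems e assms(1) by (intro wf_shift) auto
  then show ?case using Cons e by (auto simp: cert_terms_def wf_terms_def)
qed (simp add: cert_terms_def wf_terms_def)

lemma wf_append: "wf_terms n K (s @ t) \<longleftrightarrow> wf_terms n K s \<and> wf_terms n K t"
  by (simp add: wf_terms_def ball_Un)

lemma den_cert_shift:
  assumes "\<forall>g\<in>set G. wf_terms n K g" "\<forall>(b, i)\<in>set cert. length b = n \<and> i < length G" "length a = n"
  shows "den (cert_terms G (map (\<lambda>(b, i). (vec_add b a, i)) cert)) = mon (exv a) \<star> den (cert_terms G cert)"
  using assms(2)
proof (induction cert)
  case (Cons e cert)
  obtain b i where e: "e = (b, i)" by (cases e)
  have *: "length b = n" "i < length G" "wf_terms n K (G ! i)" using Cons.prems e assms(1) by auto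
  have 1: "den (shift_terms (vec_add b a) (G ! i)) = mon (exv a) \<star> den (shift_terms b (G ! i))"
  proof -
    have l: "length (vec_add b a) = n" using * assms(3) by (simp add: vec_add_def)
    have "exv (vec_add b a) = exv a + exv b" using * assms(3) by (simp add: exv_vec_add add.commute)
    then show ?thesis
      by (simp only: den_shift[OF *(3) l] den_shift[OF *(3) *(1)] smul_simps(8)[symmetric] mon_mult)
  qed
  show ?case using Cons e * 1 by (simp add: cert_terms_def smul_simps)
qed (simp add: cert_terms_def smul_simps)

text \<open>The vectors with a certificate form a submodule: concatenation yields sums, shifting
  yields monomial multiples, and the empty list yields multiples of p. A generator is certified by p
  - 1 copies of itself.\<close>

lemma member_cert_iff:
  assumes p: "p > 0" and G: "\<forall>g\<in>set G. wf_terms n K g" and t: "wf_terms n K t"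
  shows "(\<exists>cert. member_cert n p G cert t) \<longleftrightarrow> den t \<in> span_submod p n K (den ` set G)"
proof
  let ?S = "span_submod p n K (den ` set G)"
  have Gl: "den ` set G \<subseteq> lvecs n K" using G den_lvecs by auto
  have S: "submod p n K ?S" by (rule submod_span[OF Gl])
  assume "\<exists>cert. member_cert n p G cert t"
  then obtain cert where c: "\<forall>(b, i)\<in>set cert. length b = n \<and> i < length G" "zero_terms p (t @ cert_terms G cert)"
    unfolding member_cert_def by blast
  have wfc: "wf_terms n K (cert_terms G cert)" by (rule wf_cert[OF G c(1)])
  have "\<forall>i. of_nat p dvd den (t @ cert_terms G cert) i"
    using zero_terms_iff[of n K] c(2) t wfc by (simp add: wf_append)
  then have 1: "den t + den (cert_terms G cert) \<in> ?S"
    using den_lvecs[OF t] den_lvecs[OF wfc] by (intro submod_mod_p[OF S]) auto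
  have "den (cert_terms G cert) \<in> ?S"
    using c(1)
  proof (induction cert)
    case (Cons e cert)
    obtain b i where e: "e = (b, i)" by (cases e)
    have *: "length b = n" "i < length G" "wf_terms n K (G ! i)" using Cons.prems e G by auto
    have "den (G ! i) \<in> ?S" by (rule subsetD[OF span_superset imageI[OF nth_mem[OF *(2)]]])
    then have "mon (exv b) \<star> den (G ! i) \<in> ?S" using *(1) by (intro submodD(4)[OF S]) auto
    then show ?case using Cons e * submodD(3)[OF S] by (simp add: cert_terms_def den_shift)
  qed (simp add: cert_terms_def submodD(2)[OF S])
  from submod_cancel[OF S 1 this p] show "den t \<in> ?S" .
next
  define M where "M = {v \<in> lvecs n K. \<exists>cert. (\<forall>(b, i)\<in>set cert. length b = n \<and> i < length G) \<and>
     (\<forall>i. of_nat p dvd (v + den (cert_terms G cert)) i)}"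
  have "submod p n K M"
    unfolding submod_def
  proof (intro conjI ballI)
    show "0 \<in> M" by (auto simp: M_def cert_terms_def fun_app intro!: exI[of _ "[]"])
    show "u + v \<in> M" if uv: "u \<in> M" "v \<in> M" for u v
    proof -
      obtain c where c: "\<forall>(b, i)\<in>set c. length b = n \<and> i < length G" "\<forall>i. of_nat p dvd (u + den (cert_terms G c)) i"
        using uv(1) unfolding M_def by blast
      obtain c' where c': "\<forall>(b, i)\<in>set c'. length b = n \<and> i < length G" "\<forall>i. of_nat p dvd (v + den (cert_terms G c')) i"
        using uv(2) unfolding M_def by blast
      have "of_nat p dvd (u + v + den (cert_terms G (c @ c'))) i" for i
      proof -
        have "of_nat p dvd (u + den (cert_terms G c)) i + (v + den (cert_terms G c')) i"
          using c(2) c'(2) by (intro dvd_add) auto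
        then show ?thesis by (simp add: cert_terms_def fun_app algebra_simps)
      qed
      then show ?thesis using uv c(1) c'(1) unfolding M_def
        by (auto intro!: exI[of _ "c @ c'"])
    qed
    show "mon a \<star> v \<in> M" if v: "v \<in> M" and a: "a \<in> expos n" for v a
    proof -
      obtain c where c: "\<forall>(b, i)\<in>set c. length b = n \<and> i < length G" "\<forall>i. of_nat p dvd (v + den (cert_terms G c)) i"
        using v unfolding M_def by blast
      define a' where "a' = map a [0..<n]"
      have a': "exv a' = a" "length a' = n" using a by (simp_all add: a'_def exv_map_upt)
      let ?c = "map (\<lambda>(b, i). (vec_add b a', i)) c"
      have "of_nat p dvd (mon a \<star> v + den (cert_terms G ?c)) i" for i
      proof -
        have "of_nat p dvd mon a * (v + den (cert_terms G c)) i" using c(2) by (intro dvd_mult) auto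
        then show ?thesis using den_cert_shift[OF G c(1) a'(2)] a'(1) by (simp add: fun_app algebra_simps)
      qed
      moreover have "\<forall>(b, i)\<in>set ?c. length b = n \<and> i < length G" using c(1) a'(2) by (auto simp: vec_add_def)
      moreover have "mon a \<star> v \<in> lvecs n K" using v a by (auto simp: M_def)
      ultimately show ?thesis unfolding M_def by blast
    qed
    show "of_nat p \<star> v \<in> M" if "v \<in> lvecs n K" for v
      using that by (auto simp: M_def cert_terms_def fun_app intro!: exI[of _ "[]"])
  qed (auto simp: M_def)
  moreover have "den ` set G \<subseteq> M"
  proof
    fix v assume "v \<in> den ` set G"
    then obtain i where i: "i < length G" "v = den (G ! i)" by (auto simp: in_set_conv_nth)
    have wfi: "wf_terms n K (G ! i)" using G i by auto
    have "den (cert_terms G (replicate c (replicate n 0, i))) = of_nat c \<star> v" for c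
      by (induction c) (use i wfi in \<open>auto simp: cert_terms_def den_shift smul_simps\<close>)
    then have "v + den (cert_terms G (replicate (p - 1) (replicate n 0, i))) = of_nat p \<star> v"
      using p by (simp add: fun_eq_iff fun_app algebra_simps of_nat_diff)
    then have "of_nat p dvd (v + den (cert_terms G (replicate (p - 1) (replicate n 0, i)))) j" for j
      by (simp only: smul_apply dvd_triv_left)
    moreover have "\<forall>(b, i)\<in>set (replicate (p - 1) (replicate n (0::int), i)). length b = n \<and> i < length G"
      using i by auto
    ultimately show "v \<in> M" unfolding M_def using den_lvecs[OF wfi] i(2) by blast
  qed
  ultimately have "span_submod p n K (den ` set G) \<subseteq> M" by (rule span_least)
  moreover assume "den t \<in> span_submod p n K (den ` set G)"
  ultimately have "den t \<in> M" by (rule subsetD)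
  then obtain cert where c: "\<forall>(b, i)\<in>set cert. length b = n \<and> i < length G"
      "\<forall>i. of_nat p dvd (den t + den (cert_terms G cert)) i"
    unfolding M_def by blast
  have "zero_terms p (t @ cert_terms G cert)"
    using c(2) zero_terms_iff[of n K "t @ cert_terms G cert" p] t wf_cert[OF G c(1)] by (simp add: wf_append)
  then show "\<exists>cert. member_cert n p G cert t" using c(1) unfolding member_cert_def by blast
qed

lemma bvec_uminus [simp]: "bvec (- f) i = - bvec f i"
  by (auto simp: bvec_def fun_eq_iff fun_app)

lemma den_surj:
  assumes "v \<in> lvecs n K" shows "\<exists>ts. wf_terms n K ts \<and> den ts = v"
  using assms
proof (induction rule: lvecs_induct)
  case zero
  show ?case by (rule exI[of _ "[]"]) (simp add: wf_terms_def)
next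
  case (mon a i)
  then show ?case
    by (intro exI[of _ "[(1, i, map a [0..<n])]"]) (auto simp: wf_terms_def den_term_def exv_map_upt smul_simps)
next
  case (diff u v)
  then obtain s t where st: "wf_terms n K s" "den s = u" "wf_terms n K t" "den t = v" by blast
  have "den (map (\<lambda>(c, i, a). (- c, i, a)) t) = - den t"
    by (induction t) (auto simp: den_term_def smul_simps)
  then show ?case using st
    by (intro exI[of _ "s @ map (\<lambda>(c, i, a). (- c, i, a)) t"]) (auto simp: wf_terms_def)
qed

section \<open>Arrays given by finite tables\<close>

definition arr_step :: "nat \<Rightarrow> ((nat \<times> int list) \<times> nat) list \<Rightarrow> nat \<times> int list \<Rightarrow> nat \<times> int list" where
  "arr_step p tab st = (look tab (fst st, map (\<lambda>x. x mod int p) (snd st)) 0, map (\<lambda>x. x div int p) (snd st))"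

text \<open>Bounds the number of divisions by p: an entry other than 0 and -1 strictly decreases in
  absolute value.\<close>

definition vsize :: "int list \<Rightarrow> nat" where "vsize a = foldl (\<lambda>s x. s + (nat x + nat (- x))) 0 a"

text \<open>The arrays \<open>\<int>\<^sup>n \<rightarrow> \<int>\<close> are generated by finite automata reading base-\<open>p\<close> digits; repeated division
  by \<open>p\<close> ends in a vector with entries \<open>0\<close> and \<open>-1\<close>, where the value is read off a table.\<close>

definition arr :: "nat \<Rightarrow> ((nat \<times> int list) \<times> nat) list \<Rightarrow> ((nat \<times> int list) \<times> int) list \<Rightarrow> nat \<Rightarrow> int list \<Rightarrow> int" where
  "arr p tab base j a = look base (rec_nat (j, a) (\<lambda>_. arr_step p tab) (vsize a)) 0"

text \<open>Division by p fixes the vectors with entries 0 and -1. The last condition says that one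
  more step there does not change the value, so any sufficiently large number of steps gives the
  same array.\<close>

definition check_arrays :: "nat \<Rightarrow> nat \<Rightarrow> nat \<Rightarrow> ((nat \<times> int list) \<times> nat) list \<Rightarrow> ((nat \<times> int list) \<times> int) list \<Rightarrow> bool" where
  "check_arrays p n M tab base \<longleftrightarrow> 0 < M \<and> (\<forall>e\<in>set tab. snd e < M) \<and>
     (\<forall>j\<in>set [0..<M]. \<forall>a\<in>set (List.n_lists n [- 1, 0]).
        look base (look tab (j, map (\<lambda>x. x mod int p) a) 0, a) 0 = look base (j, a) 0)"

lemma vsize_sum: "vsize a = sum_list (map (\<lambda>x. nat \<bar>x\<bar>) a)"
proof -
  have "foldl (\<lambda>s x. s + (nat x + nat (- x))) k a = k + sum_list (map (\<lambda>x. nat \<bar>x\<bar>) a)" for k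
    by (induction a arbitrary: k) (auto simp: abs_if)
  then show ?thesis by (simp add: vsize_def)
qed

lemma div_abs_le: "p \<ge> 2 \<Longrightarrow> nat \<bar>x div int p\<bar> \<le> nat \<bar>x\<bar>"
  and div_abs_less: "p \<ge> 2 \<Longrightarrow> x \<noteq> 0 \<Longrightarrow> x \<noteq> - 1 \<Longrightarrow> nat \<bar>x div int p\<bar> < nat \<bar>x\<bar>"
proof -
  assume p: "p \<ge> 2"
  have *: "\<bar>x div int p\<bar> < \<bar>x\<bar>" if "x \<noteq> 0" "x \<noteq> - 1"
  proof (cases "x > 0")
    case True
    then have "x div int p < x" using p by (intro int_div_less_self) auto
    moreover have "0 \<le> x div int p" using True p by (simp add: pos_imp_zdiv_nonneg_iff)
    ultimately show ?thesis by simp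
  next
    case False
    then have x: "x \<le> - 2" using that by simp
    have "x div int p < 0" using x p by (simp add: pos_imp_zdiv_neg_iff)
    moreover have "x < x div int p"
    proof -
      have "(x + 1) * int p \<le> (x + 1) * 2" using x p by (intro mult_left_mono_neg) auto
      then have "(x + 1) * int p \<le> x" using x by simp
      then have "(x + 1) * int p div int p \<le> x div int p" using p by (intro zdiv_mono1) auto
      then have "x + 1 \<le> x div int p" using p by simp
      then show ?thesis by simp
    qed
    ultimately show ?thesis by simp
  qed
  show "nat \<bar>x div int p\<bar> < nat \<bar>x\<bar>" if "x \<noteq> 0" "x \<noteq> - 1" using *[OF that] by simp
  show "nat \<bar>x div int p\<bar> \<le> nat \<bar>x\<bar>"
  proof (cases "x = 0 \<or> x = - 1")
    case True
    then show ?thesis using p by (auto simp: zdiv_eq_0_iff div_eq_minus1)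
  qed (use * in force)
qed

section \<open>Equations in monomials with unknown exponents\<close>

definition lsumd :: "nat \<Rightarrow> int list list \<Rightarrow> int list \<Rightarrow> nat \<Rightarrow> int list" where
  "lsumd n als z i = foldl (\<lambda>acc (k, a). vec_add acc (map ((*) k) a)) (replicate n 0) (take i (zip z als))"

definition lsume :: "int list list \<Rightarrow> (nat \<Rightarrow> int) \<Rightarrow> nat \<Rightarrow> expo" where
  "lsume als k i = (\<Sum>j<i. iscale (k j) (exv (als ! j)))"

lemma lsumd:
  assumes "\<forall>a\<in>set als. length a = n" "length z = length als" "i \<le> length als"
  shows "length (lsumd n als z i) = n" "exv (lsumd n als z i) = lsume als ((!) z) i"
proof -
  have "length (lsumd n als z i) = n \<and> exv (lsumd n als z i) = lsume als ((!) z) i"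
    using assms(3)
  proof (induction i)
    case (Suc i)
    have "take (Suc i) (zip z als) = take i (zip z als) @ [(z ! i, als ! i)]"
      using Suc.prems assms(2) by (simp add: take_Suc_conv_app_nth)
    then have "lsumd n als z (Suc i) = vec_add (lsumd n als z i) (map ((*) (z ! i)) (als ! i))"
      by (simp add: lsumd_def)
    moreover have "length (als ! i) = n" using assms(1) Suc.prems by simp
    ultimately show ?case using Suc by (simp add: exv_vec_add exv_iscale lsume_def)
  qed (simp add: lsumd_def lsume_def)
  then show "length (lsumd n als z i) = n" "exv (lsumd n als z i) = lsume als ((!) z) i" by auto
qed

lemma lsume_expos: "\<forall>a\<in>set als. length a = n \<Longrightarrow> i \<le> length als \<Longrightarrow> lsume als k i \<in> expos n"
  unfolding lsume_def by (induction i) (auto intro!: expos_closed iscale_expos exv_expos)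

lemma lsume_add: "lsume als (\<lambda>j. k j + l j) i = lsume als k i + lsume als l i"
  by (simp add: lsume_def iscale_add sum.distrib)

lemma lsume_scale: "lsume als (\<lambda>j. c * k j) i = iscale c (lsume als k i)"
proof -
  have "iscale c 0 = 0" by (simp add: iscale_def fun_eq_iff fun_app)
  moreover have "iscale (c * d) a = iscale c (iscale d a)" for d a by (simp add: iscale_def fun_eq_iff)
  ultimately show ?thesis unfolding lsume_def by (induction i) (simp_all add: iscale_add)
qed

lemma lsume_0 [simp]: "lsume als (\<lambda>_. 0) i = 0"
  by (simp add: lsume_def)

text \<open>The composition of an equation with a vector-valued family of arrays: the position i is
  replaced by the number of the array that stands there.\<close>

definition eqn_form :: "nat list \<Rightarrow> form \<Rightarrow> form" where
  "eqn_form J e = map (\<lambda>(c, i, b, l). (c, nthd J i 0, b, l)) e"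

definition rel_eqn :: "tm list \<Rightarrow> form" where
  "rel_eqn r = map (\<lambda>(c, i, b). (c, i, b, 0)) r"

definition wf_eqn :: "nat \<Rightarrow> nat \<Rightarrow> nat \<Rightarrow> form \<Rightarrow> bool" where
  "wf_eqn n K m e \<longleftrightarrow> (\<forall>(c, i, b, l)\<in>set e. i < K \<and> length b = n \<and> l \<le> m)"

definition eden :: "int list list \<Rightarrow> form \<Rightarrow> (nat \<Rightarrow> int) \<Rightarrow> lvec" where
  "eden als e k = sum_list (map (\<lambda>(c, i, b, l). of_int c \<star> bvec (mon (exv b + lsume als k l)) i) e)"

lemma eden_rel: "eden als (rel_eqn r) k = den r"
  by (induction r) (auto simp: eden_def rel_eqn_def den_term_def lsume_def)

text \<open>Evaluates the equation at an arbitrary vector of Laurent polynomials instead of the monomials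
  with exponents \<open>lsume als k l\<close>.\<close>

definition eapp :: "form \<Rightarrow> lvec \<Rightarrow> lvec" where
  "eapp e f = sum_list (map (\<lambda>(c, i, b, l). of_int c \<star> bvec (mon (exv b) * f l) i) e)"

text \<open>The vector of monomials of the partial sums; its entry at l = 0 is 1 and carries the
  constant terms of an equation.\<close>

definition sol_vec :: "int list list \<Rightarrow> (nat \<Rightarrow> int) \<Rightarrow> lvec" where
  "sol_vec als k = (\<lambda>l. if l \<le> length als then mon (lsume als k l) else 0)"

lemma eapp_sol_vec: "wf_eqn n K (length als) e \<Longrightarrow> eapp e (sol_vec als k) = eden als e k"
proof (induction e)
  case (Cons t e)
  obtain c i b l where t: "t = (c, i, b, l)" by (cases t)
  then have "l \<le> length als" "wf_eqn n K (length als) e" using Cons.prems by (auto simp: wf_eqn_def)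
  then show ?case using Cons.IH by (simp add: eapp_def eden_def t sol_vec_def mon_mult)
qed (simp add: eapp_def eden_def)

lemma eapp_simps: "eapp e 0 = 0" "eapp e (f + g) = eapp e f + eapp e g" "eapp e (f - g) = eapp e f - eapp e g"
  "eapp e (h \<star> f) = h \<star> eapp e f"
proof -
  show "eapp e 0 = 0" "eapp e (f + g) = eapp e f + eapp e g" "eapp e (f - g) = eapp e f - eapp e g"
    by (induction e) (auto simp: eapp_def fun_app smul_simps distrib_left right_diff_distrib)
  show "eapp e (h \<star> f) = h \<star> eapp e f"
  proof (induction e)
    case (Cons t e)
    obtain c i b l where t: "t = (c, i, b, l)" by (cases t)
    have "bvec (mon (exv b) * (h * f l)) i = h \<star> bvec (mon (exv b) * f l) i"
      by (simp add: mult_ac)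
    then have "of_int c \<star> bvec (mon (exv b) * (h * f l)) i = h \<star> (of_int c \<star> bvec (mon (exv b) * f l) i)"
      by (simp only: smul_commute)
    moreover have "eapp (t # e) (h \<star> f) = of_int c \<star> bvec (mon (exv b) * (h * f l)) i + eapp e (h \<star> f)"
      "eapp (t # e) f = of_int c \<star> bvec (mon (exv b) * f l) i + eapp e f"
      by (simp_all only: eapp_def t list.map sum_list.Cons prod.case smul_apply)
    ultimately show ?case using Cons.IH by (simp only: smul_simps(1))
  qed (simp add: eapp_def smul_simps)
qed

lemma eapp_lvecs:
  assumes "wf_eqn n K m e" "f \<in> lvecs n K2" shows "eapp e f \<in> lvecs n K"
  using assms(1)
proof (induction e)
  case (Cons t e)
  obtain c i b l where t: "t = (c, i, b, l)" by (cases t)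
  have *: "i < K" "length b = n" "wf_eqn n K m e" using Cons.prems t by (auto simp: wf_eqn_def)
  have "f l \<in> lpolys n" using assms(2) by (simp add: lvecs_def)
  then have "of_int c \<star> bvec (mon (exv b) * f l) i \<in> lvecs n K"
    using * by (intro lvecs_closed lpolys_of_int bvec_lvecs lpolys_closed exv_expos)
  then show ?case using Cons.IH[OF *(3)] by (simp add: eapp_def t lvecs_closed)
qed (simp add: eapp_def)

definition subst_eqn :: "form \<Rightarrow> tm list \<Rightarrow> tm list" where
  "subst_eqn e g = concat (map (\<lambda>(c, i, b, l). concat (map (\<lambda>(c', l', a).
     if l' = l then [(c * c', i, vec_add a b)] else []) g)) e)"

lemma subst_eqn:
  assumes "wf_eqn n K m e" "wf_terms n K2 g"
  shows "wf_terms n K (subst_eqn e g)" "den (subst_eqn e g) = eapp e (den g)"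
proof -
  have "wf_terms n K (subst_eqn e g) \<and> den (subst_eqn e g) = eapp e (den g)"
    using assms(1)
  proof (induction e)
    case (Cons t e)
    obtain c i b l where t: "t = (c, i, b, l)" by (cases t)
    have *: "i < K" "length b = n" "wf_eqn n K m e" using Cons.prems t by (auto simp: wf_eqn_def)
    let ?s = "\<lambda>g. concat (map (\<lambda>(c', l', a). if l' = l then [(c * c', i, vec_add a b)] else []) g)"
    have "wf_terms n K (?s g) \<and> den (?s g) = of_int c \<star> bvec (mon (exv b) * den g l) i"
      using assms(2)
    proof (induction g)
      case (Cons u g)
      obtain c' l' a where u: "u = (c', l', a)" by (cases u)
      have a: "length a = n" "wf_terms n K2 g" using Cons.prems u by (auto simp: wf_terms_def)
      have "den_term (c', l', a) l = (if l' = l then of_int c' * mon (exv a) else 0)"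
        by (simp add: den_term_def fun_app bvec_def)
      then have "of_int c \<star> bvec (mon (exv b) * den (u # g) l) i =
         (if l' = l then den_term (c * c', i, vec_add a b) else 0) + of_int c \<star> bvec (mon (exv b) * den g l) i"
        using a * by (simp add: u fun_app distrib_left smul_simps den_term_def exv_vec_add mon_mult[symmetric] mult_ac)
      then show ?case using Cons.IH[OF a(2)] a * by (auto simp: u wf_terms_def vec_add_def)
    qed (simp add: wf_terms_def fun_app smul_simps)
    then show ?case using Cons.IH[OF *(3)]
      by (simp add: subst_eqn_def eapp_def t wf_append)
  qed (simp add: subst_eqn_def eapp_def wf_terms_def)
  then show "wf_terms n K (subst_eqn e g)" "den (subst_eqn e g) = eapp e (den g)" by auto
qed

definition twist :: "nat \<Rightarrow> nat \<Rightarrow> int list list \<Rightarrow> int list \<Rightarrow> tm list \<Rightarrow> tm list" where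
  "twist p n als z g = map (\<lambda>(c, l, a). (c, l, vec_add (map ((*) (int p)) a) (lsumd n als z l))) g"

text \<open>The semilinear map that appends a least significant digit: it sends the monomial vector
  of k to that of p k + z.\<close>

definition twistv :: "nat \<Rightarrow> int list list \<Rightarrow> int list \<Rightarrow> lvec \<Rightarrow> lvec" where
  "twistv p als z f = (\<lambda>l. mon (lsume als ((!) z) l) * frob p (f l))"

lemma twistv_simps: "twistv p als z 0 = 0" "twistv p als z (f + g) = twistv p als z f + twistv p als z g"
  "twistv p als z (f - g) = twistv p als z f - twistv p als z g" "twistv p als z (h \<star> f) = frob p h \<star> twistv p als z f"
  by (auto simp: twistv_def fun_eq_iff fun_app distrib_left right_diff_distrib frob_mult mult_ac)

lemma twistv_lvecs:
  assumes "\<forall>a\<in>set als. length a = n" "f \<in> lvecs n (Suc (length als))"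
  shows "twistv p als z f \<in> lvecs n (Suc (length als))"
proof -
  have "mon (lsume als ((!) z) l) * frob p (f l) \<in> lpolys n" for l
  proof (cases "l \<le> length als")
    case True
    then show ?thesis using assms by (intro lpolys_closed lsume_expos frob_lpolys) (auto simp: lvecs_def)
  next
    case False
    then have "f l = 0" using assms(2) by (simp add: lvecs_def)
    then show ?thesis by simp
  qed
  then show ?thesis using assms(2) by (auto simp: twistv_def lvecs_def)
qed

lemma scale_expo_iscale: "scale_expo p a = iscale (int p) a"
  by (simp add: scale_expo_def iscale_def)

lemma twist:
  assumes als: "\<forall>a\<in>set als. length a = n" "length z = length als" and g: "wf_terms n (Suc (length als)) g"
  shows "wf_terms n (Suc (length als)) (twist p n als z g)" "den (twist p n als z g) = twistv p als z (den g)"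
proof -
  have "wf_terms n (Suc (length als)) (twist p n als z g) \<and> den (twist p n als z g) = twistv p als z (den g)"
    using g
  proof (induction g)
    case (Cons u g)
    obtain c l a where u: "u = (c, l, a)" by (cases u)
    have a: "length a = n" "l \<le> length als" "wf_terms n (Suc (length als)) g" using Cons.prems u by (auto simp: wf_terms_def)
    note ls = lsumd[OF als a(2)]
    have "den_term (c, l, vec_add (map ((*) (int p)) a) (lsumd n als z l)) = twistv p als z (den_term (c, l, a))"
    proof -
      have fr: "frob p (of_int c * mon (exv a)) = of_int c * mon (iscale (int p) (exv a))"
        by (simp add: frob_mult push_of_int[OF scale_expo_add]) (simp add: scale_expo_iscale)
      have ev: "exv (vec_add (map ((*) (int p)) a) (lsumd n als z l)) = iscale (int p) (exv a) + lsume als ((!) z) l"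
        using a(1) ls by (simp add: exv_vec_add exv_iscale)
      show ?thesis
      proof
        fix i show "den_term (c, l, vec_add (map ((*) (int p)) a) (lsumd n als z l)) i = twistv p als z (den_term (c, l, a)) i"
        proof (cases "i = l")
          case True
          show ?thesis unfolding True
            by (simp only: den_term_def twistv_def prod.case smul_apply bvec_def simp_thms if_True fr ev mon_mult[symmetric])
              (simp only: mult_ac)
        qed (simp add: den_term_def twistv_def fun_app bvec_def)
      qed
    qed
    then show ?case using Cons.IH[OF a(3)] a ls
      by (auto simp: u twist_def twistv_simps wf_terms_def vec_add_def)
  qed (simp add: twist_def twistv_simps wf_terms_def)
  then show "wf_terms n (Suc (length als)) (twist p n als z g)" "den (twist p n als z g) = twistv p als z (den g)" by auto
qed

lemma twistv_sol_vec:
  "twistv p als z (sol_vec als k) = sol_vec als (\<lambda>j. int p * k j + z ! j)"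
  by (auto simp: twistv_def sol_vec_def fun_eq_iff mon_mult scale_expo_iscale lsume_add lsume_scale add.commute)

definition ones :: "nat \<Rightarrow> nat \<Rightarrow> tm list" where
  "ones n m = map (\<lambda>l. (1, l, replicate n 0)) [0..<Suc m]"

lemma ones: "wf_terms n (Suc (length als)) (ones n (length als))" "den (ones n (length als)) = sol_vec als (\<lambda>_. 0)"
proof -
  have "den (map (\<lambda>l. (1, l, replicate n 0)) [0..<k]) i = (if i < k then 1 else 0)" for k i
    by (induction k) (auto simp: den_term_def fun_app bvec_def)
  then show "den (ones n (length als)) = sol_vec als (\<lambda>_. 0)"
    unfolding ones_def sol_vec_def by (intro ext) (simp only: lsume_0 mon_0 less_Suc_eq_le)
qed (auto simp: ones_def wf_terms_def)

section \<open>Functionals and their decimation\<close>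

definition form_val :: "nat \<Rightarrow> ((nat \<times> int list) \<times> nat) list \<Rightarrow> ((nat \<times> int list) \<times> int) list \<Rightarrow> form \<Rightarrow> int list \<Rightarrow> int" where
  "form_val p tab base phi a = sum_list (map (\<lambda>(c, j, b, l). c * arr p tab base j (vec_add a b)) phi)"

text \<open>The functional at the shift p a + s and the unknowns p k + z, rewritten in a and k: the
  accumulated constant is divided by p, its remainder selects the next array and its quotient is the
  new b.\<close>

definition form_dec :: "nat \<Rightarrow> nat \<Rightarrow> ((nat \<times> int list) \<times> nat) list \<Rightarrow> int list list \<Rightarrow> int list \<Rightarrow> int list \<Rightarrow> form \<Rightarrow> form" where
  "form_dec p n tab als s z phi = map (\<lambda>(c, j, b, l).
     (c, look tab (j, map (\<lambda>x. x mod int p) (vec_add (vec_add b s) (lsumd n als z l))) 0,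
      map (\<lambda>x. x div int p) (vec_add (vec_add b s) (lsumd n als z l)), l)) phi"

lemma exv_div_mod: "exv x = iscale (int p) (exv (map (\<lambda>x. x div int p) x)) + exv (map (\<lambda>x. x mod int p) x)"
  by (auto simp: exv_def iscale_def fun_eq_iff fun_app)

locale arrays =
  fixes p n M tab base
  assumes p: "p \<ge> 2" and ok: "check_arrays p n M tab base"
begin

definition tau :: "nat \<Rightarrow> int list \<Rightarrow> nat" where "tau j s = look tab (j, s) 0"
definition val :: "nat \<times> int list \<Rightarrow> int" where "val st = look base st 0"
definition fixed :: "int list \<Rightarrow> bool" where "fixed a \<longleftrightarrow> set a \<subseteq> {- 1, 0}"

lemma tau_less: "tau j s < M"
  using look_cases[of tab "(j, s)" 0] ok by (auto simp: check_arrays_def tau_def)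

lemma fixed_div: "fixed a \<Longrightarrow> map (\<lambda>x. x div int p) a = a"
  by (rule map_idI) (use p in \<open>auto simp: fixed_def div_eq_minus1\<close>)

lemma val_fixed:
  assumes "fixed a" "length a = n" "j < M" shows "val (arr_step p tab (j, a)) = val (j, a)"
proof -
  have "a \<in> set (List.n_lists n [- 1, 0])" using assms by (auto simp: set_n_lists fixed_def)
  then have "look base (look tab (j, map (\<lambda>x. x mod int p) a) 0, a) 0 = look base (j, a) 0"
    using ok assms(3) unfolding check_arrays_def by auto
  then show ?thesis by (simp add: val_def arr_step_def fixed_div[OF assms(1)])
qed

lemma step_simps: "fst (arr_step p tab (j, a)) < M" "length (snd (arr_step p tab st)) = length (snd st)"
  using tau_less[of j] by (auto simp: arr_step_def tau_def)

lemma vsize_step: "vsize (map (\<lambda>x. x div int p) a) \<le> vsize a"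
  unfolding vsize_sum by (induction a) (use div_abs_le[OF p] in \<open>auto intro: add_mono\<close>)

lemma vsize_step_less: "\<not> fixed a \<Longrightarrow> vsize (map (\<lambda>x. x div int p) a) < vsize a"
proof (induction a)
  case (Cons x a)
  show ?case
  proof (cases "x = 0 \<or> x = - 1")
    case True
    then have "\<not> fixed a" using Cons.prems by (auto simp: fixed_def)
    then show ?thesis using Cons.IH div_abs_le[OF p, of x] by (simp add: vsize_sum)
  next
    case False
    then show ?thesis using div_abs_less[OF p, of x] vsize_step[of a] by (simp add: vsize_sum)
  qed
qed (simp add: fixed_def)

lemma iter_stable:
  assumes "j < M" "length a = n" "N \<ge> vsize a"
  shows "val ((arr_step p tab ^^ N) (j, a)) = arr p tab base j a"
proof -
  have rec: "rec_nat st (\<lambda>_. arr_step p tab) k = (arr_step p tab ^^ k) st" for st k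
    by (induction k) auto
  have stb: "fixed (snd ((arr_step p tab ^^ k) (j, a)))" if "k \<ge> vsize a" "j < M" for k j a
    using that
  proof (induction k arbitrary: j a)
    case 0
    then show ?case by (auto simp: vsize_sum fixed_def)
  next
    case (Suc k)
    have s: "(arr_step p tab ^^ Suc k) (j, a) =
       (arr_step p tab ^^ k) (tau j (map (\<lambda>x. x mod int p) a), map (\<lambda>x. x div int p) a)"
      by (simp add: funpow_Suc_right arr_step_def tau_def del: funpow.simps)
    show ?case
    proof (cases "fixed a")
      case True
      have "snd ((arr_step p tab ^^ k') (j', a)) = a" for k' j'
        by (induction k') (simp_all add: arr_step_def fixed_div[OF True])
      then show ?thesis using True by (simp only:)
    next
      case False
      then show ?thesis unfolding s using vsize_step_less[OF False] Suc.prems by (intro Suc.IH tau_less) simp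
    qed
  qed
  have len: "length (snd ((arr_step p tab ^^ k) (j, a))) = n" for k
    by (induction k) (use assms(2) in \<open>auto simp: step_simps\<close>)
  have lt: "fst ((arr_step p tab ^^ k) (j, a)) < M" for k
    by (cases k) (use assms(1) step_simps(1)[of "fst ((arr_step p tab ^^ (k - 1)) (j, a))"
      "snd ((arr_step p tab ^^ (k - 1)) (j, a))"] in auto)
  have "val ((arr_step p tab ^^ (vsize a + k)) (j, a)) = val ((arr_step p tab ^^ vsize a) (j, a))" for k
  proof (induction k)
    case (Suc k)
    let ?st = "(arr_step p tab ^^ (vsize a + k)) (j, a)"
    have "val (arr_step p tab (fst ?st, snd ?st)) = val (fst ?st, snd ?st)"
      by (rule val_fixed) (use stb[of a "vsize a + k" j] assms(1) len lt in auto)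
    then show ?case using Suc by simp
  qed simp
  from this[of "N - vsize a"] show ?thesis using assms(3) by (simp add: arr_def val_def rec)
qed

text \<open>The two sides run for different numbers of steps; \<open>iter_stable\<close> allows a
  common bound N, with one further step on the left.\<close>

lemma arr_dec:
  assumes "j < M" "length a = n" "length s = n" "\<And>x. x \<in> set s \<Longrightarrow> 0 \<le> x \<and> x < int p"
  shows "arr p tab base j (map2 (\<lambda>x y. int p * x + y) a s) = arr p tab base (tau j s) a"
proof -
  let ?b = "map2 (\<lambda>x y. int p * x + y) a s"
  have b: "map (\<lambda>x. x mod int p) ?b = s" "map (\<lambda>x. x div int p) ?b = a"
    using assms(2-4) p by (auto intro!: nth_equalityI simp: nth_mem)
  define N where "N = max (vsize ?b) (vsize a)"
  have "arr p tab base j ?b = val ((arr_step p tab ^^ Suc N) (j, ?b))"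
    by (rule iter_stable[symmetric]) (use assms in \<open>auto simp: N_def\<close>)
  also have "arr_step p tab (j, ?b) = (tau j s, a)" by (simp only: arr_step_def fst_conv snd_conv b tau_def)
  then have "(arr_step p tab ^^ Suc N) (j, ?b) = (arr_step p tab ^^ N) (tau j s, a)"
    by (simp add: funpow_Suc_right del: funpow.simps)
  also have "val \<dots> = arr p tab base (tau j s) a"
    by (rule iter_stable) (use assms tau_less in \<open>auto simp: N_def\<close>)
  finally show ?thesis .
qed

definition Th :: "nat \<Rightarrow> expo \<Rightarrow> int" where "Th j x = arr p tab base j (map x [0..<n])"

lemma Th_exv: "length a = n \<Longrightarrow> Th j (exv a) = arr p tab base j a"
proof -
  assume "length a = n"
  then have "map (exv a) [0..<n] = a" by (auto intro!: nth_equalityI simp: exv_def)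
  then show ?thesis by (simp add: Th_def)
qed

lemma Th_dec:
  assumes "j < M" "length s = n" "\<And>x. x \<in> set s \<Longrightarrow> 0 \<le> x \<and> x < int p"
  shows "Th j (iscale (int p) x + exv s) = Th (tau j s) x"
proof -
  have "map (iscale (int p) x + exv s) [0..<n] = map2 (\<lambda>x y. int p * x + y) (map x [0..<n]) s"
    using assms(2) by (auto intro!: nth_equalityI simp: iscale_def exv_def fun_app)
  then show ?thesis unfolding Th_def using assms by (simp add: arr_dec)
qed

definition FV :: "int list list \<Rightarrow> form \<Rightarrow> expo \<Rightarrow> (nat \<Rightarrow> int) \<Rightarrow> int" where
  "FV als phi a k = sum_list (map (\<lambda>(c, j, b, l). c * Th j (a + exv b + lsume als k l)) phi)"

lemma form_val: "wf_eqn n M m phi \<Longrightarrow> length a = n \<Longrightarrow> form_val p tab base phi a = FV als phi (exv a) (\<lambda>_. 0)"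
proof (induction phi)
  case (Cons t phi)
  obtain c j b l where t: "t = (c, j, b, l)" by (cases t)
  have *: "length b = n" "wf_eqn n M m phi" using Cons.prems t by (auto simp: wf_eqn_def)
  have "Th j (exv a + exv b) = arr p tab base j (vec_add a b)"
    using Th_exv[of "vec_add a b" j] * Cons.prems(2) by (simp add: exv_vec_add)
  then show ?case using Cons.IH[OF *(2) Cons.prems(2)] by (simp add: FV_def form_val_def t)
qed (simp add: FV_def form_val_def)

lemma FV_dec:
  assumes als: "\<forall>a\<in>set als. length a = n" "length z = length als" and phi: "wf_eqn n M (length als) phi"
    and s: "length s = n"
  shows "FV als (form_dec p n tab als s z phi) a k = FV als phi (iscale (int p) a + exv s) (\<lambda>j. int p * k j + z ! j)"
    "wf_eqn n M (length als) (form_dec p n tab als s z phi)"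
proof -
  have "FV als (form_dec p n tab als s z phi) a k = FV als phi (iscale (int p) a + exv s) (\<lambda>j. int p * k j + z ! j) \<and>
    wf_eqn n M (length als) (form_dec p n tab als s z phi)"
    using phi
  proof (induction phi)
    case (Cons t phi)
    obtain c j b l where t: "t = (c, j, b, l)" by (cases t)
    have *: "j < M" "length b = n" "l \<le> length als" "wf_eqn n M (length als) phi" using Cons.prems t by (auto simp: wf_eqn_def)
    note ls = lsumd[OF als *(3)]
    define x where "x = vec_add (vec_add b s) (lsumd n als z l)"
    have x: "length x = n" "exv x = exv b + exv s + lsume als ((!) z) l"
      using * ls s by (simp_all add: x_def exv_vec_add)
    have "iscale (int p) a + exv s + exv b + lsume als (\<lambda>j. int p * k j + z ! j) l =
        iscale (int p) (a + lsume als k l) + exv x"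
      by (simp add: x lsume_add lsume_scale iscale_add algebra_simps)
    also have "\<dots> = iscale (int p) (a + exv (map (\<lambda>x. x div int p) x) + lsume als k l) + exv (map (\<lambda>x. x mod int p) x)"
      by (subst exv_div_mod[of x p]) (simp add: iscale_add algebra_simps)
    finally have e: "iscale (int p) a + exv s + exv b + lsume als (\<lambda>j. int p * k j + z ! j) l =
      iscale (int p) (a + exv (map (\<lambda>x. x div int p) x) + lsume als k l) + exv (map (\<lambda>x. x mod int p) x)" .
    have "Th j (iscale (int p) (a + exv (map (\<lambda>x. x div int p) x) + lsume als k l) + exv (map (\<lambda>x. x mod int p) x)) =
        Th (tau j (map (\<lambda>x. x mod int p) x)) (a + exv (map (\<lambda>x. x div int p) x) + lsume als k l)"
      by (rule Th_dec[OF *(1)]) (use x p in auto)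
    then have "Th j (iscale (int p) a + exv s + exv b + lsume als (\<lambda>j. int p * k j + z ! j) l) =
       Th (look tab (j, map (\<lambda>x. x mod int p) x) 0) (a + exv (map (\<lambda>x. x div int p) x) + lsume als k l)"
      by (simp only: tau_def e)
    then show ?case using Cons.IH[OF *(4)] tau_less x(1) *(3)
      by (simp add: FV_def form_dec_def t x_def[symmetric] wf_eqn_def tau_def)
  qed (simp add: FV_def form_dec_def wf_eqn_def)
  then show "FV als (form_dec p n tab als s z phi) a k = FV als phi (iscale (int p) a + exv s) (\<lambda>j. int p * k j + z ! j)"
    "wf_eqn n M (length als) (form_dec p n tab als s z phi)" by auto
qed

lemma FV_eqn_form:
  assumes "length J = K" "wf_eqn n K m e"
  shows "FV als (eqn_form J e) a k = evl K (\<lambda>i. Th (nthd J i 0)) (mon a \<star> eden als e k)"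
  using assms(2)
proof (induction e)
  case (Cons t e)
  obtain c i b l where t: "t = (c, i, b, l)" by (cases t)
  have *: "i < K" "wf_eqn n K m e" using Cons.prems t by (auto simp: wf_eqn_def)
  have "evl K (\<lambda>i. Th (nthd J i 0)) (mon a \<star> of_int c \<star> bvec (mon (exv b + lsume als k l)) i) =
      c * Th (nthd J i 0) (a + exv b + lsume als k l)"
    by (subst smul_commute) (simp add: evl_bvec[OF *(1)] mon_mult add.assoc)
  then show ?case using Cons.IH[OF *(2)] by (simp add: FV_def eqn_form_def eden_def t smul_simps(1))
qed (simp add: FV_def eqn_form_def eden_def smul_simps)

lemma wf_eqn_form:
  assumes "length J = K" "wf_eqn n K m e" "\<forall>j\<in>set J. j < M" shows "wf_eqn n M m (eqn_form J e)"
  using assms by (auto simp: wf_eqn_def eqn_form_def)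

end

section \<open>The automaton of a certificate\<close>

text \<open>The signs are fixed by the first letter and never change, since every entry is read
  through the digits of its absolute value. The functionals bound the submodule of the state from
  above, the generators from below.\<close>

type_synonym state = "int list \<times> nat list \<times> nat \<times> form list \<times> tm list list \<times> mcert"

abbreviation s_eps :: "state \<Rightarrow> int list" where "s_eps s \<equiv> fst s"
abbreviation s_pend :: "state \<Rightarrow> nat list" where "s_pend s \<equiv> fst (snd s)"
abbreviation s_flag :: "state \<Rightarrow> nat" where "s_flag s \<equiv> fst (snd (snd s))"
abbreviation s_forms :: "state \<Rightarrow> form list" where "s_forms s \<equiv> fst (snd (snd (snd s)))"
abbreviation s_gens :: "state \<Rightarrow> tm list list" where "s_gens s \<equiv> fst (snd (snd (snd (snd s))))"
abbreviation s_cert :: "state \<Rightarrow> mcert" where "s_cert s \<equiv> snd (snd (snd (snd (snd s))))"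

definition no_state :: state where "no_state = ([], [], 0, [], [], [])"

definition signs :: "nat \<Rightarrow> int list list" where "signs m = List.n_lists m [1, - 1]"
definition digit_vecs :: "nat \<Rightarrow> nat \<Rightarrow> nat list list" where "digit_vecs p m = List.n_lists m [0..<p]"
definition int_digit_vecs :: "nat \<Rightarrow> nat \<Rightarrow> int list list" where "int_digit_vecs p m = List.n_lists m (map int [0..<p])"

text \<open>Signed digits: with d the first letter and k' the vector of the remaining word under the
  same signs e, the vector read is p k' + \<open>zmul e d\<close>.\<close>

definition zmul :: "int list \<Rightarrow> nat list \<Rightarrow> int list" where
  "zmul e d = map (\<lambda>x. fst x * int (snd x)) (zip e d)"

text \<open>Functionals without unknowns in a finite set that is closed under decimation, and that
  vanishes on the vectors with entries 0 and -1, vanish everywhere, by descent in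
  \<open>vsize\<close>. As the set contains each J evaluated at each relator, it proves that J kills
  the submodule of relations.\<close>

definition check_zero where
  "check_zero p n m M K tab base als rels Js Zs \<longleftrightarrow>
     (\<forall>J\<in>set Js. length J = K \<and> (\<forall>j\<in>set J. j < M) \<and> (\<forall>r\<in>set rels. eqn_form J (rel_eqn r) \<in> set Zs)) \<and>
     (\<forall>phi\<in>set Zs. (\<forall>s\<in>set (int_digit_vecs p n). form_dec p n tab als s (replicate m 0) phi \<in> set Zs) \<and>
        (\<forall>a\<in>set (List.n_lists n [- 1, 0]). int p dvd form_val p tab base phi a))"

definition check_member_list where
  "check_member_list n p G certs ts \<longleftrightarrow> length certs = length ts \<and>
     (\<forall>y\<in>set (zip ts certs). member_cert n p G (snd y) (fst y))"

text \<open>The span of the generators lies in the preimage of the relations under the equation, and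
  the functionals vanish on every monomial vector in this preimage.\<close>

definition init_ok where
  "init_ok n p m rels eqn Js s certs \<longleftrightarrow> s_eps s \<in> set (signs m) \<and>
     s_pend s = map (\<lambda>e. if e = - 1 then 1 else 0) (s_eps s) \<and> s_flag s = 0 \<and>
     (\<forall>phi\<in>set (s_forms s). \<exists>J\<in>set Js. phi = eqn_form J eqn) \<and>
     check_member_list n p rels certs (map (subst_eqn eqn) (s_gens s))"

definition check_inits where
  "check_inits n p m rels eqn Js sts inits \<longleftrightarrow>
     (\<forall>e\<in>set (signs m). \<exists>x\<in>set inits. s_eps (nthd sts (fst x) no_state) = e) \<and>
     (\<forall>x\<in>set inits. fst x < length sts \<and> init_ok n p m rels eqn Js (nthd sts (fst x) no_state) (snd x))"

text \<open>Membership is carried backwards along a path and vanishing forwards, so the conditions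
  on generators and functionals point in opposite directions.\<close>

definition trans_ok where
  "trans_ok p n m tab als s d s' certs \<longleftrightarrow> d \<in> set (digit_vecs p m) \<and> s_eps s' = s_eps s \<and>
     s_pend s' = map (\<lambda>x. if fst x = 0 then snd x else 0) (zip d (s_pend s)) \<and>
     s_flag s' = (if s_flag s = 0 \<or> (\<exists>x\<in>set d. x \<noteq> 0) then 1 else 2) \<and>
     (\<forall>phi\<in>set (s_forms s'). \<exists>psi\<in>set (s_forms s). \<exists>v\<in>set (int_digit_vecs p n).
        phi = form_dec p n tab als v (zmul (s_eps s) d) psi) \<and>
     check_member_list n p (s_gens s) certs (map (twist p n als (zmul (s_eps s) d)) (s_gens s'))"

definition check_trans where
  "check_trans p n m tab als sts trs \<longleftrightarrow>
     (\<forall>q\<in>set [0..<length sts]. \<forall>d\<in>set (digit_vecs p m). \<exists>t\<in>set trs. fst t = q \<and> fst (snd t) = d) \<and>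
     (\<forall>t\<in>set trs. fst t < length sts \<and> fst (snd (snd t)) < length sts \<and>
        trans_ok p n m tab als (nthd sts (fst t) no_state) (fst (snd t)) (nthd sts (fst (snd (snd t))) no_state)
          (snd (snd (snd t))))"

text \<open>For m = 0 the only letter is the empty tuple, and just the empty word denotes the
  element of Z^0.\<close>

definition s_accepting where
  "s_accepting m s \<longleftrightarrow> (if m = 0 then s_flag s = 0 else s_flag s = 1 \<and> (\<forall>x\<in>set (s_pend s). x = 0))"

text \<open>Only here do the two bounds have to meet, and only at the vector of ones, the monomial
  vector of k = 0 that remains when all digits have been read.\<close>

definition final_ok where
  "final_ok p n m tab base wits fin s \<longleftrightarrow>
     (if s_accepting m s then
        (if fin then member_cert n p (s_gens s) (s_cert s) (ones n m)
         else \<exists>phi\<in>set (s_forms s). \<exists>a\<in>set wits. \<not> int p dvd form_val p tab base phi a)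
      else \<not> fin)"

definition check_final where
  "check_final p n m tab base wits sts fins \<longleftrightarrow> (\<forall>q\<in>set fins. q < length sts) \<and> (\<forall>a\<in>set wits. length a = n) \<and>
     (\<forall>q\<in>set [0..<length sts]. final_ok p n m tab base wits (q \<in> set fins) (nthd sts q no_state))"

definition check_gens where
  "check_gens n m sts \<longleftrightarrow> (\<forall>s\<in>set sts. \<forall>g\<in>set (s_gens s). \<forall>t\<in>set g. fst (snd t) < Suc m \<and> length (snd (snd t)) = n)"

text \<open>The additional state reads the letter of signs. For m = 0 the word is empty and has no
  such letter, so there the initial states of the certificate are used directly.\<close>

definition cert_automaton where
  "cert_automaton m sts inits trs fins = Automaton (Suc (length sts))
     (if m = 0 then map fst inits else [length sts])
     (map (\<lambda>x. (length sts, map (\<lambda>e. if e = 1 then Plus else Minus) (s_eps (nthd sts (fst x) no_state)), fst x)) inits @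
      map (\<lambda>t. (fst t, map Digit (fst (snd t)), fst (snd (snd t)))) trs)
     fins"

fun dval :: "nat \<Rightarrow> nat list list \<Rightarrow> nat \<Rightarrow> nat" where
  "dval p [] j = 0"
| "dval p (d # ds) j = d ! j + p * dval p ds j"

fun path :: "(nat \<times> nat list \<times> nat \<times> 'c) list \<Rightarrow> nat \<Rightarrow> nat list list \<Rightarrow> nat \<Rightarrow> bool" where
  "path trs q [] q' \<longleftrightarrow> q = q'"
| "path trs q (d # ds) q' \<longleftrightarrow> (\<exists>t\<in>set trs. fst t = q \<and> fst (snd t) = d \<and> path trs (fst (snd (snd t))) ds q')"

lemma lsume_cong: "(\<And>j. j < i \<Longrightarrow> k j = l j) \<Longrightarrow> lsume als k i = lsume als l i"
  by (simp add: lsume_def)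

lemma sol_vec_cong: "(\<And>j. j < length als \<Longrightarrow> k j = l j) \<Longrightarrow> sol_vec als k = sol_vec als l"
  unfolding sol_vec_def by (intro ext if_cong arg_cong[of _ _ mon] lsume_cong) auto

lemma eden_cong:
  assumes "wf_eqn n K (length als) e" "\<And>j. j < length als \<Longrightarrow> k j = l j" shows "eden als e k = eden als e l"
  unfolding eapp_sol_vec[OF assms(1), symmetric] by (simp only: sol_vec_cong[OF assms(2)])

lemma digit_vec: "d \<in> set (digit_vecs p m) \<longleftrightarrow> length d = m \<and> (\<forall>x\<in>set d. x < p)"
  by (auto simp: digit_vecs_def set_n_lists)

lemma int_digit_vec: "v \<in> set (int_digit_vecs p k) \<longleftrightarrow> length v = k \<and> (\<forall>x\<in>set v. 0 \<le> x \<and> x < int p)"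
proof -
  have "x \<in> int ` {0..<p} \<longleftrightarrow> 0 \<le> x \<and> x < int p" for x
    by (auto simp: image_iff Bex_def intro!: exI[of _ "nat x"])
  then show ?thesis by (auto simp: int_digit_vecs_def set_n_lists subset_iff)
qed

lemma sign_vec: "e \<in> set (signs m) \<longleftrightarrow> length e = m \<and> set e \<subseteq> {1, - 1}"
  by (auto simp: signs_def set_n_lists)

lemma (in arrays) FV_cong:
  assumes "wf_eqn n M m phi" "\<And>j. j < m \<Longrightarrow> k j = k' j" shows "FV als phi a k = FV als phi a k'"
  using assms(1)
proof (induction phi)
  case (Cons t phi)
  obtain c j b l where t: "t = (c, j, b, l)" by (cases t)
  have "l \<le> m" "wf_eqn n M m phi" using Cons.prems t by (auto simp: wf_eqn_def)
  moreover have "lsume als k l = lsume als k' l" by (rule lsume_cong) (use \<open>l \<le> m\<close> assms(2) in auto)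
  ultimately show ?case using Cons.IH by (simp add: FV_def t)
qed (simp add: FV_def)

locale cert_ok = arrays p n M tab base
  for p n M tab base +
  fixes m K :: nat and rels :: "tm list list" and eqn :: form and als :: "int list list"
    and Js :: "nat list list" and Zs :: "form list" and wits :: "int list list" and sts :: "state list"
    and inits :: "(nat \<times> mcert list) list" and trs :: "(nat \<times> nat list \<times> nat \<times> mcert list) list" and fins :: "nat list"
  assumes prime: "prime p" and als: "\<forall>a\<in>set als. length a = n" "length als = m"
    and rels: "\<forall>r\<in>set rels. wf_terms n K r" and eqn: "wf_eqn n K m eqn"
    and zero: "check_zero p n m M K tab base als rels Js Zs"
    and inits: "check_inits n p m rels eqn Js sts inits"
    and trans: "check_trans p n m tab als sts trs"
    and final: "check_final p n m tab base wits sts fins"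
    and gens: "check_gens n m sts"
begin

lemma p_pos: "p > 0" using prime by (simp add: prime_gt_0_nat)

definition st :: "nat \<Rightarrow> state" where "st q = nthd sts q no_state"

definition Sp :: "nat \<Rightarrow> lvec set" where "Sp q = span_submod p n (Suc m) (den ` set (s_gens (st q)))"

definition Rel :: "lvec set" where "Rel = span_submod p n K (den ` set rels)"

lemma wf_gens: "q < length sts \<Longrightarrow> \<forall>g\<in>set (s_gens (st q)). wf_terms n (Suc m) g"
  using gens by (fastforce simp: check_gens_def st_def wf_terms_def)

lemma Sp: assumes "q < length sts" shows "submod p n (Suc m) (Sp q)"
  unfolding Sp_def using wf_gens[OF assms] den_lvecs by (intro submod_span) auto

lemma Rel: "submod p n K Rel"
  unfolding Rel_def using rels den_lvecs by (intro submod_span) auto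

lemma check_member_listD:
  assumes "check_member_list n p G certs ts" "\<forall>g\<in>set G. wf_terms n L g" "t \<in> set ts" "wf_terms n L t"
  shows "den t \<in> span_submod p n L (den ` set G)"
proof -
  obtain i where i: "i < length ts" "ts ! i = t" using assms(3) by (auto simp: in_set_conv_nth)
  then have "(t, certs ! i) \<in> set (zip ts certs)" using assms(1) by (auto simp: check_member_list_def set_zip)
  then have "member_cert n p G (certs ! i) t" using assms(1) by (force simp: check_member_list_def)
  then show ?thesis using member_cert_iff[OF p_pos assms(2,4)] by blast
qed

lemma transD:
  assumes "t \<in> set trs"
  shows "fst t < length sts" "fst (snd (snd t)) < length sts"
    "trans_ok p n m tab als (st (fst t)) (fst (snd t)) (st (fst (snd (snd t)))) (snd (snd (snd t)))"
  using trans assms by (auto simp: check_trans_def st_def)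

lemma Sp_step:
  assumes t: "t \<in> set trs" and eps: "length (s_eps (st (fst t))) = m" and f: "f \<in> Sp (fst (snd (snd t)))"
  shows "twistv p als (zmul (s_eps (st (fst t))) (fst (snd t))) f \<in> Sp (fst t)"
proof -
  let ?q = "fst t" and ?q' = "fst (snd (snd t))" and ?z = "zmul (s_eps (st (fst t))) (fst (snd t))"
  note ok = transD[OF t]
  have d: "length (fst (snd t)) = m" using ok(3) by (auto simp: trans_ok_def digit_vec)
  have z: "length ?z = length als" using eps d als(2) by (simp add: zmul_def)
  note S = Sp[OF ok(1)]
  let ?M = "{f \<in> lvecs n (Suc m). twistv p als ?z f \<in> Sp ?q}"
  have "submod p n (Suc m) ?M"
    unfolding submod_def
  proof (intro conjI ballI)
    show "0 \<in> ?M" using submodD(2)[OF S] by (simp add: twistv_simps)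
    show "u + v \<in> ?M" if "u \<in> ?M" "v \<in> ?M" for u v using that submodD(3)[OF S] by (simp add: twistv_simps lvecs_closed)
    show "mon a \<star> v \<in> ?M" if "v \<in> ?M" "a \<in> expos n" for v a
      using that submodD(4)[OF S] by (simp add: twistv_simps lvecs_closed)
    show "of_nat p \<star> v \<in> ?M" if "v \<in> lvecs n (Suc m)" for v
      using that submodD(5)[OF S] twistv_lvecs[OF als(1), of v p ?z] als(2) by (simp add: twistv_simps lvecs_closed)
  qed auto
  moreover have "den ` set (s_gens (st ?q')) \<subseteq> ?M"
  proof
    fix v assume "v \<in> den ` set (s_gens (st ?q'))"
    then obtain g where g: "g \<in> set (s_gens (st ?q'))" "v = den g" by blast
    have wg: "wf_terms n (Suc (length als)) g" using wf_gens[OF ok(2)] g(1) als(2) by auto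
    have "den (twist p n als ?z g) \<in> Sp ?q"
      unfolding Sp_def
    proof (rule check_member_listD)
      show "check_member_list n p (s_gens (st ?q)) (snd (snd (snd t))) (map (twist p n als ?z) (s_gens (st ?q')))"
        using ok(3) by (simp add: trans_ok_def)
    qed (use wf_gens[OF ok(1)] g(1) twist(1)[OF als(1) z wg] als(2) in auto)
    then show "v \<in> ?M" using twist(2)[OF als(1) z wg] g(2) den_lvecs[OF wg] als(2) by simp
  qed
  ultimately have "Sp ?q' \<subseteq> ?M" unfolding Sp_def[of ?q'] by (rule span_least)
  then show ?thesis using f by blast
qed

definition kval :: "int list \<Rightarrow> nat list list \<Rightarrow> nat \<Rightarrow> int" where
  "kval e ds j = e ! j * int (dval p ds j)"

lemma kval_step:
  assumes "j < m" "length e = m" "length d = m"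
  shows "int p * kval e ds j + zmul e d ! j = kval e (d # ds) j"
  using assms by (simp add: kval_def zmul_def algebra_simps)

text \<open>The twists, applied from the last digit to the first, turn the vector of ones into the
  monomial vector of the number read; each of them maps the span at its target into the span at its
  source.\<close>

lemma path_lower:
  assumes "path trs q ds q'" "q < length sts" "length (s_eps (st q)) = m" "sol_vec als (\<lambda>_. 0) \<in> Sp q'"
  shows "sol_vec als (kval (s_eps (st q)) ds) \<in> Sp q"
  using assms
proof (induction ds arbitrary: q)
  case Nil
  then show ?case by (simp add: kval_def)
next
  case (Cons d ds)
  then obtain t where t: "t \<in> set trs" "fst t = q" "fst (snd t) = d" "path trs (fst (snd (snd t))) ds q'" by auto
  note ok = transD[OF t(1)]
  have e: "s_eps (st (fst (snd (snd t)))) = s_eps (st q)" and d: "length d = m"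
    using ok(3) t(2,3) by (auto simp: trans_ok_def digit_vec)
  have "sol_vec als (kval (s_eps (st q)) ds) \<in> Sp (fst (snd (snd t)))"
    using Cons.IH[OF t(4) ok(2)] e Cons.prems by simp
  from Sp_step[OF t(1) _ this] t(2,3) Cons.prems(3)
  have "twistv p als (zmul (s_eps (st q)) d) (sol_vec als (kval (s_eps (st q)) ds)) \<in> Sp q" by simp
  moreover have "sol_vec als (\<lambda>j. int p * kval (s_eps (st q)) ds j + zmul (s_eps (st q)) d ! j) =
      sol_vec als (kval (s_eps (st q)) (d # ds))"
    by (rule sol_vec_cong) (use kval_step Cons.prems(3) d als(2) in auto)
  ultimately show ?case by (simp only: twistv_sol_vec)
qed

lemma init_lower:
  assumes x: "x \<in> set inits" and f: "f \<in> Sp (fst x)" shows "eapp eqn f \<in> Rel"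
proof -
  have q: "fst x < length sts" and ok: "init_ok n p m rels eqn Js (st (fst x)) (snd x)"
    using inits x by (auto simp: check_inits_def st_def)
  let ?M = "{f \<in> lvecs n (Suc m). eapp eqn f \<in> Rel}"
  have "submod p n (Suc m) ?M"
    unfolding submod_def
  proof (intro conjI ballI)
    show "0 \<in> ?M" using submodD(2)[OF Rel] by (simp add: eapp_simps)
    show "u + v \<in> ?M" if "u \<in> ?M" "v \<in> ?M" for u v using that submodD(3)[OF Rel] by (simp add: eapp_simps lvecs_closed)
    show "mon a \<star> v \<in> ?M" if "v \<in> ?M" "a \<in> expos n" for v a
      using that submodD(4)[OF Rel] by (simp add: eapp_simps lvecs_closed)
    show "of_nat p \<star> v \<in> ?M" if "v \<in> lvecs n (Suc m)" for v
      using that submodD(5)[OF Rel] eapp_lvecs[OF eqn that] by (simp add: eapp_simps lvecs_closed)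
  qed auto
  moreover have "den ` set (s_gens (st (fst x))) \<subseteq> ?M"
  proof
    fix v assume "v \<in> den ` set (s_gens (st (fst x)))"
    then obtain g where g: "g \<in> set (s_gens (st (fst x)))" "v = den g" by blast
    have wg: "wf_terms n (Suc m) g" using wf_gens[OF q] g(1) by auto
    have "den (subst_eqn eqn g) \<in> Rel"
      unfolding Rel_def
    proof (rule check_member_listD)
      show "check_member_list n p rels (snd x) (map (subst_eqn eqn) (s_gens (st (fst x))))"
        using ok by (simp add: init_ok_def)
    qed (use rels g(1) subst_eqn(1)[OF eqn wg] in auto)
    then show "v \<in> ?M" using subst_eqn(2)[OF eqn wg] g(2) den_lvecs[OF wg] by simp
  qed
  ultimately have "Sp (fst x) \<subseteq> ?M" unfolding Sp_def by (rule span_least)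
  then show ?thesis using f by blast
qed

lemma zero_forms:
  assumes "phi \<in> set Zs" "wf_eqn n M m phi" "\<forall>(c, j, b, l)\<in>set phi. l = 0" "length a = n"
  shows "int p dvd FV als phi (exv a) (\<lambda>_. 0)"
  using assms
proof (induction "vsize a" arbitrary: a phi rule: less_induct)
  case less
  show ?case
  proof (cases "fixed a")
    case True
    then have "a \<in> set (List.n_lists n [- 1, 0])" using less.prems by (auto simp: set_n_lists fixed_def)
    then have "int p dvd form_val p tab base phi a" using zero less.prems(1) by (auto simp: check_zero_def)
    then show ?thesis using form_val[OF less.prems(2,4)] by simp
  next
    case False
    define a' where "a' = map (\<lambda>x. x div int p) a"
    define s where "s = map (\<lambda>x. x mod int p) a"
    have s: "s \<in> set (int_digit_vecs p n)" using less.prems(4) p by (auto simp: int_digit_vec s_def)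
    let ?z = "replicate m (0::int)"
    let ?phi = "form_dec p n tab als s ?z phi"
    have in_Zs: "?phi \<in> set Zs" using zero less.prems(1) s by (auto simp: check_zero_def)
    have len: "length s = n" using less.prems(4) by (simp add: s_def)
    have z: "length ?z = length als" using als(2) by simp
    have phi': "wf_eqn n M (length als) phi" using less.prems(2) als(2) by simp
    note dec = FV_dec[OF als(1) z phi' len]
    have "int p dvd FV als ?phi (exv a') (\<lambda>_. 0)"
    proof (rule less.hyps)
      show "vsize a' < vsize a" unfolding a'_def by (rule vsize_step_less[OF False])
      show "\<forall>(c, j, b, l)\<in>set ?phi. l = 0" using less.prems(3) by (auto simp: form_dec_def)
    qed (use in_Zs dec(2) als(2) less.prems(4) in \<open>auto simp: a'_def\<close>)
    moreover have "iscale (int p) (exv a') + exv s = exv a"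
      unfolding a'_def s_def by (rule exv_div_mod[symmetric])
    moreover have "FV als phi b (\<lambda>j. ?z ! j) = FV als phi b (\<lambda>_. 0)" for b
    proof -
      have "lsume als (\<lambda>j. ?z ! j) l = 0" if "l = 0" for l using that by (simp add: lsume_def)
      then show ?thesis using less.prems(3) unfolding FV_def
        by (intro arg_cong[of _ _ sum_list] map_cong refl) (auto simp: lsume_def)
    qed
    ultimately show ?thesis using dec(1)[of "exv a'" "\<lambda>_. 0"] by simp
  qed
qed

lemma J_kills:
  assumes J: "J \<in> set Js" and v: "v \<in> Rel" and a: "a \<in> expos n"
  shows "int p dvd evl K (\<lambda>i. Th (nthd J i 0)) (mon a \<star> v)"
proof -
  let ?t = "\<lambda>i. Th (nthd J i 0)"
  have J': "length J = K" "\<forall>j\<in>set J. j < M" "\<And>r. r \<in> set rels \<Longrightarrow> eqn_form J (rel_eqn r) \<in> set Zs"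
    using zero J by (auto simp: check_zero_def)
  let ?M = "{v \<in> lvecs n K. \<forall>a\<in>expos n. int p dvd evl K ?t (mon a \<star> v)}"
  have "submod p n K ?M"
    unfolding submod_def
  proof (intro conjI ballI)
    show "mon b \<star> v \<in> ?M" if "v \<in> ?M" "b \<in> expos n" for v b
      using that by (auto simp: smul_simps(8)[symmetric] mon_mult)
    show "of_nat p \<star> v \<in> ?M" if "v \<in> lvecs n K" for v
      using that by (auto simp: smul_commute[of "mon _"])
  qed (auto simp: smul_simps intro: dvd_add)
  moreover have "den ` set rels \<subseteq> ?M"
  proof
    fix v assume "v \<in> den ` set rels"
    then obtain r where r: "r \<in> set rels" "v = den r" by blast
    have wr: "wf_eqn n K m (rel_eqn r)" using rels r(1) by (auto simp: wf_eqn_def rel_eqn_def wf_terms_def)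
    have "int p dvd evl K ?t (mon b \<star> v)" if b: "b \<in> expos n" for b
    proof -
      define b' where "b' = map b [0..<n]"
      have b': "exv b' = b" "length b' = n" using b by (simp_all add: b'_def exv_map_upt)
      have "int p dvd FV als (eqn_form J (rel_eqn r)) (exv b') (\<lambda>_. 0)"
        by (rule zero_forms[OF J'(3)[OF r(1)] wf_eqn_form[OF J'(1) wr J'(2)] _ b'(2)])
          (auto simp: eqn_form_def rel_eqn_def)
      then show ?thesis using FV_eqn_form[OF J'(1) wr] by (simp add: b'(1) eden_rel r(2))
    qed
    then show "v \<in> ?M" using r rels den_lvecs by auto
  qed
  ultimately have "Rel \<subseteq> ?M" unfolding Rel_def by (rule span_least)
  then show ?thesis using v a by blast
qed

definition vanish :: "nat \<Rightarrow> (nat \<Rightarrow> int) \<Rightarrow> bool" where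
  "vanish q k \<longleftrightarrow> (\<forall>phi\<in>set (s_forms (st q)). wf_eqn n M m phi \<and> (\<forall>a\<in>expos n. int p dvd FV als phi a k))"

lemma vanish_step:
  assumes t: "t \<in> set trs" and eps: "length (s_eps (st (fst t))) = m"
    and v: "vanish (fst t) (kval (s_eps (st (fst t))) (fst (snd t) # ds))"
  shows "vanish (fst (snd (snd t))) (kval (s_eps (st (fst t))) ds)"
  unfolding vanish_def
proof
  let ?e = "s_eps (st (fst t))" and ?d = "fst (snd t)"
  fix phi assume "phi \<in> set (s_forms (st (fst (snd (snd t)))))"
  then obtain psi s where ps: "psi \<in> set (s_forms (st (fst t)))" "s \<in> set (int_digit_vecs p n)"
     "phi = form_dec p n tab als s (zmul ?e ?d) psi"
    using transD(3)[OF t] unfolding trans_ok_def by blast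
  have d: "length ?d = m" using transD(3)[OF t] by (auto simp: trans_ok_def digit_vec)
  have psi: "wf_eqn n M m psi" "\<And>a. a \<in> expos n \<Longrightarrow> int p dvd FV als psi a (kval ?e (?d # ds))"
    using v ps(1) by (auto simp: vanish_def)
  have s: "length s = n" using ps(2) by (simp add: int_digit_vec)
  have z: "length (zmul ?e ?d) = length als" using eps d als(2) by (simp add: zmul_def)
  note dec = FV_dec[OF als(1) z _ s, of psi]
  have "int p dvd FV als phi a (kval ?e ds)" if a: "a \<in> expos n" for a
  proof -
    have "FV als phi a (kval ?e ds) = FV als psi (iscale (int p) a + exv s) (\<lambda>j. int p * kval ?e ds j + zmul ?e ?d ! j)"
      unfolding ps(3) by (rule dec(1)) (use psi(1) als(2) in simp)
    also have "\<dots> = FV als psi (iscale (int p) a + exv s) (kval ?e (?d # ds))"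
      by (rule FV_cong[OF psi(1)]) (rule kval_step[OF _ eps d])
    finally show ?thesis using psi(2)[of "iscale (int p) a + exv s"] a s by auto
  qed
  moreover have "wf_eqn n M m phi" using dec(2) psi(1) als(2) ps(3) by simp
  ultimately show "wf_eqn n M m phi \<and> (\<forall>a\<in>expos n. int p dvd FV als phi a (kval ?e ds))" by blast
qed

lemma path_upper:
  assumes "path trs q ds q'" "q < length sts" "length (s_eps (st q)) = m" "vanish q (kval (s_eps (st q)) ds)"
  shows "vanish q' (\<lambda>_. 0)"
  using assms
proof (induction ds arbitrary: q)
  case Nil
  then show ?case by (simp add: kval_def)
next
  case (Cons d ds)
  then obtain t where t: "t \<in> set trs" "fst t = q" "fst (snd t) = d" "path trs (fst (snd (snd t))) ds q'" by auto
  note ok = transD[OF t(1)]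
  have e: "s_eps (st (fst (snd (snd t)))) = s_eps (st q)" using ok(3) t(2,3) by (auto simp: trans_ok_def)
  have "vanish (fst (snd (snd t))) (kval (s_eps (st q)) ds)"
    using vanish_step[OF t(1)] t(2,3) Cons.prems by simp
  then show ?case using Cons.IH[OF t(4) ok(2)] e Cons.prems by simp
qed

lemma init_upper:
  assumes x: "x \<in> set inits" and k: "eden als eqn k \<in> Rel" shows "vanish (fst x) k"
  unfolding vanish_def
proof
  fix phi assume "phi \<in> set (s_forms (st (fst x)))"
  then obtain J where J: "J \<in> set Js" "phi = eqn_form J eqn"
    using inits x by (fastforce simp: check_inits_def init_ok_def st_def)
  have J': "length J = K" "\<forall>j\<in>set J. j < M" using zero J(1) by (auto simp: check_zero_def)
  show "wf_eqn n M m phi \<and> (\<forall>a\<in>expos n. int p dvd FV als phi a k)"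
    using wf_eqn_form[OF J'(1) eqn J'(2)] FV_eqn_form[OF J'(1) eqn] J_kills[OF J(1) k] J(2) by auto
qed

lemma path_exists:
  assumes "q < length sts" "set ds \<subseteq> set (digit_vecs p m)"
  shows "\<exists>q'<length sts. path trs q ds q'"
  using assms
proof (induction ds arbitrary: q)
  case (Cons d ds)
  have "\<exists>t\<in>set trs. fst t = q \<and> fst (snd t) = d" using trans Cons.prems by (auto simp: check_trans_def)
  then obtain t where t: "t \<in> set trs" "fst t = q" "fst (snd t) = d" by blast
  then show ?case using Cons.IH[of "fst (snd (snd t))"] transD(2)[OF t(1)] Cons.prems by auto
qed auto

lemma path_digits: "path trs q ds q' \<Longrightarrow> set ds \<subseteq> set (digit_vecs p m)"
proof (induction ds arbitrary: q)
  case (Cons d ds)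
  then obtain t where t: "t \<in> set trs" "fst (snd t) = d" "path trs (fst (snd (snd t))) ds q'" by auto
  then show ?case using Cons.IH transD(3)[OF t(1)] by (auto simp: trans_ok_def)
qed simp

text \<open>The components \<open>s_pend\<close> and \<open>s_flag\<close> recognize canonical words: \<open>s_pend\<close> marks the negative
  entries of which no nonzero digit has been read, and the flag is 2 if the last letter consists of
  superfluous zeros.\<close>

lemma path_labels:
  assumes "path trs q ds q'" "q < length sts" "length (s_eps (st q)) = m" "length (s_pend (st q)) = m"
  shows "s_eps (st q') = s_eps (st q) \<and> length (s_pend (st q')) = m \<and> q' < length sts \<and>
    (\<forall>j<m. s_pend (st q') ! j = (if dval p ds j = 0 then s_pend (st q) ! j else 0)) \<and>
    (ds \<noteq> [] \<longrightarrow> s_flag (st q') = (if (length ds = 1 \<and> s_flag (st q) = 0) \<or> (\<exists>x\<in>set (last ds). x \<noteq> 0) then 1 else 2))"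
  using assms
proof (induction ds arbitrary: q)
  case Nil
  then show ?case by simp
next
  case (Cons d ds)
  then obtain t where t: "t \<in> set trs" "fst t = q" "fst (snd t) = d" "path trs (fst (snd (snd t))) ds q'" by auto
  note ok = transD[OF t(1)]
  let ?r = "fst (snd (snd t))"
  have d: "length d = m" and e: "s_eps (st ?r) = s_eps (st q)"
    and pd: "s_pend (st ?r) = map (\<lambda>x. if fst x = 0 then snd x else 0) (zip d (s_pend (st q)))"
    and fl: "s_flag (st ?r) = (if s_flag (st q) = 0 \<or> (\<exists>x\<in>set d. x \<noteq> 0) then 1 else 2)"
    using ok(3) t(2,3) by (auto simp: trans_ok_def digit_vec)
  have lp: "length (s_pend (st ?r)) = m" using pd d Cons.prems(4) by simp
  note IH = Cons.IH[OF t(4) ok(2) _ lp]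
  have IH': "s_eps (st q') = s_eps (st q)" "length (s_pend (st q')) = m" "q' < length sts"
    "\<And>j. j < m \<Longrightarrow> s_pend (st q') ! j = (if dval p ds j = 0 then s_pend (st ?r) ! j else 0)"
    "ds \<noteq> [] \<Longrightarrow> s_flag (st q') = (if (length ds = 1 \<and> s_flag (st ?r) = 0) \<or> (\<exists>x\<in>set (last ds). x \<noteq> 0) then 1 else 2)"
    using IH e Cons.prems(3) by simp_all
  have "s_pend (st q') ! j = (if dval p (d # ds) j = 0 then s_pend (st q) ! j else 0)" if "j < m" for j
    using IH'(4)[OF that] that d pd Cons.prems(4) p_pos by auto
  moreover have "s_flag (st q') = (if (length (d # ds) = 1 \<and> s_flag (st q) = 0) \<or> (\<exists>x\<in>set (last (d # ds)). x \<noteq> 0) then 1 else 2)"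
  proof (cases "ds = []")
    case True
    then show ?thesis using t(4) fl by simp
  next
    case False
    have "s_flag (st ?r) \<noteq> 0" using fl by simp
    then show ?thesis using IH'(5)[OF False] False by simp
  qed
  ultimately show ?case using IH' by simp
qed

end

section \<open>Digits and words of integer vectors\<close>

lemma digit_extract: "d < p \<Longrightarrow> (d + p * v) div p ^ Suc i mod p = v div p ^ i mod (p::nat)"
  by (simp add: div_mult2_eq)

lemma dval_digit:
  assumes "\<forall>d\<in>set ds. d ! j < p" "i < length ds"
  shows "dval p ds j div p ^ i mod p = ds ! i ! j"
  using assms
proof (induction ds arbitrary: i)
  case (Cons d ds)
  then show ?case by (cases i) (simp_all only: nth_Cons_0 nth_Cons_Suc dval.simps digit_extract list.set_intros, auto)
qed simp

lemma dval_less: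
  assumes "\<forall>d\<in>set ds. d ! j < p" shows "dval p ds j < p ^ length ds"
  using assms
proof (induction ds)
  case (Cons d ds)
  then have "Suc (dval p ds j) \<le> p ^ length ds" "d ! j < p" by auto
  then have "p * Suc (dval p ds j) \<le> p * p ^ length ds" by (intro mult_le_mono) auto
  then show ?case using \<open>d ! j < p\<close> by simp
qed simp

lemma dval_last:
  assumes "ds \<noteq> []" shows "dval p ds j \<ge> last ds ! j * p ^ (length ds - 1)"
  using assms
proof (induction ds)
  case (Cons d ds)
  show ?case
  proof (cases "ds = []")
    case False
    then obtain l where l: "length ds = Suc l" by (cases ds) auto
    have "p * (last ds ! j * p ^ (length ds - 1)) \<le> p * dval p ds j" using Cons False by (intro mult_le_mono) auto
    moreover have "last (d # ds) ! j * p ^ (length (d # ds) - 1) = p * (last ds ! j * p ^ (length ds - 1))"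
      using False l by simp
    ultimately show ?thesis by (simp only: dval.simps trans_le_add2)
  qed simp
qed simp

lemma dval_digits_of:
  "v < p ^ R \<Longrightarrow> dval p (map (\<lambda>i. map (\<lambda>w. w div p ^ i mod p) ws) [0..<R]) j = v" if "j < length ws" "ws ! j = v" "p > 0"
proof -
  have *: "dval p (map (\<lambda>i. map (\<lambda>w. w div p ^ (i + s) mod p) ws) [0..<R]) j = (ws ! j div p ^ s) mod p ^ R" for s R
  proof (induction R arbitrary: s)
    case (Suc R)
    have "map (\<lambda>i. map (\<lambda>w. w div p ^ (i + s) mod p) ws) [0..<Suc R] =
      map (\<lambda>w. w div p ^ s mod p) ws # map (\<lambda>i. map (\<lambda>w. w div p ^ (i + Suc s) mod p) ws) [0..<R]"
      by (simp add: upt_conv_Cons map_Suc_upt[symmetric] del: upt_Suc)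
    then show ?case using that Suc[of "Suc s"]
      by (simp add: mod_mult2_eq div_mult2_eq[symmetric] mult.commute)
  qed simp
  assume "v < p ^ R"
  then show ?thesis using *[of 0 R] that by simp
qed

lemma digits_length_props:
  assumes "p \<ge> 2"
  shows "a < p ^ length (digits p a)" "length (digits p a) = 1 \<or> p ^ (length (digits p a) - 1) \<le> a" "length (digits p a) \<ge> 1"
proof -
  let ?r = "LEAST r. a < p ^ Suc r"
  have len: "length (digits p a) = Suc ?r" by (simp add: digits_def)
  have ex: "a < p ^ Suc a"
  proof -
    have "a < 2 ^ a" by (rule less_exp)
    also have "(2::nat) ^ a \<le> p ^ a" using assms by (intro power_mono) auto
    also have "\<dots> \<le> p ^ Suc a" using assms by simp
    finally show ?thesis .
  qed
  then show "a < p ^ length (digits p a)" unfolding len by (rule LeastI)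
  show "length (digits p a) = 1 \<or> p ^ (length (digits p a) - 1) \<le> a"
  proof (cases ?r)
    case (Suc r)
    then have "\<not> a < p ^ Suc r" using not_less_Least[of r "\<lambda>r. a < p ^ Suc r"] by simp
    then show ?thesis using len Suc by simp
  qed (use len in simp)
  show "length (digits p a) \<ge> 1" using len by simp
qed

lemma digits_nth: "i < length (digits p a) \<Longrightarrow> digits p a ! i = a div p ^ i mod p"
  by (simp add: digits_def del: upt_Suc)

lemma foldr_max_Max: "foldr max (xs :: nat list) 0 = (if xs = [] then 0 else Max (set xs))"
  by (induction xs) (auto simp: max_def)

text \<open>The hypotheses say that R is the greatest number of digits among the entries. Beyond the
  top digit of an entry the quotients by powers of p vanish, in agreement with the padding by
  zeros.\<close>

lemma tuple_word_eq:
  assumes p: "p \<ge> 2" and ks: "ks \<noteq> []" and R: "R \<ge> 1" "\<forall>k\<in>set ks. nat \<bar>k\<bar> < p ^ R"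
    "R = 1 \<or> (\<exists>k\<in>set ks. p ^ (R - 1) \<le> nat \<bar>k\<bar>)"
  shows "tuple_word p ks = map (\<lambda>k. if k \<ge> 0 then Plus else Minus) ks #
     map (\<lambda>i. map (\<lambda>k. Digit (nat \<bar>k\<bar> div p ^ i mod p)) ks) [0..<R]"
proof -
  let ?D = "\<lambda>k. length (digits p (nat \<bar>k\<bar>))"
  have len: "length (int_word p k) = Suc (?D k)" for k by (simp add: int_word_def)
  have leR: "?D k \<le> R" if "k \<in> set ks" for k
  proof (rule ccontr)
    assume "\<not> ?D k \<le> R"
    then have "?D k \<noteq> 1" "R \<le> ?D k - 1" using R(1) by auto
    then have "p ^ R \<le> p ^ (?D k - 1)" "p ^ (?D k - 1) \<le> nat \<bar>k\<bar>"
      using digits_length_props(2)[OF p, of "nat \<bar>k\<bar>"] p by (auto intro: power_increasing)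
    then show False using R(2) that by (meson le_trans not_le)
  qed
  have exR: "\<exists>k\<in>set ks. ?D k = R"
  proof (cases "R = 1")
    case True
    obtain k where "k \<in> set ks" using ks by (cases ks) auto
    then show ?thesis using leR digits_length_props(3)[OF p, of "nat \<bar>k\<bar>"] True by force
  next
    case False
    then obtain k where k: "k \<in> set ks" "p ^ (R - 1) \<le> nat \<bar>k\<bar>" using R(3) by auto
    have "\<not> ?D k \<le> R - 1"
    proof
      assume "?D k \<le> R - 1"
      then have "p ^ ?D k \<le> p ^ (R - 1)" using p by (intro power_increasing) auto
      then show False using digits_length_props(1)[OF p, of "nat \<bar>k\<bar>"] k(2) by simp
    qed
    then show ?thesis using leR[OF k(1)] k(1) by (intro bexI[of _ k]) auto
  qed
  have L: "foldr max (map length (map (int_word p) ks)) 0 = Suc R"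
  proof -
    have "Max (set (map length (map (int_word p) ks))) = Suc R"
      by (rule Max_eqI) (use len leR exR in \<open>auto simp: image_image intro!: image_eqI\<close>)
    then show ?thesis using ks by (simp add: foldr_max_Max)
  qed
  have pad: "(int_word p k @ replicate (Suc R - length (int_word p k)) (Digit 0)) ! Suc i = Digit (nat \<bar>k\<bar> div p ^ i mod p)"
    if "k \<in> set ks" "i < R" for k i
  proof (cases "i < ?D k")
    case True
    then show ?thesis by (simp add: int_word_def nth_append digits_nth)
  next
    case False
    have "nat \<bar>k\<bar> < p ^ i"
      using digits_length_props(1)[OF p, of "nat \<bar>k\<bar>"] False p
      by (meson le_trans not_less power_increasing less_le_trans le_less_trans one_le_numeral order.trans)
    moreover have "i - ?D k < R - ?D k" using False that by simp
    ultimately show ?thesis using False that by (simp add: int_word_def nth_append)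
  qed
  have "tuple_word p ks = map (\<lambda>j. map (\<lambda>w. w ! j) (map (\<lambda>w. w @ replicate (Suc R - length w) (Digit 0)) (map (int_word p) ks))) [0..<Suc R]"
    unfolding tuple_word_def Let_def L ..
  also have "[0..<Suc R] = 0 # map Suc [0..<R]" by (simp add: upt_conv_Cons map_Suc_upt del: upt_Suc)
  finally show ?thesis using pad by (simp add: comp_def) (auto simp: int_word_def)
qed

section \<open>The language of the automaton\<close>

context cert_ok
begin

abbreviation "autom \<equiv> cert_automaton m sts inits trs fins"

definition word :: "int list \<Rightarrow> nat list list \<Rightarrow> sym list list" where
  "word e ds = (if m = 0 then [] else [map (\<lambda>x. if x = 1 then Plus else Minus) e]) @ map (map Digit) ds"

definition acc :: "int list \<Rightarrow> nat list list \<Rightarrow> bool" where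
  "acc e ds \<longleftrightarrow> (\<exists>x\<in>set inits. s_eps (st (fst x)) = e \<and> (\<exists>q'\<in>set fins. path trs (fst x) ds q'))"

definition canon :: "int list \<Rightarrow> nat list list \<Rightarrow> bool" where
  "canon e ds \<longleftrightarrow> e \<in> set (signs m) \<and> set ds \<subseteq> set (digit_vecs p m) \<and> (if m = 0 then ds = []
     else ds \<noteq> [] \<and> (length ds = 1 \<or> (\<exists>x\<in>set (last ds). x \<noteq> 0)) \<and> (\<forall>j<m. e ! j = - 1 \<longrightarrow> dval p ds j \<noteq> 0))"

lemma initD:
  assumes "x \<in> set inits"
  shows "fst x < length sts" "s_eps (st (fst x)) \<in> set (signs m)" "length (s_eps (st (fst x))) = m"
    "s_pend (st (fst x)) = map (\<lambda>e. if e = - 1 then 1 else 0) (s_eps (st (fst x)))" "s_flag (st (fst x)) = 0"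
proof -
  have *: "fst x < length sts" "init_ok n p m rels eqn Js (st (fst x)) (snd x)"
    using inits assms by (auto simp: check_inits_def st_def)
  show "fst x < length sts" by (rule *(1))
  from *(2) show "s_eps (st (fst x)) \<in> set (signs m)" unfolding init_ok_def by blast
  then show "length (s_eps (st (fst x))) = m" unfolding sign_vec by blast
  from *(2) show "s_pend (st (fst x)) = map (\<lambda>e. if e = - 1 then 1 else 0) (s_eps (st (fst x)))"
    "s_flag (st (fst x)) = 0" unfolding init_ok_def by blast+
qed

lemma finD: "q \<in> set fins \<Longrightarrow> q < length sts"
  using final by (auto simp: check_final_def)

lemma transitions_core:
  "q < length sts \<Longrightarrow> (q, c, r) \<in> set (transitions autom) \<longleftrightarrow>
     (\<exists>t\<in>set trs. q = fst t \<and> c = map Digit (fst (snd t)) \<and> r = fst (snd (snd t)))"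
  by (auto simp: cert_automaton_def)

lemma run_core: "q < length sts \<Longrightarrow> run autom q w q' \<longleftrightarrow> (\<exists>ds. w = map (map Digit) ds \<and> path trs q ds q')"
proof (induction w arbitrary: q)
  case (Cons c w)
  have "run autom q (c # w) q' \<longleftrightarrow> (\<exists>t\<in>set trs. q = fst t \<and> c = map Digit (fst (snd t)) \<and> run autom (fst (snd (snd t))) w q')"
    using transitions_core[OF Cons.prems] by auto
  also have "\<dots> \<longleftrightarrow> (\<exists>t\<in>set trs. q = fst t \<and> c = map Digit (fst (snd t)) \<and>
      (\<exists>ds. w = map (map Digit) ds \<and> path trs (fst (snd (snd t))) ds q'))"
    using Cons.IH transD(2) by blast
  also have "\<dots> \<longleftrightarrow> (\<exists>ds. c # w = map (map Digit) ds \<and> path trs q ds q')"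
  proof
    assume "\<exists>t\<in>set trs. q = fst t \<and> c = map Digit (fst (snd t)) \<and>
      (\<exists>ds. w = map (map Digit) ds \<and> path trs (fst (snd (snd t))) ds q')"
    then obtain t ds where "t \<in> set trs" "q = fst t" "c = map Digit (fst (snd t))" "w = map (map Digit) ds"
      "path trs (fst (snd (snd t))) ds q'" by blast
    then show "\<exists>ds. c # w = map (map Digit) ds \<and> path trs q ds q'"
      by (intro exI[of _ "fst (snd t) # ds"]) auto
  next
    assume "\<exists>ds. c # w = map (map Digit) ds \<and> path trs q ds q'"
    then obtain d ds where "c = map Digit d" "w = map (map Digit) ds" "path trs q (d # ds) q'"
      by (auto simp: Cons_eq_map_conv)
    then show "\<exists>t\<in>set trs. q = fst t \<and> c = map Digit (fst (snd t)) \<and>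
      (\<exists>ds. w = map (map Digit) ds \<and> path trs (fst (snd (snd t))) ds q')" by fastforce
  qed
  finally show ?case .
qed auto

lemma language_autom: "language autom = {word e ds |e ds. acc e ds}"
proof (cases "m = 0")
  case True
  have "language autom = {w. \<exists>x\<in>set inits. \<exists>q'\<in>set fins. run autom (fst x) w q'}"
    unfolding language_def using True by (auto simp: cert_automaton_def)
  also have "\<dots> = {w. \<exists>x\<in>set inits. \<exists>q'\<in>set fins. \<exists>ds. w = map (map Digit) ds \<and> path trs (fst x) ds q'}"
    using run_core initD(1) by auto
  also have "\<dots> = {word e ds |e ds. acc e ds}"
  proof -
    have w: "word e ds = map (map Digit) ds" for e ds unfolding word_def using True by simp
    show ?thesis unfolding acc_def w by blast
  qed
  finally show ?thesis .
next
  case False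
  have tr: "(length sts, c, r) \<in> set (transitions autom) \<longleftrightarrow>
     (\<exists>x\<in>set inits. c = map (\<lambda>e. if e = 1 then Plus else Minus) (s_eps (st (fst x))) \<and> r = fst x)" for c r
  proof -
    \<comment> \<open>No transition of the certificate leaves the additional state, so only sign
      letters are read there.\<close>
    have "(length sts, c, r) \<notin> (\<lambda>t. (fst t, map Digit (fst (snd t)), fst (snd (snd t)))) ` set trs"
      using transD(1) by (metis (no_types, lifting) fst_conv imageE less_irrefl)
    then show ?thesis
      unfolding cert_automaton_def st_def automaton.sel set_append set_map Un_iff by (auto simp: image_iff Bex_def)
  qed
  have "run autom (length sts) w q' \<longleftrightarrow> (\<exists>x\<in>set inits. \<exists>ds. w = word (s_eps (st (fst x))) ds \<and> path trs (fst x) ds q')"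
    if "q' \<in> set fins" for w q'
  proof (cases w)
    case Nil
    then show ?thesis using finD[OF that] False by (auto simp: word_def)
  next
    case (Cons c w')
    have "run autom (length sts) w q' \<longleftrightarrow> (\<exists>x\<in>set inits. c = map (\<lambda>e. if e = 1 then Plus else Minus) (s_eps (st (fst x))) \<and>
       run autom (fst x) w' q')"
      using tr by (auto simp: Cons)
    also have "\<dots> \<longleftrightarrow> (\<exists>x\<in>set inits. \<exists>ds. w = word (s_eps (st (fst x))) ds \<and> path trs (fst x) ds q')"
      using run_core initD(1) False by (auto simp: Cons word_def)
    finally show ?thesis .
  qed
  moreover have "language autom = {w. \<exists>q'\<in>set fins. run autom (length sts) w q'}"
    using False by (simp add: language_def cert_automaton_def)
  ultimately show ?thesis unfolding acc_def by auto
qed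

lemma labels:
  assumes x: "x \<in> set inits" and path: "path trs (fst x) ds q'"
  shows "q' < length sts" "s_eps (st q') = s_eps (st (fst x))"
    "s_accepting m (st q') \<longleftrightarrow> canon (s_eps (st (fst x))) ds"
proof -
  note i = initD[OF x]
  have lp: "length (s_pend (st (fst x))) = m" using i(3,4) by simp
  note L = path_labels[OF path i(1,3) lp]
  show "q' < length sts" "s_eps (st q') = s_eps (st (fst x))" using L by auto
  have pend: "(\<forall>y\<in>set (s_pend (st q')). y = 0) \<longleftrightarrow> (\<forall>j<m. s_eps (st (fst x)) ! j = - 1 \<longrightarrow> dval p ds j \<noteq> 0)"
  proof -
    have "(\<forall>y\<in>set (s_pend (st q')). y = 0) \<longleftrightarrow> (\<forall>j<m. s_pend (st q') ! j = 0)"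
      using L by (auto simp: all_set_conv_all_nth)
    also have "\<dots> \<longleftrightarrow> (\<forall>j<m. s_eps (st (fst x)) ! j = - 1 \<longrightarrow> dval p ds j \<noteq> 0)"
      using L i(3,4) by auto
    finally show ?thesis .
  qed
  have flag: "s_flag (st q') = (if ds = [] then 0 else if length ds = 1 \<or> (\<exists>x\<in>set (last ds). x \<noteq> 0) then 1 else 2)"
  proof (cases "ds = []")
    case True
    then show ?thesis using path i(5) by simp
  next
    case False
    then show ?thesis using L i(5) by simp
  qed
  show "s_accepting m (st q') \<longleftrightarrow> canon (s_eps (st (fst x))) ds"
    unfolding s_accepting_def canon_def flag pend using i(2) path_digits[OF path] by auto
qed

text \<open>A path into a final state carries the lower bound at the vector of ones back to the
  equation. Conversely, a solution makes every functional along its path vanish, whereas an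
  accepting state that is not final exhibits a functional that does not vanish at the vector of
  ones.\<close>

lemma acc_iff: "acc e ds \<longleftrightarrow> canon e ds \<and> eden als eqn (kval e ds) \<in> Rel"
proof
  assume "acc e ds"
  then obtain x q' where x: "x \<in> set inits" "s_eps (st (fst x)) = e" "q' \<in> set fins" "path trs (fst x) ds q'"
    by (auto simp: acc_def)
  note i = initD[OF x(1)]
  have "final_ok p n m tab base wits (q' \<in> set fins) (st q')"
    using final finD[OF x(3)] unfolding check_final_def st_def by simp
  then have fin: "final_ok p n m tab base wits True (st q')" using x(3) by simp
  then have a: "s_accepting m (st q')" by (simp add: final_ok_def split: if_splits)
  then have "member_cert n p (s_gens (st q')) (s_cert (st q')) (ones n m)" using fin by (simp add: final_ok_def)
  then have "den (ones n m) \<in> Sp q'"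
    unfolding Sp_def using member_cert_iff[OF p_pos wf_gens[OF finD[OF x(3)]], of "ones n m"] ones(1)[of n als] als(2) by auto
  then have "sol_vec als (\<lambda>_. 0) \<in> Sp q'" using ones(2)[of n als] als(2) by simp
  from path_lower[OF x(4) i(1,3) this] have "sol_vec als (kval e ds) \<in> Sp (fst x)" using x(2) by simp
  from init_lower[OF x(1) this] have "eden als eqn (kval e ds) \<in> Rel"
    using eapp_sol_vec[of n K als eqn] eqn als(2) by simp
  moreover have "canon e ds" using labels(3)[OF x(1,4)] a x(2) by simp
  ultimately show "canon e ds \<and> eden als eqn (kval e ds) \<in> Rel" by blast
next
  assume *: "canon e ds \<and> eden als eqn (kval e ds) \<in> Rel"
  then have "e \<in> set (signs m)" "set ds \<subseteq> set (digit_vecs p m)" by (auto simp: canon_def)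
  then obtain x where x: "x \<in> set inits" "s_eps (st (fst x)) = e"
    using inits unfolding check_inits_def st_def by blast
  note i = initD[OF x(1)]
  obtain q' where q': "path trs (fst x) ds q'" using path_exists[OF i(1)] \<open>set ds \<subseteq> _\<close> by blast
  note l = labels[OF x(1) q']
  have "vanish (fst x) (kval e ds)" using init_upper[OF x(1)] * by blast
  then have v: "vanish q' (\<lambda>_. 0)" using path_upper[OF q' i(1,3)] x(2) by simp
  have "q' \<in> set fins"
  proof (rule ccontr)
    assume "q' \<notin> set fins"
    moreover have "final_ok p n m tab base wits (q' \<in> set fins) (st q')"
      using final l(1) unfolding check_final_def st_def by simp
    moreover have "s_accepting m (st q')" using l(3) x(2) * by simp
    ultimately have "final_ok p n m tab base wits False (st q')" "s_accepting m (st q')" by simp_all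
    then obtain phi a where pa: "phi \<in> set (s_forms (st q'))" "a \<in> set wits" "\<not> int p dvd form_val p tab base phi a"
      by (auto simp: final_ok_def)
    have "length a = n" using final pa(2) by (auto simp: check_final_def)
    moreover have "wf_eqn n M m phi" "\<forall>a\<in>expos n. int p dvd FV als phi a (\<lambda>_. 0)"
      using v pa(1) unfolding vanish_def by blast+
    ultimately show False using pa(3) form_val[of m phi a als] exv_expos[of a n] by simp
  qed
  then show "acc e ds" unfolding acc_def using x q' by blast
qed

definition kvec :: "int list \<Rightarrow> nat list list \<Rightarrow> int list" where "kvec e ds = map (kval e ds) [0..<m]"

lemma canon_word:
  assumes c: "canon e ds" shows "tuple_word p (kvec e ds) = word e ds"
proof (cases "m = 0")
  case True
  then have "ds = []" using c unfolding canon_def by simp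
  then show ?thesis using True unfolding kvec_def tuple_word_def word_def by simp
next
  case False
  have e: "length e = m" "\<And>j. j < m \<Longrightarrow> e ! j = 1 \<or> e ! j = - 1"
  proof -
    have "e \<in> set (signs m)" using c by (simp add: canon_def)
    then show l: "length e = m" by (simp add: sign_vec)
    show "e ! j = 1 \<or> e ! j = - 1" if "j < m" for j
      using \<open>e \<in> set (signs m)\<close> nth_mem[of j e] that l unfolding sign_vec by blast
  qed
  have ds: "\<And>d. d \<in> set ds \<Longrightarrow> length d = m" "\<And>d j. d \<in> set ds \<Longrightarrow> j < m \<Longrightarrow> d ! j < p"
    using c by (auto simp: canon_def digit_vec subset_iff)
  have ne: "ds \<noteq> []" "length ds = 1 \<or> (\<exists>x\<in>set (last ds). x \<noteq> 0)" "\<And>j. j < m \<Longrightarrow> e ! j = - 1 \<Longrightarrow> dval p ds j \<noteq> 0"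
    using c False by (auto simp: canon_def)
  have abs: "nat \<bar>kval e ds j\<bar> = dval p ds j" if "j < m" for j
    using e(2)[OF that] by (auto simp: kval_def)
  have less: "dval p ds j < p ^ length ds" if "j < m" for j by (rule dval_less) (use ds that in auto)
  have "tuple_word p (kvec e ds) = map (\<lambda>k. if k \<ge> 0 then Plus else Minus) (kvec e ds) #
     map (\<lambda>i. map (\<lambda>k. Digit (nat \<bar>k\<bar> div p ^ i mod p)) (kvec e ds)) [0..<length ds]"
  proof (rule tuple_word_eq[OF p])
    show "kvec e ds \<noteq> []" using False by (simp add: kvec_def)
    show "1 \<le> length ds" using ne(1) by (cases ds) auto
    show "\<forall>k\<in>set (kvec e ds). nat \<bar>k\<bar> < p ^ length ds" using abs less by (auto simp: kvec_def)
    show "length ds = 1 \<or> (\<exists>k\<in>set (kvec e ds). p ^ (length ds - 1) \<le> nat \<bar>k\<bar>)"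
    proof (cases "length ds = 1")
      case False
      then obtain x where "x \<in> set (last ds)" "x \<noteq> 0" using ne(2) by auto
      moreover have "length (last ds) = m" using ds(1) ne(1) by simp
      ultimately obtain j where j: "j < m" "last ds ! j \<noteq> 0" by (metis in_set_conv_nth)
      have "1 * p ^ (length ds - 1) \<le> last ds ! j * p ^ (length ds - 1)" using j(2) by (intro mult_le_mono) auto
      also have "\<dots> \<le> dval p ds j" by (rule dval_last[OF ne(1)])
      finally show ?thesis using abs[OF j(1)] j(1) by (auto simp: kvec_def intro!: disjI2 bexI[of _ j])
    qed simp
  qed
  also have "map (\<lambda>k. if k \<ge> 0 then Plus else Minus) (kvec e ds) = map (\<lambda>x. if x = 1 then Plus else Minus) e"
  proof (rule nth_equalityI)
    fix j assume "j < length (map (\<lambda>k. if k \<ge> 0 then Plus else Minus) (kvec e ds))"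
    then have j: "j < m" by (simp add: kvec_def)
    show "map (\<lambda>k. if k \<ge> 0 then Plus else Minus) (kvec e ds) ! j = map (\<lambda>x. if x = 1 then Plus else Minus) e ! j"
      using e(2)[OF j] ne(3)[OF j] j e(1) by (auto simp: kvec_def kval_def)
  qed (simp add: kvec_def e)
  also have "map (\<lambda>i. map (\<lambda>k. Digit (nat \<bar>k\<bar> div p ^ i mod p)) (kvec e ds)) [0..<length ds] = map (map Digit) ds"
  proof (rule nth_equalityI)
    fix i assume "i < length (map (\<lambda>i. map (\<lambda>k. Digit (nat \<bar>k\<bar> div p ^ i mod p)) (kvec e ds)) [0..<length ds])"
    then have i: "i < length ds" by simp
    then have di: "length (ds ! i) = m" using ds(1) by simp
    have "map (\<lambda>k. Digit (nat \<bar>k\<bar> div p ^ i mod p)) (kvec e ds) = map Digit (ds ! i)"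
      by (rule nth_equalityI) (use di abs dval_digit[of ds _ p i] ds(2) i in \<open>auto simp: kvec_def\<close>)
    then show "map (\<lambda>i. map (\<lambda>k. Digit (nat \<bar>k\<bar> div p ^ i mod p)) (kvec e ds)) [0..<length ds] ! i = map (map Digit) ds ! i"
      using i by simp
  qed simp
  finally show ?thesis using False by (simp add: word_def)
qed

lemma canon_exists:
  assumes "length ks = m" shows "\<exists>e ds. canon e ds \<and> kvec e ds = ks"
proof (cases "m = 0")
  case True
  then show ?thesis using assms unfolding canon_def kvec_def sign_vec by (intro exI[of _ "[]"]) simp
next
  case False
  let ?P = "\<lambda>R. R \<ge> 1 \<and> (\<forall>k\<in>set ks. nat \<bar>k\<bar> < p ^ R)"
  \<comment> \<open>The common number of digits; at least 1, because 0 is written with one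
    digit.\<close>
  define R where "R = (LEAST R. ?P R)"
  have "?P (Suc (sum_list (map (\<lambda>k. nat \<bar>k\<bar>) ks)))"
  proof (intro conjI ballI)
    fix k assume "k \<in> set ks"
    then have "nat \<bar>k\<bar> \<le> sum_list (map (\<lambda>k. nat \<bar>k\<bar>) ks)" by (intro member_le_sum_list) auto
    also have "\<dots> < 2 ^ sum_list (map (\<lambda>k. nat \<bar>k\<bar>) ks)" by (rule less_exp)
    also have "\<dots> \<le> p ^ sum_list (map (\<lambda>k. nat \<bar>k\<bar>) ks)" using p by (intro power_mono) auto
    also have "\<dots> \<le> p ^ Suc (sum_list (map (\<lambda>k. nat \<bar>k\<bar>) ks))" using p by simp
    finally show "nat \<bar>k\<bar> < p ^ Suc (sum_list (map (\<lambda>k. nat \<bar>k\<bar>) ks))" .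
  qed simp
  then have R: "?P R" unfolding R_def by (rule LeastI)
  have R1: "\<exists>k\<in>set ks. p ^ (R - 1) \<le> nat \<bar>k\<bar>" if "R \<noteq> 1"
  proof (rule ccontr)
    assume "\<not> ?thesis"
    then have "?P (R - 1)" using R that by (auto simp: not_le)
    then have "R \<le> R - 1" unfolding R_def by (rule Least_le)
    moreover have "1 \<le> R" using R by blast
    ultimately show False by simp
  qed
  define e where "e = map (\<lambda>k. if k \<ge> 0 then 1 else - 1 :: int) ks"
  define ws where "ws = map (\<lambda>k. nat \<bar>k\<bar>) ks"
  define ds where "ds = map (\<lambda>i. map (\<lambda>w. w div p ^ i mod p) ws) [0..<R]"
  have dv: "dval p ds j = nat \<bar>ks ! j\<bar>" if "j < m" for j
    unfolding ds_def by (rule dval_digits_of) (use that assms R p_pos in \<open>auto simp: ws_def\<close>)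
  have "ds \<noteq> []" using R by (simp add: ds_def)
  have last: "last ds = map (\<lambda>w. w div p ^ (R - 1) mod p) ws"
    using R by (simp add: ds_def last_map)
  have "canon e ds"
    unfolding canon_def
  proof (intro conjI)
    show "e \<in> set (signs m)" using assms by (auto simp: e_def sign_vec)
    show "set ds \<subseteq> set (digit_vecs p m)"
    proof
      fix d assume "d \<in> set ds"
      then show "d \<in> set (digit_vecs p m)" using assms p_pos unfolding digit_vec by (auto simp: ds_def ws_def)
    qed
    have "length ds = 1 \<or> (\<exists>x\<in>set (last ds). x \<noteq> 0)"
    proof (cases "R = 1")
      case False
      then obtain k where k: "k \<in> set ks" "p ^ (R - 1) \<le> nat \<bar>k\<bar>" using R1 by blast
      have "nat \<bar>k\<bar> < p * p ^ (R - 1)" using R k(1) by (cases R) auto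
      then have "nat \<bar>k\<bar> div p ^ (R - 1) < p" by (simp add: less_mult_imp_div_less)
      moreover have "nat \<bar>k\<bar> div p ^ (R - 1) \<noteq> 0" using k(2) p_pos by (simp add: div_eq_0_iff)
      ultimately have "nat \<bar>k\<bar> div p ^ (R - 1) mod p \<noteq> 0" by simp
      moreover have "nat \<bar>k\<bar> div p ^ (R - 1) mod p \<in> set (last ds)" using k(1) by (simp add: last ws_def image_image)
      ultimately show ?thesis by blast
    qed (simp add: ds_def)
    then show "if m = 0 then ds = [] else ds \<noteq> [] \<and> (length ds = 1 \<or> (\<exists>x\<in>set (last ds). x \<noteq> 0)) \<and>
        (\<forall>j<m. e ! j = - 1 \<longrightarrow> dval p ds j \<noteq> 0)"
      using False \<open>ds \<noteq> []\<close> dv assms by (auto simp: e_def)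
  qed
  moreover have "kvec e ds = ks"
    by (rule nth_equalityI) (use dv assms in \<open>auto simp: kvec_def kval_def e_def\<close>)
  ultimately show ?thesis by blast
qed

theorem cert_automaton_correct:
  "accepting_automaton p m {ks. length ks = m \<and> eden als eqn ((!) ks) \<in> Rel} autom"
  unfolding accepting_automaton_def
proof (intro conjI)
  show "automaton_over (tuple_letters p m) autom"
  proof -
    have "map (\<lambda>e. if e = 1 then Plus else Minus) (s_eps (st (fst x))) \<in> tuple_letters p m" if "x \<in> set inits" for x
      using initD(3)[OF that] by (auto simp: tuple_letters_def sigma_def)
    moreover have "map Digit (fst (snd t)) \<in> tuple_letters p m" if "t \<in> set trs" for t
      using transD(3)[OF that] by (auto simp: trans_ok_def digit_vec tuple_letters_def sigma_def)
    ultimately show ?thesis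
      using initD(1) transD(1,2) finD
      unfolding automaton_over_def cert_automaton_def by (auto simp: st_def less_SucI)
  qed
  have ed: "eden als eqn ((!) (kvec e ds)) = eden als eqn (kval e ds)" for e ds
    by (rule eden_cong) (use eqn als(2) in \<open>auto simp: kvec_def\<close>)
  show "language autom = tuple_word p ` {ks. length ks = m \<and> eden als eqn ((!) ks) \<in> Rel}"
  proof (intro equalityI subsetI)
    fix w assume "w \<in> language autom"
    then obtain e ds where "w = word e ds" "canon e ds" "eden als eqn (kval e ds) \<in> Rel"
      unfolding language_autom acc_iff by blast
    then show "w \<in> tuple_word p ` {ks. length ks = m \<and> eden als eqn ((!) ks) \<in> Rel}"
      using canon_word ed by (intro image_eqI[of _ _ "kvec e ds"]) (auto simp: kvec_def)
  next
    fix w assume "w \<in> tuple_word p ` {ks. length ks = m \<and> eden als eqn ((!) ks) \<in> Rel}"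
    then obtain ks where ks: "w = tuple_word p ks" "length ks = m" "eden als eqn ((!) ks) \<in> Rel" by blast
    obtain e ds where "canon e ds" "kvec e ds = ks" using canon_exists[OF ks(2)] by blast
    then show "w \<in> language autom"
      unfolding language_autom acc_iff using ks canon_word ed by (auto intro!: exI[of _ e] exI[of _ ds])
  qed
qed auto

end

section \<open>Existence of certificates\<close>

context arrays
begin

lemma arr_unfold:
  assumes "j < M" "length a = n"
  shows "arr p tab base j a = arr p tab base (tau j (map (\<lambda>x. x mod int p) a)) (map (\<lambda>x. x div int p) a)"
proof -
  have "map2 (\<lambda>x y. int p * x + y) (map (\<lambda>x. x div int p) a) (map (\<lambda>x. x mod int p) a) = a"
    by (auto intro!: nth_equalityI)
  moreover have "arr p tab base j (map2 (\<lambda>x y. int p * x + y) (map (\<lambda>x. x div int p) a) (map (\<lambda>x. x mod int p) a)) =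
      arr p tab base (tau j (map (\<lambda>x. x mod int p) a)) (map (\<lambda>x. x div int p) a)"
    by (rule arr_dec) (use assms p in auto)
  ultimately show ?thesis by simp
qed

lemma arr_fixed:
  assumes "j < M" "length a = n" "fixed a" shows "arr p tab base j a = val (j, a)"
proof -
  have "val ((arr_step p tab ^^ k) (i, a)) = val (i, a)" if "i < M" for k i
    using that
  proof (induction k arbitrary: i)
    case (Suc k)
    have "(arr_step p tab ^^ Suc k) (i, a) = (arr_step p tab ^^ k) (tau i (map (\<lambda>x. x mod int p) a), a)"
      by (simp add: funpow_Suc_right arr_step_def tau_def fixed_div[OF assms(3)] del: funpow.simps)
    also have "val \<dots> = val (tau i (map (\<lambda>x. x mod int p) a), a)" by (rule Suc.IH[OF tau_less])
    also have "\<dots> = val (arr_step p tab (i, a))" by (simp add: arr_step_def tau_def fixed_div[OF assms(3)])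
    also have "\<dots> = val (i, a)" by (rule val_fixed[OF assms(3,2) Suc.prems])
    finally show ?case .
  qed simp
  then show ?thesis using iter_stable[OF assms(1,2) order.refl] assms(1) by simp
qed

text \<open>The recursion by decimation together with the values at vectors with entries 0 and -1
  determines an array, by descent in \<open>vsize\<close>.\<close>

lemma arr_eqI:
  assumes step: "\<And>j a. j < M \<Longrightarrow> length a = n \<Longrightarrow>
      T j a = T (tau j (map (\<lambda>x. x mod int p) a)) (map (\<lambda>x. x div int p) a)"
    and base: "\<And>j a. j < M \<Longrightarrow> length a = n \<Longrightarrow> fixed a \<Longrightarrow> val (j, a) = T j a"
  shows "j < M \<Longrightarrow> length a = n \<Longrightarrow> arr p tab base j a = T j a"
proof (induction "vsize a" arbitrary: a j rule: less_induct)
  case less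
  show ?case
  proof (cases "fixed a")
    case True
    then show ?thesis using arr_fixed base less.prems by simp
  next
    case False
    have "arr p tab base (tau j (map (\<lambda>x. x mod int p) a)) (map (\<lambda>x. x div int p) a) =
        T (tau j (map (\<lambda>x. x mod int p) a)) (map (\<lambda>x. x div int p) a)"
      by (rule less.hyps[OF vsize_step_less[OF False] tau_less]) (simp add: less.prems)
    then show ?thesis using arr_unfold[OF less.prems] step[OF less.prems] by simp
  qed
qed

end

lemma evl_cong:
  assumes "v \<in> lvecs n K" "\<And>i a. i < K \<Longrightarrow> a \<in> expos n \<Longrightarrow> t i a = t' i a" shows "evl K t v = evl K t' v"
  unfolding evl_def
proof (rule sum.cong[OF refl])
  fix i assume "i \<in> {..<K}"
  moreover have "v i \<in> lpolys n" using assms(1) by (simp add: lvecs_def)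
  ultimately show "lin (t i) (v i) = lin (t' i) (v i)" using assms(2) by (intro lin_cong[of _ n]) auto
qed

text \<open>Decimation acts on the component arrays separately, so the components of the finite
  family are again a finite set closed under decimation. Its enumeration gives the transition table,
  and the values at vectors with entries 0 and -1 give the base table.\<close>

lemma tables_exist:
  assumes p: "prime p" and N: "submod p n K N"
  shows "\<exists>M tab base Js. arrays p n M tab base \<and> (\<forall>J\<in>set Js. length J = K \<and> (\<forall>j\<in>set J. j < M)) \<and>
    N = {v \<in> lvecs n K. \<forall>J\<in>set Js. \<forall>a\<in>expos n. int p dvd evl K (\<lambda>i. arrays.Th p n tab base (nthd J i 0)) (mon a \<star> v)}"
proof -
  have p2: "p \<ge> 2" using p by (rule prime_ge_2_nat)
  have "finite_state p n K N" by (rule finite_state_submod[OF p N])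
  then obtain T T0 where T: "finite T" "T0 \<subseteq> T" "\<And>t s. t \<in> T \<Longrightarrow> s \<in> digs p n \<Longrightarrow> decim p s t \<in> T"
    "N = {v \<in> lvecs n K. \<forall>t\<in>T0. \<forall>a\<in>expos n. int p dvd evl K t (mon a \<star> v)}"
    unfolding finite_state_def by (elim exE conjE) blast
  \<comment> \<open>The zero array makes the table nonempty also if K is 0 or the family is
    empty.\<close>
  define A where "A = (\<lambda>x. fst x (snd x)) ` (T \<times> {..<K}) \<union> {\<lambda>_::expo. 0}"
  have "finite A" using T(1) by (simp add: A_def)
  then obtain arrs where arrs: "set arrs = A" using finite_list by blast
  define M where "M = length arrs"
  have "\<exists>j. j < M \<and> arrs ! j = f" if "f \<in> A" for f
    using that arrs in_set_conv_nth[of f arrs] by (simp add: M_def)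
  then obtain idx where idx: "\<And>f. f \<in> A \<Longrightarrow> idx f < M \<and> arrs ! idx f = f" by metis
  define D where "D = (\<lambda>(f::expo \<Rightarrow> int) s a. f (scale_expo p a + exv s))"
  have AD: "D f s \<in> A" if f: "f \<in> A" and s: "s \<in> set (int_digit_vecs p n)" for f s
  proof -
    have s': "exv s \<in> digs p n"
      using s p2 by (auto simp: int_digit_vec digs_def exv_def expos_def)
    consider "f = (\<lambda>_. 0)" | t i where "t \<in> T" "i < K" "f = t i" using f by (auto simp: A_def)
    then show ?thesis
    proof cases
      case 1
      then show ?thesis by (simp add: A_def D_def)
    next
      case 2
      have "D f s = decim p (exv s) t i" by (simp add: 2(3) D_def decim_def)
      then show ?thesis using T(3)[OF 2(1) s'] 2(2) by (auto simp: A_def intro!: rev_image_eqI)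
    qed
  qed
  define g where "g = (\<lambda>k::nat \<times> int list. idx (D (arrs ! fst k) (snd k)))"
  define tab where "tab = map (\<lambda>k. (k, g k)) (List.product [0..<M] (int_digit_vecs p n))"
  define base where "base = map (\<lambda>k. (k, (arrs ! fst k) (exv (snd k)))) (List.product [0..<M] (List.n_lists n [- 1, 0]))"
  have arrsA: "arrs ! j \<in> A" if "j < M" for j using that arrs M_def nth_mem by blast
  have gM: "g (j, s) < M" "arrs ! g (j, s) = D (arrs ! j) s" if "j < M" "s \<in> set (int_digit_vecs p n)" for j s
    using idx[OF AD[OF arrsA[OF that(1)] that(2)]] by (simp_all add: g_def)
  have look_tab: "look tab (j, s) 0 = g (j, s)" if "j < M" "s \<in> set (int_digit_vecs p n)" for j s
    unfolding tab_def by (rule look_map) (use that in simp)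
  have look_base: "look base (j, a) 0 = (arrs ! j) (exv a)" if "j < M" "length a = n" "set a \<subseteq> {- 1, 0}" for j a
  proof -
    have "(j, a) \<in> set (List.product [0..<M] (List.n_lists n [- 1, 0]))" using that by (simp add: set_n_lists)
    from look_map[OF this, of "\<lambda>k. (arrs ! fst k) (exv (snd k))" 0] show ?thesis by (simp add: base_def)
  qed
  have mod_digit: "map (\<lambda>x. x mod int p) a \<in> set (int_digit_vecs p n)" if "length a = n" for a
    using that p2 by (auto simp: int_digit_vec)
  have D_split: "D f (map (\<lambda>x. x mod int p) a) (exv (map (\<lambda>x. x div int p) a)) = f (exv a)" for f a
    using exv_div_mod[of a p] by (simp add: D_def scale_expo_iscale)
  have "0 < M" using arrs by (cases arrs) (auto simp: M_def A_def)
  have fixed_div: "map (\<lambda>x. x div int p) a = a" if "set a \<subseteq> {- 1, 0}" for a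
    by (rule map_idI) (use that p2 in \<open>auto simp: div_eq_minus1\<close>)
  have "check_arrays p n M tab base"
    unfolding check_arrays_def
  proof (intro conjI ballI)
    show "snd e < M" if "e \<in> set tab" for e
      using that gM by (auto simp: tab_def)
    fix j and a :: "int list" assume "j \<in> set [0..<M]" "a \<in> set (List.n_lists n [- 1, 0])"
    then have ja: "j < M" "length a = n" "set a \<subseteq> {- 1, 0}" by (auto simp: set_n_lists)
    note m = mod_digit[OF ja(2)]
    show "look base (look tab (j, map (\<lambda>x. x mod int p) a) 0, a) 0 = look base (j, a) 0"
      unfolding look_tab[OF ja(1) m] look_base[OF gM(1)[OF ja(1) m] ja(2,3)] look_base[OF ja] gM(2)[OF ja(1) m]
      using D_split[of "arrs ! j" a] fixed_div[OF ja(3)] by simp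
  qed fact
  then interpret arrays p n M tab base using p2 by unfold_locales
  have arr: "arr p tab base j a = (arrs ! j) (exv a)" if "j < M" "length a = n" for j a
  proof (rule arr_eqI[OF _ _ that])
    fix j a assume ja: "j < M" "length (a :: int list) = n"
    note m = mod_digit[OF ja(2)]
    show "(arrs ! j) (exv a) = (arrs ! tau j (map (\<lambda>x. x mod int p) a)) (exv (map (\<lambda>x. x div int p) a))"
      unfolding tau_def look_tab[OF ja(1) m] gM(2)[OF ja(1) m] by (rule D_split[symmetric])
    show "val (j, a) = (arrs ! j) (exv a)" if "fixed a"
      using look_base[OF ja] that by (simp add: val_def fixed_def)
  qed
  have Th: "Th (idx f) x = f x" if "f \<in> A" "x \<in> expos n" for f x
    unfolding Th_def using arr[of "idx f" "map x [0..<n]"] idx[OF that(1)] exv_map_upt[OF that(2)] by simp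
  obtain ts where ts: "set ts = T0" using T(1,2) finite_list finite_subset by metis
  define Js where "Js = map (\<lambda>t. map (\<lambda>i. idx (t i)) [0..<K]) ts"
  have tA: "t i \<in> A" if "t \<in> T0" "i < K" for t i using that T(2) by (force simp: A_def)
  have ev: "evl K (\<lambda>i. Th (nthd (map (\<lambda>i. idx (t i)) [0..<K]) i 0)) v = evl K t v" if "t \<in> T0" "v \<in> lvecs n K" for t v
    by (rule evl_cong[OF that(2)]) (use Th tA[OF that(1)] in simp)
  have "N = {v \<in> lvecs n K. \<forall>J\<in>set Js. \<forall>a\<in>expos n. int p dvd evl K (\<lambda>i. Th (nthd J i 0)) (mon a \<star> v)}"
    unfolding T(4) Js_def using ts ev by (auto simp: image_iff)
  moreover have "\<forall>J\<in>set Js. length J = K \<and> (\<forall>j\<in>set J. j < M)"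
    using tA idx ts by (auto simp: Js_def)
  ultimately show ?thesis using arrays_axioms by blast
qed

section \<open>Functionals on vectors and finite families closed under decimation\<close>

context arrays
begin

text \<open>Extends a functional from shifted monomial vectors, where it is \<open>FV\<close>, to
  all vectors; the generators of a state need not be monomial vectors.\<close>

definition EF :: "form \<Rightarrow> lvec \<Rightarrow> int" where
  "EF phi f = sum_list (map (\<lambda>(c, j, b, l). c * lin (\<lambda>x. Th j (exv b + x)) (f l)) phi)"

lemma EF_simps: "EF phi 0 = 0" "EF phi (f + g) = EF phi f + EF phi g" "EF phi (of_nat q \<star> f) = int q * EF phi f"
  by (induction phi) (auto simp: EF_def fun_app algebra_simps)

lemma EF_sol_vec:
  assumes "wf_eqn n M (length als) phi" shows "EF phi (mon a \<star> sol_vec als k) = FV als phi a k"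
  using assms
proof (induction phi)
  case (Cons t phi)
  obtain c j b l where t: "t = (c, j, b, l)" by (cases t)
  have "l \<le> length als" "wf_eqn n M (length als) phi" using Cons.prems t by (auto simp: wf_eqn_def)
  then show ?case using Cons.IH
    by (simp add: EF_def FV_def t fun_app sol_vec_def mon_mult add_ac)
qed (simp add: EF_def FV_def)

text \<open>The counterpart of \<open>evl_decim\<close> for functionals with unknowns: decimation is
  adjoint to the twist followed by the shift by s.\<close>

lemma EF_form_dec:
  assumes als: "\<forall>a\<in>set als. length a = n" "length z = length als" and phi: "wf_eqn n M (length als) phi"
    and s: "length s = n"
  shows "EF (form_dec p n tab als s z phi) f = EF phi (mon (exv s) \<star> twistv p als z f)"
  using phi
proof (induction phi)
  case (Cons t phi)
  obtain c j b l where t: "t = (c, j, b, l)" by (cases t)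
  have *: "j < M" "length b = n" "l \<le> length als" "wf_eqn n M (length als) phi" using Cons.prems t by (auto simp: wf_eqn_def)
  note ls = lsumd[OF als *(3)]
  define x where "x = vec_add (vec_add b s) (lsumd n als z l)"
  have x: "length x = n" "exv x = exv b + exv s + lsume als ((!) z) l"
    using * ls s by (simp_all add: x_def exv_vec_add)
  have "Th j (exv b + (exv s + (lsume als ((!) z) l + scale_expo p y))) =
      Th (tau j (map (\<lambda>x. x mod int p) x)) (exv (map (\<lambda>x. x div int p) x) + y)" for y
  proof -
    have "exv b + (exv s + (lsume als ((!) z) l + scale_expo p y)) =
        iscale (int p) (exv (map (\<lambda>x. x div int p) x) + y) + exv (map (\<lambda>x. x mod int p) x)"
      using x(2) exv_div_mod[of x p] by (simp add: iscale_add scale_expo_iscale algebra_simps)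
    moreover have "Th j (iscale (int p) (exv (map (\<lambda>x. x div int p) x) + y) + exv (map (\<lambda>x. x mod int p) x)) =
        Th (tau j (map (\<lambda>x. x mod int p) x)) (exv (map (\<lambda>x. x div int p) x) + y)"
      by (rule Th_dec[OF *(1)]) (use x p in auto)
    ultimately show ?thesis by simp
  qed
  then show ?case using Cons.IH[OF *(4)]
    by (simp add: EF_def form_dec_def t x_def[symmetric] tau_def fun_app twistv_def lin_mon_mult lin_push)
qed (simp add: EF_def form_dec_def)

lemma EF_eqn_form:
  assumes "length J = K" "wf_eqn n K m e"
  shows "EF (eqn_form J e) f = evl K (\<lambda>i. Th (nthd J i 0)) (eapp e f)"
  using assms(2)
proof (induction e)
  case (Cons t e)
  obtain c i b l where t: "t = (c, i, b, l)" by (cases t)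
  have *: "i < K" "wf_eqn n K m e" using Cons.prems t by (auto simp: wf_eqn_def)
  then show ?case using Cons.IH by (simp add: EF_def eqn_form_def eapp_def t evl_bvec lin_mon_mult)
qed (simp add: EF_def eqn_form_def eapp_def)

definition form_box :: "int set \<Rightarrow> nat \<Rightarrow> nat \<Rightarrow> nat \<Rightarrow> form set" where
  "form_box C L m B = {phi. set phi \<subseteq> C \<times> {..<M} \<times> {b. set b \<subseteq> {- int B..int B} \<and> length b = n} \<times> {..m} \<and> length phi \<le> L}"

lemma finite_form_box: "finite C \<Longrightarrow> finite (form_box C L m B)"
  unfolding form_box_def by (intro finite_lists_length_le finite_cartesian_product finite_lists_length_eq) auto

lemma form_box_wf: "phi \<in> form_box C L m B \<Longrightarrow> wf_eqn n M m phi"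
  by (force simp: form_box_def wf_eqn_def)

text \<open>Decimation keeps coefficients, length and the indices l, and replaces a shift b by the
  quotient of b + s + c by p, where c ranges over finitely many vectors. As soon as B exceeds the
  bound for s + c, the dividend has absolute value at most 2 B <= p B, so the quotient stays within
  B.\<close>

lemma form_dec_box:
  assumes als: "\<forall>a\<in>set als. length a = n" "length als = m" and Z: "finite Z" "\<forall>z\<in>Z. length z = m"
  shows "\<exists>B0. \<forall>B\<ge>B0. \<forall>phi\<in>form_box C L m B. \<forall>s\<in>set (int_digit_vecs p n). \<forall>z\<in>Z.
    form_dec p n tab als s z phi \<in> form_box C L m B"
proof -
  define X where "X = (\<Union>z\<in>Z. \<Union>l\<in>{..m}. set (lsumd n als z l))"
  have "finite X" using Z by (simp add: X_def)
  then obtain D where D: "\<And>x. x \<in> X \<Longrightarrow> nat \<bar>x\<bar> \<le> D"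
    by (metis finite_imageI finite_nat_set_iff_bounded_le image_eqI)
  show ?thesis
  proof (intro exI allI impI ballI)
    fix B phi s z assume B: "B \<ge> D + p + 2" and phi: "phi \<in> form_box C L m B"
      and s: "s \<in> set (int_digit_vecs p n)" and z: "z \<in> Z"
    have "(c, look tab (j, map (\<lambda>x. x mod int p) (vec_add (vec_add b s) (lsumd n als z l))) 0,
        map (\<lambda>x. x div int p) (vec_add (vec_add b s) (lsumd n als z l)), l) \<in>
        C \<times> {..<M} \<times> {b. set b \<subseteq> {- int B..int B} \<and> length b = n} \<times> {..m}" (is "_ \<in> ?T") if t: "(c, j, b, l) \<in> set phi" for c j b l
    proof -
      have *: "c \<in> C" "j < M" "length b = n" "l \<le> m" "set b \<subseteq> {- int B..int B}" using phi t by (auto simp: form_box_def)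
      have s': "length s = n" "\<And>x. x \<in> set s \<Longrightarrow> 0 \<le> x \<and> x < int p" using s by (auto simp: int_digit_vec)
      have ll: "length (lsumd n als z l) = n" using lsumd(1)[OF als(1), of z l] als(2) Z(2) z *(4) by simp
      have "(b ! i + s ! i + lsumd n als z l ! i) div int p \<in> {- int B..int B}" if i: "i < n" for i
      proof -
        have "b ! i \<in> {- int B..int B}" using *(3,5) i nth_mem[of i b] by blast
        moreover have "0 \<le> s ! i \<and> s ! i < int p" using s' i by simp
        moreover have "lsumd n als z l ! i \<in> X" 
          unfolding X_def by (rule UN_I[OF z UN_I]) (use *(4) ll i in auto)
        then have "\<bar>lsumd n als z l ! i\<bar> \<le> int D" using D by fastforce
        ultimately have y: "- (2 * int B) \<le> b ! i + s ! i + lsumd n als z l ! i" "b ! i + s ! i + lsumd n als z l ! i \<le> 2 * int B"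
          using B by auto
        have "int B * 2 \<le> int B * int p" using p by (intro mult_left_mono) simp_all
        then have "b ! i + s ! i + lsumd n als z l ! i \<le> int B * int p" "- int B * int p \<le> b ! i + s ! i + lsumd n als z l ! i"
          using y by auto
        then have "(b ! i + s ! i + lsumd n als z l ! i) div int p \<le> int B * int p div int p"
          "- int B * int p div int p \<le> (b ! i + s ! i + lsumd n als z l ! i) div int p"
          using p by (intro zdiv_mono1; simp)+
        moreover have "int B * int p div int p = int B" "- int B * int p div int p = - int B"
          using p by (intro nonzero_mult_div_cancel_right; simp)+
        ultimately show ?thesis by simp
      qed
      then have "set (map (\<lambda>x. x div int p) (vec_add (vec_add b s) (lsumd n als z l))) \<subseteq> {- int B..int B}"
        using *(3) s'(1) ll by (auto simp: in_set_conv_nth vec_add_def)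
      then show ?thesis using * s'(1) ll tau_less by (auto simp: tau_def)
    qed
    note T = this
    have "set (form_dec p n tab als s z phi) \<subseteq> C \<times> {..<M} \<times> {b. set b \<subseteq> {- int B..int B} \<and> length b = n} \<times> {..m}"
    proof
      fix u assume "u \<in> set (form_dec p n tab als s z phi)"
      then obtain t where t: "t \<in> set phi" "u = (case t of (c, j, b, l) \<Rightarrow> (c,
          look tab (j, map (\<lambda>x. x mod int p) (vec_add (vec_add b s) (lsumd n als z l))) 0,
          map (\<lambda>x. x div int p) (vec_add (vec_add b s) (lsumd n als z l)), l))"
        unfolding form_dec_def set_map by blast
      obtain c j b l where tt: "t = (c, j, b, l)" by (cases t)
      show "u \<in> C \<times> {..<M} \<times> {b. set b \<subseteq> {- int B..int B} \<and> length b = n} \<times> {..m}"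
        unfolding t(2) tt prod.case by (rule T) (use t(1) tt in simp)
    qed
    moreover have "length (form_dec p n tab als s z phi) \<le> L" using phi by (simp add: form_dec_def form_box_def)
    ultimately show "form_dec p n tab als s z phi \<in> form_box C L m B" unfolding form_box_def by blast
  qed
qed

end

lemma check_member_list_exists:
  assumes "\<And>t. t \<in> set ts \<Longrightarrow> \<exists>cert. member_cert n p G cert t" shows "\<exists>certs. check_member_list n p G certs ts"
proof -
  obtain c where "\<And>t. t \<in> set ts \<Longrightarrow> member_cert n p G (c t) t" using assms by metis
  then have "check_member_list n p G (map c ts) ts"
    by (auto simp: check_member_list_def set_zip)
  then show ?thesis by blast
qed

lemma list_choice:
  assumes "\<And>x. x \<in> set xs \<Longrightarrow> \<exists>y. P x y" shows "\<exists>ys. (\<forall>x\<in>set xs. \<exists>y\<in>set ys. fst y = x \<and> P x (snd y)) \<and> (\<forall>y\<in>set ys. fst y \<in> set xs \<and> P (fst y) (snd y))"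
proof -
  obtain c where "\<And>x. x \<in> set xs \<Longrightarrow> P x (c x)" using assms by metis
  then show ?thesis by (intro exI[of _ "map (\<lambda>x. (x, c x)) xs"]) auto
qed

context arrays
begin

text \<open>The largest submodule on which the functionals vanish modulo p. In the certificate
  constructed below it is the lower and the upper bound of a state at once.\<close>

definition form_submod :: "nat \<Rightarrow> form set \<Rightarrow> lvec set" where
  "form_submod m Phi = {f \<in> lvecs n (Suc m). \<forall>phi\<in>Phi. \<forall>a\<in>expos n. int p dvd EF phi (mon a \<star> f)}"

lemma form_submod: "submod p n (Suc m) (form_submod m Phi)"
  unfolding submod_def
proof (intro conjI ballI)
  show "mon b \<star> v \<in> form_submod m Phi" if "v \<in> form_submod m Phi" "b \<in> expos n" for v b
    using that by (auto simp: form_submod_def smul_simps(8)[symmetric] mon_mult)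
  show "of_nat p \<star> v \<in> form_submod m Phi" if "v \<in> lvecs n (Suc m)" for v
    using that by (auto simp: form_submod_def smul_commute[of "mon _"] EF_simps)
qed (auto simp: form_submod_def smul_simps EF_simps intro: dvd_add)

lemma form_submod_gens:
  assumes "prime p" shows "\<exists>gs. (\<forall>g\<in>set gs. wf_terms n (Suc m) g) \<and> span_submod p n (Suc m) (den ` set gs) = form_submod m Phi"
proof -
  obtain S where S: "finite S" "S \<subseteq> form_submod m Phi" "span_submod p n (Suc m) S = form_submod m Phi"
    using submod_finitely_generated[OF assms form_submod] by metis
  obtain vs where vs: "set vs = S" using S(1) finite_list by blast
  have "\<exists>t. wf_terms n (Suc m) t \<and> den t = v" if "v \<in> S" for v
    by (rule den_surj) (use that S(2) in \<open>auto simp: form_submod_def\<close>)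
  then obtain t where t: "\<And>v. v \<in> S \<Longrightarrow> wf_terms n (Suc m) (t v) \<and> den (t v) = v" by metis
  have "den ` set (map t vs) = S" using t vs by (simp add: image_image)
  then show ?thesis using S(3) t vs by (intro exI[of _ "map t vs"]) auto
qed

text \<open>Every shift is p a' + s with a digit vector s, and the family contains the decimations
  for all s; together they test all shifts of the twisted vector.\<close>

lemma form_submod_step:
  assumes als: "\<forall>a\<in>set als. length a = n" "length als = m" "length z = m" and Phi: "\<forall>phi\<in>Phi. wf_eqn n M m phi"
    and f: "f \<in> form_submod m {form_dec p n tab als s z phi |phi s. phi \<in> Phi \<and> s \<in> set (int_digit_vecs p n)}"
  shows "twistv p als z f \<in> form_submod m Phi"
proof -
  have fl: "f \<in> lvecs n (Suc (length als))" using f als(2) by (simp add: form_submod_def)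
  have "int p dvd EF phi (mon a \<star> twistv p als z f)" if phi: "phi \<in> Phi" and a: "a \<in> expos n" for phi a
  proof -
    define b where "b = map a [0..<n]"
    define s where "s = map (\<lambda>x. x mod int p) b"
    define a' where "a' = map (\<lambda>x. x div int p) b"
    have b: "exv b = a" "length b = n" using a by (simp_all add: b_def exv_map_upt)
    have s: "s \<in> set (int_digit_vecs p n)" "length s = n" using p b(2) by (auto simp: int_digit_vec s_def)
    have e: "a = scale_expo p (exv a') + exv s"
      using exv_div_mod[of b p] b by (simp add: s_def a'_def scale_expo_iscale)
    have "mon (exv s) \<star> twistv p als z (mon (exv a') \<star> f) = mon a \<star> twistv p als z f"
      by (simp add: twistv_simps e smul_simps(8)[symmetric] mon_mult add.commute)
    then have "EF phi (mon a \<star> twistv p als z f) = EF (form_dec p n tab als s z phi) (mon (exv a') \<star> f)"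
      using EF_form_dec[OF als(1) _ _ s(2), of z phi "mon (exv a') \<star> f"] als(2,3) Phi phi by simp
    moreover have "exv a' \<in> expos n" using b(2) by (simp add: a'_def)
    ultimately show ?thesis using f phi s(1) unfolding form_submod_def by auto
  qed
  then show ?thesis using twistv_lvecs[OF als(1) fl, of p z] als(2) by (simp add: form_submod_def)
qed

lemma closed_box:
  assumes F: "finite F" "\<forall>phi\<in>F. wf_eqn n M m phi"
    and als: "\<forall>a\<in>set als. length a = n" "length als = m" and Z: "finite Z" "\<forall>z\<in>Z. length z = m"
  shows "\<exists>X. finite X \<and> F \<subseteq> X \<and> (\<forall>phi\<in>X. wf_eqn n M m phi) \<and>
    (\<forall>phi\<in>X. \<forall>s\<in>set (int_digit_vecs p n). \<forall>z\<in>Z. form_dec p n tab als s z phi \<in> X)"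
proof -
  define C where "C = (\<Union>phi\<in>F. fst ` set phi)"
  have C: "finite C" using F(1) by (simp add: C_def)
  obtain L where L: "\<And>phi. phi \<in> F \<Longrightarrow> length phi \<le> L"
    using F(1) by (metis finite_imageI finite_nat_set_iff_bounded_le image_eqI)
  define E where "E = (\<Union>phi\<in>F. \<Union>t\<in>set phi. set (fst (snd (snd t))))"
  have "finite E" using F(1) by (simp add: E_def)
  then obtain B1 where B1: "\<And>x. x \<in> E \<Longrightarrow> nat \<bar>x\<bar> \<le> B1"
    by (metis finite_imageI finite_nat_set_iff_bounded_le image_eqI)
  obtain B0 where B0: "\<And>B. B \<ge> B0 \<Longrightarrow> \<forall>phi\<in>form_box C L m B. \<forall>s\<in>set (int_digit_vecs p n). \<forall>z\<in>Z.
    form_dec p n tab als s z phi \<in> form_box C L m B"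
    using form_dec_box[OF als Z] by metis
  define B where "B = max B0 B1"
  have "F \<subseteq> form_box C L m B"
  proof
    fix phi assume phi: "phi \<in> F"
    have "t \<in> C \<times> {..<M} \<times> {b. set b \<subseteq> {- int B..int B} \<and> length b = n} \<times> {..m}" if t: "t \<in> set phi" for t
    proof -
      obtain c j b l where tt: "t = (c, j, b, l)" by (cases t)
      have "c \<in> C" using phi t tt by (force simp: C_def)
      moreover have "j < M" "length b = n" "l \<le> m" using F(2) phi t tt by (auto simp: wf_eqn_def)
      moreover have "x \<in> {- int B..int B}" if "x \<in> set b" for x
      proof -
        have "x \<in> E" using phi t tt that by (force simp: E_def)
        then have "nat \<bar>x\<bar> \<le> B" using B1 by (fastforce simp: B_def)
        then show ?thesis by auto
      qed
      ultimately show ?thesis by (auto simp: tt)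
    qed
    then show "phi \<in> form_box C L m B" using L[OF phi] unfolding form_box_def by blast
  qed
  then show ?thesis using finite_form_box[OF C] form_box_wf B0[of B]
    by (intro exI[of _ "form_box C L m B"]) (auto simp: B_def)
qed

text \<open>Among the finitely many functionals of a closed family, those without unknowns that
  vanish identically modulo p pass every test.\<close>

lemma zero_cert_exists:
  assumes als: "\<forall>a\<in>set als. length a = n" "length als = m"
    and rels: "\<forall>r\<in>set rels. wf_terms n K r" and Js: "\<forall>J\<in>set Js. length J = K \<and> (\<forall>j\<in>set J. j < M)"
    and kill: "\<And>r J a. r \<in> set rels \<Longrightarrow> J \<in> set Js \<Longrightarrow> a \<in> expos n \<Longrightarrow>
       int p dvd evl K (\<lambda>i. Th (nthd J i 0)) (mon a \<star> den r)"
  shows "\<exists>Zs. check_zero p n m M K tab base als rels Js Zs"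
proof -
  define F where "F = (\<lambda>x. eqn_form (fst x) (rel_eqn (snd x))) ` (set Js \<times> set rels)"
  have wr: "wf_eqn n K m (rel_eqn r)" if "r \<in> set rels" for r
    using rels that by (auto simp: wf_eqn_def rel_eqn_def wf_terms_def)
  have wJ: "wf_eqn n M m (eqn_form J (rel_eqn r))" if "r \<in> set rels" "J \<in> set Js" for r J
    by (rule wf_eqn_form[OF _ wr[OF that(1)]]) (use Js that in auto)
  have F: "finite F" "\<forall>phi\<in>F. wf_eqn n M m phi" using wJ by (auto simp: F_def)
  have "\<exists>X. finite X \<and> F \<subseteq> X \<and> (\<forall>phi\<in>X. wf_eqn n M m phi) \<and>
      (\<forall>phi\<in>X. \<forall>s\<in>set (int_digit_vecs p n). \<forall>z\<in>{replicate m 0}. form_dec p n tab als s z phi \<in> X)"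
    by (rule closed_box[OF F als]) simp_all
  then obtain X where X0: "finite X" "F \<subseteq> X" "\<forall>phi\<in>X. wf_eqn n M m phi"
    "\<forall>phi\<in>X. \<forall>s\<in>set (int_digit_vecs p n). \<forall>z\<in>{replicate m 0}. form_dec p n tab als s z phi \<in> X"
    by (elim exE conjE)
  note X = X0(1,2) bspec[OF X0(3)] X0(4)[THEN bspec, THEN bspec, THEN bspec, OF _ _ singletonI]
  define V where "V = {phi \<in> X. (\<forall>t\<in>set phi. snd (snd (snd t)) = 0) \<and> (\<forall>a\<in>expos n. int p dvd FV als phi a (\<lambda>_. 0))}"
  have "finite V" using X(1) by (simp add: V_def)
  then obtain Zs where Zs: "set Zs = V" using finite_list by blast
  have "check_zero p n m M K tab base als rels Js Zs"
    unfolding check_zero_def Zs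
  proof (intro conjI ballI)
    fix J assume J: "J \<in> set Js"
    show "length J = K" "\<And>j. j \<in> set J \<Longrightarrow> j < M" using Js J by auto
    fix r assume r: "r \<in> set rels"
    have "eqn_form J (rel_eqn r) \<in> X" using X(2) J r by (force simp: F_def)
    moreover have "int p dvd FV als (eqn_form J (rel_eqn r)) a (\<lambda>_. 0)" if "a \<in> expos n" for a
      using FV_eqn_form[OF _ wr[OF r], of J als a] Js J kill[OF r J that] by (simp add: eden_rel)
    ultimately show "eqn_form J (rel_eqn r) \<in> V"
      by (auto simp: V_def eqn_form_def rel_eqn_def)
  next
    fix phi s assume phi: "phi \<in> V" and s: "s \<in> set (int_digit_vecs p n)"
    have phi': "phi \<in> X" "\<And>a. a \<in> expos n \<Longrightarrow> int p dvd FV als phi a (\<lambda>_. 0)" "\<forall>t\<in>set phi. snd (snd (snd t)) = 0"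
      using phi by (auto simp: V_def)
    have len: "length s = n" using s by (simp add: int_digit_vec)
    have "int p dvd FV als (form_dec p n tab als s (replicate m 0) phi) a (\<lambda>_. 0)" if a: "a \<in> expos n" for a
    proof -
      have "FV als (form_dec p n tab als s (replicate m 0) phi) a (\<lambda>_. 0) =
          FV als phi (iscale (int p) a + exv s) (\<lambda>j. int p * 0 + replicate m 0 ! j)"
        by (rule FV_dec(1)) (use als X(3)[OF phi'(1)] len in auto)
      also have "\<dots> = FV als phi (iscale (int p) a + exv s) (\<lambda>_. 0)"
        by (rule FV_cong[OF X(3)[OF phi'(1)]]) simp
      finally show ?thesis using phi'(2)[of "iscale (int p) a + exv s"] a len by auto
    qed
    moreover have "\<forall>t\<in>set (form_dec p n tab als s (replicate m 0) phi). snd (snd (snd t)) = 0"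
      using phi'(3) by (auto simp: form_dec_def)
    ultimately show "form_dec p n tab als s (replicate m 0) phi \<in> V"
      using X(4)[OF phi'(1) s] by (simp add: V_def)
  next
    fix phi and a :: "int list" assume phi: "phi \<in> V" and a: "a \<in> set (List.n_lists n [- 1, 0])"
    have "length a = n" using a by (simp add: set_n_lists)
    then show "int p dvd form_val p tab base phi a"
      using form_val[OF X(3), of phi a als] phi by (auto simp: V_def)
  qed
  then show ?thesis by blast
qed

text \<open>The families of functionals at the states run through all subsets of a finite set closed
  under decimation. The generators are chosen to span exactly \<open>form_submod m Phi\<close>, so
  every membership demanded by the checks is true and therefore has a certificate.\<close>

lemma states_exist:
  assumes prime: "prime p" and als: "\<forall>a\<in>set als. length a = n" "length als = m"
    and rels: "\<forall>r\<in>set rels. wf_terms n K r" and eqn: "wf_eqn n K m eqn"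
    and Js: "\<forall>J\<in>set Js. length J = K \<and> (\<forall>j\<in>set J. j < M)"
    and Rel: "span_submod p n K (den ` set rels) =
       {v \<in> lvecs n K. \<forall>J\<in>set Js. \<forall>a\<in>expos n. int p dvd evl K (\<lambda>i. Th (nthd J i 0)) (mon a \<star> v)}" (is "?Rel = _")
  shows "\<exists>wits sts inits trs fins. check_inits n p m rels eqn Js sts inits \<and> check_trans p n m tab als sts trs \<and>
    check_final p n m tab base wits sts fins \<and> check_gens n m sts"
proof -
  have p_pos: "p > 0" using p by simp
  define Z where "Z = (\<lambda>x. zmul (fst x) (snd x)) ` (set (signs m) \<times> set (digit_vecs p m))"
  have Z: "finite Z" "\<forall>z\<in>Z. length z = m" by (auto simp: Z_def zmul_def sign_vec digit_vec)
  define F0 where "F0 = (\<lambda>J. eqn_form J eqn) ` set Js"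
  have F0: "finite F0" "\<forall>phi\<in>F0. wf_eqn n M m phi" using wf_eqn_form[OF _ eqn] Js by (auto simp: F0_def)
  obtain X where X: "finite X" "F0 \<subseteq> X" "\<forall>phi\<in>X. wf_eqn n M m phi"
    "\<forall>phi\<in>X. \<forall>s\<in>set (int_digit_vecs p n). \<forall>z\<in>Z. form_dec p n tab als s z phi \<in> X"
    using closed_box[OF F0 als Z] by (elim exE conjE)
  obtain G where G: "\<And>Phi. \<forall>g\<in>set (G Phi). wf_terms n (Suc m) g"
    "\<And>Phi. span_submod p n (Suc m) (den ` set (G Phi)) = form_submod m Phi"
    using form_submod_gens[OF prime] by metis
  have mem: "(\<exists>cert. member_cert n p (G Phi) cert t) \<longleftrightarrow> den t \<in> form_submod m Phi" if "wf_terms n (Suc m) t" for Phi t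
    using member_cert_iff[OF p_pos G(1) that] G(2) by simp
  have Gin: "den g \<in> form_submod m Phi" if "g \<in> set (G Phi)" for g Phi
    using that G(2)[of Phi] span_superset[of "den ` set (G Phi)" p n "Suc m"] by blast
  have ones: "wf_terms n (Suc m) (ones n m)" "den (ones n m) = sol_vec als (\<lambda>_. 0)" using ones[of n als] als(2) by simp_all
  define C where "C = (\<lambda>Phi. SOME cert. member_cert n p (G Phi) cert (ones n m))"
  have C: "member_cert n p (G Phi) (C Phi) (ones n m)" if "den (ones n m) \<in> form_submod m Phi" for Phi
    using that unfolding C_def mem[OF ones(1), symmetric] by (rule someI_ex)
  define Li where "Li = (\<lambda>Phi :: form set. SOME l. set l = Phi)"
  have Li: "set (Li Phi) = Phi" if "Phi \<subseteq> X" for Phi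
    unfolding Li_def by (rule someI_ex) (use that X(1) finite_list finite_subset in metis)
  define Q where "Q = set (signs m) \<times> set (List.n_lists m [0, 1 :: nat]) \<times> {0, 1, 2 :: nat} \<times> Pow X"
  define mk where "mk = (\<lambda>q. (fst q, fst (snd q), fst (snd (snd q)), Li (snd (snd (snd q))), G (snd (snd (snd q))), C (snd (snd (snd q)))) :: state)"
  have "finite Q" using X(1) by (simp add: Q_def)
  then obtain qs where qs: "set qs = Q" using finite_list by blast
  define sts where "sts = map mk qs"
  have idx: "\<exists>i<length sts. sts ! i = mk q" if "q \<in> Q" for q
    using that in_set_conv_nth[of q qs] unfolding qs sts_def by force
  have nth: "sts ! i = mk (qs ! i)" "qs ! i \<in> Q" if "i < length sts" for i
    using that qs nth_mem[of i qs] by (auto simp: sts_def)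
  have step: "\<exists>q'\<in>Q. \<exists>certs. trans_ok p n m tab als (mk q) d (mk q') certs"
    if q: "q \<in> Q" and d: "d \<in> set (digit_vecs p m)" for q d
  proof -
    obtain e pend flag Phi where qq: "q = (e, pend, flag, Phi)" by (cases q)
    have e: "e \<in> set (signs m)" and pend: "length pend = m" "set pend \<subseteq> {0, 1}" and Phi: "Phi \<subseteq> X"
      using q by (auto simp: Q_def qq set_n_lists)
    define z where "z = zmul e d"
    have "z \<in> Z" unfolding Z_def z_def by (rule image_eqI[of _ _ "(e, d)"]) (use e d in auto)
    then have z: "z \<in> Z" "length z = m" using Z(2) by auto
    \<comment> \<open>The check accepts any decimations; taking those for all s makes the twist map
      the module of the target into that of the source.\<close>
    define Phi' where "Phi' = {form_dec p n tab als s z phi |phi s. phi \<in> Phi \<and> s \<in> set (int_digit_vecs p n)}"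
    have Phi': "Phi' \<subseteq> X" using X(4) Phi z(1) by (auto simp: Phi'_def)
    define pend' where "pend' = map (\<lambda>x. if fst x = 0 then snd x else 0) (zip d pend)"
    define flag' :: nat where "flag' = (if flag = 0 \<or> (\<exists>x\<in>set d. x \<noteq> 0) then 1 else 2)"
    have "pend' \<in> set (List.n_lists m [0, 1])"
      using pend d by (auto simp: pend'_def set_n_lists digit_vec dest!: set_zip_rightD)
    then have q': "(e, pend', flag', Phi') \<in> Q" using e Phi' by (simp add: Q_def flag'_def)
    have "\<exists>certs. check_member_list n p (G Phi) certs (map (twist p n als z) (G Phi'))"
    proof (rule check_member_list_exists)
      fix t assume "t \<in> set (map (twist p n als z) (G Phi'))"
      then obtain g where g: "g \<in> set (G Phi')" "t = twist p n als z g" by auto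
      have wg: "wf_terms n (Suc (length als)) g" using G(1) g(1) als(2) by auto
      have lz: "length z = length als" using z(2) als(2) by simp
      note tw = twist[OF als(1) lz wg]
      have "twistv p als z (den g) \<in> form_submod m Phi"
        by (rule form_submod_step[OF als z(2)]) (use X(3) Phi Gin[OF g(1)] in \<open>auto simp: Phi'_def\<close>)
      then show "\<exists>cert. member_cert n p (G Phi) cert t" using mem[of t Phi] tw g(2) als(2) by simp
    qed
    then obtain certs where certs: "check_member_list n p (G Phi) certs (map (twist p n als z) (G Phi'))" by blast
    have "trans_ok p n m tab als (mk q) d (mk (e, pend', flag', Phi')) certs"
      unfolding trans_ok_def mk_def qq fst_conv snd_conv Li[OF Phi] Li[OF Phi'] z_def[symmetric]
      using d certs pend'_def flag'_def unfolding Phi'_def by auto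
    then show ?thesis using q' by blast
  qed
  have "\<exists>ys. (\<forall>x\<in>set (List.product [0..<length sts] (digit_vecs p m)). \<exists>y\<in>set ys. fst y = x \<and>
        fst (snd y) < length sts \<and> trans_ok p n m tab als (sts ! fst x) (snd x) (sts ! fst (snd y)) (snd (snd y))) \<and>
     (\<forall>y\<in>set ys. fst y \<in> set (List.product [0..<length sts] (digit_vecs p m)) \<and> fst (snd y) < length sts \<and>
        trans_ok p n m tab als (sts ! fst (fst y)) (snd (fst y)) (sts ! fst (snd y)) (snd (snd y)))"
  proof (rule list_choice)
    fix x assume "x \<in> set (List.product [0..<length sts] (digit_vecs p m))"
    then have x: "fst x < length sts" "snd x \<in> set (digit_vecs p m)" by auto
    obtain q' certs where "q' \<in> Q" "trans_ok p n m tab als (mk (qs ! fst x)) (snd x) (mk q') certs"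
      using step[OF nth(2)[OF x(1)] x(2)] by blast
    moreover obtain i where "i < length sts" "sts ! i = mk q'" using idx[OF \<open>q' \<in> Q\<close>] by blast
    ultimately show "\<exists>y. fst y < length sts \<and> trans_ok p n m tab als (sts ! fst x) (snd x) (sts ! fst y) (snd y)"
      using nth(1)[OF x(1)] by (intro exI[of _ "(i, certs)"]) simp
  qed
  then obtain ys where ys: "\<forall>x\<in>set (List.product [0..<length sts] (digit_vecs p m)). \<exists>y\<in>set ys. fst y = x \<and>
        fst (snd y) < length sts \<and> trans_ok p n m tab als (sts ! fst x) (snd x) (sts ! fst (snd y)) (snd (snd y))"
     "\<forall>y\<in>set ys. fst y \<in> set (List.product [0..<length sts] (digit_vecs p m)) \<and> fst (snd y) < length sts \<and>
        trans_ok p n m tab als (sts ! fst (fst y)) (snd (fst y)) (sts ! fst (snd y)) (snd (snd y))" by (elim exE conjE)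
  define trs where "trs = map (\<lambda>y. (fst (fst y), snd (fst y), fst (snd y), snd (snd y))) ys"
  have trans: "check_trans p n m tab als sts trs"
    unfolding check_trans_def
  proof (intro conjI ballI)
    fix q d assume "q \<in> set [0..<length sts]" "d \<in> set (digit_vecs p m)"
    then have "(q, d) \<in> set (List.product [0..<length sts] (digit_vecs p m))" by simp
    then obtain y where "y \<in> set ys" "fst y = (q, d)" using ys(1) by blast
    then show "\<exists>t\<in>set trs. fst t = q \<and> fst (snd t) = d" by (force simp: trs_def)
  next
    fix t assume "t \<in> set trs"
    then obtain y where y: "y \<in> set ys" "t = (fst (fst y), snd (fst y), fst (snd y), snd (snd y))" by (auto simp: trs_def)
    have *: "fst y \<in> set (List.product [0..<length sts] (digit_vecs p m))" "fst (snd y) < length sts"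
      "trans_ok p n m tab als (sts ! fst (fst y)) (snd (fst y)) (sts ! fst (snd y)) (snd (snd y))"
      using ys(2) y(1) by blast+
    then have "fst (fst y) < length sts" by auto
    then show "fst t < length sts" "fst (snd (snd t)) < length sts"
      "trans_ok p n m tab als (nthd sts (fst t) no_state) (fst (snd t)) (nthd sts (fst (snd (snd t))) no_state) (snd (snd (snd t)))"
      using * by (simp_all add: y(2))
  qed
  have "\<exists>ys. (\<forall>e\<in>set (signs m). \<exists>y\<in>set ys. fst y = e \<and> fst (snd y) < length sts \<and> s_eps (sts ! fst (snd y)) = e \<and>
       init_ok n p m rels eqn Js (sts ! fst (snd y)) (snd (snd y))) \<and>
     (\<forall>y\<in>set ys. fst y \<in> set (signs m) \<and> fst (snd y) < length sts \<and> s_eps (sts ! fst (snd y)) = fst y \<and>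
       init_ok n p m rels eqn Js (sts ! fst (snd y)) (snd (snd y)))"
  proof (rule list_choice)
    fix e assume e: "e \<in> set (signs m)"
    define pend where "pend = map (\<lambda>e. if e = - 1 then 1 else 0 :: nat) e"
    have "pend \<in> set (List.n_lists m [0, 1])" using e by (auto simp: pend_def set_n_lists sign_vec)
    then have q: "(e, pend, 0, F0) \<in> Q" using e X(2) by (simp add: Q_def)
    have "\<exists>certs. check_member_list n p rels certs (map (subst_eqn eqn) (G F0))"
    proof (rule check_member_list_exists)
      fix t assume "t \<in> set (map (subst_eqn eqn) (G F0))"
      then obtain g where g: "g \<in> set (G F0)" "t = subst_eqn eqn g" by auto
      have wg: "wf_terms n (Suc m) g" using G(1) g(1) by auto
      have gl: "den g \<in> lvecs n (Suc m)" by (rule den_lvecs[OF wg])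
      have "int p dvd evl K (\<lambda>i. Th (nthd J i 0)) (mon a \<star> eapp eqn (den g))" if J: "J \<in> set Js" and a: "a \<in> expos n" for J a
      proof -
        have "int p dvd EF (eqn_form J eqn) (mon a \<star> den g)"
          using Gin[OF g(1)] J a by (auto simp: form_submod_def F0_def)
        then show ?thesis using EF_eqn_form[OF _ eqn, of J "mon a \<star> den g"] Js J by (simp add: eapp_simps)
      qed
      then have "eapp eqn (den g) \<in> ?Rel" unfolding Rel using eapp_lvecs[OF eqn gl] by blast
      then show "\<exists>cert. member_cert n p rels cert t"
        using member_cert_iff[OF p_pos rels, of t] subst_eqn[OF eqn wg] g(2) by simp
    qed
    then obtain certs where certs: "check_member_list n p rels certs (map (subst_eqn eqn) (G F0))" by blast
    have "init_ok n p m rels eqn Js (mk (e, pend, 0, F0)) certs"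
      unfolding init_ok_def mk_def fst_conv snd_conv Li[OF X(2)] using e certs pend_def by (auto simp: F0_def)
    moreover obtain i where "i < length sts" "sts ! i = mk (e, pend, 0, F0)" using idx[OF q] by blast
    moreover have "s_eps (mk (e, pend, 0, F0)) = e" by (simp add: mk_def)
    ultimately show "\<exists>y. fst y < length sts \<and> s_eps (sts ! fst y) = e \<and> init_ok n p m rels eqn Js (sts ! fst y) (snd y)"
      by (intro exI[of _ "(i, certs)"]) simp
  qed
  then obtain zs where zs: "\<forall>e\<in>set (signs m). \<exists>y\<in>set zs. fst y = e \<and> fst (snd y) < length sts \<and> s_eps (sts ! fst (snd y)) = e \<and>
       init_ok n p m rels eqn Js (sts ! fst (snd y)) (snd (snd y))"
     "\<forall>y\<in>set zs. fst y \<in> set (signs m) \<and> fst (snd y) < length sts \<and> s_eps (sts ! fst (snd y)) = fst y \<and>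
       init_ok n p m rels eqn Js (sts ! fst (snd y)) (snd (snd y))" by (elim exE conjE)
  have inits: "check_inits n p m rels eqn Js sts (map snd zs)"
    unfolding check_inits_def
  proof (intro conjI ballI)
    fix e assume "e \<in> set (signs m)"
    then obtain y where "y \<in> set zs" "fst (snd y) < length sts" "s_eps (sts ! fst (snd y)) = e" using zs(1) by blast
    then show "\<exists>x\<in>set (map snd zs). s_eps (nthd sts (fst x) no_state) = e" by (intro bexI[of _ "snd y"]) auto
  next
    fix x assume "x \<in> set (map snd zs)"
    then obtain y where y: "y \<in> set zs" "x = snd y" by auto
    have "fst (snd y) < length sts" "init_ok n p m rels eqn Js (sts ! fst (snd y)) (snd (snd y))" using zs(2) y(1) by blast+
    then show "fst x < length sts" "init_ok n p m rels eqn Js (nthd sts (fst x) no_state) (snd x)" using y(2) by simp_all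
  qed
  have fin_Phis: "finite {Phi \<in> Pow X. den (ones n m) \<notin> form_submod m Phi}" using X(1) by simp
  obtain Phis where Phis: "set Phis = {Phi \<in> Pow X. den (ones n m) \<notin> form_submod m Phi}"
    using finite_list[OF fin_Phis] by (elim exE)
  \<comment> \<open>One witnessing shift for each family whose module does not contain the vector of
    ones.\<close>
  have "\<exists>ws. (\<forall>Phi\<in>set Phis. \<exists>y\<in>set ws. fst y = Phi \<and> length (snd y) = n \<and> (\<exists>phi\<in>Phi. \<not> int p dvd form_val p tab base phi (snd y))) \<and>
     (\<forall>y\<in>set ws. fst y \<in> set Phis \<and> length (snd y) = n \<and> (\<exists>phi\<in>fst y. \<not> int p dvd form_val p tab base phi (snd y)))"
  proof (rule list_choice)
    fix Phi assume "Phi \<in> set Phis"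
    then have P: "Phi \<subseteq> X" "den (ones n m) \<notin> form_submod m Phi" using Phis by auto
    then obtain phi a where pa: "phi \<in> Phi" "a \<in> expos n" "\<not> int p dvd EF phi (mon a \<star> den (ones n m))"
      using den_lvecs[OF ones(1)] by (auto simp: form_submod_def)
    have wf: "wf_eqn n M m phi" "wf_eqn n M (length als) phi" using X(3) P(1) pa(1) als(2) by auto
    define b where "b = map a [0..<n]"
    have b: "exv b = a" "length b = n" using pa(2) by (simp_all add: b_def exv_map_upt)
    have "form_val p tab base phi b = EF phi (mon a \<star> den (ones n m))"
      unfolding ones(2) EF_sol_vec[OF wf(2)] b(1)[symmetric] by (rule form_val[OF wf(1) b(2)])
    then have "\<not> int p dvd form_val p tab base phi b" using pa(3) by simp
    then show "\<exists>a. length a = n \<and> (\<exists>phi\<in>Phi. \<not> int p dvd form_val p tab base phi a)"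
      using pa(1) b(2) by blast
  qed
  then obtain ws where ws: "\<forall>Phi\<in>set Phis. \<exists>y\<in>set ws. fst y = Phi \<and> length (snd y) = n \<and> (\<exists>phi\<in>Phi. \<not> int p dvd form_val p tab base phi (snd y))"
     "\<forall>y\<in>set ws. fst y \<in> set Phis \<and> length (snd y) = n \<and> (\<exists>phi\<in>fst y. \<not> int p dvd form_val p tab base phi (snd y))" by (elim exE conjE)
  define fins where "fins = filter (\<lambda>q. s_accepting m (sts ! q) \<and> den (ones n m) \<in> form_submod m (snd (snd (snd (qs ! q))))) [0..<length sts]"
  have "check_final p n m tab base (map snd ws) sts fins"
    unfolding check_final_def
  proof (intro conjI ballI)
    show "q < length sts" if "q \<in> set fins" for q using that by (simp add: fins_def)
    show "length a = n" if "a \<in> set (map snd ws)" for a using that ws(2) by auto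
    fix q assume "q \<in> set [0..<length sts]"
    then have q: "q < length sts" by simp
    define Phi where "Phi = snd (snd (snd (qs ! q)))"
    have Phi: "Phi \<subseteq> X" using nth(2)[OF q] by (auto simp: Phi_def Q_def)
    have st: "s_forms (sts ! q) = Li Phi" "s_gens (sts ! q) = G Phi" "s_cert (sts ! q) = C Phi"
      unfolding nth(1)[OF q] mk_def Phi_def by simp_all
    have fq: "q \<in> set fins \<longleftrightarrow> s_accepting m (sts ! q) \<and> den (ones n m) \<in> form_submod m Phi"
      using q by (simp add: fins_def Phi_def)
    have "\<exists>phi\<in>Phi. \<exists>a\<in>set (map snd ws). \<not> int p dvd form_val p tab base phi a" if "den (ones n m) \<notin> form_submod m Phi"
    proof -
      have "Phi \<in> set Phis" using Phi that by (simp add: Phis)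
      from bspec[OF ws(1) this] obtain y where
        y: "y \<in> set ws" "\<exists>phi\<in>Phi. \<not> int p dvd form_val p tab base phi (snd y)"
        by (rule bexE) (elim conjE, erule (1) that)
      then have "snd y \<in> set (map snd ws)" by simp
      then show ?thesis using y(2) by blast
    qed
    then have "final_ok p n m tab base (map snd ws) (q \<in> set fins) (sts ! q)"
      unfolding final_ok_def fq st Li[OF Phi] using C[of Phi] by auto
    then show "final_ok p n m tab base (map snd ws) (q \<in> set fins) (nthd sts q no_state)" using q by simp
  qed
  moreover have "check_gens n m sts"
    using G(1) by (fastforce simp: check_gens_def sts_def mk_def wf_terms_def)
  ultimately show ?thesis using inits trans by blast
qed

end

theorem cert_exists:
  assumes prime: "prime p" and als: "\<forall>a\<in>set als. length a = n" "length als = m"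
    and rels: "\<forall>r\<in>set rels. wf_terms n K r" and eqn: "wf_eqn n K m eqn"
  shows "\<exists>M tab base Js Zs wits sts inits trs fins. cert_ok p n M tab base m K rels eqn als Js Zs wits sts inits trs fins"
proof -
  have "den ` set rels \<subseteq> lvecs n K" using rels den_lvecs by auto
  then have "submod p n K (span_submod p n K (den ` set rels))" by (rule submod_span)
  from tables_exist[OF prime this] obtain M tab base Js where
    ar: "arrays p n M tab base" and Js: "\<forall>J\<in>set Js. length J = K \<and> (\<forall>j\<in>set J. j < M)"
    and Rel: "span_submod p n K (den ` set rels) = {v \<in> lvecs n K. \<forall>J\<in>set Js. \<forall>a\<in>expos n.
       int p dvd evl K (\<lambda>i. arrays.Th p n tab base (nthd J i 0)) (mon a \<star> v)}"
    by (elim exE conjE)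
  interpret arrays p n M tab base by (rule ar)
  have kill: "int p dvd evl K (\<lambda>i. Th (nthd J i 0)) (mon a \<star> den r)"
    if "r \<in> set rels" "J \<in> set Js" "a \<in> expos n" for r J a
  proof -
    have "den r \<in> span_submod p n K (den ` set rels)" using that(1) span_superset by blast
    then show ?thesis using that(2,3) unfolding Rel by blast
  qed
  obtain Zs where "check_zero p n m M K tab base als rels Js Zs"
    using zero_cert_exists[OF als rels Js kill] by blast
  moreover obtain wits sts inits trs fins where "check_inits n p m rels eqn Js sts inits" "check_trans p n m tab als sts trs"
    "check_final p n m tab base wits sts fins" "check_gens n m sts"
    using states_exist[OF prime als rels eqn Js Rel] by blast
  ultimately have "cert_ok p n M tab base m K rels eqn als Js Zs wits sts inits trs fins"
    using prime als rels eqn by unfold_locales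
  then show ?thesis by blast
qed

section \<open>Computing the automaton\<close>

text \<open>Here and below a definition is unfolded and taken apart along its syntax. The
  assumptions enter through \<open>computable_comp\<close>, because under binders they are needed at
  a projection of the extended context.\<close>

lemma computable_nthd:
  assumes "computable l" "computable i" "computable d" shows "computable (\<lambda>x. nthd (l x) (i x) (d x))"
  unfolding nthd_def by (intro computable_intros assms[THEN computable_comp])

lemma computable_look:
  assumes "computable l" "computable k" "computable d" shows "computable (\<lambda>x. look (l x) (k x) (d x))"
  unfolding look_def by (intro computable_intros assms[THEN computable_comp])

lemma computable_vec_add:
  assumes "computable a" "computable b" shows "computable (\<lambda>x. vec_add (a x) (b x))"
  unfolding vec_add_def case_prod_unfold by (intro computable_intros assms[THEN computable_comp])

lemma computable_shift_terms:
  assumes "computable b" "computable ts" shows "computable (\<lambda>x. shift_terms (b x) (ts x))"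
  unfolding shift_terms_def case_prod_unfold
  by (intro computable_intros computable_vec_add assms[THEN computable_comp])

lemma computable_cert_terms:
  assumes "computable G" "computable c" shows "computable (\<lambda>x. cert_terms (G x) (c x))"
  unfolding cert_terms_def case_prod_unfold
  by (intro computable_intros computable_nthd computable_shift_terms computable_const assms[THEN computable_comp])

lemma decidable_zero_terms:
  assumes "computable p" "computable ts" shows "decidable (\<lambda>x. zero_terms (p x) (ts x))"
  unfolding zero_terms_def by (intro computable_intros assms[THEN computable_comp])

lemma decidable_member_cert:
  assumes "computable n" "computable p" "computable G" "computable c" "computable t"
  shows "decidable (\<lambda>x. member_cert (n x) (p x) (G x) (c x) (t x))"
  unfolding member_cert_def case_prod_unfold
  by (intro computable_intros decidable_zero_terms computable_cert_terms assms[THEN computable_comp])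

lemma computable_lsumd:
  assumes "computable n" "computable als" "computable z" "computable i"
  shows "computable (\<lambda>x. lsumd (n x) (als x) (z x) (i x))"
  unfolding lsumd_def case_prod_unfold
  by (intro computable_intros computable_vec_add computable_const assms[THEN computable_comp])

lemma computable_eqn_form:
  assumes "computable J" "computable e" shows "computable (\<lambda>x. eqn_form (J x) (e x))"
  unfolding eqn_form_def case_prod_unfold
  by (intro computable_intros computable_nthd computable_const assms[THEN computable_comp])

lemma computable_rel_eqn:
  assumes "computable r" shows "computable (\<lambda>x. rel_eqn (r x))"
  unfolding rel_eqn_def case_prod_unfold
  by (intro computable_intros computable_const assms[THEN computable_comp])

lemma computable_subst_eqn:
  assumes "computable e" "computable g" shows "computable (\<lambda>x. subst_eqn (e x) (g x))"
  unfolding subst_eqn_def case_prod_unfold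
  by (intro computable_intros computable_vec_add computable_const assms[THEN computable_comp])

lemma computable_twist:
  assumes "computable p" "computable n" "computable als" "computable z" "computable g"
  shows "computable (\<lambda>x. twist (p x) (n x) (als x) (z x) (g x))"
  unfolding twist_def case_prod_unfold
  by (intro computable_intros computable_vec_add computable_lsumd assms[THEN computable_comp])

lemma computable_ones:
  assumes "computable n" "computable m" shows "computable (\<lambda>x. ones (n x) (m x))"
  unfolding ones_def by (intro computable_intros computable_const assms[THEN computable_comp])

lemma computable_vsize:
  assumes "computable a" shows "computable (\<lambda>x. vsize (a x))"
  unfolding vsize_def by (intro computable_intros computable_const assms[THEN computable_comp])

lemma computable_arr_step:
  assumes "computable p" "computable tab" "computable s" shows "computable (\<lambda>x. arr_step (p x) (tab x) (s x))"
  unfolding arr_step_def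
  by (intro computable_intros computable_look computable_const assms[THEN computable_comp])

lemma computable_arr:
  assumes "computable p" "computable tab" "computable base" "computable j" "computable a"
  shows "computable (\<lambda>x. arr (p x) (tab x) (base x) (j x) (a x))"
  unfolding arr_def
  by (intro computable_intros computable_look computable_rec_nat computable_arr_step computable_vsize computable_const
    assms[THEN computable_comp])

lemma computable_form_val:
  assumes "computable p" "computable tab" "computable base" "computable phi" "computable a"
  shows "computable (\<lambda>x. form_val (p x) (tab x) (base x) (phi x) (a x))"
  unfolding form_val_def case_prod_unfold
  by (intro computable_intros computable_arr computable_vec_add assms[THEN computable_comp])

lemma computable_form_dec:
  assumes "computable p" "computable n" "computable tab" "computable als" "computable s" "computable z" "computable phi"
  shows "computable (\<lambda>x. form_dec (p x) (n x) (tab x) (als x) (s x) (z x) (phi x))"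
  unfolding form_dec_def case_prod_unfold
  by (intro computable_intros computable_look computable_vec_add computable_lsumd computable_const assms[THEN computable_comp])

lemma computable_signs:
  assumes "computable m" shows "computable (\<lambda>x. signs (m x))"
  unfolding signs_def by (intro computable_intros computable_const assms[THEN computable_comp])

lemma computable_digit_vecs:
  assumes "computable p" "computable m" shows "computable (\<lambda>x. digit_vecs (p x) (m x))"
  unfolding digit_vecs_def by (intro computable_intros computable_const assms[THEN computable_comp])

lemma computable_int_digit_vecs:
  assumes "computable p" "computable m" shows "computable (\<lambda>x. int_digit_vecs (p x) (m x))"
  unfolding int_digit_vecs_def by (intro computable_intros computable_const assms[THEN computable_comp])

lemma computable_zmul:
  assumes "computable e" "computable d" shows "computable (\<lambda>x. zmul (e x) (d x))"
  unfolding zmul_def by (intro computable_intros assms[THEN computable_comp])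

lemma decidable_check_arrays:
  assumes "computable p" "computable n" "computable M" "computable tab" "computable base"
  shows "decidable (\<lambda>x. check_arrays (p x) (n x) (M x) (tab x) (base x))"
  unfolding check_arrays_def by (intro computable_intros computable_look computable_const assms[THEN computable_comp])

lemma decidable_check_zero:
  assumes "computable p" "computable n" "computable m" "computable M" "computable K" "computable tab" "computable base"
    "computable als" "computable rels" "computable Js" "computable Zs"
  shows "decidable (\<lambda>x. check_zero (p x) (n x) (m x) (M x) (K x) (tab x) (base x) (als x) (rels x) (Js x) (Zs x))"
  unfolding check_zero_def
  by (intro computable_intros computable_eqn_form computable_rel_eqn computable_form_dec computable_int_digit_vecs
    computable_form_val computable_const assms[THEN computable_comp])

lemma decidable_check_member_list:
  assumes "computable n" "computable p" "computable G" "computable c" "computable t"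
  shows "decidable (\<lambda>x. check_member_list (n x) (p x) (G x) (c x) (t x))"
  unfolding check_member_list_def
  by (intro computable_intros decidable_member_cert assms[THEN computable_comp])

lemma decidable_init_ok:
  assumes "computable n" "computable p" "computable m" "computable rels" "computable eqn" "computable Js" "computable s" "computable c"
  shows "decidable (\<lambda>x. init_ok (n x) (p x) (m x) (rels x) (eqn x) (Js x) (s x) (c x))"
  unfolding init_ok_def
  by (intro computable_intros computable_signs computable_eqn_form computable_subst_eqn decidable_check_member_list
    computable_const assms[THEN computable_comp])

lemma decidable_check_inits:
  assumes "computable n" "computable p" "computable m" "computable rels" "computable eqn" "computable Js" "computable sts" "computable inits"
  shows "decidable (\<lambda>x. check_inits (n x) (p x) (m x) (rels x) (eqn x) (Js x) (sts x) (inits x))"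
  unfolding check_inits_def
  by (intro computable_intros computable_signs computable_nthd decidable_init_ok computable_const assms[THEN computable_comp])

lemma decidable_trans_ok:
  assumes "computable p" "computable n" "computable m" "computable tab" "computable als" "computable s" "computable d"
    "computable s'" "computable c"
  shows "decidable (\<lambda>x. trans_ok (p x) (n x) (m x) (tab x) (als x) (s x) (d x) (s' x) (c x))"
  unfolding trans_ok_def
  by (intro computable_intros computable_digit_vecs computable_int_digit_vecs computable_form_dec computable_zmul
    computable_twist decidable_check_member_list computable_const assms[THEN computable_comp])

lemma decidable_check_trans:
  assumes "computable p" "computable n" "computable m" "computable tab" "computable als" "computable sts" "computable trs"
  shows "decidable (\<lambda>x. check_trans (p x) (n x) (m x) (tab x) (als x) (sts x) (trs x))"
  unfolding check_trans_def
  by (intro computable_intros computable_digit_vecs computable_nthd decidable_trans_ok computable_const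
    assms[THEN computable_comp])

lemma decidable_s_accepting:
  assumes "computable m" "computable s" shows "decidable (\<lambda>x. s_accepting (m x) (s x))"
  unfolding s_accepting_def by (intro decidable_bool_if computable_intros computable_const assms[THEN computable_comp])

lemma decidable_check_final:
  assumes "computable p" "computable n" "computable m" "computable tab" "computable base" "computable wits" "computable sts" "computable fins"
  shows "decidable (\<lambda>x. check_final (p x) (n x) (m x) (tab x) (base x) (wits x) (sts x) (fins x))"
  unfolding check_final_def final_ok_def
  by (intro decidable_bool_if computable_intros decidable_s_accepting decidable_member_cert computable_ones computable_form_val
    computable_nthd computable_const assms[THEN computable_comp])

lemma decidable_check_gens:
  assumes "computable n" "computable m" "computable sts" shows "decidable (\<lambda>x. check_gens (n x) (m x) (sts x))"
  unfolding check_gens_def by (intro computable_intros computable_const assms[THEN computable_comp])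

lemma decidable_wf_terms:
  assumes "computable n" "computable K" "computable t" shows "decidable (\<lambda>x. wf_terms (n x) (K x) (t x))"
  unfolding wf_terms_def case_prod_unfold by (intro computable_intros assms[THEN computable_comp])

lemma decidable_wf_eqn:
  assumes "computable n" "computable K" "computable m" "computable e" shows "decidable (\<lambda>x. wf_eqn (n x) (K x) (m x) (e x))"
  unfolding wf_eqn_def case_prod_unfold by (intro computable_intros assms[THEN computable_comp])

lemma decidable_prime:
  assumes "computable p" shows "decidable (\<lambda>x. prime (p x :: nat))"
proof -
  have "decidable (\<lambda>x. 1 < p x \<and> (\<forall>q\<in>set [2..<p x]. \<not> q dvd p x))"
    unfolding dvd_eq_mod_eq_0 by (intro computable_intros computable_const assms[THEN computable_comp])
  then show ?thesis by (rule decidable_cong) (simp add: prime_nat_iff')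
qed

section \<open>The coded input as an equation in monomials\<close>

definition poly_den :: "poly_data \<Rightarrow> lpoly" where
  "poly_den ts = sum_list (map (\<lambda>t. of_int (snd t) * mon (exv (fst t))) ts)"

definition vec_den :: "vec_data \<Rightarrow> lvec" where
  "vec_den v = (\<lambda>i. if i < length v then poly_den (v ! i) else 0)"

text \<open>The appended 0 is the exponent of the adjoined variable t.\<close>

definition vec_terms :: "vec_data \<Rightarrow> tm list" where
  "vec_terms v = concat (map (\<lambda>x. map (\<lambda>t. (snd t, fst x, fst t @ [0])) (snd x)) (zip [0..<length v] v))"

definition neg_terms :: "tm list \<Rightarrow> tm list" where
  "neg_terms ts = map (\<lambda>t. (- fst t, snd t)) ts"

text \<open>The relator t - 1 at position i.\<close>

definition unit_terms :: "nat \<Rightarrow> nat \<Rightarrow> tm list" where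
  "unit_terms n i = [(1, i, replicate n 0 @ [1]), (- 1, i, replicate (Suc n) 0)]"

definition core_rels :: "nat \<Rightarrow> nat \<Rightarrow> vec_data list \<Rightarrow> elem_data list \<Rightarrow> tm list list" where
  "core_rels n d rels hs = map vec_terms rels @ map (unit_terms n) [0..<d] @
     map (\<lambda>x. (1, d + fst x, snd (snd x) @ [1]) # (- 1, d + fst x, replicate (Suc n) 0) #
       neg_terms (vec_terms (fst (snd x)))) (zip [0..<length hs] hs) @ [unit_terms n (d + length hs)]"

text \<open>The list form of \<open>lhs\<close>: an index l stands for the partial sum of the first
  l unknown exponents, so constants carry the index 0.\<close>

definition core_eqn :: "nat \<Rightarrow> nat \<Rightarrow> nat \<Rightarrow> elem_data \<Rightarrow> form" where
  "core_eqn n d m g = concat (map (\<lambda>j. [(1, d + j, replicate (Suc n) 0, Suc j), (- 1, d + j, replicate (Suc n) 0, j)]) [0..<m]) @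
     rel_eqn (neg_terms (vec_terms (fst g))) @
     [(1, d + m, replicate (Suc n) 0, m), (- 1, d + m, snd g @ [0], 0)]"

text \<open>The appended 1 is the exponent of t in \<open>al j\<close>.\<close>

definition core_als :: "elem_data list \<Rightarrow> int list list" where
  "core_als hs = map (\<lambda>h. snd h @ [1]) hs"

lemma exv_snoc_0 [simp]: "exv (a @ [0]) = exv a"
  by (auto simp: exv_def fun_eq_iff nth_append)

lemma exv_snoc_1: "length a = n \<Longrightarrow> exv (a @ [1]) = exv a + (\<lambda>i. if i = n then 1 else 0)"
  by (auto simp: exv_def fun_eq_iff nth_append fun_app)

lemma exv_zeros_1: "exv (replicate n 0 @ [1]) = (\<lambda>i. if i = n then 1 else 0)"
  by (auto simp: exv_def fun_eq_iff nth_append)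

lemma den_concat: "den (concat tss) = sum_list (map den tss)"
  by (induction tss) auto

lemma den_neg_terms: "den (neg_terms ts) = - den ts"
proof (induction ts)
  case (Cons t ts)
  have "den_term (- fst t, snd t) = - den_term t"
    by (cases t) (simp add: den_term_def)
  then show ?case using Cons by (simp add: neg_terms_def)
qed (simp add: neg_terms_def)

lemma den_terms_at: "den (map (\<lambda>t. (snd t, i, fst t @ [0])) ts) = bvec (poly_den ts) i"
  by (induction ts) (simp_all add: den_term_def poly_den_def)

lemma sum_list_bvec:
  "sum_list (map (\<lambda>x. bvec (f (snd x)) (fst x)) (zip [0..<length v] v)) = (\<lambda>i. if i < length v then f (v ! i) else 0)"
proof (induction v rule: rev_induct)
  case (snoc x v)
  have "sum_list (map (\<lambda>x. bvec (f (snd x)) (fst x)) (zip [0..<length (v @ [x])] (v @ [x]))) =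
      sum_list (map (\<lambda>x. bvec (f (snd x)) (fst x)) (zip [0..<length v] v)) + bvec (f x) (length v)"
    by simp
  then show ?case unfolding snoc by (auto simp: fun_eq_iff fun_app bvec_def nth_append)
qed (simp add: fun_eq_iff fun_app)

lemma den_vec_terms: "den (vec_terms v) = vec_den v"
proof -
  have "den (vec_terms v) = sum_list (map (\<lambda>x. bvec (poly_den (snd x)) (fst x)) (zip [0..<length v] v))"
    unfolding vec_terms_def den_concat by (simp add: comp_def den_terms_at)
  then show ?thesis by (simp add: sum_list_bvec vec_den_def)
qed

lemma wf_vec_terms:
  assumes "wf_vec p n d v" "d \<le> K" shows "wf_terms (Suc n) K (vec_terms v)"
proof -
  have "i < K \<and> length a = Suc n" if t: "(c, i, a) \<in> set (vec_terms v)" for c i a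
  proof -
    obtain x t where xt: "x \<in> set (zip [0..<length v] v)" "t \<in> set (snd x)" "i = fst x" "a = fst t @ [0]"
      using t by (auto simp: vec_terms_def)
    have "fst x < length v" "snd x \<in> set v" using xt(1) by (auto simp: set_zip)
    then have "fst x < d" "wf_poly p n (snd x)" using assms(1) by (auto simp: wf_vec_def)
    then show ?thesis using xt assms(2) by (auto simp: wf_poly_def)
  qed
  then show ?thesis by (auto simp: wf_terms_def)
qed

lemma poly_den_lpolys: "wf_poly p n ts \<Longrightarrow> poly_den ts \<in> lpolys n"
proof (induction ts)
  case (Cons t ts)
  then have "poly_den ts \<in> lpolys n" "length (fst t) = n" by (auto simp: wf_poly_def)
  then show ?case by (auto simp: poly_den_def intro!: lpolys_closed lpolys_of_int)
qed (simp add: poly_den_def)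

lemma vec_den_lvecs: "wf_vec p n d v \<Longrightarrow> vec_den v \<in> lvecs n d"
  using poly_den_lpolys[of p n] by (auto simp: lvecs_def vec_den_def wf_vec_def)

context coset_rep
begin

lemma lrep_term:
  assumes "length a = n" "c \<in> carrier K" shows "lrep p n (of_int c * mon (exv a)) = laurent_monom K c a"
  by (rule ext) (use assms in \<open>auto simp: lrep_def laurent_monom_def exv_inject lookup_of_int_mult\<close>)

lemma lrep_poly_den: "wf_poly p n ts \<Longrightarrow> lrep p n (poly_den ts) = poly_of p n ts"
proof (induction ts)
  case Nil
  show ?case using lrep_0 by (simp add: poly_of_def poly_den_def R_def K_def)
next
  case (Cons t ts)
  have t: "length (fst t) = n" "snd t \<in> carrier K" "wf_poly p n ts" using Cons.prems by (auto simp: wf_poly_def K_def)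
  have "lrep p n (poly_den (t # ts)) = lrep p n (of_int (snd t) * mon (exv (fst t))) \<oplus>\<^bsub>R\<^esub> lrep p n (poly_den ts)"
    by (simp add: poly_den_def lrep_add)
  also have "\<dots> = laurent_monom K (snd t) (fst t) \<oplus>\<^bsub>R\<^esub> poly_of p n ts"
    by (simp only: lrep_term[OF t(1,2)] Cons.IH[OF t(3)])
  finally show ?case by (simp add: poly_of_def R_def K_def case_prod_beta)
qed

lemma vrep_vec_den: "wf_vec p n d v \<Longrightarrow> vrep p n d (vec_den v) = vec_of p n v"
  by (rule nth_equalityI) (auto simp: vrep_def vec_of_def wf_vec_def vec_den_def lrep_poly_den)

end

text \<open>The description of the group by cosets and the linearization are instantiated at the
  same integral representatives of the input, so that both refer to the same submodule N.\<close>

locale knapsack_input =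
  fixes x :: input_data
  assumes wf: "wf_input x"
begin

abbreviation "n \<equiv> in_n x"
abbreviation "d \<equiv> in_d x"
abbreviation "p \<equiv> in_p x"
abbreviation "m \<equiv> length (in_hs x)"

lemma prime_p: "prime p"
  using wf by (simp add: wf_input_def)

lemma wf_rels: "v \<in> set (in_rels x) \<Longrightarrow> wf_vec p n d v"
  and wf_hs: "h \<in> set (in_hs x) \<Longrightarrow> wf_vec p n d (fst h) \<and> length (snd h) = n"
  and wf_g: "wf_vec p n d (fst (in_g x))" "length (snd (in_g x)) = n"
  using wf by (auto simp: wf_input_def wf_elem_def case_prod_beta)

sublocale C: coset_rep p n d "vec_den ` set (in_rels x)"
  by unfold_locales (use prime_p vec_den_lvecs[OF wf_rels] in auto)

lemma vec_den_hs: "j < m \<Longrightarrow> vec_den (fst (in_hs x ! j)) \<in> lvecs n d \<and> length (snd (in_hs x ! j)) = n"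
  using wf_hs[OF nth_mem, of j] vec_den_lvecs by blast

sublocale S: knapsack p n d m "vec_den ` set (in_rels x)" "\<lambda>j. vec_den (fst (in_hs x ! j))"
  "\<lambda>j. exv (snd (in_hs x ! j))" "vec_den (fst (in_g x))" "exv (snd (in_g x))"
  by unfold_locales (use prime_p vec_den_lvecs[OF wf_rels] vec_den_hs vec_den_lvecs[OF wf_g(1)] wf_g(2) in auto)

lemma H_eq: "C.H = submodule_gen (in_ring x) (free_module (in_ring x) d) (in_relators x)"
proof -
  have "vrep p n d ` vec_den ` set (in_rels x) = in_relators x"
    unfolding in_relators_def image_image set_map by (rule image_cong[OF refl]) (simp add: C.vrep_vec_den wf_rels)
  then show ?thesis by (simp add: C.H_def C.F_def C.R_def C.K_def in_ring_def)
qed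

lemma G_eq: "C.G = in_group x"
  unfolding C.G_def C.Q_def H_eq
  by (simp add: C.F_def C.R_def C.K_def in_ring_def in_group_def in_module_def presented_module_def)

lemma elem_of_eq: "wf_vec p n d (fst h) \<Longrightarrow> elem_of x h = (C.cst (vec_den (fst h)), snd h)"
  unfolding elem_of_def C.cst_def H_eq presented_elem_def
  by (simp add: C.vrep_vec_den case_prod_beta) (simp add: C.F_def C.R_def C.K_def in_ring_def)

lemma solutions_eq: "solutions x = {ks. length ks = m \<and> S.lhs ((!) ks) \<in> S.N'}"
proof -
  have "power_product (in_group x) (map (elem_of x) (in_hs x)) ks = elem_of x (in_g x) \<longleftrightarrow> S.lhs ((!) ks) \<in> S.N'"
    if len: "length ks = m" for ks
  proof -
    let ?hs = "map (\<lambda>h. (vec_den (fst h), snd h)) (in_hs x)"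
    have "map (elem_of x) (in_hs x) = map (\<lambda>h. (C.cst (fst h), snd h)) ?hs"
      using elem_of_eq wf_hs by simp
    then have "power_product (in_group x) (map (elem_of x) (in_hs x)) ks = elem_of x (in_g x) \<longleftrightarrow>
        power_product C.G (map (\<lambda>h. (C.cst (fst h), snd h)) ?hs) ks = (C.cst (vec_den (fst (in_g x))), snd (in_g x))"
      by (simp only: G_eq elem_of_eq[OF wf_g(1)])
    also have "\<dots> \<longleftrightarrow> ppv ?hs ks - vec_den (fst (in_g x)) \<in> C.N \<and> ppx ?hs ks = exv (snd (in_g x))"
      by (rule C.G_solution_iff) (use wf_hs wf_g(2) vec_den_lvecs[OF wf_g(1)] vec_den_lvecs[of p n d] len in auto)
    also have "ppv ?hs ks = S.py ((!) ks)" using len by (simp add: ppv_sum S.py_def S.px_def)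
    also have "ppx ?hs ks = S.px ((!) ks) m" using len by (simp add: ppx_sum S.px_def)
    also have "C.N = S.N" by (simp add: C.N_def S.N_def)
    finally show ?thesis by (simp only: S.lhs_iff)
  qed
  then show ?thesis unfolding solutions_def by blast
qed

lemma tau_eq: "exv (replicate n 0 @ [1]) = S.tau"
  by (simp add: exv_zeros_1 S.tau_def)

lemma al_eq: "j < m \<Longrightarrow> exv (core_als (in_hs x) ! j) = S.al j"
  using wf_hs[OF nth_mem, of j] by (simp add: core_als_def S.al_def S.tau_def exv_snoc_1)

lemma den_unit_terms: "den (unit_terms n i) = bvec (mon S.tau - 1) i"
  by (simp add: unit_terms_def den_term_def tau_eq del: replicate_Suc)

lemma den_core_rels: "den ` set (core_rels n d (in_rels x) (in_hs x)) = S.rels"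
proof -
  have "den ((1, d + j, snd h @ [1]) # (- 1, d + j, replicate (Suc n) 0) # neg_terms (vec_terms (fst h))) =
      bvec (mon (S.al j) - 1) (d + j) - vec_den (fst h)" if "j < m" "h = in_hs x ! j" for j h
    using al_eq[OF that(1)] that
    by (simp add: den_term_def den_neg_terms den_vec_terms core_als_def del: replicate_Suc)
  note h = this
  have "zip [0..<m] (in_hs x) = map (\<lambda>j. (j, in_hs x ! j)) [0..<m]" by (rule nth_equalityI) auto
  then have "den ` set (map (\<lambda>x. (1, d + fst x, snd (snd x) @ [1]) # (- 1, d + fst x, replicate (Suc n) 0) #
       neg_terms (vec_terms (fst (snd x)))) (zip [0..<m] (in_hs x))) =
     (\<lambda>j. bvec (mon (S.al j) - 1) (d + j) - vec_den (fst (in_hs x ! j))) ` {..<m}"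
    unfolding set_map image_image by (simp only: set_map image_image fst_conv snd_conv set_upt atLeast0LessThan)
      (intro image_cong refl h; simp)
  moreover have "den ` set (map vec_terms (in_rels x)) = vec_den ` set (in_rels x)"
    by (simp add: image_image den_vec_terms)
  moreover have "den ` set (map (unit_terms n) [0..<d]) = (\<lambda>i. bvec (mon S.tau - 1) i) ` {..<d}"
    by (simp add: image_image den_unit_terms atLeast0LessThan)
  ultimately show ?thesis
    unfolding core_rels_def S.rels_def set_append image_Un by (simp only: list.set image_insert image_empty den_unit_terms Un_assoc)
qed

lemma lsum_eq: "j \<le> m \<Longrightarrow> lsume (core_als (in_hs x)) k j = S.lsum k j"
  unfolding lsume_def S.lsum_def by (rule sum.cong) (auto simp: al_eq)

lemma eden_core_eqn: "eden (core_als (in_hs x)) (core_eqn n d m (in_g x)) k = S.lhs k"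
proof -
  let ?als = "core_als (in_hs x)"
  have app: "eden ?als (e @ e') k = eden ?als e k + eden ?als e' k" for e e' by (simp add: eden_def)
  have "eden ?als (concat (map (\<lambda>j. [(1, d + j, replicate (Suc n) 0, Suc j), (- 1, d + j, replicate (Suc n) 0, j)]) [0..<i])) k =
     (\<Sum>j<i. bvec (mon (S.lsum k (Suc j)) - mon (S.lsum k j)) (d + j))" if "i \<le> m" for i
    using that
  proof (induction i)
    case (Suc i)
    have "eden ?als [(1, d + i, replicate (Suc n) 0, Suc i), (- 1, d + i, replicate (Suc n) 0, i)] k =
      bvec (mon (S.lsum k (Suc i)) - mon (S.lsum k i)) (d + i)"
      using Suc.prems by (simp add: eden_def lsum_eq del: replicate_Suc)
    then show ?case using Suc by (simp add: app)
  qed (simp add: eden_def)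
  moreover have "eden ?als [(1, d + m, replicate (Suc n) 0, m), (- 1, d + m, snd (in_g x) @ [0], 0)] k =
      bvec (mon (S.lsum k m) - mon (exv (snd (in_g x)))) (d + m)"
    by (simp add: eden_def lsum_eq del: replicate_Suc) (simp add: S.lsum_def)
  ultimately show ?thesis
    unfolding core_eqn_def app S.lhs_def eden_rel den_neg_terms den_vec_terms by simp
qed

lemma core_wf:
  "\<forall>r\<in>set (core_rels n d (in_rels x) (in_hs x)). wf_terms (Suc n) (d + m + 1) r"
  "wf_eqn (Suc n) (d + m + 1) m (core_eqn n d m (in_g x))"
  "\<forall>a\<in>set (core_als (in_hs x)). length a = Suc n" "length (core_als (in_hs x)) = m"
proof -
  have neg: "wf_terms n' K' (neg_terms ts) \<longleftrightarrow> wf_terms n' K' ts" for n' K' ts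
    by (force simp: wf_terms_def neg_terms_def)
  have wv: "wf_terms (Suc n) (d + m + 1) (vec_terms v)" if "wf_vec p n d v" for v
    by (rule wf_vec_terms[OF that]) simp
  have wu: "wf_terms (Suc n) (d + m + 1) (unit_terms n i)" if "i \<le> d + m" for i
    using that by (simp add: wf_terms_def unit_terms_def)
  have wh: "wf_terms (Suc n) (d + m + 1) ((1, d + fst y, snd (snd y) @ [1]) # (- 1, d + fst y, replicate (Suc n) 0) #
       neg_terms (vec_terms (fst (snd y))))" if "y \<in> set (zip [0..<m] (in_hs x))" for y
  proof -
    have "fst y < m" "snd y \<in> set (in_hs x)" using that by (auto simp: set_zip)
    moreover have "wf_terms (Suc n) (d + m + 1) (neg_terms (vec_terms (fst (snd y))))"
      unfolding neg using wv wf_hs[OF calculation(2)] by blast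
    ultimately show ?thesis using wf_hs[of "snd y"] by (simp add: wf_terms_def)
  qed
  show "\<forall>r\<in>set (core_rels n d (in_rels x) (in_hs x)). wf_terms (Suc n) (d + m + 1) r"
    unfolding core_rels_def set_append set_map ball_Un
    by (intro conjI; use wv wf_rels wu wh in auto)
  have "wf_terms (Suc n) (d + m + 1) (neg_terms (vec_terms (fst (in_g x))))"
    unfolding neg by (rule wv[OF wf_g(1)])
  then have "wf_eqn (Suc n) (d + m + 1) m (rel_eqn (neg_terms (vec_terms (fst (in_g x)))))"
    by (auto simp: wf_eqn_def rel_eqn_def wf_terms_def)
  then show "wf_eqn (Suc n) (d + m + 1) m (core_eqn n d m (in_g x))"
    unfolding core_eqn_def using wf_g by (simp add: wf_eqn_def ball_Un)
  show "\<forall>a\<in>set (core_als (in_hs x)). length a = Suc n" "length (core_als (in_hs x)) = m"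
    using wf_hs by (auto simp: core_als_def)
qed

lemma solutions_core: "solutions x = {ks. length ks = m \<and> eden (core_als (in_hs x)) (core_eqn n d m (in_g x)) ((!) ks) \<in>
    span_submod p (Suc n) (d + m + 1) (den ` set (core_rels n d (in_rels x) (in_hs x)))}"
  unfolding solutions_eq eden_core_eqn den_core_rels S.N'_def ..

end

lemma computable_vec_terms:
  assumes "computable v" shows "computable (\<lambda>x. vec_terms (v x))"
  unfolding vec_terms_def by (intro computable_intros computable_const assms[THEN computable_comp])

lemma computable_neg_terms:
  assumes "computable t" shows "computable (\<lambda>x. neg_terms (t x))"
  unfolding neg_terms_def by (intro computable_intros computable_const assms[THEN computable_comp])

lemma computable_unit_terms:
  assumes "computable n" "computable i" shows "computable (\<lambda>x. unit_terms (n x) (i x))"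
  unfolding unit_terms_def by (intro computable_intros computable_const assms[THEN computable_comp])

lemma computable_core_rels:
  assumes "computable n" "computable d" "computable rels" "computable hs"
  shows "computable (\<lambda>x. core_rels (n x) (d x) (rels x) (hs x))"
  unfolding core_rels_def
  by (intro computable_intros computable_vec_terms computable_neg_terms computable_unit_terms computable_const
    assms[THEN computable_comp])

lemma computable_core_eqn:
  assumes "computable n" "computable d" "computable m" "computable g"
  shows "computable (\<lambda>x. core_eqn (n x) (d x) (m x) (g x))"
  unfolding core_eqn_def
  by (intro computable_intros computable_vec_terms computable_neg_terms computable_rel_eqn computable_const
    assms[THEN computable_comp])

lemma computable_core_als:
  assumes "computable hs" shows "computable (\<lambda>x. core_als (hs x))"
  unfolding core_als_def by (intro computable_intros computable_const assms[THEN computable_comp])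

section \<open>Search for a certificate\<close>

type_synonym inst = "nat \<times> nat \<times> nat \<times> nat \<times> tm list list \<times> form \<times> int list list"
type_synonym cert = "nat \<times> ((nat \<times> int list) \<times> nat) list \<times> ((nat \<times> int list) \<times> int) list \<times> nat list list \<times>
  form list \<times> int list list \<times> state list \<times> (nat \<times> mcert list) list \<times> (nat \<times> nat list \<times> nat \<times> mcert list) list \<times> nat list"

text \<open>For an input the list has six entries, the last three being codes themselves. The number
  of variables grows by one for t, and the rank by one for every h_j and by one for the free
  generator.\<close>

definition inst_of :: "nat list \<Rightarrow> inst" where
  "inst_of L = (nthd L 0 0, Suc (nthd L 1 0), length (dec (nthd L 4 0) :: elem_data list),
     nthd L 2 0 + length (dec (nthd L 4 0) :: elem_data list) + 1,
     core_rels (nthd L 1 0) (nthd L 2 0) (dec (nthd L 3 0)) (dec (nthd L 4 0)),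
     core_eqn (nthd L 1 0) (nthd L 2 0) (length (dec (nthd L 4 0) :: elem_data list)) (dec (nthd L 5 0)),
     core_als (dec (nthd L 4 0)))"

definition valid_inst :: "inst \<Rightarrow> bool" where
  "valid_inst = (\<lambda>(p, n, m, K, rels, eqn, als). prime p \<and> (\<forall>a\<in>set als. length a = n) \<and> length als = m \<and>
     (\<forall>r\<in>set rels. wf_terms n K r) \<and> wf_eqn n K m eqn)"

definition valid_cert :: "inst \<times> cert \<Rightarrow> bool" where
  "valid_cert = (\<lambda>((p, n, m, K, rels, eqn, als), M, tab, base, Js, Zs, wits, sts, inits, trs, fins).
     check_arrays p n M tab base \<and> check_zero p n m M K tab base als rels Js Zs \<and>
     check_inits n p m rels eqn Js sts inits \<and> check_trans p n m tab als sts trs \<and>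
     check_final p n m tab base wits sts fins \<and> check_gens n m sts)"

definition output_automaton :: "inst \<times> cert \<Rightarrow> sym list automaton" where
  "output_automaton = (\<lambda>((p, n, m, K, rels, eqn, als), M, tab, base, Js, Zs, wits, sts, inits, trs, fins).
     cert_automaton m sts inits trs fins)"

definition output_list :: "sym list automaton \<Rightarrow> nat list" where
  "output_list A = [num_states A, enc (initial A), enc (transitions A), enc (final A)]"

text \<open>The implication lets the search stop at once on invalid instances, so that the
  minimization succeeds at every argument.\<close>

definition find_cert :: "inst \<Rightarrow> cert" where
  "find_cert I = dec (LEAST c. valid_inst I \<longrightarrow> valid_cert (I, dec c))"

lemma enc_output_list: "enc (output_list A) = automaton_code A"
proof -
  have s: "(enc :: sym \<Rightarrow> nat) = sym_code" by (simp add: enc_sym_def fun_eq_iff)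
  have n: "(enc :: nat \<Rightarrow> nat) = (\<lambda>x. x)" by (simp add: fun_eq_iff)
  have t: "(enc :: nat \<times> sym list \<times> nat \<Rightarrow> nat) = transition_code"
    by (simp add: fun_eq_iff transition_code_def enc_prod_def enc_list_def s)
  show ?thesis
    by (simp add: output_list_def automaton_code_def enc_list_def[of "_ :: nat list"]
      enc_list_def[of "_ :: (nat \<times> sym list \<times> nat) list"] n t)
qed

lemma valid_cert_exists:
  assumes "valid_inst I" shows "\<exists>c. valid_cert (I, c)"
proof -
  obtain p n m K rels eqn als where I: "I = (p, n, m, K, rels, eqn, als)" by (cases I)
  have "\<exists>M tab base Js Zs wits sts inits trs fins. cert_ok p n M tab base m K rels eqn als Js Zs wits sts inits trs fins"
    by (rule cert_exists) (use assms in \<open>simp_all add: I valid_inst_def\<close>)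
  then obtain M tab base Js Zs wits sts inits trs fins where
    "cert_ok p n M tab base m K rels eqn als Js Zs wits sts inits trs fins" by (elim exE)
  then have "valid_cert (I, (M, tab, base, Js, Zs, wits, sts, inits, trs, fins))"
    unfolding cert_ok_def arrays_def cert_ok_axioms_def by (simp add: I valid_cert_def)
  then show ?thesis by (rule exI)
qed

lemma valid_find_cert: assumes "valid_inst I" shows "valid_cert (I, find_cert I)"
proof -
  obtain c where "valid_cert (I, c)" using valid_cert_exists[OF assms] by (elim exE)
  then have "valid_inst I \<longrightarrow> valid_cert (I, dec (enc c))" by simp
  then have "valid_inst I \<longrightarrow> valid_cert (I, dec (LEAST c. valid_inst I \<longrightarrow> valid_cert (I, dec c)))" by (rule LeastI)
  then show ?thesis using assms by (simp add: find_cert_def)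
qed

lemma output_automaton_correct:
  assumes "valid_inst (p, n, m, K, rels, eqn, als)" "valid_cert ((p, n, m, K, rels, eqn, als), c)"
  shows "accepting_automaton p m {ks. length ks = m \<and> eden als eqn ((!) ks) \<in> span_submod p n K (den ` set rels)}
    (output_automaton ((p, n, m, K, rels, eqn, als), c))"
proof -
  obtain M tab base Js Zs wits sts inits trs fins where c: "c = (M, tab, base, Js, Zs, wits, sts, inits, trs, fins)"
    using prod_cases7[of c] prod_cases4 by metis
  have "cert_ok p n M tab base m K rels eqn als Js Zs wits sts inits trs fins"
    unfolding cert_ok_def arrays_def cert_ok_axioms_def
    using assms prime_ge_2_nat[of p] by (simp add: c valid_inst_def valid_cert_def)
  then interpret cert_ok p n M tab base m K rels eqn als Js Zs wits sts inits trs fins .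
  show ?thesis using cert_automaton_correct by (simp add: output_automaton_def c Rel_def)
qed

lemma computable_inst_of: assumes "computable L" shows "computable (\<lambda>x. inst_of (L x))"
  unfolding inst_of_def
  by (intro computable_intros computable_nthd computable_dec computable_core_rels computable_core_eqn computable_core_als
    computable_const assms[THEN computable_comp])

lemma decidable_valid_inst: assumes "computable I" shows "decidable (\<lambda>x. valid_inst (I x))"
  unfolding valid_inst_def case_prod_unfold
  by (intro computable_intros decidable_prime decidable_wf_terms decidable_wf_eqn assms[THEN computable_comp])

lemma decidable_valid_cert: assumes "computable I" shows "decidable (\<lambda>x. valid_cert (I x))"
  unfolding valid_cert_def case_prod_unfold
  by (intro computable_intros decidable_check_arrays decidable_check_zero decidable_check_inits decidable_check_trans
    decidable_check_final decidable_check_gens assms[THEN computable_comp])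

lemma computable_find_cert: assumes "computable I" shows "computable (\<lambda>x. find_cert (I x))"
proof -
  have "computable (\<lambda>I. LEAST c. valid_inst I \<longrightarrow> valid_cert (I, dec c))"
  proof (rule computable_Least)
    show "decidable (\<lambda>z. valid_inst (fst z) \<longrightarrow> valid_cert (fst z, dec (snd z)))"
      by (intro computable_intros computable_dec decidable_valid_inst decidable_valid_cert)
    fix I show "\<exists>c. valid_inst I \<longrightarrow> valid_cert (I, dec c)"
      using valid_find_cert[of I] by (metis dec_enc)
  qed
  from computable_dec[OF this] have "computable find_cert" unfolding find_cert_def .
  then show ?thesis using assms by (rule computable_comp)
qed

lemma computable_output_list: assumes "computable I" shows "computable (\<lambda>x. output_list (output_automaton (I x)))"
  unfolding output_list_def output_automaton_def cert_automaton_def case_prod_unfold automaton.sel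
  by (intro computable_intros computable_enc computable_nthd computable_const assms[THEN computable_comp])

definition input_list :: "input_data \<Rightarrow> nat list" where
  "input_list x = [in_p x, in_n x, in_d x, enc (in_rels x), enc (in_hs x), enc (in_g x)]"

lemma enc_input_list: "enc (input_list x) = input_code x"
proof -
  have i: "(enc :: int list \<Rightarrow> nat) = ints_code" by (simp add: fun_eq_iff enc_list_def ints_code_def enc_int_def)
  have t: "(enc :: int list \<times> int \<Rightarrow> nat) = (\<lambda>(a, c). prod_encode (ints_code a, int_encode c))"
    by (simp add: fun_eq_iff enc_prod_def i enc_int_def)
  have p: "(enc :: poly_data \<Rightarrow> nat) = poly_code"
    by (simp add: fun_eq_iff enc_list_def[of "_ :: poly_data"] poly_code_def t)
  have v: "(enc :: vec_data \<Rightarrow> nat) = vec_code"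
    by (simp add: fun_eq_iff enc_list_def[of "_ :: vec_data"] vec_code_def p)
  have e: "(enc :: elem_data \<Rightarrow> nat) = elem_code"
    by (simp add: fun_eq_iff elem_code_def enc_prod_def i v)
  show ?thesis
    by (simp add: input_list_def input_code_def enc_list_def[of "_ :: nat list"] enc_list_def[of "_ :: vec_data list"]
      enc_list_def[of "_ :: elem_data list"] v e)
qed

theorem theorem3p4:
  shows "effectively_p_automatic {x. wf_input x} input_code
           in_p (\<lambda>x. length (in_hs x)) solutions"
proof -
  let ?A = "\<lambda>L. output_automaton (inst_of L, find_cert (inst_of L))"
  have "computable (\<lambda>L. output_list (?A L))"
    by (intro computable_output_list computable_Pair computable_find_cert computable_inst_of computable_id)
  then obtain r where r: "\<And>L. computes r [enc L] (enc (output_list (?A L)))" by (rule computable_imp_computes) (rule that)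
  have "computes r [input_code x] (automaton_code (?A (input_list x))) \<and>
      accepting_automaton (in_p x) (length (in_hs x)) (solutions x) (?A (input_list x))" if wf: "wf_input x" for x
  proof -
    interpret knapsack_input x by unfold_locales (rule wf)
    have I: "inst_of (input_list x) = (p, Suc n, m, d + m + 1, core_rels n d (in_rels x) (in_hs x),
        core_eqn n d m (in_g x), core_als (in_hs x))"
      by (simp add: inst_of_def input_list_def)
    have V: "valid_inst (inst_of (input_list x))"
      unfolding I valid_inst_def prod.case using core_wf prime_p by blast
    have "accepting_automaton p m (solutions x) (?A (input_list x))"
      unfolding solutions_core I
      by (rule output_automaton_correct[OF V[unfolded I] valid_find_cert[OF V[unfolded I]]])
    then show ?thesis using r[of "input_list x"] by (simp add: enc_output_list enc_input_list)
  qed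
  then show ?thesis unfolding effectively_p_automatic_def by blast
qed

end
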